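(* Let $\lambda\in\mathbb{R}\setminus\{0\}$ and $\xi_0>0$. The collection of $\lambda$-reduced quaternionic Mathieu functions $\{M^{+}_n[\lambda]: n\ge 0\}\cup\{M^-_n[\lambda]: n\ge 1\}$ is complete in $\mathcal{M}(\xi_0;\lambda)$ in the sense of uniform convergence on compact subsets of $R_{\xi_0}$; that is, every $f\in\mathcal{M}(\xi_0;\lambda)$ is a limit, uniformly on compact subsets of $R_{\xi_0}$, of finite real linear combinations of these functions. Further, the collection is complete in the Hilbert space $\mathcal{M}_2(\xi_0;\lambda)$; that is, its finite real linear combinations are dense in $\mathcal{M}_2(\xi_0;\lambda)$ in the norm of the weighted $L^2$ inner product.
   Context: Elliptical coordinates: $x=\cosh\xi\cos\eta$, $y=\sinh\xi\sin\eta$, with $\xi\ge0$, $0\le\eta\le2\pi$. $R_{\xi_0}=[0,\xi_0)\times[0,2\pi]$ is the parameter set of the open elliptical domain $\Omega_{\xi_0}\subset\mathbb{R}^2$. $\mathbb{R}^3$ is identified with the reduced quaternions $a_0+\mathbf{i}a_1+\mathbf{j}a_2$ inside the quaternions $\mathbb{H}$; $\mathrm{Sc}$ denotes the scalar part $a_0$. $\mathcal{S}(\xi_0)$ is the set of $C^1$ functions $f$ on $R_{\xi_0}$ such that (componentwise) $f(\xi,0)=f(\xi,2\pi)$, $f(0,\eta)=f(0,2\pi-\eta)$, and $\frac{\partial f}{\partial\xi}(0,\eta)=-\frac{\partial f}{\partial\xi}(0,2\pi-\eta)$. $D=\mathbf{i}\,\partial/\partial x+\mathbf{j}\,\partial/\partial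 y$, whose expression in elliptical coordinates is $$\mathcal{D}=\frac{2}{\cosh2\xi-\cos2\eta}\Big((\mathbf{i}\sinh\xi\cos\eta+\mathbf{j}\cosh\xi\sin\eta)\frac{\partial}{\partial\xi}+(\mathbf{j}\sinh\xi\cos\eta-\mathbf{i}\cosh\xi\sin\eta)\frac{\partial}{\partial\eta}\Big).$$ $\mathcal{M}(\xi_0;\lambda)$ is the set of $\mathbb{R}^3$-valued $f\in\mathcal{S}(\xi_0)$ with $(\mathcal{D}+\lambda)f=0$. $\mathcal{M}_2(\xi_0;\lambda)$ is the set of those $f\in\mathcal{M}(\xi_0;\lambda)$ that are square-integrable for the weighted inner product $$\langle f,g\rangle_{\xi_0}=\mathrm{Sc}\int_0^{2\pi}\!\!\int_0^{\xi_0}\overline{f(\xi,\eta)}\,g(\xi,\eta)\,\tfrac12(\cosh2\xi-\cos2\eta)\,d\xi\,d\eta .$$ Mathieu functions: for $q>0$, $\mathrm{ce}_n(\eta,q)$ ($n\ge0$) and $\mathrm{se}_n(\eta,q)$ ($n\ge1$) are the even, respectively odd, $2\pi$-periodic solutions of $\phi''+(a-2q\cos2\eta)\phi=0$ for the eigenvalues $a=a_0(q)<a_1(q)<\cdots$, respectively $a=b_1(q)<b_2(q)<\cdots$. They are normalized so that the $L^2([0,2\pi])$-norm is $\sqrt\pi$, except that $\mathrm{ce}_0$ has norm $\sqrt{2\pi}$, with signs such that $\mathrm{ce}_n(\eta,q)\to\cos n\eta$ and $\mathrm{se}_n(\eta,q)\to\sin n\eta$ as $q\to0$. Modified Mathieu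 functions: $\mathrm{Ce}_n(\xi,q)=\mathrm{ce}_n(i\xi,q)$, $\mathrm{Se}_n(\xi,q)=-i\,\mathrm{se}_n(i\xi,q)$. Put $\zeta^+_n[q](\xi,\eta)=\mathrm{Ce}_n(\xi,q)\,\mathrm{ce}_n(\eta,q)$ and $\zeta^-_n[q](\xi,\eta)=\mathrm{Se}_n(\xi,q)\,\mathrm{se}_n(\eta,q)$ (the minus functions only for $n\ge1$). The $\lambda$-reduced quaternionic Mathieu functions are $M^\pm_n[\lambda]=-\frac1\lambda(\mathcal{D}-\lambda)\,\zeta^\pm_n[\lambda^2/4]$. *)

theory Defs
  imports "HOL-Complex_Analysis.Complex_Analysis"
begin

section \<open>Quaternions\<close>

text \<open>A quaternion is a pair (scalar part, vector part), with the coordinates of the vector part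
  taken along i, j, k. The pair type carries the Euclidean norm and topology of \<open>\<real>\<^sup>4\<close>.\<close>

type_synonym quat = "real \<times> (real ^ 3)"

definition qmult :: "quat \<Rightarrow> quat \<Rightarrow> quat" (infixl "\<odot>" 70) where
  "x \<odot> y = (fst x * fst y - snd x \<bullet> snd y,
            fst x *\<^sub>R snd y + fst y *\<^sub>R snd x + cross3 (snd x) (snd y))"

definition qcnj :: "quat \<Rightarrow> quat" where
  "qcnj x = (fst x, - snd x)"

definition Sc :: "quat \<Rightarrow> real" where
  "Sc x = fst x"

definition qreal :: "real \<Rightarrow> quat" where
  "qreal a = (a, 0)"

definition qi :: quat where "qi = (0, axis 1 1)"
definition qj :: quat where "qj = (0, axis 2 1)"

definition reduced_quats :: "quat set" where
  "reduced_quats = {x. snd x $ 3 = 0}"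


section \<open>Functions in elliptical coordinates\<close>

text \<open>Functions on \<open>ell_rect \<xi>0\<close> are represented by total functions of \<open>(\<xi>, \<eta>)\<close>; no definition
  below depends on their values outside the rectangle. Derivatives at its boundary points are
  one-sided.\<close>

definition ell_rect :: "real \<Rightarrow> (real \<times> real) set" where
  "ell_rect \<xi>0 = {0..<\<xi>0} \<times> {0..2 * pi}"

definition C1_on :: "('a::real_normed_vector) set \<Rightarrow> ('a \<Rightarrow> 'b::real_normed_vector) \<Rightarrow> bool" where
  "C1_on S f \<longleftrightarrow> (\<exists>D. (\<forall>p\<in>S. (f has_derivative blinfun_apply (D p)) (at p within S))
                    \<and> continuous_on S D)"

definition d_xi :: "(real \<times> real \<Rightarrow> quat) \<Rightarrow> real \<times> real \<Rightarrow> quat" where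
  "d_xi f = (\<lambda>(\<xi>, \<eta>). vector_derivative (\<lambda>s. f (s, \<eta>)) (at \<xi> within {0..}))"

definition d_eta :: "(real \<times> real \<Rightarrow> quat) \<Rightarrow> real \<times> real \<Rightarrow> quat" where
  "d_eta f = (\<lambda>(\<xi>, \<eta>). vector_derivative (\<lambda>t. f (\<xi>, t)) (at \<eta> within {0..2 * pi}))"

definition ell_S :: "real \<Rightarrow> (real \<times> real \<Rightarrow> quat) set" where
  "ell_S \<xi>0 = {f. C1_on (ell_rect \<xi>0) f
      \<and> (\<forall>\<xi>\<in>{0..<\<xi>0}. f (\<xi>, 0) = f (\<xi>, 2 * pi))
      \<and> (\<forall>\<eta>\<in>{0..2 * pi}. f (0, \<eta>) = f (0, 2 * pi - \<eta>))
      \<and> (\<forall>\<eta>\<in>{0..2 * pi}. d_xi f (0, \<eta>) = - d_xi f (0, 2 * pi - \<eta>))}"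

text \<open>The expression \<open>cosh 2\<xi> - cos 2\<eta>\<close> vanishes exactly at the preimages of the foci \<open>(\<plusminus>1, 0)\<close>
  of the ellipse, and there the elliptical-coordinate formula for the operator D is undefined.\<close>

definition foci :: "(real \<times> real) set" where
  "foci = {(\<xi>, \<eta>). cosh (2 * \<xi>) - cos (2 * \<eta>) = 0}"

definition ell_D :: "(real \<times> real \<Rightarrow> quat) \<Rightarrow> real \<times> real \<Rightarrow> quat" where
  "ell_D f = (\<lambda>(\<xi>, \<eta>). (2 / (cosh (2 * \<xi>) - cos (2 * \<eta>))) *\<^sub>R
      (((sinh \<xi> * cos \<eta>) *\<^sub>R qi + (cosh \<xi> * sin \<eta>) *\<^sub>R qj) \<odot> d_xi f (\<xi>, \<eta>)
     + ((sinh \<xi> * cos \<eta>) *\<^sub>R qj - (cosh \<xi> * sin \<eta>) *\<^sub>R qi) \<odot> d_eta f (\<xi>, \<eta>)))"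

text \<open>The equation is imposed away from the foci: since division by zero yields zero, imposing it
  there would force f to vanish at the foci.\<close>

definition ell_M :: "real \<Rightarrow> real \<Rightarrow> (real \<times> real \<Rightarrow> quat) set" where
  "ell_M \<xi>0 lam = {f \<in> ell_S \<xi>0. (\<forall>p\<in>ell_rect \<xi>0. f p \<in> reduced_quats)
      \<and> (\<forall>p\<in>ell_rect \<xi>0 - foci. ell_D f p + lam *\<^sub>R f p = 0)}"

definition ell_weight :: "real \<times> real \<Rightarrow> real" where
  "ell_weight = (\<lambda>(\<xi>, \<eta>). 1/2 * (cosh (2 * \<xi>) - cos (2 * \<eta>)))"

definition ell_inner :: "real \<Rightarrow> (real \<times> real \<Rightarrow> quat) \<Rightarrow> (real \<times> real \<Rightarrow> quat) \<Rightarrow> real" where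
  "ell_inner \<xi>0 f g =
     Sc (set_lebesgue_integral lborel (ell_rect \<xi>0) (\<lambda>p. ell_weight p *\<^sub>R (qcnj (f p) \<odot> g p)))"

definition ell_norm :: "real \<Rightarrow> (real \<times> real \<Rightarrow> quat) \<Rightarrow> real" where
  "ell_norm \<xi>0 f = sqrt (ell_inner \<xi>0 f f)"

definition ell_M2 :: "real \<Rightarrow> real \<Rightarrow> (real \<times> real \<Rightarrow> quat) set" where
  "ell_M2 \<xi>0 lam = {f \<in> ell_M \<xi>0 lam.
     set_integrable lborel (ell_rect \<xi>0) (\<lambda>p. ell_weight p *\<^sub>R (qcnj (f p) \<odot> f p))}"


section \<open>Mathieu functions\<close>

text \<open>Solutions of the Mathieu equation are taken as entire functions, since the modified
  Mathieu functions evaluate them on the imaginary axis.\<close>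

definition mathieu_sol :: "real \<Rightarrow> real \<Rightarrow> (complex \<Rightarrow> complex) \<Rightarrow> bool" where
  "mathieu_sol a q \<phi> \<longleftrightarrow> \<phi> holomorphic_on UNIV
     \<and> (\<forall>z. deriv (deriv \<phi>) z + (of_real a - 2 * of_real q * cos (2 * z)) * \<phi> z = 0)
     \<and> (\<forall>z. \<phi> (z + 2 * of_real pi) = \<phi> z)
     \<and> (\<exists>z. \<phi> z \<noteq> 0)"

text \<open>The sign \<open>s\<close> is 1 for even and -1 for odd functions.\<close>

definition mathieu_eigenvalues :: "real \<Rightarrow> real \<Rightarrow> real set" where
  "mathieu_eigenvalues s q = {a. \<exists>\<phi>. mathieu_sol a q \<phi> \<and> (\<forall>z. \<phi> (- z) = of_real s * \<phi> z)}"

text \<open>The element of E with exactly n predecessors in E, so that the smallest one has index 0.\<close>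

definition nth_smallest :: "real set \<Rightarrow> nat \<Rightarrow> real" where
  "nth_smallest E n = (THE a. a \<in> E \<and> finite {b \<in> E. b < a} \<and> card {b \<in> E. b < a} = n)"

definition mathieu_a :: "nat \<Rightarrow> real \<Rightarrow> real" where
  "mathieu_a n q = nth_smallest (mathieu_eigenvalues 1 q) n"

definition mathieu_b :: "nat \<Rightarrow> real \<Rightarrow> real" where
  "mathieu_b n q = nth_smallest (mathieu_eigenvalues (-1) q) (n - 1)"

definition mathieu_normalized ::
    "real \<Rightarrow> real \<Rightarrow> real \<Rightarrow> real \<Rightarrow> (complex \<Rightarrow> complex) \<Rightarrow> bool" where
  "mathieu_normalized s c a q \<phi> \<longleftrightarrow> mathieu_sol a q \<phi>
     \<and> (\<forall>z. \<phi> (- z) = of_real s * \<phi> z)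
     \<and> (\<forall>x::real. \<phi> (of_real x) \<in> \<real>)
     \<and> sqrt (integral {0..2 * pi} (\<lambda>x. (cmod (\<phi> (of_real x)))\<^sup>2)) = c"

text \<open>The function \<open>\<phi>\<close> is the member with parameter \<open>q\<close> of a family of normalized eigenfunctions
  that is continuous in the parameter and tends to \<open>t\<close> as the parameter tends to 0.\<close>

definition mathieu_branch ::
    "real \<Rightarrow> real \<Rightarrow> (real \<Rightarrow> real) \<Rightarrow> (real \<Rightarrow> real) \<Rightarrow> real \<Rightarrow> (complex \<Rightarrow> complex) \<Rightarrow> bool" where
  "mathieu_branch s c ev t q \<phi> \<longleftrightarrow> (\<exists>\<Phi>. \<Phi> q = \<phi>
     \<and> (\<forall>p\<in>{0<..q}. mathieu_normalized s c (ev p) p (\<Phi> p))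
     \<and> (\<forall>x::real. continuous_on {0<..q} (\<lambda>p. \<Phi> p (of_real x)))
     \<and> (\<forall>x::real. ((\<lambda>p. \<Phi> p (of_real x)) \<longlongrightarrow> of_real (t x)) (at_right 0)))"

text \<open>For \<open>q > 0\<close> the normalized eigenfunction is unique up to sign, and exactly one of the two
  choices of sign lies on such a branch; that one is selected.\<close>

definition mathieu_fun ::
    "real \<Rightarrow> real \<Rightarrow> (real \<Rightarrow> real) \<Rightarrow> (real \<Rightarrow> real) \<Rightarrow> real \<Rightarrow> complex \<Rightarrow> complex" where
  "mathieu_fun s c ev t q =
     (let \<psi> = (SOME \<psi>. mathieu_normalized s c (ev q) q \<psi>)
      in if mathieu_branch s c ev t q \<psi> then \<psi> else (\<lambda>z. - \<psi> z))"

definition mathieu_ce :: "nat \<Rightarrow> complex \<Rightarrow> real \<Rightarrow> complex" where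
  "mathieu_ce n z q =
     mathieu_fun 1 (if n = 0 then sqrt (2 * pi) else sqrt pi) (mathieu_a n) (\<lambda>x. cos (real n * x)) q z"

definition mathieu_se :: "nat \<Rightarrow> complex \<Rightarrow> real \<Rightarrow> complex" where
  "mathieu_se n z q =
     mathieu_fun (-1) (sqrt pi) (mathieu_b n) (\<lambda>x. sin (real n * x)) q z"

definition mathieu_Ce :: "nat \<Rightarrow> complex \<Rightarrow> real \<Rightarrow> complex" where
  "mathieu_Ce n \<xi> q = mathieu_ce n (\<i> * \<xi>) q"

definition mathieu_Se :: "nat \<Rightarrow> complex \<Rightarrow> real \<Rightarrow> complex" where
  "mathieu_Se n \<xi> q = - \<i> * mathieu_se n (\<i> * \<xi>) q"

text \<open>The products are real for real \<open>\<xi>\<close> and \<open>\<eta>\<close>; Re only adjusts the type.\<close>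

definition zeta_plus :: "nat \<Rightarrow> real \<Rightarrow> real \<times> real \<Rightarrow> real" where
  "zeta_plus n q = (\<lambda>(\<xi>, \<eta>). Re (mathieu_Ce n (of_real \<xi>) q * mathieu_ce n (of_real \<eta>) q))"

definition zeta_minus :: "nat \<Rightarrow> real \<Rightarrow> real \<times> real \<Rightarrow> real" where
  "zeta_minus n q = (\<lambda>(\<xi>, \<eta>). Re (mathieu_Se n (of_real \<xi>) q * mathieu_se n (of_real \<eta>) q))"


section \<open>Reduced quaternionic Mathieu functions\<close>

text \<open>At the foci the formula for the operator is an indeterminate 0/0, and the value is the one
  given by continuous extension.\<close>

definition D_minus_scaled :: "real \<Rightarrow> (real \<times> real \<Rightarrow> real) \<Rightarrow> real \<times> real \<Rightarrow> quat" where
  "D_minus_scaled lam u =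
     (let F = (\<lambda>p. (- (1 / lam)) *\<^sub>R (ell_D (\<lambda>p. qreal (u p)) p - lam *\<^sub>R qreal (u p)))
      in (\<lambda>p. if p \<in> foci then Lim (at p within {0..} \<times> {0..2 * pi}) F else F p))"

definition rqM_plus :: "nat \<Rightarrow> real \<Rightarrow> real \<times> real \<Rightarrow> quat" where
  "rqM_plus n lam = D_minus_scaled lam (zeta_plus n (lam\<^sup>2 / 4))"

definition rqM_minus :: "nat \<Rightarrow> real \<Rightarrow> real \<times> real \<Rightarrow> quat" where
  "rqM_minus n lam = D_minus_scaled lam (zeta_minus n (lam\<^sup>2 / 4))"

definition rqM_system :: "real \<Rightarrow> (real \<times> real \<Rightarrow> quat) set" where
  "rqM_system lam = {rqM_plus n lam | n. True} \<union> {rqM_minus n lam | n. n \<ge> 1}"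

definition real_lin_combs :: "('a \<Rightarrow> 'b::real_vector) set \<Rightarrow> ('a \<Rightarrow> 'b) set" where
  "real_lin_combs B = {g. \<exists>F c. finite F \<and> F \<subseteq> B \<and> g = (\<lambda>p. \<Sum>h\<in>F. c h *\<^sub>R h p)}"

end

theory Submission
  imports Defs
begin

text \<open>
  Let \<open>f = u + i f1 + j f2\<close> solve \<open>(D + lam) f = 0\<close>. Then \<open>u\<close> is \<open>C\<^sup>2\<close> and satisfies the Helmholtz
  equation in elliptical coordinates, and \<open>f1, f2\<close> are recovered from the gradient of \<open>u\<close>. The Mathieu
  functions are the eigenfunctions of a periodic Sturm-Liouville problem with compact positive
  resolvent, so they form a complete orthogonal system in \<open>\<eta>\<close>. The Fourier coefficients of
  \<open>u(\<xi>, \<cdot>)\<close> solve the modified Mathieu equation, and the symmetry of \<open>f\<close> at \<open>\<xi> = 0\<close> makes them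
  multiples of \<open>Ce\<^sub>n\<close> and \<open>Se\<^sub>n\<close>; hence the expansion of \<open>u\<close> lifts to one of \<open>f\<close> in the functions
  \<open>M\<^sub>n\<^sup>\<plusminus>\<close>.

  As the coefficients are bounded on a larger ellipse, the exponential growth of the modified
  Mathieu functions makes them on a smaller one decay faster than every power of the eigenvalue.
  The lift divides a gradient by the square root of the weight; since that gradient vanishes at the
  foci, the lift is bounded by second derivatives, and the expansion converges uniformly. On each
  curve \<open>\<xi> = const\<close> the weighted mean square error is bounded, through Bessel's inequality for \<open>u\<close>
  and its gradient, by a quantity integrable in \<open>\<xi>\<close>, so that dominated convergence gives the
  convergence in the weighted norm.
\<close>

section \<open>Entire solutions of second-order linear equations\<close>

text \<open>Completeness depends only on spans, so each Mathieu function is traded for a real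
  multiple of an even or odd solution with fixed initial data at 0, and eigenpairs are indexed by
  parity and eigenvalue. Symmetry, positivity and compactness of the resolvent come from one
  integration by parts and a sup-norm inequality. The foci are the recurring obstacle: the
  coordinates degenerate there and the operator is 0/0, so relations between components are kept
  multiplied by the weight, divided only for \<xi> > 0, and carried to \<xi> = 0 by continuity. This
  does not yet show that the functions of the system are C1 at the foci; for that, their gradients
  must be divided by sin (i \<xi> - \<eta>), whose squared modulus is the weight, with a
  differentiable quotient. Nothing is assumed about the behaviour towards the outer boundary \<xi> =
  \<xi>0, so convergence in the weighted norm cannot be read off from uniform convergence on smaller
  ellipses and is proved curve by curve.\<close>

fun ode_coeffs :: "complex fps \<Rightarrow> complex \<Rightarrow> complex \<Rightarrow> nat \<Rightarrow> complex" where
  "ode_coeffs P \<alpha> \<beta> 0 = \<alpha>"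
| "ode_coeffs P \<alpha> \<beta> (Suc 0) = \<beta>"
| "ode_coeffs P \<alpha> \<beta> (Suc (Suc n)) =
     (\<Sum>k\<le>n. fps_nth P k * ode_coeffs P \<alpha> \<beta> (n - k)) / of_nat ((n + 2) * (n + 1))"

text \<open>\<open>ode_coeffs\<close> solves the recursion for the Taylor coefficients of a solution
  of y'' = P y. With S the sum of |P_k| R^k, the recursion multiplies a common bound of the earlier
  weighted coefficients by at most R^2 S / ((m + 2)(m + 1)). This is at most 1 as soon as m \<ge>
  R^2 S, so the maximum over the finitely many coefficients before that point bounds all of
  them.\<close>

lemma ode_coeffs_bounded:
  assumes "fps_conv_radius P = \<infinity>" and R: "R > 0"
  shows "\<exists>B. \<forall>n. norm (ode_coeffs P \<alpha> \<beta> n) * R ^ n \<le> B"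
proof -
  define c where "c = ode_coeffs P \<alpha> \<beta>"
  define b where "b n = norm (c n) * R ^ n" for n
  define S where "S = (\<Sum>k. norm (fps_nth P k) * R ^ k)"
  have "summable (\<lambda>n. norm (fps_nth P n * complex_of_real R ^ n))"
    using assms by (intro abs_summable_in_conv_radius) (auto simp: fps_conv_radius_def)
  then have sumP: "summable (\<lambda>n. norm (fps_nth P n) * R ^ n)"
    using R by (simp add: norm_mult norm_power)
  have partS: "(\<Sum>k\<le>n. norm (fps_nth P k) * R ^ k) \<le> S" for n
    unfolding S_def by (rule sum_le_suminf[OF sumP]) (use R in auto)
  have S0: "S \<ge> 0" using partS[of 0] R by (smt (verit) sum_nonneg mult_nonneg_nonneg norm_ge_zero zero_le_power)
  obtain N :: nat where N: "R\<^sup>2 * S \<le> real N" using real_arch_simple by blast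
  define B where "B = Max (b ` {..N + 1})"
  have bnn: "b n \<ge> 0" for n using R by (simp add: b_def)
  have B1: "b n \<le> B" if "n \<le> N + 1" for n
    unfolding B_def using that by (intro Max_ge) auto
  have B0: "B \<ge> 0" using B1[of 0] bnn[of 0] by simp
  have "b n \<le> B" for n
  proof (induction n rule: less_induct)
    case (less n)
    show ?case
    proof (cases "n \<le> N + 1")
      case True then show ?thesis by (rule B1)
    next
      case False
      then obtain m where m: "n = Suc (Suc m)" "m \<ge> N"
        by (metis Suc_eq_plus1 Suc_le_mono not_less_eq_eq old.nat.exhaust zero_le)
      have "norm (\<Sum>k\<le>m. fps_nth P k * c (m - k)) * R ^ m
          \<le> (\<Sum>k\<le>m. norm (fps_nth P k) * norm (c (m - k))) * R ^ m"
        using R by (intro mult_right_mono order_trans[OF norm_sum]) (auto simp: norm_mult intro: sum_mono)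
      also have "\<dots> = (\<Sum>k\<le>m. norm (fps_nth P k) * R ^ k * b (m - k))"
        unfolding sum_distrib_right b_def
        by (intro sum.cong) (auto simp: mult_ac simp flip: power_add)
      also have "\<dots> \<le> (\<Sum>k\<le>m. norm (fps_nth P k) * R ^ k * B)"
        using R m by (intro sum_mono mult_left_mono less.IH) auto
      also have "\<dots> \<le> S * B"
        using partS B0 by (simp add: mult_right_mono flip: sum_distrib_right)
      finally have 1: "norm (\<Sum>k\<le>m. fps_nth P k * c (m - k)) * R ^ m \<le> S * B" .
      have "b n = R\<^sup>2 * (norm (\<Sum>k\<le>m. fps_nth P k * c (m - k)) * R ^ m) / real ((m + 2) * (m + 1))"
        unfolding b_def m c_def ode_coeffs.simps norm_divide norm_of_nat
        by (simp add: power2_eq_square)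
      also have "\<dots> \<le> R\<^sup>2 * (S * B) / real ((m + 2) * (m + 1))"
        using 1 by (intro divide_right_mono mult_left_mono) auto
      also have "\<dots> \<le> B"
      proof -
        have "R\<^sup>2 * S \<le> real m" using N m by linarith
        also have "\<dots> \<le> real ((m + 2) * (m + 1))" unfolding of_nat_le_iff by simp
        finally have "R\<^sup>2 * S * B \<le> real ((m + 2) * (m + 1)) * B" using B0 by (rule mult_right_mono)
        then show ?thesis by (simp add: field_simps del: of_nat_mult of_nat_add)
      qed
      finally show ?thesis .
    qed
  qed
  then show ?thesis unfolding b_def c_def by blast
qed

lemma entire_linear_ode_exists:
  fixes p :: "complex \<Rightarrow> complex"
  assumes p: "p holomorphic_on UNIV"
  shows "\<exists>y. y holomorphic_on UNIV \<and> y 0 = \<alpha> \<and> deriv y 0 = \<beta> \<and> (\<forall>z. deriv (deriv y) z = p z * y z)"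
proof -
  define P where "P = fps_expansion p 0"
  have "fps_conv_radius P \<ge> \<infinity>"
    unfolding P_def by (rule conv_radius_fps_expansion) (use p in \<open>auto intro: holomorphic_on_subset\<close>)
  then have Pr: "fps_conv_radius P = \<infinity>" by auto
  have Pe: "eval_fps P z = p z" for z
  proof -
    obtain r where r: "r > norm z" using gt_ex by blast
    show ?thesis
      using eval_fps_expansion[of p 0 "ereal r" z] p r
      unfolding P_def by (auto intro: holomorphic_on_subset)
  qed
  define F where "F = Abs_fps (ode_coeffs P \<alpha> \<beta>)"
  have "fps_conv_radius F \<ge> \<infinity>"
    unfolding fps_conv_radius_def F_def
  proof (rule conv_radius_geI_ex')
    fix r :: real assume r: "r > 0"
    \<comment> \<open>Boundedness at the radius 2 r makes the terms at radius r decay like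
      (1/2)^n.\<close>
    obtain B where B: "\<And>n. norm (ode_coeffs P \<alpha> \<beta> n) * (2 * r) ^ n \<le> B"
      using ode_coeffs_bounded[OF Pr, of "2 * r" \<alpha> \<beta>] r by auto
    show "summable (\<lambda>n. fps_nth (Abs_fps (ode_coeffs P \<alpha> \<beta>)) n * complex_of_real r ^ n)"
    proof (rule summable_comparison_test')
      show "summable (\<lambda>n. B * (1 / 2) ^ n)" by (intro summable_mult summable_geometric) auto
      fix n :: nat
      show "norm (fps_nth (Abs_fps (ode_coeffs P \<alpha> \<beta>)) n * complex_of_real r ^ n) \<le> B * (1 / 2) ^ n"
        using B[of n] r by (simp add: norm_mult norm_power field_simps power_mult_distrib)
    qed
  qed
  then have Fr: "fps_conv_radius F = \<infinity>" by auto
  have "fps_conv_radius (fps_deriv F) \<ge> \<infinity>" using fps_conv_radius_deriv[of F] Fr by auto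
  then have F'r: "fps_conv_radius (fps_deriv F) = \<infinity>" by auto
  have ode: "fps_deriv (fps_deriv F) = P * F"
  proof (rule fps_ext)
    fix n
    show "fps_nth (fps_deriv (fps_deriv F)) n = fps_nth (P * F) n"
      by (simp add: F_def fps_mult_nth field_simps atLeast0AtMost del: of_nat_Suc of_nat_add of_nat_mult)
         (simp add: algebra_simps)
  qed
  have d1: "deriv (eval_fps F) = eval_fps (fps_deriv F)"
    by (rule ext, subst eval_fps_deriv) (auto simp: Fr)
  have d2: "deriv (deriv (eval_fps F)) z = p z * eval_fps F z" for z
    unfolding d1 by (subst eval_fps_deriv [symmetric]) (auto simp: F'r ode eval_fps_mult Pr Fr Pe)
  show ?thesis
    by (rule exI[of _ "eval_fps F"])
       (use d2 in \<open>auto simp: d1 eval_fps_at_0 F_def[symmetric] Fr intro!: holomorphic_on_eval_fps,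
          simp_all add: F_def\<close>)
qed

text \<open>The coefficients are Wronskians of \<open>y\<close> with the fundamental solutions, hence constant.\<close>

lemma linear_ode_representation:
  fixes y :: "'a::real_normed_field \<Rightarrow> 'a"
  assumes S: "convex S" "0 \<in> S"
    and y: "\<And>x. x \<in> S \<Longrightarrow> (y has_field_derivative y' x) (at x within S)"
      "\<And>x. x \<in> S \<Longrightarrow> (y' has_field_derivative p x * y x) (at x within S)"
    and y1: "\<And>x. x \<in> S \<Longrightarrow> (y1 has_field_derivative y1' x) (at x within S)"
      "\<And>x. x \<in> S \<Longrightarrow> (y1' has_field_derivative p x * y1 x) (at x within S)"
    and y2: "\<And>x. x \<in> S \<Longrightarrow> (y2 has_field_derivative y2' x) (at x within S)"
      "\<And>x. x \<in> S \<Longrightarrow> (y2' has_field_derivative p x * y2 x) (at x within S)"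
    and ini: "y1 0 = 1" "y1' 0 = 0" "y2 0 = 0" "y2' 0 = 1"
    and x: "x \<in> S"
  shows "y x = y 0 * y1 x + y' 0 * y2 x" "y' x = y 0 * y1' x + y' 0 * y2' x"
    "y1 x * y2' x - y1' x * y2 x = 1"
proof -
  have W: "u x * v' x - u' x * v x = u 0 * v' 0 - u' 0 * v 0"
    if "\<And>x. x \<in> S \<Longrightarrow> (u has_field_derivative u' x) (at x within S)"
      "\<And>x. x \<in> S \<Longrightarrow> (u' has_field_derivative p x * u x) (at x within S)"
      "\<And>x. x \<in> S \<Longrightarrow> (v has_field_derivative v' x) (at x within S)"
      "\<And>x. x \<in> S \<Longrightarrow> (v' has_field_derivative p x * v x) (at x within S)" for u u' v v'
  proof -
    have "\<exists>c. \<forall>x\<in>S. u x * v' x - u' x * v x = c"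
    proof (rule has_field_derivative_zero_constant)
      fix x assume "x \<in> S"
      note d = that[OF this]
      show "((\<lambda>x. u x * v' x - u' x * v x) has_field_derivative 0) (at x within S)"
        by (rule derivative_eq_intros d | simp add: algebra_simps)+
    qed (rule S)
    then show ?thesis using x S(2) by auto
  qed
  note w1 = W[OF y y1] and w2 = W[OF y y2] and w12 = W[OF y1 y2]
  show 3: "y1 x * y2' x - y1' x * y2 x = 1" using w12 ini by simp
  have a: "y x * y2' x - y' x * y2 x = y 0" "y x * y1' x - y' x * y1 x = - y' 0"
    using w1 w2 ini by auto
  have "y x = y x * (y1 x * y2' x - y1' x * y2 x)" by (simp add: 3)
  also have "\<dots> = (y x * y2' x - y' x * y2 x) * y1 x - (y x * y1' x - y' x * y1 x) * y2 x"
    by (simp add: algebra_simps)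
  finally show "y x = y 0 * y1 x + y' 0 * y2 x" unfolding a by simp
  have "y' x = y' x * (y1 x * y2' x - y1' x * y2 x)" by (simp add: 3)
  also have "\<dots> = (y x * y2' x - y' x * y2 x) * y1' x - (y x * y1' x - y' x * y1 x) * y2' x"
    by (simp add: algebra_simps)
  finally show "y' x = y 0 * y1' x + y' 0 * y2' x" unfolding a by simp
qed


section \<open>Even and odd solutions of the Mathieu equation\<close>

definition mathieu_eq :: "real \<Rightarrow> real \<Rightarrow> (complex \<Rightarrow> complex) \<Rightarrow> bool" where
  "mathieu_eq a q \<phi> \<longleftrightarrow> \<phi> holomorphic_on UNIV
     \<and> (\<forall>z. deriv (deriv \<phi>) z = (2 * of_real q * cos (2 * z) - of_real a) * \<phi> z)"

text \<open>The cosine-type solution for \<open>s = 1\<close>, otherwise the sine-type one. Fixing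
  the data at 0 instead of the norm defines it for every \<open>a\<close>, eigenvalue or not, and
  makes it even or odd by uniqueness alone.\<close>

definition mathieu_base :: "real \<Rightarrow> real \<Rightarrow> real \<Rightarrow> complex \<Rightarrow> complex" where
  "mathieu_base s a q = (SOME \<phi>. mathieu_eq a q \<phi> \<and> \<phi> 0 = (if s = 1 then 1 else 0)
     \<and> deriv \<phi> 0 = (if s = 1 then 0 else 1))"

lemma mathieu_base:
  "mathieu_eq a q (mathieu_base s a q)"
  "mathieu_base s a q 0 = (if s = 1 then 1 else 0)"
  "deriv (mathieu_base s a q) 0 = (if s = 1 then 0 else 1)"
proof -
  have "(\<lambda>z. 2 * of_real q * cos (2 * z) - of_real a) holomorphic_on UNIV"
    by (intro holomorphic_intros)
  from someI_ex[OF entire_linear_ode_exists[OF this, of "if s = 1 then 1 else 0" "if s = 1 then 0 else 1",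
      folded mathieu_eq_def, unfolded conj_assoc[symmetric]]]
  have "\<exists>\<phi>. mathieu_eq a q \<phi> \<and> \<phi> 0 = (if s = 1 then 1 else 0) \<and> deriv \<phi> 0 = (if s = 1 then 0 else 1)"
    unfolding mathieu_eq_def by blast
  from someI_ex[OF this] show "mathieu_eq a q (mathieu_base s a q)"
    "mathieu_base s a q 0 = (if s = 1 then 1 else 0)"
    "deriv (mathieu_base s a q) 0 = (if s = 1 then 0 else 1)"
    unfolding mathieu_base_def by auto
qed

lemma mathieu_eq_deriv:
  assumes "mathieu_eq a q \<phi>"
  shows "(\<phi> has_field_derivative deriv \<phi> z) (at z)"
    "(deriv \<phi> has_field_derivative (2 * of_real q * cos (2 * z) - of_real a) * \<phi> z) (at z)"
proof -
  have h: "\<phi> holomorphic_on UNIV" and o: "deriv (deriv \<phi>) z = (2 * of_real q * cos (2 * z) - of_real a) * \<phi> z"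
    using assms by (auto simp: mathieu_eq_def)
  show "(\<phi> has_field_derivative deriv \<phi> z) (at z)"
    using h by (intro holomorphic_derivI[of _ UNIV]) auto
  have "deriv \<phi> holomorphic_on UNIV" using h by (intro holomorphic_deriv) auto
  then show "(deriv \<phi> has_field_derivative (2 * of_real q * cos (2 * z) - of_real a) * \<phi> z) (at z)"
    unfolding o[symmetric] by (intro holomorphic_derivI[of _ UNIV]) auto
qed

lemma mathieu_eqI:
  assumes "\<And>z. (\<phi> has_field_derivative \<phi>' z) (at z)"
    "\<And>z. (\<phi>' has_field_derivative (2 * of_real q * cos (2 * z) - of_real a) * \<phi> z) (at z)"
  shows "mathieu_eq a q \<phi>" "deriv \<phi> = \<phi>'"
proof -
  show d: "deriv \<phi> = \<phi>'" using assms(1) by (auto intro: DERIV_imp_deriv)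
  then show "mathieu_eq a q \<phi>" unfolding mathieu_eq_def d
    using assms by (auto intro: DERIV_imp_deriv simp: holomorphic_on_open)
qed

lemma mathieu_eq_representation:
  assumes "mathieu_eq a q \<phi>"
  shows "\<phi> z = \<phi> 0 * mathieu_base 1 a q z + deriv \<phi> 0 * mathieu_base (-1) a q z"
proof -
  note d = mathieu_eq_deriv[OF assms] and e = mathieu_eq_deriv[OF mathieu_base(1)]
  show ?thesis
    by (rule linear_ode_representation(1)[where S = UNIV and y1' = "deriv (mathieu_base 1 a q)"
          and y2' = "deriv (mathieu_base (-1) a q)"
          and p = "\<lambda>z. 2 * of_real q * cos (2 * z) - of_real a"])
       (use d e in \<open>auto simp: mathieu_base\<close>)
qed

text \<open>The equation is invariant under z to -z, which multiplies the initial data by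
  \<open>s\<close>; uniqueness does the rest.\<close>

lemma mathieu_base_minus:
  assumes "s = 1 \<or> s = -1"
  shows "mathieu_base s a q (- z) = of_real s * mathieu_base s a q z"
proof -
  define Y where "Y = mathieu_base s a q"
  note d = mathieu_eq_deriv[OF mathieu_base(1)[of a q s], folded Y_def]
  have e: "((\<lambda>z. Y (- z)) has_field_derivative - deriv Y (- z)) (at z)"
    "((\<lambda>z. - deriv Y (- z)) has_field_derivative (2 * of_real q * cos (2 * z) - of_real a) * Y (- z)) (at z)" for z
  proof -
    have m: "(uminus has_field_derivative - 1) (at z)" by (auto intro!: derivative_eq_intros)
    show "((\<lambda>z. Y (- z)) has_field_derivative - deriv Y (- z)) (at z)"
      "((\<lambda>z. - deriv Y (- z)) has_field_derivative (2 * of_real q * cos (2 * z) - of_real a) * Y (- z)) (at z)"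
      using DERIV_chain2[OF d(1) m] DERIV_minus[OF DERIV_chain2[OF d(2) m]] by auto
  qed
  note r = mathieu_eq_representation[OF mathieu_eqI(1)[OF e], of z, unfolded mathieu_eqI(2)[OF e]]
  show ?thesis using assms r by (auto simp: Y_def mathieu_base)
qed

text \<open>The coefficients are real on the real axis, so conjugating argument and value gives
  another solution with the same initial data.\<close>

lemma mathieu_base_cnj:
  assumes "s = 1 \<or> s = -1"
  shows "cnj (mathieu_base s a q (cnj z)) = mathieu_base s a q z"
proof -
  define Y where "Y = mathieu_base s a q"
  note d = mathieu_eq_deriv[OF mathieu_base(1)[of a q s], folded Y_def]
  have e: "((\<lambda>z. cnj (Y (cnj z))) has_field_derivative cnj (deriv Y (cnj z))) (at z)"
    "((\<lambda>z. cnj (deriv Y (cnj z))) has_field_derivative (2 * of_real q * cos (2 * z) - of_real a) * cnj (Y (cnj z))) (at z)" for z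
    using has_field_derivative_cnj_cnj[OF d(1), of z] has_field_derivative_cnj_cnj[OF d(2), of z]
    by (auto simp: o_def cnj_cos)
  note r = mathieu_eq_representation[OF mathieu_eqI(1)[OF e], of z, unfolded mathieu_eqI(2)[OF e]]
  show ?thesis using assms r by (auto simp: Y_def mathieu_base)
qed

definition ang :: "real \<Rightarrow> real \<Rightarrow> real \<Rightarrow> real \<Rightarrow> real" where
  "ang s a q x = Re (mathieu_base s a q (of_real x))"

definition ang' :: "real \<Rightarrow> real \<Rightarrow> real \<Rightarrow> real \<Rightarrow> real" where
  "ang' s a q x = Re (deriv (mathieu_base s a q) (of_real x))"

text \<open>On the imaginary axis an even solution is real and an odd one purely imaginary.\<close>

definition rad :: "real \<Rightarrow> real \<Rightarrow> real \<Rightarrow> real \<Rightarrow> real" where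
  "rad s a q x = (if s = 1 then Re else Im) (mathieu_base s a q (\<i> * of_real x))"

definition rad' :: "real \<Rightarrow> real \<Rightarrow> real \<Rightarrow> real \<Rightarrow> real" where
  "rad' s a q x = (if s = 1 then Re else Im) (\<i> * deriv (mathieu_base s a q) (\<i> * of_real x))"

lemma of_real_ang: "s = 1 \<or> s = -1 \<Longrightarrow> of_real (ang s a q x) = mathieu_base s a q (of_real x)"
  using mathieu_base_cnj[of s a q "of_real x"] by (simp add: ang_def complex_eq_iff)

text \<open>On the imaginary axis conjugation is z to -z, so the conjugate of the value is
  \<open>s\<close> times the value: real for the even solution, purely imaginary for the odd
  one.\<close>

lemma of_real_rad:
  assumes "s = 1 \<or> s = -1"
  shows "mathieu_base s a q (\<i> * of_real x) = (if s = 1 then 1 else \<i>) * of_real (rad s a q x)"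
  using mathieu_base_cnj[OF assms, of a q "\<i> * of_real x"] mathieu_base_minus[OF assms, of a q "\<i> * of_real x"]
    assms by (auto simp: rad_def complex_eq_iff)

lemma ang_has_deriv:
  "(ang s a q has_real_derivative ang' s a q x) (at x within S)"
  "(ang' s a q has_real_derivative (2 * q * cos (2 * x) - a) * ang s a q x) (at x within S)"
proof -
  note d = mathieu_eq_deriv[OF mathieu_base(1)[of a q s]]
  have v: "((\<lambda>x. mathieu_base s a q (of_real x)) has_vector_derivative deriv (mathieu_base s a q) (of_real x)) (at x within S)"
    "((\<lambda>x. deriv (mathieu_base s a q) (of_real x)) has_vector_derivative
      (2 * of_real q * cos (2 * of_real x) - of_real a) * mathieu_base s a q (of_real x)) (at x within S)"
    by (intro has_vector_derivative_real_field d)+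
  show "(ang s a q has_real_derivative ang' s a q x) (at x within S)"
    unfolding ang_def[abs_def] ang'_def by (rule has_field_derivative_Re[OF v(1)])
  have "Re ((2 * of_real q * cos (2 * of_real x) - of_real a) * mathieu_base s a q (of_real x))
      = (2 * q * cos (2 * x) - a) * ang s a q x"
  proof -
    have "cos (2 * of_real x) = complex_of_real (cos (2 * x))" by (metis cos_of_real of_real_mult of_real_numeral)
    then show ?thesis by (simp add: ang_def)
  qed
  then show "(ang' s a q has_real_derivative (2 * q * cos (2 * x) - a) * ang s a q x) (at x within S)"
    unfolding ang'_def[abs_def] using has_field_derivative_Re[OF v(2)] by simp
qed

lemma rad_has_deriv:
  "(rad s a q has_real_derivative rad' s a q x) (at x within S)"
  "(rad' s a q has_real_derivative (a - 2 * q * cosh (2 * x)) * rad s a q x) (at x within S)"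
proof -
  define Y where "Y = mathieu_base s a q"
  note d = mathieu_eq_deriv[OF mathieu_base(1)[of a q s], folded Y_def]
  have m: "((\<lambda>w. \<i> * w) has_field_derivative \<i>) (at z)" for z
    by (auto intro!: derivative_eq_intros)
  have 1: "((\<lambda>w. Y (\<i> * w)) has_field_derivative \<i> * deriv Y (\<i> * z)) (at z)" for z
    using DERIV_chain2[OF d(1) m, of z] by (simp add: mult_ac)
  have 2: "((\<lambda>w. \<i> * deriv Y (\<i> * w)) has_field_derivative
      (of_real a - 2 * of_real q * cosh (2 * z)) * Y (\<i> * z)) (at z)" for z
  proof -
    have "\<i> * ((2 * of_real q * cos (2 * (\<i> * z)) - of_real a) * Y (\<i> * z) * \<i>)
        = (of_real a - 2 * of_real q * cosh (2 * z)) * Y (\<i> * z)"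
      unfolding cosh_conv_cos mult.left_commute[of 2 \<i> z] by (simp add: algebra_simps)
    then show ?thesis by (rule DERIV_cong[OF DERIV_cmult[OF DERIV_chain2[OF d(2) m]]])
  qed
  have v: "((\<lambda>x. Y (\<i> * of_real x)) has_vector_derivative \<i> * deriv Y (\<i> * of_real x)) (at x within S)"
    "((\<lambda>x. \<i> * deriv Y (\<i> * of_real x)) has_vector_derivative
      (of_real a - 2 * of_real q * cosh (2 * of_real x)) * Y (\<i> * of_real x)) (at x within S)"
    by (rule has_vector_derivative_real_field[OF 1], rule has_vector_derivative_real_field[OF 2])
  have c: "cosh (2 * of_real x) = complex_of_real (cosh (2 * x))" 
  proof -
    have "cosh (of_real t) = complex_of_real (cosh t)" for t
      unfolding cosh_def of_real_minus[symmetric] exp_of_real by (simp add: scaleR_conv_of_real)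
    from this[of "2 * x"] show ?thesis by simp
  qed
  show "(rad s a q has_real_derivative rad' s a q x) (at x within S)"
    unfolding rad_def[abs_def] rad'_def Y_def[symmetric]
    using has_field_derivative_Re[OF v(1)] has_field_derivative_Im[OF v(1)] by (cases "s = 1") auto
  show "(rad' s a q has_real_derivative (a - 2 * q * cosh (2 * x)) * rad s a q x) (at x within S)"
    unfolding rad_def rad'_def[abs_def] Y_def[symmetric]
    using has_field_derivative_Re[OF v(2)] has_field_derivative_Im[OF v(2)] unfolding c by (cases "s = 1") auto
qed

lemma ang_rad_0:
  "ang s a q 0 = (if s = 1 then 1 else 0)" "ang' s a q 0 = (if s = 1 then 0 else 1)"
  "rad s a q 0 = (if s = 1 then 1 else 0)" "rad' s a q 0 = (if s = 1 then 0 else 1)"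
  by (auto simp: ang_def ang'_def rad_def rad'_def mathieu_base)

lemma ang_rad_minus:
  assumes "s = 1 \<or> s = -1"
  shows "ang s a q (- x) = s * ang s a q x" "rad s a q (- x) = s * rad s a q x"
  using mathieu_base_minus[OF assms, of a q "of_real x"] mathieu_base_minus[OF assms, of a q "\<i> * of_real x"] assms
  by (auto simp: ang_def rad_def)

section \<open>The periodic boundary value problem\<close>

abbreviation "circ \<equiv> {0..2 * pi}"

definition ip :: "(real \<Rightarrow> real) \<Rightarrow> (real \<Rightarrow> real) \<Rightarrow> real" where
  "ip f g = integral circ (\<lambda>x. f x * g x)"

text \<open>The shift makes the potential at least 1, and thereby the resolvent positive.\<close>

definition pot :: "real \<Rightarrow> real \<Rightarrow> real" where
  "pot q x = 2 * q * cos (2 * x) + (2 * \<bar>q\<bar> + 1)"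

text \<open>\<open>\<phi>\<close> is the image of \<open>v\<close> under the resolvent, the inverse
  of -d^2/dx^2 + \<open>pot\<close> with periodic boundary conditions. The derivative is carried
  along as an explicit function, one-sided at the two ends, so that linear combinations are again of
  this form.\<close>

definition per_sol :: "real \<Rightarrow> (real \<Rightarrow> real) \<Rightarrow> (real \<Rightarrow> real) \<Rightarrow> (real \<Rightarrow> real) \<Rightarrow> bool" where
  "per_sol q v \<phi> \<phi>' \<longleftrightarrow> continuous_on circ v
     \<and> (\<forall>x\<in>circ. (\<phi> has_real_derivative \<phi>' x) (at x within circ))
     \<and> (\<forall>x\<in>circ. (\<phi>' has_real_derivative pot q x * \<phi> x - v x) (at x within circ))
     \<and> \<phi> 0 = \<phi> (2 * pi) \<and> \<phi>' 0 = \<phi>' (2 * pi)"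

lemma pot_bounds: "1 \<le> pot q x" "pot q x \<le> 4 * \<bar>q\<bar> + 1"
proof -
  have "\<bar>q * cos (2 * x)\<bar> \<le> \<bar>q\<bar> * 1" unfolding abs_mult by (intro mult_left_mono) auto
  then show "1 \<le> pot q x" "pot q x \<le> 4 * \<bar>q\<bar> + 1" unfolding pot_def by auto
qed

lemma continuous_on_pot [continuous_intros]: "continuous_on S (pot q)"
  unfolding pot_def[abs_def] by (intro continuous_intros)

lemma ip_commute: "ip f g = ip g f"
  by (simp add: ip_def mult.commute)

lemma ip_cong: "(\<And>x. x \<in> circ \<Longrightarrow> f x = f' x) \<Longrightarrow> (\<And>x. x \<in> circ \<Longrightarrow> g x = g' x) \<Longrightarrow> ip f g = ip f' g'"
  unfolding ip_def by (intro integral_cong) auto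

lemma ip_integrable:
  "continuous_on circ f \<Longrightarrow> continuous_on circ g \<Longrightarrow> (\<lambda>x. f x * g x) integrable_on circ"
  for f g :: "real \<Rightarrow> real"
  by (intro integrable_continuous_real continuous_intros)

lemma ip_lin:
  assumes "continuous_on circ f" "continuous_on circ g" "continuous_on circ h"
  shows "ip (\<lambda>x. a * f x + b * g x) h = a * ip f h + b * ip g h"
proof -
  have "ip (\<lambda>x. a * f x + b * g x) h = integral circ (\<lambda>x. a * (f x * h x) + b * (g x * h x))"
    unfolding ip_def by (simp add: algebra_simps)
  also have "\<dots> = a * ip f h + b * ip g h"
    unfolding ip_def using assms
    by (subst integral_add) (auto intro!: integrable_on_cmult_left ip_integrable continuous_intros)
  finally show ?thesis .
qed

lemma ip_cmult: "ip (\<lambda>x. c * f x) g = c * ip f g" "ip g (\<lambda>x. c * f x) = c * ip g f"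
  unfolding ip_def by (simp_all add: mult.assoc mult.left_commute)

lemma ip_zero_left [simp]: "ip (\<lambda>x. 0) g = 0"
  by (simp add: ip_def)

lemma ip_sum:
  assumes "\<And>i. i \<in> F \<Longrightarrow> continuous_on circ (e i)" "continuous_on circ h"
  shows "ip (\<lambda>x. \<Sum>i\<in>F. c i * e i x) h = (\<Sum>i\<in>F. c i * ip (e i) h)"
  using assms(1)
proof (induction F rule: infinite_finite_induct)
  case (insert i F)
  have "ip (\<lambda>x. \<Sum>j\<in>insert i F. c j * e j x) h = ip (\<lambda>x. c i * e i x + 1 * (\<Sum>j\<in>F. c j * e j x)) h"
    using insert by simp
  also have "\<dots> = c i * ip (e i) h + 1 * ip (\<lambda>x. \<Sum>j\<in>F. c j * e j x) h"
    using insert.prems assms(2) by (intro ip_lin continuous_intros) auto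
  finally show ?case using insert by simp
qed auto

lemma ip_square:
  assumes "continuous_on circ f" "continuous_on circ g"
  shows "ip (\<lambda>x. a * f x + b * g x) (\<lambda>x. a * f x + b * g x)
    = a\<^sup>2 * ip f f + 2 * a * b * ip f g + b\<^sup>2 * ip g g"
proof -
  have c: "continuous_on circ (\<lambda>x. a * f x + b * g x)" using assms by (intro continuous_intros)
  have 1: "ip f (\<lambda>x. a * f x + b * g x) = a * ip f f + b * ip f g"
    using ip_lin[OF assms assms(1), of a b] by (simp add: ip_commute)
  have 2: "ip g (\<lambda>x. a * f x + b * g x) = a * ip f g + b * ip g g"
    using ip_lin[OF assms assms(2), of a b] by (simp add: ip_commute)
  show ?thesis
    unfolding ip_lin[OF assms c] 1 2 by (simp add: power2_eq_square algebra_simps)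
qed

lemma ip_nonneg: "0 \<le> ip f f"
  by (cases "(\<lambda>x. f x * f x) integrable_on circ")
     (auto simp: ip_def not_integrable_integral intro: integral_nonneg)

lemma ip_mono:
  assumes "continuous_on circ f" "continuous_on circ g" "continuous_on circ f'" "continuous_on circ g'"
    and "\<And>x. x \<in> circ \<Longrightarrow> f x * g x \<le> f' x * g' x"
  shows "ip f g \<le> ip f' g'"
  unfolding ip_def using assms by (intro integral_le ip_integrable) auto

lemma ip_le_half:
  assumes "continuous_on circ f" "continuous_on circ g"
  shows "2 * ip f g \<le> ip f f + ip g g"
  using ip_square[OF assms, of 1 "-1"] ip_nonneg[of "\<lambda>x. 1 * f x + -1 * g x"] by simp

lemma ip_add_le:
  assumes "continuous_on circ f" "continuous_on circ g"
  shows "ip (\<lambda>x. f x + g x) (\<lambda>x. f x + g x) \<le> 2 * ip f f + 2 * ip g g"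
  using ip_square[OF assms, of 1 1] ip_le_half[OF assms] by simp

lemma ip_square_eq_0D:
  assumes "continuous_on circ f" "ip f f = 0" "x \<in> circ"
  shows "f x = 0"
proof -
  have "((\<lambda>x. f x * f x) has_integral 0) circ"
    using ip_integrable[OF assms(1,1)] assms(2) by (simp add: ip_def has_integral_iff)
  then have "f x * f x = 0"
    by (intro has_integral_0_cbox_imp_0[of 0 "2 * pi" "\<lambda>x. f x * f x"])
       (use assms pi_gt_zero in \<open>auto intro!: continuous_intros simp del: pi_gt_zero\<close>)
  then show ?thesis by simp
qed

text \<open>A one-dimensional Sobolev inequality: (g^2)' = 2 g g' is at most g^2 + g'^2 in modulus,
  so g^2 oscillates by at most \<open>D\<close> over the circle, and averaging over a second point
  compares g(x)^2 with the mean of g^2.\<close>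

lemma sup_bound:
  assumes d: "\<And>x. x \<in> circ \<Longrightarrow> (g has_real_derivative g' x) (at x within circ)"
    and c: "continuous_on circ g'" and x: "x \<in> circ"
  shows "(g x)\<^sup>2 \<le> 2 * (ip g g + ip g' g')"
proof -
  define D where "D = ip g g + ip g' g'"
  have cg: "continuous_on circ g" using d by (intro DERIV_continuous_on) auto
  have le: "(g b)\<^sup>2 - (g a)\<^sup>2 \<le> D \<and> (g a)\<^sup>2 - (g b)\<^sup>2 \<le> D" if ab: "a \<in> circ" "b \<in> circ" "a \<le> b" for a b
  proof -
    have sub: "{a..b} \<subseteq> circ" using ab by auto
    have "((\<lambda>x. 2 * (g x * g' x)) has_integral (g b)\<^sup>2 - (g a)\<^sup>2) {a..b}"
    proof (rule fundamental_theorem_of_calculus[OF ab(3)])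
      fix x assume "x \<in> {a..b}"
      then have "(g has_real_derivative g' x) (at x within {a..b})"
        using d sub by (meson DERIV_subset subsetD)
      then show "((\<lambda>x. (g x)\<^sup>2) has_vector_derivative 2 * (g x * g' x)) (at x within {a..b})"
        unfolding has_real_derivative_iff_has_vector_derivative[symmetric]
        by (auto intro!: derivative_eq_intros)
    qed
    then have i: "(g b)\<^sup>2 - (g a)\<^sup>2 = integral {a..b} (\<lambda>x. 2 * (g x * g' x))"
      by (rule integral_unique[symmetric])
    have "norm (integral {a..b} (\<lambda>x. 2 * (g x * g' x))) \<le> integral {a..b} (\<lambda>x. g x * g x + g' x * g' x)"
    proof (rule integral_norm_bound_integral)
      fix x
      have "0 \<le> (g x + g' x)\<^sup>2" "0 \<le> (g x - g' x)\<^sup>2" by auto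
      then show "norm (2 * (g x * g' x)) \<le> g x * g x + g' x * g' x"
        by (auto simp: power2_eq_square algebra_simps abs_le_iff)
    qed (use c cg sub in \<open>auto intro!: integrable_continuous_real continuous_intros intro: continuous_on_subset\<close>)
    also have "\<dots> \<le> integral circ (\<lambda>x. g x * g x + g' x * g' x)"
      using c cg sub by (intro integral_subset_le) 
        (auto intro!: integrable_continuous_real continuous_intros intro: continuous_on_subset)
    also have "\<dots> = D" unfolding D_def ip_def
      using c cg by (intro integral_add integrable_continuous_real continuous_intros)
    finally have "\<bar>(g b)\<^sup>2 - (g a)\<^sup>2\<bar> \<le> D" unfolding i by simp
    then show ?thesis by linarith
  qed
  have "(g x)\<^sup>2 \<le> (g y)\<^sup>2 + D" if "y \<in> circ" for y
    using le[of x y] le[of y x] x that by (cases "x \<le> y") auto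
  then have "integral circ (\<lambda>y. (g x)\<^sup>2) \<le> integral circ (\<lambda>y. (g y)\<^sup>2 + D)"
    using cg by (intro integral_le integrable_continuous_real continuous_intros) auto
  also have "\<dots> = ip g g + 2 * pi * D"
    unfolding ip_def using cg
    by (subst integral_add) (auto intro!: integrable_continuous_real continuous_intros simp: power2_eq_square)
  finally have 1: "2 * pi * (g x)\<^sup>2 \<le> ip g g + 2 * pi * D" by simp
  have "ip g g \<le> D" "0 \<le> D" unfolding D_def using ip_nonneg[of g] ip_nonneg[of g'] by auto
  \<comment> \<open>Crude but sufficient: the mean-square term is absorbed into a second copy of 2
    pi D, which produces the factor 2.\<close>
  moreover have "D * 1 \<le> 2 * pi * D" using pi_gt3 \<open>0 \<le> D\<close> mult_right_mono[of 1 "2 * pi" D] by simp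
  ultimately have "2 * pi * (g x)\<^sup>2 \<le> 2 * pi * (2 * D)" using 1 by linarith
  then have "(g x)\<^sup>2 \<le> 2 * D" by (rule mult_left_le_imp_le) (use pi_gt_zero in simp)
  then show ?thesis unfolding D_def .
qed

section \<open>A priori bounds and existence for the periodic problem\<close>

lemma per_sol_continuous:
  assumes "per_sol q v \<phi> \<phi>'"
  shows "continuous_on circ v" "continuous_on circ \<phi>" "continuous_on circ \<phi>'"
  using assms by (auto simp: per_sol_def intro!: DERIV_continuous_on)

lemma per_sol_lin:
  assumes "per_sol q v \<phi> \<phi>'" "per_sol q w \<psi> \<psi>'"
  shows "per_sol q (\<lambda>x. a * v x + b * w x) (\<lambda>x. a * \<phi> x + b * \<psi> x) (\<lambda>x. a * \<phi>' x + b * \<psi>' x)"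
  using assms unfolding per_sol_def
  by (auto intro!: continuous_intros derivative_eq_intros simp: algebra_simps)

lemma per_sol_cong:
  assumes "per_sol q v \<phi> \<phi>'" "\<And>x. x \<in> circ \<Longrightarrow> v x = w x" "\<And>x. x \<in> circ \<Longrightarrow> \<phi> x = \<psi> x"
  shows "per_sol q w \<psi> \<phi>'"
  unfolding per_sol_def
proof (intro conjI ballI)
  show "continuous_on circ w"
    by (rule continuous_on_eq[of _ v]) (use assms in \<open>auto simp: per_sol_def\<close>)
  fix x :: real assume x: "x \<in> circ"
  show "(\<psi> has_real_derivative \<phi>' x) (at x within circ)"
    unfolding has_field_derivative_def
    by (rule has_derivative_transform[OF x, of _ \<phi>])
       (use assms x in \<open>auto simp: per_sol_def has_field_derivative_def\<close>)
  show "(\<phi>' has_real_derivative pot q x * \<psi> x - w x) (at x within circ)"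
    using assms x by (auto simp: per_sol_def)
qed (use assms in \<open>auto simp: per_sol_def\<close>)

text \<open>The weak form of the equation: integrate (\<phi>' \<psi>)' over a period; the boundary
  terms cancel by periodicity. Its left side is symmetric in the two solutions, hence so is the
  resolvent.\<close>

lemma per_sol_energy:
  assumes "per_sol q v \<phi> \<phi>'" "per_sol q w \<psi> \<psi>'"
  shows "ip \<phi>' \<psi>' + ip (\<lambda>x. pot q x * \<phi> x) \<psi> = ip v \<psi>"
proof -
  note c = per_sol_continuous[OF assms(1)] per_sol_continuous[OF assms(2)]
  have "((\<lambda>x. (pot q x * \<phi> x - v x) * \<psi> x + \<phi>' x * \<psi>' x) has_integral
      \<phi>' (2 * pi) * \<psi> (2 * pi) - \<phi>' 0 * \<psi> 0) circ"
    using assms unfolding per_sol_def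
    by (intro fundamental_theorem_of_calculus)
       (auto simp: has_real_derivative_iff_has_vector_derivative[symmetric] intro!: derivative_eq_intros)
  moreover have "\<phi>' (2 * pi) * \<psi> (2 * pi) - \<phi>' 0 * \<psi> 0 = 0"
    using assms by (simp add: per_sol_def)
  ultimately have "integral circ (\<lambda>x. ((pot q x * \<phi> x) * \<psi> x + \<phi>' x * \<psi>' x) - v x * \<psi> x) = 0"
    by (simp add: integral_unique algebra_simps)
  also have "integral circ (\<lambda>x. ((pot q x * \<phi> x) * \<psi> x + \<phi>' x * \<psi>' x) - v x * \<psi> x)
      = integral circ (\<lambda>x. (pot q x * \<phi> x) * \<psi> x + \<phi>' x * \<psi>' x) - ip v \<psi>"
    unfolding ip_def using c by (intro integral_diff integrable_continuous_real continuous_intros)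
  also have "integral circ (\<lambda>x. (pot q x * \<phi> x) * \<psi> x + \<phi>' x * \<psi>' x)
      = ip (\<lambda>x. pot q x * \<phi> x) \<psi> + ip \<phi>' \<psi>'"
    unfolding ip_def using c by (intro integral_add integrable_continuous_real continuous_intros)
  finally show ?thesis by simp
qed

lemma per_sol_symmetric:
  assumes "per_sol q v \<phi> \<phi>'" "per_sol q w \<psi> \<psi>'"
  shows "ip v \<psi> = ip \<phi> w"
proof -
  have "ip (\<lambda>x. pot q x * \<phi> x) \<psi> = ip (\<lambda>x. pot q x * \<psi> x) \<phi>"
    unfolding ip_def by (simp add: mult_ac)
  then show ?thesis
    using per_sol_energy[OF assms] per_sol_energy[OF assms(2,1)] ip_commute[of \<phi>' \<psi>'] ip_commute[of \<phi> w] by simp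
qed

lemma ip_pot_ge:
  assumes "continuous_on circ \<phi>"
  shows "ip \<phi> \<phi> \<le> ip (\<lambda>x. pot q x * \<phi> x) \<phi>"
proof (rule ip_mono)
  fix x
  have "1 * (\<phi> x * \<phi> x) \<le> pot q x * (\<phi> x * \<phi> x)" using pot_bounds by (intro mult_right_mono) auto
  then show "\<phi> x * \<phi> x \<le> pot q x * \<phi> x * \<phi> x" by (simp add: mult.assoc)
qed (use assms in \<open>auto intro!: continuous_intros\<close>)

text \<open>Testing the equation with its own solution, where \<open>pot\<close> \<ge> 1, shows that
  the resolvent is positive and a contraction.\<close>

lemma per_sol_bounds:
  assumes "per_sol q v \<phi> \<phi>'"
  shows "ip \<phi> \<phi> + ip \<phi>' \<phi>' \<le> ip v \<phi>" "ip \<phi> \<phi> + ip \<phi>' \<phi>' \<le> ip v v" "ip \<phi> \<phi> \<le> ip v v"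
proof -
  note c = per_sol_continuous[OF assms]
  show 1: "ip \<phi> \<phi> + ip \<phi>' \<phi>' \<le> ip v \<phi>"
    using per_sol_energy[OF assms assms] ip_pot_ge[OF c(2), of q] by simp
  then show 2: "ip \<phi> \<phi> + ip \<phi>' \<phi>' \<le> ip v v" "ip \<phi> \<phi> \<le> ip v v"
    using ip_le_half[OF c(1,2)] ip_nonneg[of \<phi>'] ip_nonneg[of \<phi>] ip_nonneg[of v] by auto
qed

text \<open>The Sobolev inequality for \<open>\<phi>\<close> and then for \<open>\<phi>'\<close>,
  whose derivative \<open>pot\<close> \<phi> - v is controlled by the upper bound 4 |q| + 1 of the
  potential. The derivative bound is what yields equicontinuity below.\<close>

lemma per_sol_sup:
  assumes "per_sol q v \<phi> \<phi>'" "x \<in> circ"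
  shows "(\<phi> x)\<^sup>2 \<le> 2 * ip v v" "(\<phi>' x)\<^sup>2 \<le> (4 * (4 * \<bar>q\<bar> + 1)\<^sup>2 + 6) * ip v v"
proof -
  note c = per_sol_continuous[OF assms(1)] and b = per_sol_bounds[OF assms(1)]
  show "(\<phi> x)\<^sup>2 \<le> 2 * ip v v"
    using sup_bound[of \<phi> \<phi>' x] assms c b by (auto simp: per_sol_def)
  define K where "K = 4 * \<bar>q\<bar> + 1"
  define \<phi>'' where "\<phi>'' x = pot q x * \<phi> x + - 1 * v x" for x
  have "ip (\<lambda>x. pot q x * \<phi> x) (\<lambda>x. pot q x * \<phi> x) \<le> ip (\<lambda>x. K * \<phi> x) (\<lambda>x. K * \<phi> x)"
  proof (rule ip_mono)
    fix x
    have "pot q x * pot q x * (\<phi> x)\<^sup>2 \<le> K * K * (\<phi> x)\<^sup>2"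
      using pot_bounds[where q=q and x=x] unfolding K_def by (intro mult_right_mono mult_mono) auto
    then show "pot q x * \<phi> x * (pot q x * \<phi> x) \<le> K * \<phi> x * (K * \<phi> x)"
      by (simp add: mult_ac power2_eq_square)
  qed (use c in \<open>auto intro!: continuous_intros\<close>)
  then have 1: "ip (\<lambda>x. pot q x * \<phi> x) (\<lambda>x. pot q x * \<phi> x) \<le> K\<^sup>2 * ip \<phi> \<phi>"
    by (simp add: ip_cmult power2_eq_square)
  have "ip \<phi>'' \<phi>'' \<le> 2 * ip (\<lambda>x. pot q x * \<phi> x) (\<lambda>x. pot q x * \<phi> x) + 2 * ip (\<lambda>x. - 1 * v x) (\<lambda>x. - 1 * v x)"
    unfolding \<phi>''_def using c by (intro ip_add_le continuous_intros)
  also have "\<dots> \<le> 2 * (K\<^sup>2 * ip v v) + 2 * ip v v"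
    using 1 mult_left_mono[OF b(3), of "K\<^sup>2"] unfolding ip_cmult by simp
  finally have 2: "ip \<phi>'' \<phi>'' \<le> 2 * (K\<^sup>2 * ip v v) + 2 * ip v v" .
  have "(\<phi>' x)\<^sup>2 \<le> 2 * (ip \<phi>' \<phi>' + ip \<phi>'' \<phi>'')"
    using assms c by (intro sup_bound) (auto simp: per_sol_def \<phi>''_def intro!: continuous_intros)
  also have "\<dots> \<le> 2 * (ip v v + (2 * (K\<^sup>2 * ip v v) + 2 * ip v v))"
    using 2 b ip_nonneg[of \<phi>] by simp
  finally show "(\<phi>' x)\<^sup>2 \<le> (4 * (4 * \<bar>q\<bar> + 1)\<^sup>2 + 6) * ip v v"
    unfolding K_def by (simp add: algebra_simps)
qed

text \<open>Variation of constants gives all solutions on the interval; the two periodicity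
  conditions are a 2 by 2 linear system for the free constants, invertible because the homogeneous
  periodic problem has only the zero solution.\<close>

lemma per_sol_exists:
  assumes v: "continuous_on circ v"
  shows "\<exists>\<phi> \<phi>'. per_sol q v \<phi> \<phi>'"
proof -
  \<comment> \<open>For this value the coefficient of the Mathieu equation is exactly the shifted
    potential.\<close>
  define a where "a = - (2 * \<bar>q\<bar> + 1)"
  define y1 where "y1 = ang 1 a q"
  define y1' where "y1' = ang' 1 a q"
  define y2 where "y2 = ang (-1) a q"
  define y2' where "y2' = ang' (-1) a q"
  have pa: "2 * q * cos (2 * x) - a = pot q x" for x by (simp add: a_def pot_def)
  have d: "(y1 has_real_derivative y1' x) (at x within S)" "(y2 has_real_derivative y2' x) (at x within S)"
    "(y1' has_real_derivative pot q x * y1 x) (at x within S)"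
    "(y2' has_real_derivative pot q x * y2 x) (at x within S)" for x S
    using ang_has_deriv[where s=1 and a=a and q=q and x=x and S=S]
      ang_has_deriv[where s="-1" and a=a and q=q and x=x and S=S]
    unfolding pa y1_def y1'_def y2_def y2'_def by auto
  have i: "y1 0 = 1" "y1' 0 = 0" "y2 0 = 0" "y2' 0 = 1"
    by (auto simp: y1_def y1'_def y2_def y2'_def ang_rad_0)
  have W: "y1 x * y2' x - y1' x * y2 x = 1" for x
    by (rule linear_ode_representation(3)[OF _ _ d(1,3) d(1,3) d(2,4) i, of UNIV]) auto
  have cy: "continuous_on circ y1" "continuous_on circ y2"
    using d by (auto intro!: DERIV_continuous_on)
  define I1 where "I1 x = integral {0..x} (\<lambda>t. y1 t * v t)" for x
  define I2 where "I2 x = integral {0..x} (\<lambda>t. y2 t * v t)" for x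
  have dI: "(I1 has_real_derivative y1 x * v x) (at x within circ)"
    "(I2 has_real_derivative y2 x * v x) (at x within circ)" if "x \<in> circ" for x
    unfolding I1_def[abs_def] I2_def[abs_def]
    by (intro integral_has_real_derivative that continuous_intros cy v)+
  define u where "u \<alpha> \<beta> x = \<alpha> * y1 x + \<beta> * y2 x + (y1 x * I2 x - y2 x * I1 x)" for \<alpha> \<beta> x
  define u' where "u' \<alpha> \<beta> x = \<alpha> * y1' x + \<beta> * y2' x + (y1' x * I2 x - y2' x * I1 x)" for \<alpha> \<beta> x
  have du: "(u \<alpha> \<beta> has_real_derivative u' \<alpha> \<beta> x) (at x within circ)" if "x \<in> circ" for \<alpha> \<beta> x
    unfolding u_def[abs_def] u'_def
    by (rule derivative_eq_intros d dI that refl)+ (simp add: algebra_simps)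
  have du': "(u' \<alpha> \<beta> has_real_derivative pot q x * u \<alpha> \<beta> x - v x) (at x within circ)" if "x \<in> circ" for \<alpha> \<beta> x
  proof -
    have "v x = v x * (y1 x * y2' x - y1' x * y2 x)" by (simp add: W)
    then have e: "pot q x * u \<alpha> \<beta> x - v x = pot q x * u \<alpha> \<beta> x - v x * (y1 x * y2' x - y1' x * y2 x)" by simp
    show ?thesis unfolding e unfolding u'_def[abs_def] u_def
      by (rule derivative_eq_intros d dI that refl)+ (simp add: algebra_simps)
  qed
  define T where "T = 2 * pi"
  define m11 where "m11 = y1 T - 1"
  define m12 where "m12 = y2 T"
  define m21 where "m21 = y1' T"
  define m22 where "m22 = y2' T - 1"
  \<comment> \<open>A kernel vector would be a periodic solution with right-hand side 0, and the sup
    bounds annihilate its data at 0.\<close>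
  have ker: "\<alpha> = 0 \<and> \<beta> = 0" if "m11 * \<alpha> + m12 * \<beta> = 0" "m21 * \<alpha> + m22 * \<beta> = 0" for \<alpha> \<beta>
  proof -
    have "per_sol q (\<lambda>x. 0) (\<lambda>x. \<alpha> * y1 x + \<beta> * y2 x) (\<lambda>x. \<alpha> * y1' x + \<beta> * y2' x)"
      unfolding per_sol_def using that
      by (auto simp: i m11_def m12_def m21_def m22_def T_def algebra_simps intro!: derivative_eq_intros d)
    from per_sol_sup[OF this, of 0] show ?thesis by (simp add: i)
  qed
  define dt where "dt = m11 * m22 - m12 * m21"
  have dt: "dt \<noteq> 0"
  proof
    assume "dt = 0"
    \<comment> \<open>For determinant 0 the vectors (m12, -m11) and (m22, -m21) lie in the kernel,
      so the whole matrix vanishes; but then (1, 0) lies in the kernel as well.\<close>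
    then have "m12 = 0 \<and> m11 = 0" "m22 = 0 \<and> m21 = 0"
      using ker[of m12 "- m11"] ker[of m22 "- m21"] by (auto simp: dt_def algebra_simps)
    then show False using ker[of 1 0] by auto
  qed
  define P where "P = y1 T * I2 T - y2 T * I1 T"
  define P' where "P' = y1' T * I2 T - y2' T * I1 T"
  define \<alpha> where "\<alpha> = (m12 * P' - m22 * P) / dt"
  define \<beta> where "\<beta> = (m21 * P - m11 * P') / dt"
  have E: "dt * \<alpha> = m12 * P' - m22 * P" "dt * \<beta> = m21 * P - m11 * P'"
    using dt by (auto simp: \<alpha>_def \<beta>_def)
  have "dt * (m11 * \<alpha> + m12 * \<beta>) = m11 * (dt * \<alpha>) + m12 * (dt * \<beta>)"
    "dt * (m21 * \<alpha> + m22 * \<beta>) = m21 * (dt * \<alpha>) + m22 * (dt * \<beta>)" by (auto simp: algebra_simps)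
  then have "dt * (m11 * \<alpha> + m12 * \<beta>) = dt * (- P)" "dt * (m21 * \<alpha> + m22 * \<beta>) = dt * (- P')"
    unfolding E by (auto simp: dt_def algebra_simps)
  then have e: "m11 * \<alpha> + m12 * \<beta> = - P" "m21 * \<alpha> + m22 * \<beta> = - P'"
    using dt unfolding mult_left_cancel[OF dt] by auto
  have I0: "I1 0 = 0" "I2 0 = 0" by (auto simp: I1_def I2_def)
  have "per_sol q v (u \<alpha> \<beta>) (u' \<alpha> \<beta>)"
    unfolding per_sol_def
    using v du du' e by (auto simp: u_def u'_def I0 i P_def P'_def m11_def m12_def m21_def m22_def T_def algebra_simps)
  then show ?thesis by blast
qed

section \<open>Compactness and norm of the resolvent\<close>

lemma ip_Cauchy_Schwarz:
  assumes "continuous_on circ f" "continuous_on circ g"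
  shows "(ip f g)\<^sup>2 \<le> ip f f * ip g g"
proof (cases "ip g g = 0")
  case True
  have "ip f g = ip f (\<lambda>x. 0)"
    by (rule ip_cong) (use ip_square_eq_0D[OF assms(2) True] in auto)
  also have "\<dots> = 0" using ip_commute[of f "\<lambda>x. 0"] by simp
  finally show ?thesis using True by simp
next
  case False
  then have g: "ip g g > 0" using ip_nonneg[of g] by simp
  define t where "t = - ip f g / ip g g"
  have "0 \<le> ip f f + 2 * t * ip f g + t\<^sup>2 * ip g g"
    using ip_square[OF assms, of 1 t] ip_nonneg[of "\<lambda>x. 1 * f x + t * g x"] by simp
  then show ?thesis using g by (simp add: t_def power2_eq_square field_simps)
qed

lemma ip_diff_uniform_limit:
  assumes "uniform_limit circ f g sequentially" "\<And>n. continuous_on circ (f n)" "continuous_on circ g"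
  shows "(\<lambda>n. ip (\<lambda>x. f n x - g x) (\<lambda>x. f n x - g x)) \<longlonglongrightarrow> 0"
proof (rule LIMSEQ_I)
  fix r :: real assume r: "r > 0"
  define e where "e = sqrt (r / (4 * pi))"
  have e: "e > 0" "e * e = r / (4 * pi)" using r by (auto simp: e_def)
  obtain N where N: "\<And>n x. n \<ge> N \<Longrightarrow> x \<in> circ \<Longrightarrow> \<bar>f n x - g x\<bar> < e"
    using uniform_limitD[OF assms(1) e(1)] unfolding eventually_sequentially dist_real_def by metis
  have "norm (ip (\<lambda>x. f n x - g x) (\<lambda>x. f n x - g x) - 0) < r" if "n \<ge> N" for n
  proof -
    have "ip (\<lambda>x. f n x - g x) (\<lambda>x. f n x - g x) \<le> ip (\<lambda>x. e) (\<lambda>x. e)"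
    proof (rule ip_mono)
      fix x assume "x \<in> circ"
      then have "\<bar>f n x - g x\<bar> * \<bar>f n x - g x\<bar> \<le> e * e"
        using N[OF that] by (intro mult_mono) (use e in \<open>auto intro: less_imp_le\<close>)
      then show "(f n x - g x) * (f n x - g x) \<le> e * e" by (simp flip: abs_mult)
    qed (use assms in \<open>auto intro!: continuous_intros\<close>)
    also have "\<dots> = r / 2" unfolding ip_def e(2) by simp
    finally show ?thesis using r ip_nonneg[of "\<lambda>x. f n x - g x"] by simp
  qed
  then show "\<exists>no. \<forall>n\<ge>no. norm (ip (\<lambda>x. f n x - g x) (\<lambda>x. f n x - g x) - 0) < r" by blast
qed

lemma ip_tendsto:
  assumes "(\<lambda>n. ip (\<lambda>x. f n x - g x) (\<lambda>x. f n x - g x)) \<longlonglongrightarrow> 0"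
    and "\<And>n. continuous_on circ (f n)" "continuous_on circ g"
  shows "continuous_on circ h \<Longrightarrow> (\<lambda>n. ip (f n) h) \<longlonglongrightarrow> ip g h"
    and "(\<lambda>n. ip (f n) (f n)) \<longlonglongrightarrow> ip g g"
proof -
  define d where "d n x = f n x - g x" for n x
  have cd: "continuous_on circ (d n)" for n unfolding d_def[abs_def] using assms by (intro continuous_intros)
  have 1: "(\<lambda>n. ip (d n) h) \<longlonglongrightarrow> 0" if h: "continuous_on circ h" for h
  proof (rule Lim_null_comparison)
    have "\<bar>ip (d n) h\<bar> \<le> sqrt (ip (d n) (d n) * ip h h)" for n
      using ip_Cauchy_Schwarz[OF cd h] by (intro real_le_rsqrt) simp
    then show "\<forall>\<^sub>F n in sequentially. norm (ip (d n) h) \<le> sqrt (ip (d n) (d n) * ip h h)" by simp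
    have "(\<lambda>n. sqrt (ip (d n) (d n) * ip h h)) \<longlonglongrightarrow> sqrt (0 * ip h h)"
      using assms(1) unfolding d_def by (intro tendsto_intros)
    then show "(\<lambda>n. sqrt (ip (d n) (d n) * ip h h)) \<longlonglongrightarrow> 0" by simp
  qed
  have f: "f n = (\<lambda>x. 1 * d n x + 1 * g x)" for n by (auto simp: d_def)
  show "(\<lambda>n. ip (f n) h) \<longlonglongrightarrow> ip g h" if h: "continuous_on circ h"
  proof -
    have "ip (f n) h = ip (d n) h + ip g h" for n
      unfolding f using ip_lin[OF cd assms(3) h, of 1 n 1] by simp
    then show ?thesis using tendsto_add[OF 1[OF h] tendsto_const[of "ip g h"]] by simp
  qed
  have "ip (f n) (f n) = ip (d n) (d n) + 2 * ip (d n) g + ip g g" for n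
    unfolding f using ip_square[OF cd assms(3), of 1 n 1] by simp
  moreover have "(\<lambda>n. ip (d n) (d n) + 2 * ip (d n) g + ip g g) \<longlonglongrightarrow> 0 + 2 * 0 + ip g g"
    using assms(1) unfolding d_def[symmetric] by (intro tendsto_intros 1 assms)
  ultimately show "(\<lambda>n. ip (f n) (f n)) \<longlonglongrightarrow> ip g g" by simp
qed

text \<open>Compactness of the resolvent, from the mean square norm into the uniform norm: the sup
  bounds make the solutions equibounded and equi-Lipschitz, so the Arzela-Ascoli theorem
  applies.\<close>

lemma per_sol_compact:
  fixes v \<phi> :: "nat \<Rightarrow> real \<Rightarrow> real"
  assumes s: "\<And>n. per_sol q (v n) (\<phi> n) (\<phi>' n)" and B: "\<And>n. ip (v n) (v n) \<le> B"
  shows "\<exists>g (k :: nat \<Rightarrow> nat). continuous_on circ g \<and> strict_mono k \<and> uniform_limit circ (\<lambda>n. \<phi> (k n)) g sequentially"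
proof -
  define K where "K = (4 * (4 * \<bar>q\<bar> + 1)\<^sup>2 + 6) * B"
  define L where "L = sqrt K"
  have "0 \<le> B" using B[of 0] ip_nonneg[of "v 0"] by simp
  then have K0: "0 \<le> K" unfolding K_def by (intro mult_nonneg_nonneg) auto
  then have L0: "0 \<le> L" by (simp add: L_def)
  have d: "\<bar>\<phi>' n x\<bar> \<le> L" if "x \<in> circ" for n x
  proof -
    have "(\<phi>' n x)\<^sup>2 \<le> (4 * (4 * \<bar>q\<bar> + 1)\<^sup>2 + 6) * ip (v n) (v n)" by (rule per_sol_sup(2)[OF s that])
    also have "\<dots> \<le> K" unfolding K_def by (intro mult_left_mono B) auto
    finally show ?thesis unfolding L_def by (intro real_le_rsqrt) simp
  qed
  have m: "\<bar>\<phi> n x\<bar> \<le> sqrt (2 * B)" if "x \<in> circ" for n x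
    using per_sol_sup(1)[OF s[of n] that] B[of n] by (intro real_le_rsqrt) simp
  have lip: "\<bar>\<phi> n x - \<phi> n y\<bar> \<le> L * \<bar>x - y\<bar>" if "x \<in> circ" "y \<in> circ" for n x y
    using field_differentiable_bound[of circ "\<phi> n" "\<phi>' n" L x y] s[of n] d that by (auto simp: per_sol_def)
  obtain g k where g: "continuous_on circ g" "strict_mono (k :: nat \<Rightarrow> nat)"
    "\<And>e. 0 < e \<Longrightarrow> \<exists>N. \<forall>n x. n \<ge> N \<and> x \<in> circ \<longrightarrow> norm (\<phi> (k n) x - g x) < e"
  proof (rule Arzela_Ascoli[of circ \<phi> "sqrt (2 * B)"])
    fix x e :: real assume xe: "x \<in> circ" "0 < e"
    show "\<exists>d>0. \<forall>n y. y \<in> circ \<and> norm (x - y) < d \<longrightarrow> norm (\<phi> n x - \<phi> n y) < e"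
    proof (intro exI[of _ "e / (L + 1)"] conjI allI impI)
      fix n y assume y: "y \<in> circ \<and> norm (x - y) < e / (L + 1)"
      have "\<bar>\<phi> n x - \<phi> n y\<bar> \<le> L * \<bar>x - y\<bar>" using lip xe y by blast
      also have "\<dots> \<le> (L + 1) * \<bar>x - y\<bar>" by (intro mult_right_mono) auto
      also have "\<dots> < e" using y L0 by (simp add: field_simps)
      finally show "norm (\<phi> n x - \<phi> n y) < e" by simp
    qed (use xe L0 in auto)
  qed (use m in auto)
  have "uniform_limit circ (\<lambda>n. \<phi> (k n)) g sequentially"
    unfolding uniform_limit_iff eventually_sequentially dist_norm using g(3) by blast
  then show ?thesis using g by blast
qed

text \<open>The supremum \<open>S\<close> of the squared norm of the solution operator on a closed invariant subspace
  is attained: for a maximizing sequence \<open>v n\<close>, the square of the operator acts on a limit \<open>y\<close> of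
  the solutions as multiplication by \<open>S\<close>, and positivity of the operator excludes the eigenvalue
  \<open>- sqrt S\<close>.\<close>

lemma spectral_bound:
  fixes W :: "(real \<Rightarrow> real) set"
  assumes Wc: "\<And>v. v \<in> W \<Longrightarrow> continuous_on circ v"
    and Wlin: "\<And>v w a b. v \<in> W \<Longrightarrow> w \<in> W \<Longrightarrow> (\<lambda>x. a * v x + b * w x) \<in> W"
    and Wsol: "\<And>v \<phi> \<phi>'. v \<in> W \<Longrightarrow> per_sol q v \<phi> \<phi>' \<Longrightarrow> \<phi> \<in> W"
    and Wlim: "\<And>f g. (\<And>n. f n \<in> W) \<Longrightarrow> continuous_on circ g
      \<Longrightarrow> uniform_limit circ f g sequentially \<Longrightarrow> g \<in> W"
    and eig: "\<And>\<phi> \<phi>' \<mu> x. \<phi> \<in> W \<Longrightarrow> per_sol q (\<lambda>x. \<mu> * \<phi> x) \<phi> \<phi>' \<Longrightarrow> x \<in> circ \<Longrightarrow> \<phi> x \<noteq> 0 \<Longrightarrow> L \<le> \<mu>"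
    and L: "L > 0" and v: "v \<in> W" "per_sol q v \<phi> \<phi>'"
  shows "L\<^sup>2 * ip \<phi> \<phi> \<le> ip v v"
proof (rule ccontr)
  assume "\<not> ?thesis"
  then have contr: "ip v v < L\<^sup>2 * ip \<phi> \<phi>" by simp
  define A where "A = {ip \<phi> \<phi> | v \<phi> \<phi>'. v \<in> W \<and> ip v v \<le> 1 \<and> per_sol q v \<phi> \<phi>'}"
  define S where "S = Sup A"
  have bdd: "bdd_above A"
    unfolding A_def by (intro bdd_aboveI[of _ 1]) (auto dest: per_sol_bounds(3))
  have H: "ip \<psi> \<psi> \<le> S * ip w w" if w: "w \<in> W" "per_sol q w \<psi> \<psi>'" for w \<psi> \<psi>'
  proof (cases "ip w w = 0")
    case True
    then show ?thesis using per_sol_bounds(3)[OF w(2)] by simp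
  next
    case False
    then have p: "ip w w > 0" using ip_nonneg[of w] by simp
    define c where "c = 1 / sqrt (ip w w)"
    have c: "c * c = 1 / ip w w" using p by (simp add: c_def)
    have "(\<lambda>x. c * w x + 0 * w x) \<in> W" by (intro Wlin w)
    moreover have "per_sol q (\<lambda>x. c * w x + 0 * w x) (\<lambda>x. c * \<psi> x + 0 * \<psi> x) (\<lambda>x. c * \<psi>' x + 0 * \<psi>' x)"
      by (intro per_sol_lin w)
    moreover have "ip (\<lambda>x. c * w x + 0 * w x) (\<lambda>x. c * w x + 0 * w x) = c * c * ip w w" by (simp add: ip_cmult)
    ultimately have "ip (\<lambda>x. c * \<psi> x + 0 * \<psi> x) (\<lambda>x. c * \<psi> x + 0 * \<psi> x) \<in> A"
      unfolding A_def using p c by force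
    then have "c * c * ip \<psi> \<psi> \<le> S"
      unfolding S_def using cSup_upper[OF _ bdd] by (simp add: ip_cmult mult.assoc)
    then show ?thesis unfolding c using p by (simp add: field_simps)
  qed
  have p\<phi>: "ip \<phi> \<phi> > 0" using contr L ip_nonneg[of v] by (metis less_le_trans not_le zero_less_mult_pos zero_less_power le_less_trans)
  have vpos: "ip v v > 0" using p\<phi> per_sol_bounds(3)[OF v(2)] by simp
  have "ip v v < L\<^sup>2 * (S * ip v v)"
    \<comment> \<open>The supposed violation says that the squared norm \<open>S\<close> of the
      resolvent on \<open>W\<close> exceeds 1 / L^2.\<close>
    by (rule less_le_trans[OF contr mult_left_mono[OF H[OF v]]]) simp
  then have SL: "1 < L\<^sup>2 * S" using vpos by (simp add: mult.assoc[symmetric])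
  then have S0: "S > 0" using L by (metis less_trans zero_less_mult_pos zero_less_one zero_less_power)
  have ne: "A \<noteq> {}" using v vpos S0 unfolding A_def
  proof -
    have "(\<lambda>x. 0 * v x + 0 * v x) \<in> W" by (intro Wlin v)
    moreover have "per_sol q (\<lambda>x. 0 * v x + 0 * v x) (\<lambda>x. 0 * \<phi> x + 0 * \<phi> x) (\<lambda>x. 0 * \<phi>' x + 0 * \<phi>' x)"
      by (intro per_sol_lin v)
    ultimately show "{ip \<phi> \<phi> | v \<phi> \<phi>'. v \<in> W \<and> ip v v \<le> 1 \<and> per_sol q v \<phi> \<phi>'} \<noteq> {}"
      by (auto intro!: exI[of _ "\<lambda>x. 0 * v x + 0 * v x"])
  qed
  have "\<exists>v \<phi> \<phi>'. v \<in> W \<and> ip v v \<le> 1 \<and> per_sol q v \<phi> \<phi>' \<and> S - 1 / real (Suc n) < ip \<phi> \<phi>" for n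
  proof -
    have "S - 1 / real (Suc n) < Sup A" unfolding S_def by simp
    then obtain a where "a \<in> A" "S - 1 / real (Suc n) < a" using less_cSupE[OF _ ne] by blast
    then show ?thesis unfolding A_def by blast
  qed
  then obtain V P P' where V: "\<And>n. V n \<in> W" "\<And>n. ip (V n) (V n) \<le> 1" "\<And>n. per_sol q (V n) (P n) (P' n)"
    "\<And>n. S - 1 / real (Suc n) < ip (P n) (P n)" by metis
  have PW: "P n \<in> W" for n by (rule Wsol[OF V(1) V(3)])
  have PS: "ip (P n) (P n) \<le> S" for n
  proof -
    have "ip (P n) (P n) \<le> S * ip (V n) (V n)" by (rule H[OF V(1)[of n] V(3)[of n]])
    also have "\<dots> \<le> S * 1" using V(2)[of n] S0 by (intro mult_left_mono) auto
    finally show ?thesis by simp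
  qed
  obtain y k where y: "continuous_on circ y" "strict_mono (k :: nat \<Rightarrow> nat)"
    "uniform_limit circ (\<lambda>n. P (k n)) y sequentially"
    using per_sol_compact[where v = V and \<phi> = P and \<phi>' = P', OF V(3) V(2)] by blast
  have yW: "y \<in> W" by (rule Wlim[OF PW y(1,3)])
  obtain z z' where z: "per_sol q y z z'" using per_sol_exists[OF y(1)] by blast
  have zW: "z \<in> W" by (rule Wsol[OF yW z])
  obtain \<psi> \<psi>' where \<psi>: "per_sol q z \<psi> \<psi>'" using per_sol_exists[OF per_sol_continuous(2)[OF z]] by blast
  define r where "r n = ip (\<lambda>x. P (k n) x - y x) (\<lambda>x. P (k n) x - y x)" for n
  have r0: "r \<longlonglongrightarrow> 0"
    unfolding r_def[abs_def] by (rule ip_diff_uniform_limit[OF y(3) _ y(1)]) (use PW Wc in auto)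
  define e where "e x = \<psi> x - S * y x" for x
  \<comment> \<open>Write R for the resolvent, so that \<open>P n\<close> = R \<open>V n\<close> and
    \<open>e\<close> = R^2 y - S y. It splits into R^2 (y - P), then R (R P - S V), then S (P - y).
    The outer terms are controlled by \<open>r\<close>, as R is a contraction. For the middle one,
    symmetry gives <V, R P> = <P, P>, whence |R P - S V|^2 \<le> S (S - |P|^2), which is small along
    a maximizing sequence.\<close>
  have bound: "ip e e \<le> (2 + 4 * S\<^sup>2) * r n + 4 * S * (1 / real (Suc n))" for n
  proof -
    define m where "m = k n"
    obtain \<kappa> \<kappa>' where \<kappa>: "per_sol q (P m) \<kappa> \<kappa>'" using per_sol_exists[OF Wc[OF PW]] by blast
    obtain \<tau> \<tau>' where \<tau>: "per_sol q \<kappa> \<tau> \<tau>'" using per_sol_exists[OF per_sol_continuous(2)[OF \<kappa>]] by blast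
    note c = per_sol_continuous[OF \<kappa>] per_sol_continuous[OF \<tau>] per_sol_continuous[OF \<psi>] per_sol_continuous[OF z] 
      Wc[OF V(1)[of m]]
    define d where "d x = 1 * \<kappa> x + (- S) * V m x" for x
    have sm: "ip (V m) \<kappa> = ip (P m) (P m)" by (rule per_sol_symmetric[OF V(3) \<kappa>])
    have "ip d d = ip \<kappa> \<kappa> - 2 * S * ip (V m) \<kappa> + S\<^sup>2 * ip (V m) (V m)"
      unfolding d_def using ip_square[OF c(2) c(13), of 1 "- S"] by (simp add: ip_commute)
    also have "\<dots> \<le> S * ip (P m) (P m) - 2 * S * ip (P m) (P m) + S\<^sup>2 * 1"
      unfolding sm using H[OF PW \<kappa>] V(2)[of m] S0 by (intro add_mono diff_mono mult_left_mono) auto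
    also have "\<dots> = S * (S - ip (P m) (P m))" by (simp add: power2_eq_square algebra_simps)
    also have "\<dots> \<le> S * (1 / real (Suc m))" using V(4)[of m] S0 by (intro mult_left_mono) auto
    also have "\<dots> \<le> S * (1 / real (Suc n))"
      using S0 seq_suble[OF y(2), of n] unfolding m_def by (intro mult_left_mono divide_left_mono) auto
    finally have dd: "ip d d \<le> S * (1 / real (Suc n))" .
    have p1: "per_sol q d (\<lambda>x. 1 * \<tau> x + (- S) * P m x) (\<lambda>x. 1 * \<tau>' x + (- S) * P' m x)"
      unfolding d_def by (rule per_sol_lin[OF \<tau> V(3)])
    have p2: "per_sol q (\<lambda>x. - 1 * P m x + 1 * y x) (\<lambda>x. - 1 * \<kappa> x + 1 * z x) (\<lambda>x. - 1 * \<kappa>' x + 1 * z' x)"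
      by (rule per_sol_lin[OF \<kappa> z])
    have p3: "per_sol q (\<lambda>x. - 1 * \<kappa> x + 1 * z x) (\<lambda>x. - 1 * \<tau> x + 1 * \<psi> x) (\<lambda>x. - 1 * \<tau>' x + 1 * \<psi>' x)"
      by (rule per_sol_lin[OF \<tau> \<psi>])
    define E1 where "E1 x = - 1 * \<tau> x + 1 * \<psi> x" for x
    define E2 where "E2 x = 1 * \<tau> x + (- S) * P m x" for x
    define E3 where "E3 x = S * (P m x - y x)" for x
    have rr: "ip (\<lambda>x. - 1 * P m x + 1 * y x) (\<lambda>x. - 1 * P m x + 1 * y x) = r n"
      unfolding r_def m_def ip_def by (simp add: algebra_simps)
    have 1: "ip E1 E1 \<le> r n"
      using per_sol_bounds(3)[OF p3] per_sol_bounds(3)[OF p2] unfolding E1_def rr by linarith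
    have 2: "ip E2 E2 \<le> S * (1 / real (Suc n))"
      using per_sol_bounds(3)[OF p1] dd unfolding E2_def by linarith
    have 3: "ip E3 E3 = S\<^sup>2 * r n"
      unfolding E3_def ip_cmult r_def m_def by (simp add: power2_eq_square)
    have cE: "continuous_on circ E1" "continuous_on circ E2" "continuous_on circ E3"
      unfolding E1_def[abs_def] E2_def[abs_def] E3_def[abs_def] using c y by (auto intro!: continuous_intros)
    have "e = (\<lambda>x. E1 x + (E2 x + E3 x))" by (auto simp: e_def E1_def E2_def E3_def algebra_simps)
    then have "ip e e \<le> 2 * ip E1 E1 + 2 * ip (\<lambda>x. E2 x + E3 x) (\<lambda>x. E2 x + E3 x)"
      using ip_add_le[OF cE(1), of "\<lambda>x. E2 x + E3 x"] cE by (simp add: continuous_intros)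
    also have "\<dots> \<le> 2 * ip E1 E1 + 2 * (2 * ip E2 E2 + 2 * ip E3 E3)"
      using ip_add_le[OF cE(2,3)] by simp
    also have "\<dots> \<le> 2 * r n + 2 * (2 * (S * (1 / real (Suc n))) + 2 * (S\<^sup>2 * r n))"
      using 1 2 3 by simp
    finally show ?thesis by (simp add: algebra_simps)
  qed
  have "(\<lambda>n. (2 + 4 * S\<^sup>2) * r n + 4 * S * (1 / real (Suc n))) \<longlonglongrightarrow> (2 + 4 * S\<^sup>2) * 0 + 4 * S * 0"
    by (intro tendsto_intros r0 LIMSEQ_Suc[OF lim_1_over_n])
  then have "ip e e \<le> 0" using bound by (intro LIMSEQ_le_const) auto
  then have "ip e e = 0" using ip_nonneg[of e] by simp
  moreover have "continuous_on circ e"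
    unfolding e_def[abs_def] using per_sol_continuous[OF \<psi>] y by (intro continuous_intros)
  ultimately have \<psi>y: "\<psi> x = S * y x" if "x \<in> circ" for x
    using ip_square_eq_0D[of e x] that by (simp add: e_def)
  have yy: "ip y y = S"
  proof (rule LIMSEQ_unique)
    show "(\<lambda>n. ip (P (k n)) (P (k n))) \<longlonglongrightarrow> ip y y"
      by (rule ip_tendsto(2)[OF r0[unfolded r_def[abs_def]]]) (use PW Wc y in auto)
    have "(\<lambda>n. ip (P n) (P n)) \<longlonglongrightarrow> S"
    proof (rule tendsto_sandwich[OF always_eventually always_eventually])
      show "(\<lambda>n. S - 1 / real (Suc n)) \<longlonglongrightarrow> S"
        using tendsto_diff[OF tendsto_const[of S] LIMSEQ_Suc[OF lim_1_over_n]] by simp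
      show "\<forall>n. S - 1 / real (Suc n) \<le> ip (P n) (P n)" using V(4) less_imp_le by blast
      show "\<forall>n. ip (P n) (P n) \<le> S" "(\<lambda>n. S) \<longlonglongrightarrow> S" using PS by auto
    qed
    from LIMSEQ_subseq_LIMSEQ[OF this y(2)] show "(\<lambda>n. ip (P (k n)) (P (k n))) \<longlonglongrightarrow> S" by (simp add: o_def)
  qed
  define m where "m = sqrt S"
  have m: "m > 0" "m * m = S" using S0 by (auto simp: m_def)
  \<comment> \<open>R^2 - m^2 = (R - m)(R + m) annihilates \<open>y\<close>, so (R + m) y is either
    an eigenfunction with \<mu> = 1 / m < L or zero. In the second case R y = -m y, against
    positivity.\<close>
  define \<eta> where "\<eta> x = 1 * z x + m * y x" for x
  have \<eta>W: "\<eta> \<in> W" unfolding \<eta>_def[abs_def] by (intro Wlin zW yW)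
  have "per_sol q \<eta> (\<lambda>x. 1 * \<psi> x + m * z x) (\<lambda>x. 1 * \<psi>' x + m * z' x)"
    unfolding \<eta>_def[abs_def] by (rule per_sol_lin[OF \<psi> z])
  from per_sol_lin[OF this this, of "1 / m" 0]
  have sol: "per_sol q (\<lambda>x. 1 / m * \<eta> x) \<eta> (\<lambda>x. 1 / m * (1 * \<psi>' x + m * z' x) + 0 * (1 * \<psi>' x + m * z' x))"
    by (rule per_sol_cong) (use m in \<open>auto simp: \<psi>y \<eta>_def field_simps\<close>)
  show False
  proof (cases "\<exists>x\<in>circ. \<eta> x \<noteq> 0")
    case True
    then have "L \<le> 1 / m" using eig[OF \<eta>W sol] by auto
    then have "L * m \<le> 1" using m by (simp add: field_simps)
    then have "(L * m) * (L * m) \<le> 1 * 1" using L m by (intro mult_mono) auto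
    then show False using SL m by (simp add: power2_eq_square mult_ac)
  next
    case False
    then have "z x = (- m) * y x" if "x \<in> circ" for x
    proof -
      have "\<eta> x = 0" using False that by blast
      then show ?thesis by (simp add: \<eta>_def)
    qed
    then have "ip y z = ip y (\<lambda>x. (- m) * y x)" by (intro ip_cong) auto
    also have "\<dots> = - (m * S)" unfolding ip_cmult yy by simp
    also have "\<dots> < 0" using m S0 by simp
    finally show False using per_sol_bounds(1)[OF z] ip_nonneg[of z] ip_nonneg[of z'] by simp
  qed
qed

section \<open>Mathieu eigenvalues\<close>

lemma ang_continuous [continuous_intros]:
  "continuous_on S (ang s a q)" "continuous_on S (ang' s a q)"
  by (rule DERIV_continuous_on[OF ang_has_deriv(1)], rule DERIV_continuous_on[OF ang_has_deriv(2)])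

lemma mathieu_eq_parity:
  assumes "mathieu_eq a q \<phi>" "s = 1 \<or> s = -1" "\<And>z. \<phi> (- z) = of_real s * \<phi> z"
  shows "\<phi> z = (if s = 1 then \<phi> 0 else deriv \<phi> 0) * mathieu_base s a q z"
proof -
  note r = mathieu_eq_representation[OF assms(1)]
  have m: "mathieu_base 1 a q (- z) = mathieu_base 1 a q z" 
    "mathieu_base (-1) a q (- z) = - mathieu_base (-1) a q z"
    using mathieu_base_minus[of 1 a q z] mathieu_base_minus[of "-1" a q z] by auto
  have "\<phi> (- z) = of_real s * \<phi> z" by (rule assms)
  then show ?thesis
    using assms(2) unfolding r[of "- z"] m by (auto simp: r[of z])
qed

lemma mathieu_sol_altdef:
  "mathieu_sol a q \<phi> \<longleftrightarrow> mathieu_eq a q \<phi> \<and> (\<forall>z. \<phi> (z + 2 * of_real pi) = \<phi> z) \<and> (\<exists>z. \<phi> z \<noteq> 0)"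
proof -
  have "(d + (of_real a - 2 * of_real q * cos (2 * z)) * p = 0) \<longleftrightarrow>
      d = (2 * of_real q * cos (2 * z) - of_real a) * p" for d p z :: complex
    by (auto simp: algebra_simps add_eq_0_iff)
  then show ?thesis unfolding mathieu_sol_def mathieu_eq_def by auto
qed

lemma mathieu_eigenvalues_iff:
  assumes "s = 1 \<or> s = -1"
  shows "a \<in> mathieu_eigenvalues s q \<longleftrightarrow> mathieu_sol a q (mathieu_base s a q)"
proof
  assume "a \<in> mathieu_eigenvalues s q"
  then obtain \<phi> where \<phi>: "mathieu_sol a q \<phi>" "\<And>z. \<phi> (- z) = of_real s * \<phi> z"
    by (auto simp: mathieu_eigenvalues_def)
  define c where "c = (if s = 1 then \<phi> 0 else deriv \<phi> 0)"
  have c: "\<phi> z = c * mathieu_base s a q z" for z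
    unfolding c_def using mathieu_eq_parity[of a q \<phi> s z] \<phi> assms by (auto simp: mathieu_sol_altdef)
  then show "mathieu_sol a q (mathieu_base s a q)"
    using \<phi>(1) unfolding mathieu_sol_altdef c by (auto simp: mathieu_base)
next
  assume "mathieu_sol a q (mathieu_base s a q)"
  then show "a \<in> mathieu_eigenvalues s q"
    using mathieu_base_minus[OF assms] by (auto simp: mathieu_eigenvalues_def)
qed

lemma mathieu_eq_shift:
  assumes "mathieu_eq a q \<phi>"
  shows "mathieu_eq a q (\<lambda>z. \<phi> (z + 2 * of_real pi))"
    "deriv (\<lambda>z. \<phi> (z + 2 * of_real pi)) = (\<lambda>z. deriv \<phi> (z + 2 * of_real pi))"
proof -
  note d = mathieu_eq_deriv[OF assms]
  have p: "cos (w + complex_of_real (2 * pi)) = cos w" for w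
    unfolding cos_add cos_of_real sin_of_real by simp
  have "cos (2 * (z + 2 * complex_of_real pi)) = cos (2 * z)" for z
    using p[of "2 * z + complex_of_real (2 * pi)"] p[of "2 * z"] by (simp add: algebra_simps)
  then have e: "((\<lambda>z. \<phi> (z + 2 * of_real pi)) has_field_derivative deriv \<phi> (z + 2 * of_real pi)) (at z)"
    "((\<lambda>z. deriv \<phi> (z + 2 * of_real pi)) has_field_derivative
      (2 * of_real q * cos (2 * z) - of_real a) * \<phi> (z + 2 * of_real pi)) (at z)" for z
    using d(1)[of "z + 2 * of_real pi"] d(2)[of "z + 2 * of_real pi"]
    unfolding DERIV_shift by auto
  show "mathieu_eq a q (\<lambda>z. \<phi> (z + 2 * of_real pi))"
    "deriv (\<lambda>z. \<phi> (z + 2 * of_real pi)) = (\<lambda>z. deriv \<phi> (z + 2 * of_real pi))"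
    using mathieu_eqI[OF e] by auto
qed

lemma of_real_ang':
  assumes "s = 1 \<or> s = -1"
  shows "of_real (ang' s a q x) = deriv (mathieu_base s a q) (of_real x)"
proof -
  have "((\<lambda>x. mathieu_base s a q (of_real x)) has_vector_derivative deriv (mathieu_base s a q) (of_real x)) (at x)"
    by (intro has_vector_derivative_real_field mathieu_eq_deriv(1)[OF mathieu_base(1)])
  moreover have "((\<lambda>x. mathieu_base s a q (of_real x)) has_vector_derivative of_real (ang' s a q x)) (at x)"
    unfolding of_real_ang[OF assms, symmetric]
    by (intro has_vector_derivative_of_real) (auto intro!: ang_has_deriv simp flip: has_real_derivative_iff_has_vector_derivative)
  ultimately show ?thesis by (metis vector_derivative_unique_at)
qed

text \<open>The parity belongs to the index: an eigenvalue occurring for both parities would be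
  counted twice, once for each of its eigenfunctions.\<close>

abbreviation eig_index :: "real \<Rightarrow> (real \<times> real) set" where
  "eig_index q \<equiv> {(s, a). (s = 1 \<or> s = -1) \<and> a \<in> mathieu_eigenvalues s q}"

definition shift_ev :: "real \<Rightarrow> real \<times> real \<Rightarrow> real" where
  "shift_ev q i = snd i + (2 * \<bar>q\<bar> + 1)"

lemma ang_periodic:
  assumes "(s, a) \<in> eig_index q"
  shows "ang s a q (x + 2 * pi) = ang s a q x" "ang' s a q (x + 2 * pi) = ang' s a q x"
proof -
  have s: "s = 1 \<or> s = -1" and sol: "mathieu_sol a q (mathieu_base s a q)"
    using assms mathieu_eigenvalues_iff by auto
  show 1: "ang s a q (x + 2 * pi) = ang s a q x" for x
    using sol unfolding ang_def mathieu_sol_altdef by simp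
  have "(ang s a q has_real_derivative ang' s a q (x + 2 * pi)) (at (x + 2 * pi))"
    by (rule ang_has_deriv)
  then have "((\<lambda>x. ang s a q (x + 2 * pi)) has_real_derivative ang' s a q (x + 2 * pi)) (at x)"
    unfolding DERIV_shift .
  then show "ang' s a q (x + 2 * pi) = ang' s a q x"
    unfolding 1 using ang_has_deriv(1) DERIV_unique by blast
qed

lemma per_sol_ang:
  assumes "i \<in> eig_index q"
  shows "per_sol q (\<lambda>x. shift_ev q i * ang (fst i) (snd i) q x) (ang (fst i) (snd i) q) (ang' (fst i) (snd i) q)"
proof -
  obtain s a where i: "i = (s, a)" by (cases i)
  note p = ang_periodic[OF assms[unfolded i], of 0]
  have e: "(2 * q * cos (2 * x) - a) * ang s a q x = pot q x * ang s a q x - (a + (2 * \<bar>q\<bar> + 1)) * ang s a q x" for x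
    by (simp add: pot_def algebra_simps)
  have s: "s = 1 \<or> s = -1" using assms i by auto
  show ?thesis unfolding i shift_ev_def per_sol_def fst_conv snd_conv
    using p ang_has_deriv[where s=s and a=a and q=q] s
    by (auto simp: e[symmetric] intro!: continuous_intros)
qed

text \<open>An eigenfunction on the interval is the restriction of an entire combination of the even
  and the odd base solution. The even and odd parts of a periodic entire function are periodic, so
  each base solution that occurs with a nonzero coefficient is itself an eigenfunction.\<close>

lemma eigenfunction_representation:
  assumes sol: "per_sol q (\<lambda>x. \<mu> * \<phi> x) \<phi> \<phi>'" and a: "a = \<mu> - (2 * \<bar>q\<bar> + 1)"
  shows "x \<in> circ \<Longrightarrow> \<phi> x = \<phi> 0 * ang 1 a q x + \<phi>' 0 * ang (-1) a q x"
    and "\<phi> 0 \<noteq> 0 \<Longrightarrow> a \<in> mathieu_eigenvalues 1 q" and "\<phi>' 0 \<noteq> 0 \<Longrightarrow> a \<in> mathieu_eigenvalues (-1) q"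
proof -
  have e: "pot q x * \<phi> x - \<mu> * \<phi> x = (2 * q * cos (2 * x) - a) * \<phi> x" for x
    by (simp add: pot_def a algebra_simps)
  have d: "\<And>x. x \<in> circ \<Longrightarrow> (\<phi> has_real_derivative \<phi>' x) (at x within circ)"
    "\<And>x. x \<in> circ \<Longrightarrow> (\<phi>' has_real_derivative (2 * q * cos (2 * x) - a) * \<phi> x) (at x within circ)"
    using sol unfolding per_sol_def e by auto
  have rep: "\<phi> x = \<phi> 0 * ang 1 a q x + \<phi>' 0 * ang (-1) a q x"
    "\<phi>' x = \<phi> 0 * ang' 1 a q x + \<phi>' 0 * ang' (-1) a q x" if "x \<in> circ" for x
    using linear_ode_representation(1,2)[of circ \<phi> \<phi>' "\<lambda>x. 2 * q * cos (2 * x) - a" "ang 1 a q" "ang' 1 a q"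
        "ang (-1) a q" "ang' (-1) a q" x] d that ang_has_deriv
    by (auto simp: ang_rad_0)
  show "x \<in> circ \<Longrightarrow> \<phi> x = \<phi> 0 * ang 1 a q x + \<phi>' 0 * ang (-1) a q x" by (rule rep)
  define \<alpha> \<beta> where "\<alpha> = complex_of_real (\<phi> 0)" and "\<beta> = complex_of_real (\<phi>' 0)"
  define Y where "Y s = mathieu_base s a q" for s
  define \<Phi> where "\<Phi> z = \<alpha> * Y 1 z + \<beta> * Y (-1) z" for z
  note dY = mathieu_eq_deriv[OF mathieu_base(1), of _ a q, folded Y_def]
  have d\<Phi>: "(\<Phi> has_field_derivative \<alpha> * deriv (Y 1) z + \<beta> * deriv (Y (-1)) z) (at z)"
    "((\<lambda>z. \<alpha> * deriv (Y 1) z + \<beta> * deriv (Y (-1)) z) has_field_derivative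
      (2 * of_real q * cos (2 * z) - of_real a) * \<Phi> z) (at z)" for z
    unfolding \<Phi>_def[abs_def] by (rule derivative_eq_intros dY refl | simp add: algebra_simps)+
  have \<Phi>: "mathieu_eq a q \<Phi>" and \<Phi>': "deriv \<Phi> = (\<lambda>z. \<alpha> * deriv (Y 1) z + \<beta> * deriv (Y (-1)) z)"
    by (rule mathieu_eqI[OF d\<Phi>])+
  have "\<Phi> (of_real (2 * pi)) = of_real (\<phi> (2 * pi))"
    unfolding \<Phi>_def Y_def \<alpha>_def \<beta>_def of_real_ang[OF disjI1[OF refl], symmetric]
      of_real_ang[OF disjI2[OF refl], symmetric] using rep(1)[of "2 * pi"] by simp
  moreover have "deriv \<Phi> (of_real (2 * pi)) = of_real (\<phi>' (2 * pi))"
    unfolding \<Phi>' Y_def \<alpha>_def \<beta>_def of_real_ang'[OF disjI1[OF refl], symmetric]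
      of_real_ang'[OF disjI2[OF refl], symmetric] using rep(2)[of "2 * pi"] by simp
  moreover have "\<phi> (2 * pi) = \<phi> 0" "\<phi>' (2 * pi) = \<phi>' 0" using sol by (auto simp: per_sol_def)
  moreover have "\<Phi> 0 = \<alpha>" "deriv \<Phi> 0 = \<beta>" by (auto simp: \<Phi>_def \<Phi>' Y_def mathieu_base)
  ultimately have "\<Phi> (2 * of_real pi) = \<Phi> 0" "deriv \<Phi> (2 * of_real pi) = deriv \<Phi> 0"
    by (auto simp: \<alpha>_def \<beta>_def)
  \<comment> \<open>The translate by 2 pi solves the same equation and has the same data at
    0.\<close>
  then have per: "\<Phi> (z + 2 * of_real pi) = \<Phi> z" for z
    using mathieu_eq_representation[OF mathieu_eq_shift(1)[OF \<Phi>], of z] mathieu_eq_representation[OF \<Phi>, of z]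
    unfolding mathieu_eq_shift(2)[OF \<Phi>] by simp
  have per': "\<Phi> (- (z + 2 * of_real pi)) = \<Phi> (- z)" for z
    using per[of "- z - 2 * of_real pi"] by simp
  have pm: "Y 1 (- z) = Y 1 z" "Y (-1) (- z) = - Y (-1) z" for z
    using mathieu_base_minus[of 1 a q z] mathieu_base_minus[of "-1" a q z] by (auto simp: Y_def)
  have eo: "2 * \<alpha> * Y 1 z = \<Phi> z + \<Phi> (- z)" "2 * \<beta> * Y (-1) z = \<Phi> z - \<Phi> (- z)" for z
    unfolding \<Phi>_def pm by auto
  have Y0: "\<exists>z. Y s z \<noteq> 0" for s
  proof (rule ccontr)
    assume "\<not> ?thesis"
    then have "Y s = (\<lambda>z. 0)" by auto
    then have "deriv (Y s) 0 = 0" "Y s 0 = 0" by auto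
    then show False by (auto simp: Y_def mathieu_base split: if_splits)
  qed
  show "a \<in> mathieu_eigenvalues 1 q" if "\<phi> 0 \<noteq> 0"
  proof -
    have "2 * \<alpha> * Y 1 (z + 2 * of_real pi) = 2 * \<alpha> * Y 1 z" for z unfolding eo per per' ..
    then show ?thesis using that mathieu_base(1) Y0[of 1]
      by (subst mathieu_eigenvalues_iff) (auto simp: mathieu_sol_altdef Y_def \<alpha>_def)
  qed
  show "a \<in> mathieu_eigenvalues (-1) q" if "\<phi>' 0 \<noteq> 0"
  proof -
    have "2 * \<beta> * Y (-1) (z + 2 * of_real pi) = 2 * \<beta> * Y (-1) z" for z unfolding eo per per' ..
    then show ?thesis using that mathieu_base(1) Y0[of "-1"]
      by (subst mathieu_eigenvalues_iff) (auto simp: mathieu_sol_altdef Y_def \<beta>_def)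
  qed
qed


section \<open>The orthonormal system of eigenfunctions\<close>

definition ang_norm :: "real \<Rightarrow> real \<times> real \<Rightarrow> real" where
  "ang_norm q i = sqrt (ip (ang (fst i) (snd i) q) (ang (fst i) (snd i) q))"

definition eigfun :: "real \<Rightarrow> real \<times> real \<Rightarrow> real \<Rightarrow> real" where
  "eigfun q i x = ang (fst i) (snd i) q x / ang_norm q i"

definition eigfun' :: "real \<Rightarrow> real \<times> real \<Rightarrow> real \<Rightarrow> real" where
  "eigfun' q i x = ang' (fst i) (snd i) q x / ang_norm q i"

lemma integral_reflect_circ: "integral circ (\<lambda>x. f (2 * pi - x)) = integral circ (f :: real \<Rightarrow> real)"
proof -
  have "integral circ (\<lambda>x. f (2 * pi - x)) = integral {- (2 * pi)..- 0} (\<lambda>x. f (2 * pi - - x))"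
    by (subst Henstock_Kurzweil_Integration.integral_reflect_real) simp
  also have "\<dots> = integral {0 - 2 * pi..2 * pi - 2 * pi} (\<lambda>x. f (x + 2 * pi))" by (simp add: add.commute)
  also have "\<dots> = integral circ f" by (rule integral_shift_real_ivl)
  finally show ?thesis .
qed

text \<open>On the interval, the reflection y to 2 pi - y takes the role of y to -y; for periodic
  functions the two agree.\<close>

lemma ip_parity:
  assumes "\<And>x. x \<in> circ \<Longrightarrow> f (2 * pi - x) = s * f x" "\<And>x. x \<in> circ \<Longrightarrow> g (2 * pi - x) = t * g x" "s * t = -1"
  shows "ip f g = 0"
proof -
  have "ip f g = integral circ (\<lambda>x. f (2 * pi - x) * g (2 * pi - x))"
    unfolding ip_def by (rule integral_reflect_circ[symmetric])
  also have "\<dots> = integral circ (\<lambda>x. - (f x * g x))"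
  proof (rule integral_cong)
    fix x assume x: "x \<in> circ"
    have "f (2 * pi - x) * g (2 * pi - x) = (s * t) * (f x * g x)"
      unfolding assms(1)[OF x] assms(2)[OF x] by (simp add: mult_ac)
    then show "f (2 * pi - x) * g (2 * pi - x) = - (f x * g x)" using assms(3) by simp
  qed
  also have "\<dots> = - ip f g" unfolding ip_def by simp
  finally show ?thesis by simp
qed

lemma ang_reflect:
  assumes "i \<in> eig_index q"
  shows "ang (fst i) (snd i) q (2 * pi - x) = fst i * ang (fst i) (snd i) q x"
  using ang_periodic(1)[of "fst i" "snd i" q "- x"] ang_rad_minus(1)[of "fst i" "snd i" q x] assms
  by (auto simp: add.commute split: prod.splits)

lemma ang_norm_pos:
  assumes "i \<in> eig_index q"
  shows "ang_norm q i > 0"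
proof -
  define u where "u = ang (fst i) (snd i) q"
  have c: "continuous_on circ u" "continuous_on circ (ang' (fst i) (snd i) q)"
    using per_sol_continuous[OF per_sol_ang[OF assms]] by (auto simp: u_def)
  have "ip u u \<noteq> 0"
  proof
    assume 0: "ip u u = 0"
    have 1: "u x = 0" if "x \<in> circ" for x using ip_square_eq_0D[OF c(1) 0 that] .
    have "per_sol q (\<lambda>x. 0) u (ang' (fst i) (snd i) q)"
      by (rule per_sol_cong[OF per_sol_ang[OF assms]]) (auto simp: 1[unfolded u_def] u_def)
    from per_sol_sup(2)[OF this, of 0] have "ang' (fst i) (snd i) q 0 = 0" by simp
    moreover have "u 0 = 0" using 1 by simp
    ultimately show False by (auto simp: u_def ang_rad_0 split: if_splits)
  qed
  then show ?thesis using ip_nonneg[of u] by (simp add: ang_norm_def u_def)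
qed

lemma per_sol_eigfun:
  assumes "i \<in> eig_index q"
  shows "per_sol q (\<lambda>x. shift_ev q i * eigfun q i x) (eigfun q i) (eigfun' q i)"
  using per_sol_lin[OF per_sol_ang[OF assms] per_sol_ang[OF assms], of "1 / ang_norm q i" 0]
  by (rule back_subst[of "\<lambda>f. f"]) (simp add: eigfun_def[abs_def] eigfun'_def[abs_def] fun_eq_iff mult_ac)

lemma continuous_eigfun:
  assumes "i \<in> eig_index q"
  shows "continuous_on circ (eigfun q i)" "continuous_on circ (eigfun' q i)"
  using per_sol_continuous[OF per_sol_eigfun[OF assms]] by auto

lemma eigfun_reflect:
  assumes "i \<in> eig_index q"
  shows "eigfun q i (2 * pi - x) = fst i * eigfun q i x"
  unfolding eigfun_def ang_reflect[OF assms] by simp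

lemma eigfun_orthonormal:
  assumes i: "i \<in> eig_index q" and j: "j \<in> eig_index q"
  shows "ip (eigfun q i) (eigfun q j) = (if i = j then 1 else 0)"
proof (cases "i = j")
  case True
  define u where "u = ang (fst i) (snd i) q"
  have "ip (eigfun q i) (eigfun q i) = ip (\<lambda>x. (1 / ang_norm q i) * u x) (\<lambda>x. (1 / ang_norm q i) * u x)"
    by (rule ip_cong) (auto simp: eigfun_def u_def)
  also have "\<dots> = ip u u / (ang_norm q i)\<^sup>2" unfolding ip_cmult by (simp add: power2_eq_square)
  also have "\<dots> = 1"
    using ang_norm_pos[OF i] ip_nonneg[of u] by (auto simp: ang_norm_def u_def real_sqrt_gt_0_iff)
  finally show ?thesis using True by simp
next
  case False
  show ?thesis
  proof (cases "fst i = fst j")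
    case True
    then have ne: "shift_ev q i \<noteq> shift_ev q j" using False by (auto simp: shift_ev_def prod_eq_iff)
    have "shift_ev q i * ip (eigfun q i) (eigfun q j) = shift_ev q j * ip (eigfun q i) (eigfun q j)"
      using per_sol_symmetric[OF per_sol_eigfun[OF i] per_sol_eigfun[OF j]] by (simp add: ip_cmult)
    then show ?thesis using ne False by simp
  next
    case False
    then have "fst i * fst j = -1" using i j by auto
    then have "ip (eigfun q i) (eigfun q j) = 0"
      using eigfun_reflect[OF i] eigfun_reflect[OF j] by (intro ip_parity[of _ "fst i" _ "fst j"]) auto
    then show ?thesis using False by auto
  qed
qed

section \<open>Trace bound and growth of the eigenvalues\<close>

lemma shift_ev_ge_1:
  assumes "i \<in> eig_index q"
  shows "1 \<le> shift_ev q i"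
  using per_sol_bounds(1)[OF per_sol_eigfun[OF assms]] eigfun_orthonormal[OF assms assms]
    ip_nonneg[of "eigfun' q i"] by (simp add: ip_cmult)

lemma per_sol_sum:
  assumes "finite F" "\<And>i. i \<in> F \<Longrightarrow> per_sol q (v i) (\<phi> i) (\<phi>' i)"
  shows "per_sol q (\<lambda>x. \<Sum>i\<in>F. c i * v i x) (\<lambda>x. \<Sum>i\<in>F. c i * \<phi> i x) (\<lambda>x. \<Sum>i\<in>F. c i * \<phi>' i x)"
  using assms
proof (induction F rule: finite_induct)
  case empty
  then show ?case by (simp add: per_sol_def)
next
  case (insert j F)
  from per_sol_lin[OF insert.prems[of j] insert.IH, of "c j" 1] insert.prems insert.hyps
  show ?case by simp
qed

text \<open>The sum is the diagonal of a truncated Green function. For fixed \<open>x\<close>,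
  \<open>w\<close> is a truncated delta function at \<open>x\<close> and \<open>v\<close> its image
  under the resolvent; then v(x) and the pairing of \<open>w\<close> with \<open>v\<close> both
  equal the sum S. The Sobolev inequality together with the energy bound gives S^2 \<le> 2
  S.\<close>

lemma eigfun_sum_bound:
  assumes F: "finite F" "F \<subseteq> eig_index q" and x: "x \<in> circ"
  shows "(\<Sum>i\<in>F. (eigfun q i x)\<^sup>2 / shift_ev q i) \<le> 2"
proof -
  define S where "S = (\<Sum>i\<in>F. (eigfun q i x)\<^sup>2 / shift_ev q i)"
  define \<beta> where "\<beta> i = eigfun q i x / shift_ev q i" for i
  define v where "v y = (\<Sum>i\<in>F. \<beta> i * eigfun q i y)" for y
  define w where "w y = (\<Sum>i\<in>F. eigfun q i x * eigfun q i y)" for y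
  define v' where "v' y = (\<Sum>i\<in>F. \<beta> i * eigfun' q i y)" for y
  have \<mu>: "shift_ev q i \<ge> 1" if "i \<in> F" for i using shift_ev_ge_1 F that by blast
  have "per_sol q (\<lambda>y. \<Sum>i\<in>F. \<beta> i * (shift_ev q i * eigfun q i y)) v v'"
    unfolding v_def[abs_def] v'_def[abs_def] using F by (intro per_sol_sum per_sol_eigfun) auto
  also have "(\<lambda>y. \<Sum>i\<in>F. \<beta> i * (shift_ev q i * eigfun q i y)) = w"
  proof
    fix y show "(\<Sum>i\<in>F. \<beta> i * (shift_ev q i * eigfun q i y)) = w y"
      unfolding w_def \<beta>_def by (intro sum.cong refl) (use \<mu> in force)
  qed
  finally have sol: "per_sol q w v v'" .
  note c = per_sol_continuous[OF sol]
  have ec: "continuous_on circ (eigfun q i)" if "i \<in> F" for i using continuous_eigfun F that by blast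
  have vx: "v x = S" unfolding v_def S_def \<beta>_def by (intro sum.cong) (auto simp: power2_eq_square)
  have ev: "ip (eigfun q i) v = \<beta> i" if i: "i \<in> F" for i
  proof -
    have "ip v (eigfun q i) = (\<Sum>j\<in>F. \<beta> j * ip (eigfun q j) (eigfun q i))"
      unfolding v_def[abs_def] by (intro ip_sum ec i)
    also have "\<dots> = (\<Sum>j\<in>F. if j = i then \<beta> i else 0)"
      using F i by (intro sum.cong) (auto simp: eigfun_orthonormal[OF subsetD[OF F(2)] subsetD[OF F(2)]])
    also have "\<dots> = \<beta> i" using F i by simp
    finally show ?thesis by (simp add: ip_commute)
  qed
  have "ip w v = (\<Sum>i\<in>F. eigfun q i x * ip (eigfun q i) v)"
    unfolding w_def[abs_def] by (intro ip_sum ec c)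
  also have "\<dots> = S" unfolding S_def by (intro sum.cong) (auto simp: ev \<beta>_def power2_eq_square)
  finally have wv: "ip w v = S" .
  have "(v x)\<^sup>2 \<le> 2 * (ip v v + ip v' v')"
    using sol c x by (intro sup_bound) (auto simp: per_sol_def)
  also have "\<dots> \<le> 2 * S" using per_sol_bounds(1)[OF sol] wv by simp
  finally have "S * S \<le> 2 * S" unfolding vx by (simp add: power2_eq_square)
  moreover have "S \<ge> 0" unfolding S_def using \<mu> by (intro sum_nonneg divide_nonneg_nonneg) force+
  ultimately show ?thesis unfolding S_def[symmetric] by (cases "S = 0") (auto simp: mult_le_cancel_right)
qed

lemma eigfun_le:
  assumes "i \<in> eig_index q" "x \<in> circ"
  shows "(eigfun q i x)\<^sup>2 \<le> 2 * shift_ev q i"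
  using eigfun_sum_bound[of "{i}" q x] shift_ev_ge_1[OF assms(1)] assms by (simp add: divide_le_eq)

text \<open>The resolvent has finite trace: integrate the bound 2 on the diagonal of the Green
  function over the circle of length 2 pi. This replaces asymptotics of the eigenvalues; it gives
  their discreteness and the summability in the final series.\<close>

lemma inverse_shift_ev_sum_bound:
  assumes F: "finite F" "F \<subseteq> eig_index q"
  shows "(\<Sum>i\<in>F. 1 / shift_ev q i) \<le> 4 * pi"
proof -
  have I: "(\<lambda>x. (eigfun q i x)\<^sup>2 / shift_ev q i) integrable_on circ" if "i \<in> F" for i
    using F that continuous_eigfun[of i q] shift_ev_ge_1[of i q]
    by (intro integrable_continuous_real continuous_intros) auto
  have "integral circ (\<lambda>x. (eigfun q i x)\<^sup>2 / shift_ev q i) = 1 / shift_ev q i" if "i \<in> F" for i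
    using eigfun_orthonormal[OF subsetD[OF F(2) that] subsetD[OF F(2) that]]
    by (simp add: ip_def power2_eq_square)
  note E = this
  have "(\<Sum>i\<in>F. 1 / shift_ev q i) = (\<Sum>i\<in>F. integral circ (\<lambda>x. (eigfun q i x)\<^sup>2 / shift_ev q i))"
    by (rule sum.cong[OF refl E[symmetric]])
  also have "\<dots> = integral circ (\<lambda>x. \<Sum>i\<in>F. (eigfun q i x)\<^sup>2 / shift_ev q i)"
    using F I by (intro integral_sum[symmetric]) auto
  also have "\<dots> \<le> integral circ (\<lambda>x. 2)"
    using eigfun_sum_bound[OF F] F I by (intro integral_le integrable_sum) auto
  finally show ?thesis by simp
qed

text \<open>Each index with shifted eigenvalue at most L contributes at least 1 / L to a sum bounded
  by 4 pi.\<close>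

lemma finite_eig_index:
  shows "finite {i \<in> eig_index q. shift_ev q i \<le> L}"
proof (rule finite_if_finite_subsets_card_bdd[THEN conjunct1])
  fix G assume G: "G \<subseteq> {i \<in> eig_index q. shift_ev q i \<le> L}" "finite G"
  show "card G \<le> nat \<lfloor>4 * pi * L\<rfloor>"
  proof (cases "G = {}")
    case False
    have G': "1 \<le> shift_ev q i" "shift_ev q i \<le> L" if "i \<in> G" for i
      using G(1) that shift_ev_ge_1[of i q] by auto
    have L: "L \<ge> 1" using False G' by (meson all_not_in_conv order_trans)
    have "real (card G) / L = (\<Sum>i\<in>G. 1 / L)" by simp
    also have "\<dots> \<le> (\<Sum>i\<in>G. 1 / shift_ev q i)"
      using G'(2) less_le_trans[OF zero_less_one G'(1)] L by (intro sum_mono divide_left_mono mult_pos_pos) auto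
    also have "\<dots> \<le> 4 * pi" using G by (intro inverse_shift_ev_sum_bound) auto
    finally have "real (card G) \<le> 4 * pi * L" using L by (simp add: field_simps)
    then show ?thesis by linarith
  qed auto
qed

section \<open>Completeness of the eigenfunctions\<close>

lemma ip_eigenfunction_zero:
  assumes sol: "per_sol q (\<lambda>x. \<mu> * \<phi> x) \<phi> \<phi>'" and x: "x \<in> circ"
    and z: "\<And>i. i \<in> eig_index q \<Longrightarrow> shift_ev q i = \<mu> \<Longrightarrow> ip \<phi> (eigfun q i) = 0"
  shows "\<phi> x = 0"
proof -
  define a where "a = \<mu> - (2 * \<bar>q\<bar> + 1)"
  note rep = eigenfunction_representation[OF sol a_def]
  note c = per_sol_continuous[OF sol]
  have 0: "ip \<phi> (ang s a q) = 0" if "(s, a) \<in> eig_index q" for s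
  proof -
    have "ip \<phi> (ang s a q) = ip \<phi> (\<lambda>x. ang_norm q (s, a) * eigfun q (s, a) x)"
      using ang_norm_pos[OF that] by (intro ip_cong) (auto simp: eigfun_def)
    then show ?thesis using z[OF that] by (simp add: ip_cmult a_def shift_ev_def)
  qed
  have "ip \<phi> \<phi> = ip (\<lambda>x. \<phi> 0 * ang 1 a q x + \<phi>' 0 * ang (-1) a q x) \<phi>"
    by (rule ip_cong) (simp_all only: rep(1)[symmetric])
  also have "\<dots> = \<phi> 0 * ip \<phi> (ang 1 a q) + \<phi>' 0 * ip \<phi> (ang (-1) a q)"
    unfolding ip_commute[of \<phi>] by (intro ip_lin c continuous_intros)
  also have "\<dots> = 0" using 0[of 1] 0[of "-1"] rep(2,3) by (cases "\<phi> 0 = 0"; cases "\<phi>' 0 = 0") auto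
  finally show ?thesis using ip_square_eq_0D c x by blast
qed

text \<open>The orthogonal complement of the eigenfunctions in \<open>F\<close> is closed under
  uniform limits and, by symmetry, invariant under the resolvent; all its eigenfunctions have
  shifted eigenvalue at least L. So the norm of the resolvent there is at most 1 / L. Kept
  quantitative, this serves both for totality and for the rate of convergence of partial
  sums.\<close>

lemma eigfun_complete:
  assumes F: "F \<subseteq> eig_index q" "\<And>i. i \<in> eig_index q \<Longrightarrow> shift_ev q i < L \<Longrightarrow> i \<in> F" and L: "L > 0"
    and v: "per_sol q v \<phi> \<phi>'" "\<And>i. i \<in> F \<Longrightarrow> ip v (eigfun q i) = 0"
  shows "L\<^sup>2 * ip \<phi> \<phi> \<le> ip v v"
proof (rule spectral_bound)
  define W where "W = {v. continuous_on circ v \<and> (\<forall>i\<in>F. ip v (eigfun q i) = 0)}"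
  have ec: "continuous_on circ (eigfun q i)" if "i \<in> F" for i using continuous_eigfun F that by blast
  show "v \<in> W" using v per_sol_continuous[OF v(1)] by (auto simp: W_def)
  show "per_sol q v \<phi> \<phi>'" "L > 0" by fact+
  show "continuous_on circ v" if "v \<in> W" for v using that by (auto simp: W_def)
  show "(\<lambda>x. a * v x + b * w x) \<in> W" if "v \<in> W" "w \<in> W" for v w a b
    using that ec by (auto simp: W_def ip_lin intro!: continuous_intros)
  show "\<phi> \<in> W" if "v \<in> W" "per_sol q v \<phi> \<phi>'" for v \<phi> \<phi>'
  proof -
    have "ip \<phi> (eigfun q i) = 0" if i: "i \<in> F" for i
    proof -
      have iq: "i \<in> eig_index q" using F i by blast
      have "shift_ev q i * ip (eigfun q i) \<phi> = ip (eigfun q i) v"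
        using per_sol_symmetric[OF per_sol_eigfun[OF iq] \<open>per_sol q v \<phi> \<phi>'\<close>] by (simp add: ip_cmult)
      also have "\<dots> = 0" using \<open>v \<in> W\<close> i ip_commute[of _ v] by (simp add: W_def)
      finally show ?thesis using shift_ev_ge_1[OF iq] ip_commute[of _ \<phi>] by simp
    qed
    then show ?thesis using per_sol_continuous[OF \<open>per_sol q v \<phi> \<phi>'\<close>] by (auto simp: W_def)
  qed
  show "g \<in> W" if f: "\<And>n. f n \<in> W" "continuous_on circ g" "uniform_limit circ f g sequentially" for f g
  proof -
    have fc: "continuous_on circ (f n)" for n using f(1) by (auto simp: W_def)
    have "ip g (eigfun q i) = 0" if i: "i \<in> F" for i
    proof (rule LIMSEQ_unique)
      show "(\<lambda>n. ip (f n) (eigfun q i)) \<longlonglongrightarrow> ip g (eigfun q i)"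
        by (rule ip_tendsto(1)[OF ip_diff_uniform_limit[OF f(3) fc f(2)] fc f(2) ec[OF i]])
      show "(\<lambda>n. ip (f n) (eigfun q i)) \<longlonglongrightarrow> 0" using f(1) i by (simp add: W_def)
    qed
    then show ?thesis using f(2) by (simp add: W_def)
  qed
  show "L \<le> \<mu>" if "\<phi> \<in> W" "per_sol q (\<lambda>x. \<mu> * \<phi> x) \<phi> \<phi>'" "x \<in> circ" "\<phi> x \<noteq> 0" for \<phi> \<phi>' \<mu> x
  proof (rule ccontr)
    assume "\<not> L \<le> \<mu>"
    then have "\<phi> x = 0"
      using that(1) F(2) by (intro ip_eigenfunction_zero[OF that(2,3)]) (auto simp: W_def)
    then show False using that(4) by simp
  qed
qed

text \<open>With all eigenfunctions in \<open>F\<close> the constant L is arbitrary, which forces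
  the resolvent image of \<open>v\<close> to vanish; then \<open>v\<close> vanishes by the
  differential equation. The end points are left out because the argument differentiates on the open
  interval.\<close>

lemma eigfun_total:
  assumes v: "continuous_on circ v" "\<And>i. i \<in> eig_index q \<Longrightarrow> ip v (eigfun q i) = 0" and x: "x \<in> {0<..<2 * pi}"
  shows "v x = 0"
proof -
  obtain \<phi> \<phi>' where sol: "per_sol q v \<phi> \<phi>'" using per_sol_exists[OF v(1)] by blast
  have "ip \<phi> \<phi> = 0"
  proof (rule ccontr)
    assume "ip \<phi> \<phi> \<noteq> 0"
    then have p: "ip \<phi> \<phi> > 0" using ip_nonneg[of \<phi>] by simp
    \<comment> \<open>Chosen so that already L times the squared norm of \<open>\<phi>\<close>
      exceeds that of \<open>v\<close>.\<close>
    define L where "L = 1 + ip v v / ip \<phi> \<phi>"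
    have L: "L \<ge> 1" using p ip_nonneg[of v] by (simp add: L_def)
    have "L * 1 * ip \<phi> \<phi> \<le> L\<^sup>2 * ip \<phi> \<phi>"
      unfolding power2_eq_square using L p by (intro mult_right_mono mult_left_mono) auto
    also have "\<dots> \<le> ip v v"
      by (rule eigfun_complete[of "eig_index q"]) (use sol v L in auto)
    finally show False using p mult_pos_pos[OF p p] by (simp add: L_def field_simps)
  qed
  then have \<phi>0: "\<phi> y = 0" if "y \<in> circ" for y
    using ip_square_eq_0D[OF per_sol_continuous(2)[OF sol]] that by blast
  have at: "at y within circ = at y" if "y \<in> {0<..<2 * pi}" for y
    using that by (intro at_within_interior) auto
  have d: "(\<phi> has_real_derivative \<phi>' y) (at y)" "(\<phi>' has_real_derivative pot q y * \<phi> y - v y) (at y)"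
    if "y \<in> {0<..<2 * pi}" for y
  proof -
    have "y \<in> circ" using that by auto
    then have "(\<phi> has_real_derivative \<phi>' y) (at y within circ)"
      "(\<phi>' has_real_derivative pot q y * \<phi> y - v y) (at y within circ)"
      using sol unfolding per_sol_def by blast+
    then show "(\<phi> has_real_derivative \<phi>' y) (at y)" "(\<phi>' has_real_derivative pot q y * \<phi> y - v y) (at y)"
      unfolding at[OF that] by auto
  qed
  have zero: "g' = 0" if "(g has_real_derivative g') (at y)" "y \<in> {0<..<2 * pi}"
    "\<And>z. z \<in> {0<..<2 * pi} \<Longrightarrow> g z = 0" for g :: "real \<Rightarrow> real" and g' y
  proof -
    have "(g has_real_derivative 0) (at y)"
      by (rule has_field_derivative_transform_within_open[of "\<lambda>_. 0" _ _ "{0<..<2 * pi}"]) (use that in auto)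
    then show ?thesis using that(1) DERIV_unique by blast
  qed
  have \<phi>'0: "\<phi>' y = 0" if "y \<in> {0<..<2 * pi}" for y
    using zero[OF d(1)[OF that] that] \<phi>0 by auto
  have "pot q x * \<phi> x - v x = 0" using zero[OF d(2)[OF x] x] \<phi>'0 by auto
  then show ?thesis using \<phi>0 x by simp
qed

text \<open>If there were only finitely many eigenvalues for one parity, then every continuous function of
  that parity would be a finite sum of eigenfunctions, hence differentiable.\<close>

lemma infinite_mathieu_eigenvalues:
  assumes s: "s = 1 \<or> s = -1"
  shows "infinite (mathieu_eigenvalues s q)"
proof
  assume fin: "finite (mathieu_eigenvalues s q)"
  define F where "F = Pair s ` mathieu_eigenvalues s q"
  have F: "finite F" "F \<subseteq> eig_index q" using fin s by (auto simp: F_def)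
  define p where "p x = (if s = 1 then 1 else sin x)" for x :: real
  \<comment> \<open>A continuous function of the prescribed parity with a kink at pi / 2: the factor
    sin, inserted in the odd case, equals 1 there and leaves the kink intact.\<close>
  define h where "h x = \<bar>cos x\<bar> * p x" for x :: real
  define S where "S x = (\<Sum>i\<in>F. ip h (eigfun q i) * eigfun q i x)" for x
  have ec: "continuous_on circ (eigfun q i)" if "i \<in> F" for i using continuous_eigfun F that by blast
  have cp: "continuous_on circ p" unfolding p_def[abs_def] by (cases "s = 1") (auto intro!: continuous_intros)
  have ch: "continuous_on circ h" unfolding h_def[abs_def] by (intro continuous_intros cp)
  have cS: "continuous_on circ S" unfolding S_def[abs_def] using ec by (intro continuous_intros)
  have sF: "fst i = s" if "i \<in> F" for i using that by (auto simp: F_def)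
  have hr: "h (2 * pi - x) = s * h x" for x
    using s by (auto simp: h_def p_def cos_diff sin_diff)
  have Sr: "S (2 * pi - x) = s * S x" for x
    unfolding S_def sum_distrib_left using F eigfun_reflect[of _ q x] sF by (intro sum.cong) (auto simp: subset_iff)
  have "h x = S x" if "x \<in> {0<..<2 * pi}" for x
  proof -
    have "ip (\<lambda>x. 1 * h x + - 1 * S x) (eigfun q i) = 0" if i: "i \<in> eig_index q" for i
    proof (cases "i \<in> F")
      case True
      have "ip S (eigfun q i) = (\<Sum>j\<in>F. ip h (eigfun q j) * ip (eigfun q j) (eigfun q i))"
        unfolding S_def[abs_def] using ec True by (intro ip_sum) auto
      also have "\<dots> = (\<Sum>j\<in>F. if j = i then ip h (eigfun q i) else 0)"
        using F i by (intro sum.cong) (auto simp: eigfun_orthonormal[OF subsetD[OF F(2)] i])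
      also have "\<dots> = ip h (eigfun q i)" using F True by simp
      finally show ?thesis
        using ip_lin[OF ch cS continuous_eigfun(1)[OF i], of 1 "-1"] by simp
    next
      case False
      then have "s * fst i = -1" using i s by (auto simp: F_def)
      then show ?thesis
        using eigfun_reflect[OF i] hr Sr
        by (intro ip_parity[of _ s _ "fst i"]) (auto simp: algebra_simps)
    qed
    from eigfun_total[OF _ this that] show ?thesis using ch cS by (auto intro!: continuous_intros)
  qed
  note hS = this
  define D where "D = (\<Sum>i\<in>F. ip h (eigfun q i) * eigfun' q i (pi / 2))"
  have eigd: "(eigfun q i has_real_derivative eigfun' q i x) (at x)" for i x
    unfolding eigfun_def[abs_def] eigfun'_def by (intro DERIV_cdivide ang_has_deriv)
  have "(S has_real_derivative D) (at (pi / 2))"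
    unfolding S_def[abs_def] D_def by (intro DERIV_sum DERIV_cmult eigd)
  then have dh: "(h has_real_derivative D) (at (pi / 2))"
    by (rule has_field_derivative_transform_within_open[of _ _ _ "{0<..<2 * pi}"]) (use hS in auto)
  \<comment> \<open>To the left of pi / 2 the function \<open>h\<close> coincides with this smooth
    one, of slope -1, and to the right with its negative, of slope 1; a derivative \<open>D\<close>
    would have to equal both.\<close>
  have dk: "((\<lambda>x. cos x * p x) has_real_derivative -1) (at (pi / 2))"
    using s by (auto simp: p_def intro!: derivative_eq_intros)
  have "D + 1 = 0"
  proof (rule has_field_derivative_unique)
    show "((\<lambda>x. h x - cos x * p x) has_real_derivative D + 1) (at (pi / 2) within {0..pi / 2})"
      using DERIV_diff[OF DERIV_subset[OF dh subset_UNIV] DERIV_subset[OF dk subset_UNIV]] by simp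
    show "((\<lambda>x. h x - cos x * p x) has_real_derivative 0) (at (pi / 2) within {0..pi / 2})"
      unfolding has_field_derivative_def
      by (rule has_derivative_transform[of _ _ _ "\<lambda>_. 0"]) (auto simp: h_def cos_ge_zero simp flip: lambda_zero)
    show "at (pi / 2) within {0..pi / 2} \<noteq> bot" by (simp add: trivial_limit_within islimpt_Icc)
  qed
  moreover have "D - 1 = 0"
  proof (rule has_field_derivative_unique)
    show "((\<lambda>x. h x + cos x * p x) has_real_derivative D - 1) (at (pi / 2) within {pi / 2..pi})"
      using DERIV_add[OF DERIV_subset[OF dh subset_UNIV] DERIV_subset[OF dk subset_UNIV]] by simp
    have neg: "cos x \<le> 0" if "x \<in> {pi / 2..pi}" for x
      using cos_ge_zero[of "pi - x"] that by simp
    show "((\<lambda>x. h x + cos x * p x) has_real_derivative 0) (at (pi / 2) within {pi / 2..pi})"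
      unfolding has_field_derivative_def
      by (rule has_derivative_transform[of _ _ _ "\<lambda>_. 0"]) (use neg in \<open>auto simp: h_def abs_of_nonpos simp flip: lambda_zero\<close>)
    show "at (pi / 2) within {pi / 2..pi} \<noteq> bot" by (simp add: trivial_limit_within islimpt_Icc)
  qed
  ultimately show False by simp
qed


section \<open>Enumeration of the eigenvalues\<close>

text \<open>The rank \<open>r\<close>, the number of predecessors, is strictly increasing on E. The
  ranks of the predecessors of a point are as many distinct numbers as its rank, hence fill the
  initial segment; since E is infinite the ranks are unbounded, and \<open>r\<close> is the inverse
  bijection.\<close>

lemma nth_smallest_bij:
  assumes inf: "infinite E" and fin: "\<And>L. finite {b \<in> E. b \<le> L}"
  shows "bij_betw (nth_smallest E) UNIV E"
proof -
  define r where "r a = card {b \<in> E. b < a}" for a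
  have fl: "finite {b \<in> E. b < a}" for a by (rule finite_subset[OF _ fin[of a]]) auto
  have mono: "r a < r b" if "a \<in> E" "a < b" for a b
    unfolding r_def using that by (intro psubset_card_mono fl) auto
  have inj: "inj_on r E"
    by (rule inj_onI) (metis mono less_irrefl linorder_neqE_linordered_idom)
  have down: "\<exists>b\<in>E. r b = m" if "a \<in> E" "m < r a" for a m
  proof -
    have "r ` {b \<in> E. b < a} = {..<r a}"
    proof (rule card_subset_eq)
      show "card (r ` {b \<in> E. b < a}) = card {..<r a}"
        using inj by (subst card_image) (auto intro: inj_on_subset simp: r_def)
    qed (use mono in auto)
    then have "m \<in> r ` {b \<in> E. b < a}" using that by simp
    then show ?thesis by blast
  qed
  have surj: "\<exists>b\<in>E. r b = m" for m
  proof -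
    have "infinite (r ` E)" using inf inj finite_imageD by blast
    then obtain a where "a \<in> E" "m < r a" by (metis infinite_nat_iff_unbounded imageE)
    then show ?thesis using down by blast
  qed
  have nth: "nth_smallest E (r a) = a" if "a \<in> E" for a
    unfolding nth_smallest_def
    by (rule the_equality) (use that fl inj in \<open>auto simp: r_def[symmetric] inj_on_def\<close>)
  show ?thesis
  proof (rule bij_betwI[where g = r])
    have n: "nth_smallest E m \<in> E \<and> r (nth_smallest E m) = m" for m
    proof -
      obtain b where "b \<in> E" "r b = m" using surj by blast
      then show ?thesis using nth by auto
    qed
    show "nth_smallest E \<in> UNIV \<rightarrow> E" "\<And>m. r (nth_smallest E m) = m" using n by auto
    show "r \<in> E \<rightarrow> UNIV" by simp
  qed (rule nth)
qed

lemma mathieu_eigenvalues_bij: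
  assumes "s = 1 \<or> s = -1"
  shows "bij_betw (nth_smallest (mathieu_eigenvalues s q)) UNIV (mathieu_eigenvalues s q)"
proof (rule nth_smallest_bij[OF infinite_mathieu_eigenvalues[OF assms]])
  fix L
  have "{b \<in> mathieu_eigenvalues s q. b \<le> L} \<subseteq> snd ` {i \<in> eig_index q. shift_ev q i \<le> L + (2 * \<bar>q\<bar> + 1)}"
  proof
    fix b assume "b \<in> {b \<in> mathieu_eigenvalues s q. b \<le> L}"
    then show "b \<in> snd ` {i \<in> eig_index q. shift_ev q i \<le> L + (2 * \<bar>q\<bar> + 1)}"
      using assms by (intro image_eqI[of _ _ "(s, b)"]) (auto simp: shift_ev_def)
  qed
  then show "finite {b \<in> mathieu_eigenvalues s q. b \<le> L}"
    by (rule finite_subset) (intro finite_imageI finite_eig_index)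
qed

text \<open>Interleaves both parities: even positions carry the functions ce of order k div 2, odd
  ones the functions se, whose orders start at 1.\<close>

definition eig_idx :: "real \<Rightarrow> nat \<Rightarrow> real \<times> real" where
  "eig_idx q k = (if even k then (1, mathieu_a (k div 2) q) else (-1, mathieu_b (Suc (k div 2)) q))"

lemma eig_idx_bij: "bij_betw (eig_idx q) UNIV (eig_index q)"
proof -
  have b1: "bij_betw (\<lambda>n. mathieu_a n q) UNIV (mathieu_eigenvalues 1 q)"
    and b2: "bij_betw (\<lambda>n. mathieu_b (Suc n) q) UNIV (mathieu_eigenvalues (-1) q)"
    using mathieu_eigenvalues_bij[of 1 q] mathieu_eigenvalues_bij[of "-1" q]
    by (auto simp: mathieu_a_def mathieu_b_def)
  show ?thesis
  proof (rule bij_betw_imageI)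
    show "inj (eig_idx q)"
    proof (rule injI)
      fix j k assume e: "eig_idx q j = eig_idx q k"
      have p: "even j = even k" using e by (auto simp: eig_idx_def split: if_splits)
      have "j div 2 = k div 2"
        using e p b1 b2 unfolding eig_idx_def bij_betw_def inj_def by (auto split: if_splits)
      then show "j = k" using p by (metis even_two_times_div_two odd_two_times_div_two_succ)
    qed
    show "range (eig_idx q) = eig_index q"
    proof
      show "range (eig_idx q) \<subseteq> eig_index q"
        using b1 b2 by (auto simp: eig_idx_def bij_betw_def)
      show "eig_index q \<subseteq> range (eig_idx q)"
      proof
        fix i assume i: "i \<in> eig_index q"
        then obtain s a where sa: "i = (s, a)" "s = 1 \<or> s = -1" "a \<in> mathieu_eigenvalues s q" by auto
        show "i \<in> range (eig_idx q)"
        proof (cases "s = 1")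
          case True
          then obtain n where "a = mathieu_a n q" using sa b1 unfolding bij_betw_def by auto
          then have "i = eig_idx q (2 * n)" using sa True by (simp add: eig_idx_def)
          then show ?thesis by simp
        next
          case False
          then obtain n where "a = mathieu_b (Suc n) q" using sa b2 unfolding bij_betw_def by auto
          then have "i = eig_idx q (Suc (2 * n))" using sa False by (simp add: eig_idx_def)
          then show ?thesis by simp
        qed
      qed
    qed
  qed
qed

lemma eig_idx_in: "eig_idx q k \<in> eig_index q"
  by (rule bspec[OF bij_betwE[OF eig_idx_bij] UNIV_I])

lemma summable_inverse_shift_ev: "summable (\<lambda>k. 1 / shift_ev q (eig_idx q k))"
proof -
  have "(\<lambda>i. 1 / shift_ev q i) summable_on eig_index q"
  proof (rule nonneg_bdd_above_summable_on)
    show "bdd_above (sum (\<lambda>i. 1 / shift_ev q i) ` {F. F \<subseteq> eig_index q \<and> finite F})"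
      using inverse_shift_ev_sum_bound[of _ q] by (auto intro!: bdd_aboveI[of _ "4 * pi"])
    show "0 \<le> 1 / shift_ev q i" if "i \<in> eig_index q" for i using shift_ev_ge_1[OF that] by simp
  qed
  then have "(\<lambda>k. 1 / shift_ev q (eig_idx q k)) summable_on UNIV"
    by (subst summable_on_reindex_bij_betw[OF eig_idx_bij])
  then show ?thesis by (rule summable_on_imp_summable)
qed

section \<open>The differential operator in components\<close>

no_notation fps_nth (infixl "$" 75)

text \<open>The coordinates are the real and imaginary part of cosh (x + i y). Then
  \<open>eA\<close> + i \<open>eB\<close> is the derivative sinh (x + i y) of this conformal map,
  \<open>eA'\<close> + i \<open>eB'\<close> is the map itself, and \<open>ew\<close> is the squared
  modulus of the derivative, the Jacobian.\<close>

definition eA :: "real \<Rightarrow> real \<Rightarrow> real" where "eA x y = sinh x * cos y"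
definition eB :: "real \<Rightarrow> real \<Rightarrow> real" where "eB x y = cosh x * sin y"
definition eA' :: "real \<Rightarrow> real \<Rightarrow> real" where "eA' x y = cosh x * cos y"
definition eB' :: "real \<Rightarrow> real \<Rightarrow> real" where "eB' x y = sinh x * sin y"
definition ew :: "real \<Rightarrow> real \<Rightarrow> real" where "ew x y = (cosh (2 * x) - cos (2 * y)) / 2"

lemma ew_eq: "ew x y = (sinh x)\<^sup>2 + (sin y)\<^sup>2" "ew x y = (eA x y)\<^sup>2 + (eB x y)\<^sup>2"
proof -
  have c: "cosh (2 * x) = 1 + 2 * (sinh x)\<^sup>2" unfolding cosh_double cosh_square_eq by simp
  show 1: "ew x y = (sinh x)\<^sup>2 + (sin y)\<^sup>2" unfolding ew_def c cos_double_sin by simp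
  have "(eA x y)\<^sup>2 + (eB x y)\<^sup>2 = (sinh x)\<^sup>2 * (cos y)\<^sup>2 + (cosh x)\<^sup>2 * (sin y)\<^sup>2"
    by (simp add: eA_def eB_def power_mult_distrib)
  also have "\<dots> = (sinh x)\<^sup>2 + (sin y)\<^sup>2"
    unfolding cosh_square_eq cos_squared_eq by (simp add: algebra_simps)
  finally show "ew x y = (eA x y)\<^sup>2 + (eB x y)\<^sup>2" using 1 by simp
qed

lemma ew_nonneg: "0 \<le> ew x y"
  by (simp add: ew_eq(1))

lemma ew_eq_0_iff: "ew x y = 0 \<longleftrightarrow> x = 0 \<and> sin y = 0"
  unfolding ew_eq(1) by (simp add: sum_power2_eq_zero_iff)

lemma foci_iff: "(x, y) \<in> foci \<longleftrightarrow> ew x y = 0"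
  by (simp add: foci_def ew_def)

lemma continuous_on_eAB [continuous_intros]:
  fixes f g :: "'a::t2_space \<Rightarrow> real"
  assumes "continuous_on S f" "continuous_on S g"
  shows "continuous_on S (\<lambda>p. eA (f p) (g p))" "continuous_on S (\<lambda>p. eB (f p) (g p))"
    "continuous_on S (\<lambda>p. eA' (f p) (g p))" "continuous_on S (\<lambda>p. eB' (f p) (g p))"
    "continuous_on S (\<lambda>p. ew (f p) (g p))"
  unfolding eA_def eB_def eA'_def eB'_def ew_def using assms by (auto intro!: continuous_intros)

lemma eAB_has_deriv:
  "((\<lambda>x. eA x y) has_real_derivative eA' x y) (at x within S)"
  "((\<lambda>x. eB x y) has_real_derivative eB' x y) (at x within S)"
  "((\<lambda>y. eA x y) has_real_derivative - eB' x y) (at y within S)"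
  "((\<lambda>y. eB x y) has_real_derivative eA' x y) (at y within S)"
  unfolding eA_def eB_def eA'_def eB'_def by (auto intro!: derivative_eq_intros)

lemma quat_eq_iff:
  fixes x y :: quat
  shows "x = y \<longleftrightarrow> fst x = fst y \<and> snd x $ 1 = snd y $ 1 \<and> snd x $ 2 = snd y $ 2 \<and> snd x $ 3 = snd y $ 3"
  by (auto simp: prod_eq_iff vec_eq_iff forall_3)

lemma qij_mult:
  defines "Q a b \<equiv> a *\<^sub>R qi + b *\<^sub>R qj"
  shows "fst (Q a b \<odot> x) = - (a * snd x $ 1 + b * snd x $ 2)"
    "snd (Q a b \<odot> x) $ 1 = a * fst x + b * snd x $ 3"
    "snd (Q a b \<odot> x) $ 2 = b * fst x - a * snd x $ 3"
    "snd (Q a b \<odot> x) $ 3 = a * snd x $ 2 - b * snd x $ 1"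
  by (auto simp: Q_def qmult_def qi_def qj_def inner_vec_def sum_3 cross3_def axis_def algebra_simps)

lemma ell_D_eq:
  "ell_D f (x, y) = (1 / ew x y) *\<^sub>R
    ((eA x y *\<^sub>R qi + eB x y *\<^sub>R qj) \<odot> d_xi f (x, y) + (- eB x y *\<^sub>R qi + eA x y *\<^sub>R qj) \<odot> d_eta f (x, y))"
  unfolding ell_D_def eA_def eB_def ew_def by (simp add: algebra_simps)

lemma ell_D_components:
  fixes f x y
  defines "X \<equiv> d_xi f (x, y)" and "Y \<equiv> d_eta f (x, y)"
  shows "fst (ell_D f (x, y)) = (1 / ew x y) * (- (eA x y * snd X $ 1 + eB x y * snd X $ 2) + (eB x y * snd Y $ 1 - eA x y * snd Y $ 2))"
    "snd (ell_D f (x, y)) $ 1 = (1 / ew x y) * (eA x y * fst X + eB x y * snd X $ 3 + (eA x y * snd Y $ 3 - eB x y * fst Y))"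
    "snd (ell_D f (x, y)) $ 2 = (1 / ew x y) * (eB x y * fst X - eA x y * snd X $ 3 + (eA x y * fst Y + eB x y * snd Y $ 3))"
    "snd (ell_D f (x, y)) $ 3 = (1 / ew x y) * (eA x y * snd X $ 2 - eB x y * snd X $ 1 - (eB x y * snd Y $ 2 + eA x y * snd Y $ 1))"
  unfolding ell_D_eq X_def Y_def fst_scaleR snd_scaleR fst_add snd_add vector_scaleR_component vector_add_component qij_mult
  by (auto simp: algebra_simps)

lemma d_xi_eq:
  assumes "((\<lambda>s. f (s, y)) has_vector_derivative d) (at x within {0..<\<xi>0})" "x \<in> {0..<\<xi>0}"
  shows "d_xi f (x, y) = d"
proof -
  have "at x within {0..<\<xi>0} = at x within {0..}"
    by (rule at_within_nhd[of _ "{..<\<xi>0}"]) (use assms(2) in auto)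
  moreover have "at x within {0..<\<xi>0} \<noteq> bot"
    using assms(2) islimpt_Ico by (auto simp: trivial_limit_within)
  ultimately show ?thesis using assms(1) by (auto simp: d_xi_def intro!: vector_derivative_within)
qed

lemma d_eta_eq:
  assumes "((\<lambda>t. f (x, t)) has_vector_derivative d) (at y within circ)" "y \<in> circ"
  shows "d_eta f (x, y) = d"
proof -
  have "at y within circ \<noteq> bot"
    using assms(2) by (auto simp: trivial_limit_within islimpt_Icc)
  then show ?thesis using assms(1) by (auto simp: d_eta_def intro!: vector_derivative_within)
qed

lemma C1_on_ell_rect_partials:
  assumes "C1_on (ell_rect \<xi>0) f"
  obtains fx fy where
    "\<And>x y. x \<in> {0..<\<xi>0} \<Longrightarrow> y \<in> circ \<Longrightarrow> ((\<lambda>s. f (s, y)) has_vector_derivative fx (x, y)) (at x within {0..<\<xi>0})"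
    "\<And>x y. x \<in> {0..<\<xi>0} \<Longrightarrow> y \<in> circ \<Longrightarrow> ((\<lambda>t. f (x, t)) has_vector_derivative fy (x, y)) (at y within circ)"
    "continuous_on (ell_rect \<xi>0) f" "continuous_on (ell_rect \<xi>0) fx" "continuous_on (ell_rect \<xi>0) fy"
proof -
  obtain D where D: "\<And>p. p \<in> ell_rect \<xi>0 \<Longrightarrow> (f has_derivative blinfun_apply (D p)) (at p within ell_rect \<xi>0)"
    "continuous_on (ell_rect \<xi>0) D" using assms by (auto simp: C1_on_def)
  show ?thesis
  proof (rule that[of "\<lambda>p. blinfun_apply (D p) (1, 0)" "\<lambda>p. blinfun_apply (D p) (0, 1)"])
    fix x y assume xy: "x \<in> {0..<\<xi>0}" "y \<in> circ"
    then have p: "(x, y) \<in> ell_rect \<xi>0" by (simp add: ell_rect_def)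
    have l: "blinfun_apply (D (x, y)) (h, 0) = h *\<^sub>R blinfun_apply (D (x, y)) (1, 0)"
      "blinfun_apply (D (x, y)) (0, h) = h *\<^sub>R blinfun_apply (D (x, y)) (0, 1)" for h
      by (simp_all flip: blinfun.scaleR_right)
    have "((\<lambda>s. (s, y)) has_derivative (\<lambda>h. (h, 0))) (at x within {0..<\<xi>0})"
      by (auto intro!: derivative_eq_intros)
    moreover have "(\<lambda>s. (s, y)) ` {0..<\<xi>0} \<subseteq> ell_rect \<xi>0" using xy by (auto simp: ell_rect_def)
    ultimately have "((\<lambda>s. f (s, y)) has_derivative (\<lambda>h. blinfun_apply (D (x, y)) (h, 0))) (at x within {0..<\<xi>0})"
      using has_derivative_in_compose2[OF D(1) _ xy(1)] by blast
    then show "((\<lambda>s. f (s, y)) has_vector_derivative blinfun_apply (D (x, y)) (1, 0)) (at x within {0..<\<xi>0})"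
      unfolding has_vector_derivative_def l[symmetric] .
    have "((\<lambda>t. (x, t)) has_derivative (\<lambda>h. (0, h))) (at y within circ)"
      by (auto intro!: derivative_eq_intros)
    moreover have "(\<lambda>t. (x, t)) ` circ \<subseteq> ell_rect \<xi>0" using xy by (auto simp: ell_rect_def)
    ultimately have "((\<lambda>t. f (x, t)) has_derivative (\<lambda>h. blinfun_apply (D (x, y)) (0, h))) (at y within circ)"
      using has_derivative_in_compose2[OF D(1) _ xy(2)] by blast
    then show "((\<lambda>t. f (x, t)) has_vector_derivative blinfun_apply (D (x, y)) (0, 1)) (at y within circ)"
      unfolding has_vector_derivative_def l[symmetric] .
  next
    show "continuous_on (ell_rect \<xi>0) f"
      using D(1) has_derivative_continuous continuous_on_eq_continuous_within by blast
  qed (use D(2) in \<open>auto intro!: continuous_intros\<close>)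
qed


section \<open>Solutions in components\<close>

text \<open>For \<open>f = u + i f1 + j f2\<close>, the equation \<open>(D + lam) f = 0\<close> expresses the gradient of the scalar
  part \<open>u\<close> through \<open>f1\<close> and \<open>f2\<close>, so \<open>u\<close> is twice continuously differentiable.\<close>

locale ell_solution =
  fixes \<xi>0 lam :: real and u f1 f2 f1x f1y f2x f2y :: "real \<Rightarrow> real \<Rightarrow> real"
  assumes lam: "lam \<noteq> 0" and \<xi>0: "\<xi>0 > 0"
    and u_x: "\<And>x y. x \<in> {0..<\<xi>0} \<Longrightarrow> y \<in> circ \<Longrightarrow>
      ((\<lambda>s. u s y) has_real_derivative - lam * (eA x y * f1 x y + eB x y * f2 x y)) (at x within {0..<\<xi>0})"
    and u_y: "\<And>x y. x \<in> {0..<\<xi>0} \<Longrightarrow> y \<in> circ \<Longrightarrow>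
      (u x has_real_derivative lam * (eB x y * f1 x y - eA x y * f2 x y)) (at y within circ)"
    and f1_x: "\<And>x y. x \<in> {0..<\<xi>0} \<Longrightarrow> y \<in> circ \<Longrightarrow> ((\<lambda>s. f1 s y) has_real_derivative f1x x y) (at x within {0..<\<xi>0})"
    and f1_y: "\<And>x y. x \<in> {0..<\<xi>0} \<Longrightarrow> y \<in> circ \<Longrightarrow> (f1 x has_real_derivative f1y x y) (at y within circ)"
    and f2_x: "\<And>x y. x \<in> {0..<\<xi>0} \<Longrightarrow> y \<in> circ \<Longrightarrow> ((\<lambda>s. f2 s y) has_real_derivative f2x x y) (at x within {0..<\<xi>0})"
    and f2_y: "\<And>x y. x \<in> {0..<\<xi>0} \<Longrightarrow> y \<in> circ \<Longrightarrow> (f2 x has_real_derivative f2y x y) (at y within circ)"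
    and scalar_eq: "\<And>x y. x \<in> {0..<\<xi>0} \<Longrightarrow> y \<in> circ \<Longrightarrow>
      - (eA x y * f1x x y + eB x y * f2x x y) + (eB x y * f1y x y - eA x y * f2y x y) + lam * ew x y * u x y = 0"
    and cont: "continuous_on (ell_rect \<xi>0) (\<lambda>(x, y). u x y)"
      "continuous_on (ell_rect \<xi>0) (\<lambda>(x, y). f1 x y)" "continuous_on (ell_rect \<xi>0) (\<lambda>(x, y). f2 x y)"
      "continuous_on (ell_rect \<xi>0) (\<lambda>(x, y). f1x x y)" "continuous_on (ell_rect \<xi>0) (\<lambda>(x, y). f1y x y)"
      "continuous_on (ell_rect \<xi>0) (\<lambda>(x, y). f2x x y)" "continuous_on (ell_rect \<xi>0) (\<lambda>(x, y). f2y x y)"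
    and periodic: "\<And>x. x \<in> {0..<\<xi>0} \<Longrightarrow> u x 0 = u x (2 * pi)" "\<And>x. x \<in> {0..<\<xi>0} \<Longrightarrow> f1 x 0 = f1 x (2 * pi)"
      "\<And>x. x \<in> {0..<\<xi>0} \<Longrightarrow> f2 x 0 = f2 x (2 * pi)"
    and fold: "\<And>y. y \<in> circ \<Longrightarrow> u 0 (2 * pi - y) = u 0 y"
      "\<And>y. y \<in> circ \<Longrightarrow> eA 0 (2 * pi - y) * f1 0 (2 * pi - y) + eB 0 (2 * pi - y) * f2 0 (2 * pi - y)
        = - (eA 0 y * f1 0 y + eB 0 y * f2 0 y)"

text \<open>Away from the foci the i and j components of the equation form a linear system for the
  two partial derivatives of the scalar part, with determinant eA^2 + eB^2 = \<open>ew\<close>. The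
  solved form is free of denominators and extends to the foci by continuity of f and its partial
  derivatives.\<close>

lemma ell_M_components:
  assumes f: "f \<in> ell_M \<xi>0 lam" and lam: "lam \<noteq> 0" and \<xi>0: "\<xi>0 > 0"
  shows "\<exists>f1x f1y f2x f2y. ell_solution \<xi>0 lam (\<lambda>x y. fst (f (x, y))) (\<lambda>x y. snd (f (x, y)) $ 1)
    (\<lambda>x y. snd (f (x, y)) $ 2) f1x f1y f2x f2y"
proof -
  have C1: "C1_on (ell_rect \<xi>0) f" and S: "\<And>x. x \<in> {0..<\<xi>0} \<Longrightarrow> f (x, 0) = f (x, 2 * pi)"
    "\<And>y. y \<in> circ \<Longrightarrow> f (0, y) = f (0, 2 * pi - y)" "\<And>y. y \<in> circ \<Longrightarrow> d_xi f (0, y) = - d_xi f (0, 2 * pi - y)"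
    and red: "\<And>p. p \<in> ell_rect \<xi>0 \<Longrightarrow> snd (f p) $ 3 = 0"
    and eq: "\<And>p. p \<in> ell_rect \<xi>0 - foci \<Longrightarrow> ell_D f p + lam *\<^sub>R f p = 0"
    using f unfolding ell_M_def ell_S_def reduced_quats_def by blast+
  obtain fx fy where
    fx: "\<And>x y. x \<in> {0..<\<xi>0} \<Longrightarrow> y \<in> circ \<Longrightarrow> ((\<lambda>s. f (s, y)) has_vector_derivative fx (x, y)) (at x within {0..<\<xi>0})"
    and fy: "\<And>x y. x \<in> {0..<\<xi>0} \<Longrightarrow> y \<in> circ \<Longrightarrow> ((\<lambda>t. f (x, t)) has_vector_derivative fy (x, y)) (at y within circ)"
    and cf: "continuous_on (ell_rect \<xi>0) f" "continuous_on (ell_rect \<xi>0) fx" "continuous_on (ell_rect \<xi>0) fy"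
    using C1_on_ell_rect_partials[OF C1] by metis
  define g where "g k = (if k = 0 then fst else (\<lambda>v :: quat. snd v $ (of_nat k)))" for k :: nat
  have bl: "bounded_linear (g k)" for k
    unfolding g_def
    by (auto intro: bounded_linear_fst bounded_linear_compose[OF bounded_linear_vec_nth bounded_linear_snd, unfolded o_def])
  have gx: "((\<lambda>s. g k (f (s, y))) has_real_derivative g k (fx (x, y))) (at x within {0..<\<xi>0})"
    and gy: "((\<lambda>t. g k (f (x, t))) has_real_derivative g k (fy (x, y))) (at y within circ)"
    if "x \<in> {0..<\<xi>0}" "y \<in> circ" for k x y
    unfolding has_real_derivative_iff_has_vector_derivative
    by (rule bounded_linear.has_vector_derivative[OF bl fx[OF that]]
        bounded_linear.has_vector_derivative[OF bl fy[OF that]])+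
  have gc: "continuous_on (ell_rect \<xi>0) (\<lambda>p. g k (f p))" "continuous_on (ell_rect \<xi>0) (\<lambda>p. g k (fx p))"
    "continuous_on (ell_rect \<xi>0) (\<lambda>p. g k (fy p))" for k
    using cf bounded_linear.continuous_on[OF bl] by auto
  have g: "g 0 = fst" "g 1 = (\<lambda>v. snd v $ 1)" "g (Suc 0) = (\<lambda>v. snd v $ 1)" "g 2 = (\<lambda>v. snd v $ 2)" "g 3 = (\<lambda>v. snd v $ 3)"
    by (auto simp: g_def)
  have nbot: "at x within {0..<\<xi>0} \<noteq> bot" if "x \<in> {0..<\<xi>0}" for x
    using that islimpt_Ico by (auto simp: trivial_limit_within)
  have nbot': "at y within circ \<noteq> bot" if "y \<in> circ" for y
    using that by (auto simp: trivial_limit_within islimpt_Icc)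
  have f3: "snd (fx (x, y)) $ 3 = 0" "snd (fy (x, y)) $ 3 = 0" if xy: "x \<in> {0..<\<xi>0}" "y \<in> circ" for x y
  proof -
    have "((\<lambda>s. snd (f (s, y)) $ 3) has_real_derivative 0) (at x within {0..<\<xi>0})"
      unfolding has_field_derivative_def
      by (rule has_derivative_transform[of _ _ _ "\<lambda>_. 0"])
         (use xy red in \<open>auto simp: ell_rect_def simp flip: lambda_zero\<close>)
    then show "snd (fx (x, y)) $ 3 = 0"
      using has_field_derivative_unique[OF gx[OF xy, of 3, unfolded g] _ nbot[OF xy(1)]] by blast
    have "((\<lambda>t. snd (f (x, t)) $ 3) has_real_derivative 0) (at y within circ)"
      unfolding has_field_derivative_def
      by (rule has_derivative_transform[of _ _ _ "\<lambda>_. 0"])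
         (use xy red in \<open>auto simp: ell_rect_def simp flip: lambda_zero\<close>)
    then show "snd (fy (x, y)) $ 3 = 0"
      using has_field_derivative_unique[OF gy[OF xy, of 3, unfolded g] _ nbot'[OF xy(2)]] by blast
  qed
  have eqs: "- (eA x y * snd (fx (x, y)) $ 1 + eB x y * snd (fx (x, y)) $ 2)
        + (eB x y * snd (fy (x, y)) $ 1 - eA x y * snd (fy (x, y)) $ 2) + lam * ew x y * fst (f (x, y)) = 0"
    "ew x y \<noteq> 0 \<Longrightarrow> fst (fx (x, y)) = - lam * (eA x y * snd (f (x, y)) $ 1 + eB x y * snd (f (x, y)) $ 2)"
    "ew x y \<noteq> 0 \<Longrightarrow> fst (fy (x, y)) = lam * (eB x y * snd (f (x, y)) $ 1 - eA x y * snd (f (x, y)) $ 2)"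
    if xy: "x \<in> {0..<\<xi>0}" "y \<in> circ" for x y
  proof -
    define A B W where "A = eA x y" and "B = eB x y" and "W = ew x y"
    define X0 X1 X2 Y0 Y1 Y2 where "X0 = fst (fx (x, y))" and "X1 = snd (fx (x, y)) $ 1" and "X2 = snd (fx (x, y)) $ 2"
      and "Y0 = fst (fy (x, y))" and "Y1 = snd (fy (x, y)) $ 1" and "Y2 = snd (fy (x, y)) $ 2"
    define g0 g1 g2 where "g0 = fst (f (x, y))" and "g1 = snd (f (x, y)) $ 1" and "g2 = snd (f (x, y)) $ 2"
    note defs = A_def B_def W_def X0_def X1_def X2_def Y0_def Y1_def Y2_def g0_def g1_def g2_def
    have W: "W = A\<^sup>2 + B\<^sup>2" unfolding defs ew_eq(2) ..
    have e: "1 / W * (- (A * X1 + B * X2) + (B * Y1 - A * Y2)) + lam * g0 = 0"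
      "1 / W * (A * X0 - B * Y0) + lam * g1 = 0" "1 / W * (B * X0 + A * Y0) + lam * g2 = 0" if "W \<noteq> 0"
    proof -
      have "ell_D f (x, y) + lam *\<^sub>R f (x, y) = 0"
        using that xy by (intro eq) (auto simp: ell_rect_def foci_iff W_def)
      then have c: "fst (ell_D f (x, y)) + lam * fst (f (x, y)) = 0" "snd (ell_D f (x, y)) $ 1 + lam * snd (f (x, y)) $ 1 = 0"
        "snd (ell_D f (x, y)) $ 2 + lam * snd (f (x, y)) $ 2 = 0"
        unfolding quat_eq_iff[of "ell_D f (x, y) + lam *\<^sub>R f (x, y)"] by auto
      show "1 / W * (- (A * X1 + B * X2) + (B * Y1 - A * Y2)) + lam * g0 = 0"
        "1 / W * (A * X0 - B * Y0) + lam * g1 = 0" "1 / W * (B * X0 + A * Y0) + lam * g2 = 0"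
        using c unfolding ell_D_components d_xi_eq[OF fx[OF xy] xy(1)] d_eta_eq[OF fy[OF xy] xy(2)] f3[OF xy] defs by auto
    qed
    \<comment> \<open>Multiplied by the weight, the scalar equation holds at the foci too, because
      \<open>A\<close> and \<open>B\<close> vanish there.\<close>
    have "- (A * X1 + B * X2) + (B * Y1 - A * Y2) + lam * W * g0 = 0"
    proof (cases "W = 0")
      case True
      then show ?thesis using W by (simp add: sum_power2_eq_zero_iff)
    next
      case False
      then show ?thesis using e(1)[OF False] by (simp add: field_simps)
    qed
    then show "- (eA x y * snd (fx (x, y)) $ 1 + eB x y * snd (fx (x, y)) $ 2)
        + (eB x y * snd (fy (x, y)) $ 1 - eA x y * snd (fy (x, y)) $ 2) + lam * ew x y * fst (f (x, y)) = 0"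
      unfolding defs .
    assume "ew x y \<noteq> 0"
    then have W0: "W \<noteq> 0" by (simp add: W_def)
    have e': "A * X0 - B * Y0 = - (lam * W * g1)" "B * X0 + A * Y0 = - (lam * W * g2)"
      using e(2,3)[OF W0] W0 by (simp_all add: field_simps)
    have "W * X0 = A * (A * X0 - B * Y0) + B * (B * X0 + A * Y0)"
      "W * Y0 = A * (B * X0 + A * Y0) - B * (A * X0 - B * Y0)"
      unfolding W by (simp_all add: power2_eq_square algebra_simps)
    then have "W * X0 = W * (- lam * (A * g1 + B * g2))" "W * Y0 = W * (lam * (B * g1 - A * g2))"
      unfolding e' by (simp_all add: algebra_simps)
    then have "X0 = - lam * (A * g1 + B * g2)" "Y0 = lam * (B * g1 - A * g2)"
      unfolding mult_left_cancel[OF W0] by auto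
    then show "fst (fx (x, y)) = - lam * (eA x y * snd (f (x, y)) $ 1 + eB x y * snd (f (x, y)) $ 2)"
      "fst (fy (x, y)) = lam * (eB x y * snd (f (x, y)) $ 1 - eA x y * snd (f (x, y)) $ 2)" unfolding defs by auto
  qed
  \<comment> \<open>The weight vanishes only for x = 0, so a focus is approached along the segment
    with \<open>y\<close> fixed.\<close>
  have ext: "h (x, y) = 0"
    if h: "continuous_on (ell_rect \<xi>0) h" "\<And>x y. x \<in> {0..<\<xi>0} \<Longrightarrow> y \<in> circ \<Longrightarrow> ew x y \<noteq> 0 \<Longrightarrow> h (x, y) = 0"
      and xy: "x \<in> {0..<\<xi>0}" "y \<in> circ" for h :: "real \<times> real \<Rightarrow> real" and x y
  proof (cases "ew x y = 0")
    case True
    then have x: "x = 0" by (simp add: ew_eq_0_iff)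
    have cont: "continuous_on {0..<\<xi>0} (\<lambda>s. h (s, y))"
      by (rule continuous_on_compose2[OF h(1)]) (use xy in \<open>auto simp: ell_rect_def intro!: continuous_intros\<close>)
    have "((\<lambda>s. h (s, y)) \<longlongrightarrow> h (0, y)) (at 0 within {0..<\<xi>0})"
      using cont \<xi>0 by (auto simp: continuous_on_def)
    moreover have "((\<lambda>s. h (s, y)) \<longlongrightarrow> 0) (at 0 within {0..<\<xi>0})"
    proof (rule tendsto_eventually)
      show "\<forall>\<^sub>F s in at 0 within {0..<\<xi>0}. h (s, y) = 0"
        unfolding eventually_at_filter using xy h(2) by (intro always_eventually) (auto simp: ew_eq_0_iff)
    qed
    ultimately show ?thesis using tendsto_unique nbot[of 0] \<xi>0 x by fastforce
  qed (use that in auto)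
  note gcc = gc[of 0, unfolded g] gc[of 1, unfolded g] gc[of 2, unfolded g]
  have ux: "fst (fx (x, y)) = - lam * (eA x y * snd (f (x, y)) $ 1 + eB x y * snd (f (x, y)) $ 2)"
    and uy: "fst (fy (x, y)) = lam * (eB x y * snd (f (x, y)) $ 1 - eA x y * snd (f (x, y)) $ 2)"
    if xy: "x \<in> {0..<\<xi>0}" "y \<in> circ" for x y
  proof -
    have "continuous_on (ell_rect \<xi>0)
        (\<lambda>p. fst (fx p) + lam * (eA (fst p) (snd p) * snd (f p) $ 1 + eB (fst p) (snd p) * snd (f p) $ 2))"
      "continuous_on (ell_rect \<xi>0)
        (\<lambda>p. fst (fy p) - lam * (eB (fst p) (snd p) * snd (f p) $ 1 - eA (fst p) (snd p) * snd (f p) $ 2))"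
      by (intro continuous_intros cf)+
    from ext[OF this(1) _ xy] ext[OF this(2) _ xy]
    have "fst (fx (x, y)) + lam * (eA x y * snd (f (x, y)) $ 1 + eB x y * snd (f (x, y)) $ 2) = 0"
      "fst (fy (x, y)) - lam * (eB x y * snd (f (x, y)) $ 1 - eA x y * snd (f (x, y)) $ 2) = 0"
      using eqs(2,3) by simp_all
    then show "fst (fx (x, y)) = - lam * (eA x y * snd (f (x, y)) $ 1 + eB x y * snd (f (x, y)) $ 2)"
      "fst (fy (x, y)) = lam * (eB x y * snd (f (x, y)) $ 1 - eA x y * snd (f (x, y)) $ 2)" by simp_all
  qed
  have fold: "fst (fx (0, 2 * pi - y)) = - fst (fx (0, y))" if "y \<in> circ" for y
  proof -
    have y': "2 * pi - y \<in> circ" "0 \<in> {0..<\<xi>0}" using that \<xi>0 by auto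
    show ?thesis
      using S(3)[OF that] unfolding d_xi_eq[OF fx[OF y'(2,1)] y'(2)] d_xi_eq[OF fx[OF y'(2) that] y'(2)] by simp
  qed
  show ?thesis
  proof (intro exI)
    show "ell_solution \<xi>0 lam (\<lambda>x y. fst (f (x, y))) (\<lambda>x y. snd (f (x, y)) $ 1)
    (\<lambda>x y. snd (f (x, y)) $ 2) (\<lambda>x y. snd (fx (x, y)) $ 1) (\<lambda>x y. snd (fy (x, y)) $ 1)
      (\<lambda>x y. snd (fx (x, y)) $ 2) (\<lambda>x y. snd (fy (x, y)) $ 2)"
    proof
      fix x y assume xy: "x \<in> {0..<\<xi>0}" "y \<in> circ"
      show "((\<lambda>s. fst (f (s, y))) has_real_derivative
          - lam * (eA x y * snd (f (x, y)) $ 1 + eB x y * snd (f (x, y)) $ 2)) (at x within {0..<\<xi>0})"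
        using gx[OF xy, of 0] unfolding g ux[OF xy] .
      show "((\<lambda>t. fst (f (x, t))) has_real_derivative
          lam * (eB x y * snd (f (x, y)) $ 1 - eA x y * snd (f (x, y)) $ 2)) (at y within circ)"
        using gy[OF xy, of 0] unfolding g uy[OF xy] .
      show "((\<lambda>s. snd (f (s, y)) $ 1) has_real_derivative snd (fx (x, y)) $ 1) (at x within {0..<\<xi>0})"
        using gx[OF xy, of 1] unfolding g .
      show "((\<lambda>s. snd (f (s, y)) $ 2) has_real_derivative snd (fx (x, y)) $ 2) (at x within {0..<\<xi>0})"
        using gx[OF xy, of 2] unfolding g .
      show "((\<lambda>s. snd (f (x, s)) $ 1) has_real_derivative snd (fy (x, y)) $ 1) (at y within circ)"
        using gy[OF xy, of 1] unfolding g .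
      show "((\<lambda>s. snd (f (x, s)) $ 2) has_real_derivative snd (fy (x, y)) $ 2) (at y within circ)"
        using gy[OF xy, of 2] unfolding g .
    next
      fix y assume y: "y \<in> circ"
      show "eA 0 (2 * pi - y) * snd (f (0, 2 * pi - y)) $ 1 + eB 0 (2 * pi - y) * snd (f (0, 2 * pi - y)) $ 2
        = - (eA 0 y * snd (f (0, y)) $ 1 + eB 0 y * snd (f (0, y)) $ 2)"
      proof -
        have m: "0 \<in> {0..<\<xi>0}" "2 * pi - y \<in> circ" using y \<xi>0 by auto
        have "lam * (eA 0 (2 * pi - y) * snd (f (0, 2 * pi - y)) $ 1 + eB 0 (2 * pi - y) * snd (f (0, 2 * pi - y)) $ 2)
            = lam * - (eA 0 y * snd (f (0, y)) $ 1 + eB 0 y * snd (f (0, y)) $ 2)"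
          using fold[OF y] unfolding ux[OF m] ux[OF m(1) y] by linarith
        then show ?thesis unfolding mult_left_cancel[OF lam] .
      qed
      show "fst (f (0, 2 * pi - y)) = fst (f (0, y))" by (rule arg_cong[OF S(2)[OF y, symmetric]])
    next
      fix x assume x: "x \<in> {0..<\<xi>0}"
      show "fst (f (x, 0)) = fst (f (x, 2 * pi))" "snd (f (x, 0)) $ 1 = snd (f (x, 2 * pi)) $ 1"
        "snd (f (x, 0)) $ 2 = snd (f (x, 2 * pi)) $ 2" unfolding S(1)[OF x] by (rule refl)+
    qed (use lam \<xi>0 gcc in \<open>simp_all only: eqs(1) case_prod_beta' prod.collapse not_False_eq_True\<close>)
  qed
qed

section \<open>Helmholtz equation and Fourier coefficients of the scalar part\<close>

abbreviation "mq lam \<equiv> lam\<^sup>2 / 4 :: real"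

context ell_solution
begin

definition "ux x y = - lam * (eA x y * f1 x y + eB x y * f2 x y)"
definition "uy x y = lam * (eB x y * f1 x y - eA x y * f2 x y)"
definition "uxx x y = - lam * (eA' x y * f1 x y + eA x y * f1x x y + eB' x y * f2 x y + eB x y * f2x x y)"
definition "uyy x y = lam * (eA' x y * f1 x y + eB x y * f1y x y + eB' x y * f2 x y - eA x y * f2y x y)"

lemma u_derivs:
  assumes "x \<in> {0..<\<xi>0}" "y \<in> circ"
  shows "((\<lambda>s. u s y) has_real_derivative ux x y) (at x within {0..<\<xi>0})"
    "(u x has_real_derivative uy x y) (at y within circ)"
    "((\<lambda>s. ux s y) has_real_derivative uxx x y) (at x within {0..<\<xi>0})"
    "(uy x has_real_derivative uyy x y) (at y within circ)"
proof -
  show "((\<lambda>s. u s y) has_real_derivative ux x y) (at x within {0..<\<xi>0})"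
    "(u x has_real_derivative uy x y) (at y within circ)"
    using u_x[OF assms] u_y[OF assms] by (auto simp: ux_def uy_def)
  show "((\<lambda>s. ux s y) has_real_derivative uxx x y) (at x within {0..<\<xi>0})"
    unfolding ux_def uxx_def
    by (rule derivative_eq_intros eAB_has_deriv f1_x[OF assms] f2_x[OF assms] refl)+ (simp add: algebra_simps)
  show "(uy x has_real_derivative uyy x y) (at y within circ)"
    unfolding uy_def[abs_def] uyy_def
    by (rule derivative_eq_intros eAB_has_deriv f1_y[OF assms] f2_y[OF assms] refl)+ (simp add: algebra_simps)
qed

text \<open>This is u_xx + u_yy + lam^2 \<open>ew\<close> u = 0: when the pure second derivatives
  are added, the terms with derivatives of \<open>eA\<close> and \<open>eB\<close> cancel by the
  Cauchy-Riemann equations, and the scalar component of the first-order system remains. The shift is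
  added and subtracted so that the angular part appears as the right-hand side of a
  \<open>per_sol\<close> problem.\<close>

lemma laplace:
  assumes "x \<in> {0..<\<xi>0}" "y \<in> circ"
  shows "uxx x y = (pot (mq lam) y * u x y - uyy x y)
    - (2 * mq lam * cosh (2 * x) + (2 * \<bar>mq lam\<bar> + 1)) * u x y"
proof -
  have "uxx x y + uyy x y
      = lam * (- (eA x y * f1x x y + eB x y * f2x x y) + (eB x y * f1y x y - eA x y * f2y x y))"
    unfolding uxx_def uyy_def by (simp add: algebra_simps)
  also have "\<dots> = lam * (- (lam * ew x y * u x y))"
    using scalar_eq[OF assms] by (intro arg_cong[of _ _ "(*) lam"]) linarith
  also have "\<dots> = - (lam\<^sup>2 * ew x y) * u x y" by (simp add: power2_eq_square)
  also have "lam\<^sup>2 * ew x y = (2 * mq lam * cosh (2 * x) + (2 * \<bar>mq lam\<bar> + 1)) - pot (mq lam) y"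
    by (simp add: ew_def pot_def field_simps)
  finally show ?thesis by (simp add: algebra_simps)
qed

lemma continuous_derivs:
  "continuous_on (ell_rect \<xi>0) (\<lambda>(x, y). ux x y)" "continuous_on (ell_rect \<xi>0) (\<lambda>(x, y). uy x y)"
  "continuous_on (ell_rect \<xi>0) (\<lambda>(x, y). uxx x y)" "continuous_on (ell_rect \<xi>0) (\<lambda>(x, y). uyy x y)"
  using cont unfolding ux_def uy_def uxx_def uyy_def case_prod_beta' by - (intro continuous_intros, assumption+)+

lemma continuous_section:
  assumes "continuous_on (ell_rect \<xi>0) (\<lambda>(x, y). g x y)" "x \<in> {0..<\<xi>0}"
  shows "continuous_on circ (g x)"
proof -
  have "continuous_on circ (\<lambda>y. (x, y))" "(\<lambda>y. (x, y)) ` circ \<subseteq> ell_rect \<xi>0"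
    using assms(2) by (auto simp: ell_rect_def intro: continuous_on_Pair continuous_on_const continuous_on_id)
  from continuous_on_compose2[OF assms(1) this] show ?thesis by simp
qed

lemmas sections = cont[THEN continuous_section] continuous_derivs[THEN continuous_section]

lemma per_sol_u:
  assumes "x \<in> {0..<\<xi>0}"
  shows "per_sol (mq lam) (\<lambda>y. pot (mq lam) y * u x y - uyy x y) (u x) (uy x)"
  unfolding per_sol_def
proof (intro conjI ballI)
  show "continuous_on circ (\<lambda>y. pot (mq lam) y * u x y - uyy x y)"
    using sections[OF assms] by (intro continuous_intros)
  show "uy x 0 = uy x (2 * pi)" using periodic[OF assms] by (simp add: uy_def eA_def eB_def)
qed (use u_derivs[OF assms] periodic(1)[OF assms] in auto)

definition "coef i x = ip (u x) (eigfun (mq lam) i)"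
definition "coef' i x = ip (ux x) (eigfun (mq lam) i)"

text \<open>Differentiate twice under the integral. The equation replaces u_xx by the angular
  operator applied to u, and symmetry of the resolvent moves that operator onto the eigenfunction,
  where it acts as multiplication by the eigenvalue.\<close>

lemma coef_derivs:
  assumes i: "i \<in> eig_index (mq lam)" and x: "x \<in> {0..<\<xi>0}"
  shows "(coef i has_real_derivative coef' i x) (at x within {0..<\<xi>0})"
    "(coef' i has_real_derivative (snd i - 2 * mq lam * cosh (2 * x)) * coef i x) (at x within {0..<\<xi>0})"
proof -
  define e where "e = eigfun (mq lam) i"
  have ce: "continuous_on circ e" using continuous_eigfun(1)[OF i] by (simp add: e_def)
  have joint: "continuous_on ({0..<\<xi>0} \<times> cbox 0 (2 * pi)) (\<lambda>(x, y). g x y * e y)"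
    if "continuous_on (ell_rect \<xi>0) (\<lambda>(x, y). g x y)" for g
    using that ce unfolding ell_rect_def case_prod_beta' box_real
    by (intro continuous_intros continuous_on_compose2[OF ce, of _ snd]) auto
  have int: "(\<lambda>y. g x y * e y) integrable_on cbox 0 (2 * pi)"
    if "continuous_on (ell_rect \<xi>0) (\<lambda>(x, y). g x y)" "x \<in> {0..<\<xi>0}" for g x
    using continuous_section[OF that] ce unfolding box_real
    by (intro integrable_continuous_real continuous_intros)
  have "((\<lambda>x. integral (cbox 0 (2 * pi)) (\<lambda>y. u x y * e y)) has_real_derivative
      integral (cbox 0 (2 * pi)) (\<lambda>y. ux x y * e y)) (at x within {0..<\<xi>0})"
    using x joint[OF continuous_derivs(1)] int[OF cont(1)]
    by (intro leibniz_rule_field_derivative[where fx = "\<lambda>x y. ux x y * e y"])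
       (auto intro!: DERIV_cmult_right u_derivs)
  then show "(coef i has_real_derivative coef' i x) (at x within {0..<\<xi>0})"
    by (simp add: coef_def[abs_def] coef'_def ip_def e_def)
  have "((\<lambda>x. integral (cbox 0 (2 * pi)) (\<lambda>y. ux x y * e y)) has_real_derivative
      integral (cbox 0 (2 * pi)) (\<lambda>y. uxx x y * e y)) (at x within {0..<\<xi>0})"
    using x joint[OF continuous_derivs(3)] int[OF continuous_derivs(1)]
    by (intro leibniz_rule_field_derivative[where fx = "\<lambda>x y. uxx x y * e y"])
       (auto intro!: DERIV_cmult_right u_derivs)
  then have d: "(coef' i has_real_derivative ip (uxx x) e) (at x within {0..<\<xi>0})"
    by (simp add: coef'_def[abs_def] ip_def e_def)
  define K where "K = 2 * mq lam * cosh (2 * x) + (2 * \<bar>mq lam\<bar> + 1)"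
  define v where "v y = pot (mq lam) y * u x y - uyy x y" for y
  have cv: "continuous_on circ v" unfolding v_def[abs_def] by (rule per_sol_continuous(1)[OF per_sol_u[OF x]])
  have "ip (uxx x) e = ip (\<lambda>y. 1 * v y + (- K) * u x y) e"
    by (rule ip_cong) (simp_all add: laplace[OF x] v_def K_def algebra_simps)
  also have "\<dots> = ip v e - K * ip (u x) e"
    using ip_lin[OF cv sections(1)[OF x] ce, of 1 "- K"] by simp
  also have "ip v e = shift_ev (mq lam) i * ip (u x) e"
    using per_sol_symmetric[OF per_sol_u[OF x] per_sol_eigfun[OF i]]
    by (simp add: v_def[abs_def] e_def ip_cmult)
  finally have "ip (uxx x) e = (snd i - 2 * mq lam * cosh (2 * x)) * coef i x"
    by (simp add: coef_def e_def K_def shift_ev_def algebra_simps)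
  then show "(coef' i has_real_derivative (snd i - 2 * mq lam * cosh (2 * x)) * coef i x) (at x within {0..<\<xi>0})"
    using d by simp
qed

text \<open>The segment between the foci is covered twice at x = 0. Since f is single-valued and
  smooth across it, u is even and its x-derivative odd under y to 2 pi - y, so each is orthogonal to
  the eigenfunctions of the opposite parity.\<close>

lemma coef_at_0:
  assumes "i \<in> eig_index (mq lam)"
  shows "fst i = 1 \<Longrightarrow> coef' i 0 = 0" "fst i \<noteq> 1 \<Longrightarrow> coef i 0 = 0"
proof -
  have ux0: "ux 0 (2 * pi - y) = - 1 * ux 0 y" if "y \<in> circ" for y
    unfolding ux_def fold(2)[OF that] by (simp add: algebra_simps)
  show "coef' i 0 = 0" if "fst i = 1"
    unfolding coef'_def
    by (rule ip_parity[where s = "-1" and t = 1])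
       (use that ux0 eigfun_reflect[OF assms] in auto)
  show "coef i 0 = 0" if "fst i \<noteq> 1"
    unfolding coef_def
    by (rule ip_parity[where s = 1 and t = "-1"])
       (use that fold(1) eigfun_reflect[OF assms] assms in auto)
qed

text \<open>Of the two fundamental solutions of the modified equation, the initial data leave only
  the one whose parity agrees with that of the angular factor.\<close>

lemma coef_eq:
  assumes i: "i \<in> eig_index (mq lam)" and x: "x \<in> {0..<\<xi>0}"
  shows "coef i x = (if fst i = 1 then coef i 0 else coef' i 0) * rad (fst i) (snd i) (mq lam) x"
    "coef' i x = (if fst i = 1 then coef i 0 else coef' i 0) * rad' (fst i) (snd i) (mq lam) x"
proof -
  have s: "fst i = 1 \<or> fst i = -1" using i by auto
  define p where "p x = snd i - 2 * mq lam * cosh (2 * x)" for x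
  have d: "(coef' i has_real_derivative p x * coef i x) (at x within {0..<\<xi>0})" if "x \<in> {0..<\<xi>0}" for x
    unfolding p_def by (rule coef_derivs(2)[OF i that])
  have r: "(rad' s (snd i) (mq lam) has_real_derivative p x * rad s (snd i) (mq lam) x) (at x within S)" for s x S
    unfolding p_def by (rule rad_has_deriv)
  have "coef i x = coef i 0 * rad 1 (snd i) (mq lam) x + coef' i 0 * rad (-1) (snd i) (mq lam) x"
    "coef' i x = coef i 0 * rad' 1 (snd i) (mq lam) x + coef' i 0 * rad' (-1) (snd i) (mq lam) x"
    using linear_ode_representation(1,2)[of "{0..<\<xi>0}" "coef i" "coef' i"
        p "rad 1 (snd i) (mq lam)" "rad' 1 (snd i) (mq lam)"
        "rad (-1) (snd i) (mq lam)" "rad' (-1) (snd i) (mq lam)" x] coef_derivs(1)[OF i] d r rad_has_deriv(1) x \<xi>0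
    by (auto simp: ang_rad_0)
  then show "coef i x = (if fst i = 1 then coef i 0 else coef' i 0) * rad (fst i) (snd i) (mq lam) x"
    "coef' i x = (if fst i = 1 then coef i 0 else coef' i 0) * rad' (fst i) (snd i) (mq lam) x"
    using coef_at_0[OF i] s by auto
qed

end

section \<open>Smoothness of the reduced quaternionic Mathieu functions\<close>

text \<open>The zeros of the sine are simple, so those of the quotient are removable: near a zero it
  is the ratio of the difference quotients of N and sin, the latter tending to cos a, which is
  nonzero.\<close>

lemma entire_quotient_sin:
  fixes N :: "complex \<Rightarrow> complex"
  assumes N: "N holomorphic_on UNIV" and z: "\<And>z. sin z = 0 \<Longrightarrow> N z = 0"
  shows "\<exists>K. K holomorphic_on UNIV \<and> (\<forall>z. N z = K z * sin z)"
proof -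
  define K where "K z = (if sin z = 0 then deriv N z / cos z else N z / sin z)" for z
  have cs: "cos z \<noteq> 0" if "sin z = 0" for z :: complex
    using sin_cos_squared_add[of z] that by auto
  define Q where "Q f a z = (if z = a then deriv f a else (f z - f a) / (z - a))" for f a and z :: complex
  have holQ: "Q f a holomorphic_on UNIV" if "f holomorphic_on UNIV" for f a
    unfolding Q_def[abs_def] using that by (intro pole_lemma_open) auto
  have holS: "sin holomorphic_on (UNIV :: complex set)" by (intro holomorphic_intros)
  have "K field_differentiable (at a)" for a
  proof (cases "sin a = 0")
    case False
    have o: "open {z :: complex. sin z \<noteq> 0}" by (intro open_Collect_neq continuous_intros)
    have "(\<lambda>z. N z / sin z) holomorphic_on {z. sin z \<noteq> 0}"
      by (intro holomorphic_intros holomorphic_on_subset[OF N]) auto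
    then have "K holomorphic_on {z. sin z \<noteq> 0}"
      by (rule holomorphic_transform) (auto simp: K_def)
    then show ?thesis using o False by (auto simp: holomorphic_on_open field_differentiable_def)
  next
    case True
    have dS: "deriv sin a = cos a" by (rule DERIV_imp_deriv) (auto intro!: derivative_eq_intros)
    have "isCont (Q sin a) a"
      using holQ[OF holS] by (metis UNIV_I continuous_on_eq_continuous_at holomorphic_on_imp_continuous_on open_UNIV)
    moreover have "Q sin a a \<noteq> 0" using cs[OF True] by (simp add: Q_def dS)
    ultimately have "\<forall>\<^sub>F z in nhds a. Q sin a z \<noteq> 0"
      by (intro tendsto_imp_eventually_ne) (auto simp: isCont_def intro: tendsto_at_iff_tendsto_nhds[THEN iffD1])
    then obtain U where U: "open U" "a \<in> U" "\<And>z. z \<in> U \<Longrightarrow> Q sin a z \<noteq> 0"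
      by (auto simp: eventually_nhds)
    have "(\<lambda>z. Q N a z / Q sin a z) holomorphic_on U"
      by (intro holomorphic_intros holomorphic_on_subset[OF holQ] N holS U) auto
    moreover have "Q N a w / Q sin a w = K w" if "w \<in> U" for w
      using U(3)[OF that] z[OF True] True by (auto simp: Q_def K_def dS)
    ultimately have "K holomorphic_on U" by (rule holomorphic_transform)
    then show ?thesis using U by (auto simp: holomorphic_on_open field_differentiable_def)
  qed
  then have "K holomorphic_on UNIV" by (simp add: holomorphic_on_def)
  moreover have "N z = K z * sin z" for z using z by (simp add: K_def)
  ultimately show ?thesis by blast
qed

text \<open>The zeros are the multiples of pi, where -z and z differ by a period. Parity then forces
  Y'(z) = 0 in the even and Y(z) = 0 in the odd case, which is exactly the factor that survives the
  initial data.\<close>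

lemma mathieu_base_Wronskian_zero:
  assumes i: "(s, a) \<in> eig_index q" and z: "sin z = 0"
  defines "Y \<equiv> mathieu_base s a q"
  shows "deriv Y z * Y 0 - Y z * deriv Y 0 = 0"
proof -
  have s: "s = 1 \<or> s = -1" and sol: "mathieu_sol a q Y"
    using i mathieu_eigenvalues_iff unfolding Y_def by auto
  have per: "Y (z + 2 * of_real pi) = Y z" for z using sol by (simp add: mathieu_sol_altdef)
  have Y: "mathieu_eq a q Y" using sol by (simp add: mathieu_sol_altdef)
  have per': "deriv Y (z + 2 * of_real pi) = deriv Y z" for z
    using mathieu_eq_shift(2)[OF Y] unfolding per by metis
  interpret p: periodic_fun_simple Y "2 * of_real pi" by standard (rule per)
  interpret p': periodic_fun_simple "deriv Y" "2 * of_real pi" by standard (rule per')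
  have m: "Y (- z) = of_real s * Y z" for z using mathieu_base_minus[OF s] by (simp add: Y_def)
  have m': "deriv Y (- z) = - (of_real s * deriv Y z)" for z
  proof -
    have "(uminus has_field_derivative - 1) (at z)" by (auto intro!: derivative_eq_intros)
    from DERIV_chain2[OF mathieu_eq_deriv(1)[OF Y] this]
    have "((\<lambda>z. of_real s * Y z) has_field_derivative - deriv Y (- z)) (at z)" by (simp add: m)
    moreover have "((\<lambda>z. of_real s * Y z) has_field_derivative of_real s * deriv Y z) (at z)"
      by (intro DERIV_cmult mathieu_eq_deriv(1)[OF Y])
    ultimately have "- deriv Y (- z) = of_real s * deriv Y z" by (rule DERIV_unique)
    then show ?thesis by (metis minus_minus)
  qed
  obtain n :: int where n: "z = of_real (of_int n * pi)" using z unfolding sin_eq_0 by auto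
  have z': "z = - z + of_int n * (2 * of_real pi)" unfolding n by simp
  have "Y z = of_real s * Y z" "deriv Y z = - (of_real s * deriv Y z)"
    using p.plus_of_int[of "- z" n] p'.plus_of_int[of "- z" n] unfolding z'[symmetric] m m' by auto
  then show ?thesis using s by (auto simp: Y_def mathieu_base)
qed

text \<open>Dividing the Wronskian-like expression for the gradient of a product solution by
  \<open>sin (\<i> x - y)\<close>, which vanishes at the foci: its derivative along the direction that keeps
  \<open>\<i> x - y\<close> fixed carries the factor \<open>sin (\<i> x - y)\<close>, and the initial value is divisible by the sine.\<close>

lemma mathieu_Wronskian_quotient:
  assumes i: "(s, a) \<in> eig_index q"
  defines "Y \<equiv> mathieu_base s a q"
  shows "\<exists>g gx gy :: real \<Rightarrow> real \<Rightarrow> complex.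
    (\<forall>x y. ((\<lambda>x. g x y) has_vector_derivative gx x y) (at x)) \<and> (\<forall>x y. (g x has_vector_derivative gy x y) (at y)) \<and>
    continuous_on UNIV (\<lambda>(x, y). g x y) \<and> continuous_on UNIV (\<lambda>(x, y). gx x y) \<and> continuous_on UNIV (\<lambda>(x, y). gy x y) \<and>
    (\<forall>x y. deriv Y (\<i> * of_real x) * Y (of_real y) - Y (\<i> * of_real x) * deriv Y (of_real y)
      = sin (\<i> * of_real x - of_real y) * g x y)"
proof -
  have Y: "mathieu_eq a q Y" by (simp add: Y_def mathieu_base)
  note dY = mathieu_eq_deriv[OF Y]
  have cY: "continuous_on S (\<lambda>p. Y (h p))" "continuous_on S (\<lambda>p. deriv Y (h p))"
    if "continuous_on S h" for S :: "'b::t2_space set" and h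
    using that continuous_on_compose2[of UNIV Y S h] continuous_on_compose2[of UNIV "deriv Y" S h]
      DERIV_continuous_on[of UNIV Y, OF dY(1)] DERIV_continuous_on[of UNIV "deriv Y", OF dY(2)] by auto
  define N where "N z = deriv Y z * Y 0 - Y z * deriv Y 0" for z
  have hol: "Y holomorphic_on UNIV" using Y by (simp add: mathieu_eq_def)
  have "N holomorphic_on UNIV" unfolding N_def[abs_def]
    by (intro holomorphic_intros holomorphic_deriv hol) auto
  from entire_quotient_sin[OF this] obtain K where K: "K holomorphic_on UNIV" "\<And>z. N z = K z * sin z"
    using mathieu_base_Wronskian_zero[OF i] unfolding N_def Y_def by auto
  have dK: "(K has_field_derivative deriv K z) (at z)" for z
    using K(1) by (intro holomorphic_derivI[of _ UNIV]) auto
  have cK: "continuous_on S (\<lambda>p. K (h p))" "continuous_on S (\<lambda>p. deriv K (h p))"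
    if "continuous_on S h" for S :: "'b::t2_space set" and h
    using that continuous_on_compose2[of UNIV K S h] continuous_on_compose2[of UNIV "deriv K" S h]
      holomorphic_on_imp_continuous_on[OF K(1)]
      holomorphic_on_imp_continuous_on[OF holomorphic_deriv[OF K(1) open_UNIV]] by auto
  \<comment> \<open>A straight path of arguments: (\<open>s1\<close>, \<open>s2\<close>) runs from
    (i x - y, 0) at r = 0 to (i x, y) at r = 1. The difference stays equal to i x - y, and
    \<open>s0\<close> is the sum of the two arguments.\<close>
  define s0 where "s0 x y r = \<i> * of_real x + of_real (y * (2 * r - 1))" for x y r
  define s1 where "s1 x y r = \<i> * of_real x + of_real (y * (r - 1))" for x y r
  define s2 where "s2 y r = complex_of_real (y * r)" for y r
  have ds: "((\<lambda>x. s0 x y r) has_vector_derivative \<i>) (at x)" "((\<lambda>x. s1 x y r) has_vector_derivative \<i>) (at x)"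
    "((\<lambda>y. s0 x y r) has_vector_derivative of_real (2 * r - 1)) (at y)"
    "((\<lambda>y. s1 x y r) has_vector_derivative of_real (r - 1)) (at y)"
    "((\<lambda>y. s2 y r) has_vector_derivative of_real r) (at y)" 
    "((\<lambda>r. s1 x y r) has_vector_derivative of_real y) (at r within T)"
    "((\<lambda>r. s2 y r) has_vector_derivative of_real y) (at r within T)" for x y r T
    unfolding s0_def s1_def s2_def by (auto intro!: derivative_eq_intros simp: scaleR_conv_of_real)
  have cs: "continuous_on S (\<lambda>p. s0 (a p) (b p) (c p))" "continuous_on S (\<lambda>p. s1 (a p) (b p) (c p))"
    "continuous_on S (\<lambda>p. s2 (b p) (c p))"
    if "continuous_on S a" "continuous_on S b" "continuous_on S c" for S :: "'b::t2_space set" and a b c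
    unfolding s0_def s1_def s2_def using that by (auto intro!: continuous_intros)
  have chain: "((\<lambda>x. F (h x)) has_vector_derivative d * F') (at x within T)"
    if "(F has_field_derivative F') (at (h x))" "(h has_vector_derivative d) (at x within T)"
    for F :: "complex \<Rightarrow> complex" and F' h d x T
    using field_vector_diff_chain_within[OF that(2) DERIV_subset[OF that(1) subset_UNIV]] by (simp add: o_def)
  define f where "f x y r = sin (s0 x y r) * Y (s1 x y r) * Y (s2 y r)" for x y r
  define fx where "fx x y r = (\<i> * cos (s0 x y r) * Y (s1 x y r) + sin (s0 x y r) * (\<i> * deriv Y (s1 x y r))) * Y (s2 y r)"
    for x y r
  define fy where "fy x y r = (of_real (2 * r - 1) * cos (s0 x y r) * Y (s1 x y r)
        + sin (s0 x y r) * (of_real (r - 1) * deriv Y (s1 x y r))) * Y (s2 y r)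
      + sin (s0 x y r) * Y (s1 x y r) * (of_real r * deriv Y (s2 y r))" for x y r
  have df1: "((\<lambda>x. f x y r) has_vector_derivative fx x y r) (at x)" for x y r
    unfolding f_def fx_def
    by (rule derivative_eq_intros chain[OF DERIV_sin] chain[OF dY(1)] ds refl)+ (simp add: algebra_simps)
  have df2: "((\<lambda>y. f x y r) has_vector_derivative fy x y r) (at y)" for x y r
    unfolding f_def fy_def
    by (rule derivative_eq_intros chain[OF DERIV_sin] chain[OF dY(1)] ds refl)+ (simp add: algebra_simps)
  note df = df1 df2
  have cf: "continuous_on S (\<lambda>p. f (a p) (b p) (c p))" "continuous_on S (\<lambda>p. fx (a p) (b p) (c p))"
    "continuous_on S (\<lambda>p. fy (a p) (b p) (c p))"
    if "continuous_on S a" "continuous_on S b" "continuous_on S c" for S :: "'b::t2_space set" and a b c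
    unfolding f_def fx_def fy_def using that by - (intro continuous_intros cY cs, assumption+)+
  define H where "H x y = integral (cbox 0 1) (f x y)" for x y
  define Hx where "Hx x y = integral (cbox 0 1) (fx x y)" for x y
  define Hy where "Hy x y = integral (cbox 0 1) (fy x y)" for x y
  have int: "f x y integrable_on cbox 0 1" for x y
    by (rule integrable_continuous) (intro cf(1)[of _ "\<lambda>r. x" "\<lambda>r. y" "\<lambda>r. r"] continuous_intros)
  have dHx: "((\<lambda>x. H x y) has_vector_derivative Hx x y) (at x)" for x y
    unfolding H_def Hx_def
  proof (rule leibniz_rule_vector_derivative[where U = UNIV])
    show "continuous_on (UNIV \<times> cbox 0 1) (\<lambda>(x, t). fx x y t)"
      unfolding case_prod_beta' by (intro cf continuous_intros)
  qed (use df int in auto)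
  have dHy: "(H x has_vector_derivative Hy x y) (at y)" for x y
    unfolding H_def[abs_def] Hy_def
  proof (rule leibniz_rule_vector_derivative[where U = UNIV])
    show "continuous_on (UNIV \<times> cbox 0 1) (\<lambda>(y, t). fy x y t)"
      unfolding case_prod_beta' by (intro cf continuous_intros)
  qed (use df int in auto)
  have cH: "continuous_on UNIV (\<lambda>p. H (fst p) (snd p))" "continuous_on UNIV (\<lambda>p. Hx (fst p) (snd p))"
    "continuous_on UNIV (\<lambda>p. Hy (fst p) (snd p))"
    unfolding H_def Hx_def Hy_def
    by (rule integral_continuous_on_param, unfold case_prod_beta', intro cf continuous_intros)+
  define d where "d x y = \<i> * of_real x - complex_of_real y" for x y
  have dd: "((\<lambda>x. d x y) has_vector_derivative \<i>) (at x)" "((\<lambda>y. d x y) has_vector_derivative - 1) (at y)" for x y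
    unfolding d_def by (auto intro!: derivative_eq_intros simp: scaleR_conv_of_real)
  have cd: "continuous_on S (\<lambda>p. d (a p) (b p))" if "continuous_on S a" "continuous_on S b"
    for S :: "'b::t2_space set" and a b
    unfolding d_def using that by (auto intro!: continuous_intros)
  \<comment> \<open>The value at the start of the path is K(d) sin d; the integral of the derivative
    along the path contributes -4 q y sin d times \<open>H\<close>. Both contain the factor sin d,
    and \<open>g\<close> is what remains.\<close>
  define g where "g x y = K (d x y) - of_real (4 * q) * (of_real y * H x y)" for x y
  define gx where "gx x y = \<i> * deriv K (d x y) - of_real (4 * q) * (of_real y * Hx x y)" for x y
  define gy where "gy x y = - 1 * deriv K (d x y) - of_real (4 * q) * (of_real y * Hy x y + H x y)" for x y
  have "((\<lambda>x. g x y) has_vector_derivative gx x y) (at x)" for x y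
    unfolding g_def gx_def
    by (rule derivative_eq_intros chain[OF dK] dd dHx refl)+ simp
  moreover have "(g x has_vector_derivative gy x y) (at y)" for x y
    unfolding g_def[abs_def] gy_def
    by (rule derivative_eq_intros chain[OF dK] dd dHy refl)+ (simp add: algebra_simps scaleR_conv_of_real)
  moreover have "continuous_on UNIV (\<lambda>p. g (fst p) (snd p))" "continuous_on UNIV (\<lambda>p. gx (fst p) (snd p))"
    "continuous_on UNIV (\<lambda>p. gy (fst p) (snd p))"
    unfolding g_def gx_def gy_def by (intro continuous_intros cK cd cH)+
  moreover have "deriv Y (\<i> * of_real x) * Y (of_real y) - Y (\<i> * of_real x) * deriv Y (of_real y)
      = sin (\<i> * of_real x - of_real y) * g x y" for x y
  proof -
    define W where "W r = deriv Y (s1 x y r) * Y (s2 y r) - Y (s1 x y r) * deriv Y (s2 y r)" for r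
    define c where "c = - (of_real (4 * q) * of_real y * sin (d x y))"
    have "(W has_vector_derivative c * f x y r) (at r within {0..1})" for r
    proof -
      \<comment> \<open>The two potentials differ by a product of sines of half sum and half
        difference; this is where the factor sin (i x - y) comes from.\<close>
      have e: "cos (2 * s1 x y r) - cos (2 * s2 y r) = - (2 * sin (s0 x y r) * sin (d x y))"
      proof -
        have "2 * s1 x y r = s0 x y r + d x y" "2 * s2 y r = s0 x y r - d x y"
          by (simp_all add: s0_def s1_def s2_def d_def algebra_simps)
        then show ?thesis by (simp add: cos_add cos_diff)
      qed
      have "(W has_vector_derivative
          of_real y * ((2 * of_real q * (cos (2 * s1 x y r) - cos (2 * s2 y r))) * Y (s1 x y r) * Y (s2 y r))) (at r within {0..1})"
        unfolding W_def[abs_def]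
        by (rule derivative_eq_intros chain[OF dY(1)] chain[OF dY(2)] ds refl)+ (simp add: algebra_simps)
      then show ?thesis unfolding e c_def f_def by (simp add: algebra_simps)
    qed
    then have "((\<lambda>r. c * f x y r) has_integral W 1 - W 0) {0..1}"
      by (intro fundamental_theorem_of_calculus) auto
    moreover have "((\<lambda>r. c * f x y r) has_integral c * H x y) {0..1}"
      unfolding H_def using int[of x y] by (intro has_integral_mult_right) (simp add: integrable_integral flip: box_real)
    ultimately have "W 1 - W 0 = c * H x y" by (rule has_integral_unique)
    moreover have "W 0 = K (d x y) * sin (d x y)"
      using K(2)[of "d x y"] by (simp add: W_def N_def s1_def s2_def d_def)
    moreover have "W 1 = deriv Y (\<i> * of_real x) * Y (of_real y) - Y (\<i> * of_real x) * deriv Y (of_real y)"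
      by (simp add: W_def s1_def s2_def)
    ultimately show ?thesis by (simp add: g_def c_def d_def algebra_simps)
  qed
  ultimately show ?thesis unfolding case_prod_beta' by blast
qed

section \<open>Lifting product solutions to the first-order system\<close>

lemma C1_on_partials:
  fixes f :: "real \<times> real \<Rightarrow> 'b::real_normed_vector"
  assumes fx: "\<And>x y. ((\<lambda>s. f (s, y)) has_vector_derivative fx (x, y)) (at x)"
    and fy: "\<And>x y. ((\<lambda>t. f (x, t)) has_vector_derivative fy (x, y)) (at y)"
    and c: "continuous_on UNIV fx" "continuous_on UNIV fy"
  shows "C1_on S f"
proof -
  define D where "D p = (blinfun_scaleR_left (fx p) o\<^sub>L fst_blinfun) + (blinfun_scaleR_left (fy p) o\<^sub>L snd_blinfun)" for p
  have Dv: "blinfun_apply (D p) (h, k) = h *\<^sub>R fx p + k *\<^sub>R fy p" for p h k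
    by (simp add: D_def blinfun.add_left)
  have cl: "continuous_on UNIV (\<lambda>p. blinfun_scaleR_left (g p))" if "continuous_on UNIV g" for g :: "real \<times> real \<Rightarrow> 'b"
    using bounded_linear.continuous_on[OF bounded_linear_blinfun_scaleR_left that] .
  have "continuous_on UNIV D" unfolding D_def by (intro continuous_intros cl c)
  moreover have "(f has_derivative blinfun_apply (D p)) (at p)" for p
  proof -
    obtain x y where p: "p = (x, y)" by (cases p)
    have "((\<lambda>(x, y). f (x, y)) has_derivative (\<lambda>(tx, ty). tx *\<^sub>R fx (x, y) + blinfun_apply (blinfun_scaleR_left (fy (x, y))) ty))
        (at (x, y) within UNIV \<times> UNIV)"
    proof (rule has_derivative_partialsI[where fy = "\<lambda>x y. blinfun_scaleR_left (fy (x, y))"])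
      show "continuous (at (x, y) within UNIV \<times> UNIV) (\<lambda>(x, y). blinfun_scaleR_left (fy (x, y)))"
        using cl[OF c(2)] by (simp add: continuous_on_eq_continuous_at case_prod_beta')
    qed (use fx fy in \<open>auto simp: has_vector_derivative_def\<close>)
    moreover have "(\<lambda>(tx, ty). tx *\<^sub>R fx (x, y) + blinfun_apply (blinfun_scaleR_left (fy (x, y))) ty) = blinfun_apply (D p)"
      by (auto simp: Dv p)
    ultimately show ?thesis by (simp add: p)
  qed
  ultimately show ?thesis
    unfolding C1_on_def by (meson continuous_on_subset has_derivative_at_withinI subset_UNIV)
qed

text \<open>\<open>G1\<close> and \<open>G2\<close> are the i and j components which the equation
  attaches to the scalar part rad * ang. The gradient relations are stated without dividing by the
  weight, so they are meaningful at the foci, and the lift is required to be C1 there as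
  well.\<close>

definition is_lift where
  "is_lift lam i G1 G2 G1x G1y G2x G2y \<longleftrightarrow>
    (\<forall>x y :: real. ((\<lambda>x. G1 x y) has_real_derivative G1x x y) (at x) \<and> (G1 x has_real_derivative G1y x y) (at y)
      \<and> ((\<lambda>x. G2 x y) has_real_derivative G2x x y) (at x) \<and> (G2 x has_real_derivative G2y x y) (at y)
      \<and> rad' (fst i) (snd i) (mq lam) x * ang (fst i) (snd i) (mq lam) y = - lam * (eA x y * G1 x y + eB x y * G2 x y)
      \<and> rad (fst i) (snd i) (mq lam) x * ang' (fst i) (snd i) (mq lam) y = lam * (eB x y * G1 x y - eA x y * G2 x y))
    \<and> continuous_on UNIV (\<lambda>(x, y). G1 x y) \<and> continuous_on UNIV (\<lambda>(x, y). G1x x y) \<and> continuous_on UNIV (\<lambda>(x, y). G1y x y)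
    \<and> continuous_on UNIV (\<lambda>(x, y). G2 x y) \<and> continuous_on UNIV (\<lambda>(x, y). G2x x y) \<and> continuous_on UNIV (\<lambda>(x, y). G2y x y)"

text \<open>In complex form the gradient relations read u_x - i u_y = -lam (eA + i eB)(G1 - i G2),
  and sin (i x - y) = i (eA + i eB). So the quotient of the Wronskian expression by this sine is G1
  - i G2 up to a constant. The factor \<open>\<kappa>\<close> is 1 or i, whichever makes the base
  solution real on the imaginary axis.\<close>

lemma is_lift_exists:
  assumes lam: "lam \<noteq> 0" and i: "i \<in> eig_index (mq lam)"
  shows "\<exists>G1 G2 G1x G1y G2x G2y. is_lift lam i G1 G2 G1x G1y G2x G2y"
proof -
  obtain s a where sa: "i = (s, a)" by (cases i)
  have s: "s = 1 \<or> s = -1" using i sa by auto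
  define Y where "Y = mathieu_base s a (mq lam)"
  define \<kappa> where "\<kappa> = (if s = 1 then 1 else \<i>)"
  have \<kappa>: "\<kappa> \<noteq> 0" by (simp add: \<kappa>_def)
  obtain g gx gy where g: "\<And>x y. ((\<lambda>x. g x y) has_vector_derivative gx x y) (at x)"
      "\<And>x y. (g x has_vector_derivative gy x y) (at y)"
      "continuous_on UNIV (\<lambda>(x, y). g x y)" "continuous_on UNIV (\<lambda>(x, y). gx x y)" "continuous_on UNIV (\<lambda>(x, y). gy x y)"
      "\<And>x y. deriv Y (\<i> * of_real x) * Y (of_real y) - Y (\<i> * of_real x) * deriv Y (of_real y)
      = sin (\<i> * of_real x - of_real y) * g x y"
    using mathieu_Wronskian_quotient[OF i[unfolded sa]] unfolding Y_def by blast
  define m where "m = 1 / (\<kappa> * of_real lam)"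
  define G where "G x y = g x y * m" for x y
  have dG: "((\<lambda>x. G x y) has_vector_derivative gx x y * m) (at x)"
      "(G x has_vector_derivative gy x y * m) (at y)" for x y
    unfolding G_def[abs_def] using g(1,2) by (auto intro!: has_vector_derivative_mult_left)
  have id: "of_real (rad' s a (mq lam) x * ang s a (mq lam) y) - \<i> * of_real (rad s a (mq lam) x * ang' s a (mq lam) y)
      = - of_real lam * (of_real (eA x y) + \<i> * of_real (eB x y)) * G x y" for x y
  proof -
    have Yx: "Y (\<i> * of_real x) = \<kappa> * of_real (rad s a (mq lam) x)"
      using of_real_rad[OF s] unfolding Y_def \<kappa>_def .
    have "((\<lambda>x. Y (\<i> * of_real x)) has_vector_derivative \<i> * deriv Y (\<i> * of_real x)) (at x)"
    proof -
      have "((\<lambda>x. \<i> * complex_of_real x) has_vector_derivative \<i>) (at x)"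
        by (rule derivative_eq_intros refl | simp)+
      from field_vector_diff_chain_at[OF this mathieu_eq_deriv(1)[OF mathieu_base(1)[of a "mq lam" s]]]
      show ?thesis by (simp add: o_def Y_def)
    qed
    moreover have "((\<lambda>x. Y (\<i> * of_real x)) has_vector_derivative \<kappa> * of_real (rad' s a (mq lam) x)) (at x)"
    proof -
      have Yx': "(\<lambda>x. Y (\<i> * of_real x)) = (\<lambda>x. \<kappa> * of_real (rad s a (mq lam) x))"
        using of_real_rad[OF s] unfolding Y_def \<kappa>_def by auto
      show ?thesis unfolding Yx'
        by (intro has_vector_derivative_mult_right has_vector_derivative_of_real)
           (auto intro!: rad_has_deriv simp flip: has_real_derivative_iff_has_vector_derivative)
    qed
    ultimately have "\<i> * deriv Y (\<i> * of_real x) = \<kappa> * of_real (rad' s a (mq lam) x)"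
      by (rule vector_derivative_unique_at)
    then have Yx': "deriv Y (\<i> * of_real x) = - \<i> * (\<kappa> * of_real (rad' s a (mq lam) x))"
      by (metis (no_types, opaque_lifting) complex_i_mult_minus mult_minus_left mult_minus_right minus_minus)
    have Yy: "Y (of_real y) = of_real (ang s a (mq lam) y)" "deriv Y (of_real y) = of_real (ang' s a (mq lam) y)"
      using of_real_ang[OF s] of_real_ang'[OF s] unfolding Y_def by auto
    have "sin (\<i> * of_real x - of_real y) = sin (\<i> * of_real x) * cos (of_real y) - cos (\<i> * of_real x) * sin (of_real y)"
      by (rule sin_diff)
    also have "sin (\<i> * of_real x) = \<i> * of_real (sinh x)"
    proof -
      have "sinh (of_real x) = complex_of_real (sinh x)"
        unfolding sinh_def of_real_minus[symmetric] exp_of_real by (simp add: scaleR_conv_of_real)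
      then show ?thesis using sinh_conv_sin[of "of_real x"] by (simp add: complex_eq_iff)
    qed
    also have "cos (\<i> * of_real x) = of_real (cosh x)"
    proof -
      have "cosh (of_real x) = complex_of_real (cosh x)"
        unfolding cosh_def of_real_minus[symmetric] exp_of_real by (simp add: scaleR_conv_of_real)
      then show ?thesis using cosh_conv_cos[of "of_real x"] by simp
    qed
    finally have sn: "sin (\<i> * of_real x - of_real y) = \<i> * (of_real (eA x y) + \<i> * of_real (eB x y))"
      by (simp add: eA_def eB_def cos_of_real sin_of_real algebra_simps)
    have "- \<i> * \<kappa> * (of_real (rad' s a (mq lam) x * ang s a (mq lam) y) - \<i> * of_real (rad s a (mq lam) x * ang' s a (mq lam) y))
        = \<i> * (of_real (eA x y) + \<i> * of_real (eB x y)) * g x y"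
      using g(6)[of x y] unfolding sn Yx Yx' Yy by (simp add: algebra_simps)
    also have "g x y = \<kappa> * of_real lam * G x y" using \<kappa> lam by (simp add: G_def m_def)
    finally have "(- \<i> * \<kappa>) * (of_real (rad' s a (mq lam) x * ang s a (mq lam) y) - \<i> * of_real (rad s a (mq lam) x * ang' s a (mq lam) y))
        = (- \<i> * \<kappa>) * (- of_real lam * (of_real (eA x y) + \<i> * of_real (eB x y)) * G x y)"
      by (simp add: mult_ac)
    then show ?thesis using \<kappa> unfolding mult_cancel_left by simp
  qed
  have "is_lift lam i (\<lambda>x y. Re (G x y)) (\<lambda>x y. - Im (G x y)) (\<lambda>x y. Re (gx x y * m)) (\<lambda>x y. Re (gy x y * m))
     (\<lambda>x y. - Im (gx x y * m)) (\<lambda>x y. - Im (gy x y * m))"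
    unfolding is_lift_def
  proof (intro conjI allI)
    fix x y
    show "rad' (fst i) (snd i) (mq lam) x * ang (fst i) (snd i) (mq lam) y
        = - lam * (eA x y * Re (G x y) + eB x y * - Im (G x y))"
      using arg_cong[OF id[of x y], of Re] by (simp add: sa algebra_simps)
    show "rad (fst i) (snd i) (mq lam) x * ang' (fst i) (snd i) (mq lam) y
        = lam * (eB x y * Re (G x y) - eA x y * - Im (G x y))"
      using arg_cong[OF id[of x y], of Im] by (simp add: sa algebra_simps)
    show "((\<lambda>x. Re (G x y)) has_real_derivative Re (gx x y * m)) (at x)"
      "((\<lambda>y. Re (G x y)) has_real_derivative Re (gy x y * m)) (at y)"
      by (rule has_field_derivative_Re[OF dG(1)], rule has_field_derivative_Re[OF dG(2)])
    show "((\<lambda>x. - Im (G x y)) has_real_derivative - Im (gx x y * m)) (at x)"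
      "((\<lambda>y. - Im (G x y)) has_real_derivative - Im (gy x y * m)) (at y)"
      by (rule DERIV_minus[OF has_field_derivative_Im[OF dG(1)]], rule DERIV_minus[OF has_field_derivative_Im[OF dG(2)]])
  qed (use g(3-5) in \<open>auto simp: case_prod_beta' G_def intro!: continuous_intros\<close>)
  then show ?thesis by blast
qed

definition lift1 where
  "lift1 lam i = (SOME G1. \<exists>G2 G1x G1y G2x G2y. is_lift lam i G1 G2 G1x G1y G2x G2y)"
definition lift2 where
  "lift2 lam i = (SOME G2. \<exists>G1x G1y G2x G2y. is_lift lam i (lift1 lam i) G2 G1x G1y G2x G2y)"

lemma is_lift:
  assumes "lam \<noteq> 0" "i \<in> eig_index (mq lam)"
  shows "\<exists>G1x G1y G2x G2y. is_lift lam i (lift1 lam i) (lift2 lam i) G1x G1y G2x G2y"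
proof -
  have "\<exists>G2 G1x G1y G2x G2y. is_lift lam i (lift1 lam i) G2 G1x G1y G2x G2y"
    unfolding lift1_def by (rule someI_ex[OF is_lift_exists[OF assms]])
  then show ?thesis unfolding lift2_def by (rule someI_ex)
qed

definition qvec :: "real \<Rightarrow> real \<Rightarrow> real \<Rightarrow> quat" where
  "qvec a b c = a *\<^sub>R (1, 0) + b *\<^sub>R qi + c *\<^sub>R qj"

lemma qvec_components [simp]:
  "fst (qvec a b c) = a" "snd (qvec a b c) $ 1 = b" "snd (qvec a b c) $ 2 = c" "snd (qvec a b c) $ 3 = 0"
  by (auto simp: qvec_def qi_def qj_def axis_def)

lemma qvec_eqI:
  "fst x = a \<Longrightarrow> snd x $ 1 = b \<Longrightarrow> snd x $ 2 = c \<Longrightarrow> snd x $ 3 = 0 \<Longrightarrow> x = qvec a b c"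
  by (simp add: quat_eq_iff)

lemma scaleR_qvec: "r *\<^sub>R qvec a b c = qvec (r * a) (r * b) (r * c)"
  by (rule qvec_eqI) auto

lemma qvec_has_vector_derivative:
  assumes "(a has_real_derivative a') (at x within S)" "(b has_real_derivative b') (at x within S)"
    "(c has_real_derivative c') (at x within S)"
  shows "((\<lambda>x. qvec (a x) (b x) (c x)) has_vector_derivative qvec a' b' c') (at x within S)"
  unfolding qvec_def using assms assms[unfolded has_real_derivative_iff_has_vector_derivative]
  by (auto intro!: derivative_eq_intros)

lemma continuous_on_qvec [continuous_intros]:
  "continuous_on S a \<Longrightarrow> continuous_on S b \<Longrightarrow> continuous_on S c \<Longrightarrow> continuous_on S (\<lambda>p. qvec (a p) (b p) (c p))"
  unfolding qvec_def by (intro continuous_intros)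

definition zfun where "zfun lam i x y = rad (fst i) (snd i) (mq lam) x * ang (fst i) (snd i) (mq lam) y"

text \<open>Up to a nonzero real factor these turn out to be the functions of the system, with the
  values at the foci already filled in.\<close>

definition mlift :: "real \<Rightarrow> real \<times> real \<Rightarrow> real \<times> real \<Rightarrow> quat" where
  "mlift lam i = (\<lambda>(x, y). qvec (zfun lam i x y) (lift1 lam i x y) (lift2 lam i x y))"

text \<open>Transfers to the foci an identity between continuous functions whose proof divides by
  the weight, which is nonzero for x different from 0.\<close>

lemma continuous_zero_off_axis:
  fixes h :: "real \<times> real \<Rightarrow> real"
  assumes "continuous_on UNIV h" "\<And>x y. x \<noteq> 0 \<Longrightarrow> h (x, y) = 0"
  shows "h p = 0"
proof -
  obtain x y where p: "p = (x, y)" by (cases p)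
  have "isCont (\<lambda>x. h (x, y)) 0"
    using continuous_on_compose2[OF assms(1), of UNIV "\<lambda>x. (x, y)"]
    by (auto intro!: continuous_intros simp: continuous_on_eq_continuous_at)
  then have "((\<lambda>x. h (x, y)) \<longlongrightarrow> h (0, y)) (at 0)" by (simp add: isCont_def)
  moreover have "((\<lambda>x. h (x, y)) \<longlongrightarrow> 0) (at 0)"
    by (rule tendsto_eventually) (use assms(2) in \<open>auto simp: eventually_at_filter\<close>)
  ultimately have "h (0, y) = 0" by (rule tendsto_unique[rotated]) auto
  then show ?thesis using assms(2) p by (cases "x = 0") auto
qed

context
  fixes lam :: real and i :: "real \<times> real"
  assumes lam: "lam \<noteq> 0" and i: "i \<in> eig_index (mq lam)"
begin

abbreviation "rdl x \<equiv> rad (fst i) (snd i) (mq lam) x"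
abbreviation "rdl' x \<equiv> rad' (fst i) (snd i) (mq lam) x"
abbreviation "agl x \<equiv> ang (fst i) (snd i) (mq lam) x"
abbreviation "agl' x \<equiv> ang' (fst i) (snd i) (mq lam) x"

lemma lift_eqs:
  "ew x y * lift1 lam i x y = - (1 / lam) * (eA x y * (rdl' x * agl y) - eB x y * (rdl x * agl' y))"
  "ew x y * lift2 lam i x y = - (1 / lam) * (eB x y * (rdl' x * agl y) + eA x y * (rdl x * agl' y))"
proof -
  obtain G1x G1y G2x G2y where "is_lift lam i (lift1 lam i) (lift2 lam i) G1x G1y G2x G2y"
    using is_lift[OF lam i] by blast
  then have e: "rdl' x * agl y = - lam * (eA x y * lift1 lam i x y + eB x y * lift2 lam i x y)"
    "rdl x * agl' y = lam * (eB x y * lift1 lam i x y - eA x y * lift2 lam i x y)"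
    unfolding is_lift_def by blast+
  show "ew x y * lift1 lam i x y = - (1 / lam) * (eA x y * (rdl' x * agl y) - eB x y * (rdl x * agl' y))"
    "ew x y * lift2 lam i x y = - (1 / lam) * (eB x y * (rdl' x * agl y) + eA x y * (rdl x * agl' y))"
    unfolding e ew_eq(2) using lam by (auto simp: power2_eq_square field_simps)
qed

lemma base_symmetries:
  "rdl (- x) * agl (- y) = rdl x * agl y" "rdl' (- x) * agl (- y) = - (rdl' x * agl y)" "rdl (- x) * agl' (- y) = - (rdl x * agl' y)"
  "agl (y + 2 * pi) = agl y" "agl' (y + 2 * pi) = agl' y"
proof -
  define s where "s = fst i"
  have s: "s = 1 \<or> s = -1" using i by (auto simp: s_def)
  have m: "rdl (- x) = s * rdl x" "agl (- x) = s * agl x" for x using ang_rad_minus[OF s] by (auto simp: s_def)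
  have "(uminus has_real_derivative - 1) (at x)" for x :: real by (auto intro!: derivative_eq_intros)
  note c = DERIV_chain2[OF _ this]
  have m': "rdl' (- x) = - (s * rdl' x)" "agl' (- x) = - (s * agl' x)" for x
  proof -
    have "((\<lambda>x. s * rdl x) has_real_derivative - rdl' (- x)) (at x)"
      "((\<lambda>x. s * agl x) has_real_derivative - agl' (- x)) (at x)"
      using c[OF rad_has_deriv(1)[of "fst i" "snd i" "mq lam" "- x" UNIV]]
        c[OF ang_has_deriv(1)[of "fst i" "snd i" "mq lam" "- x" UNIV]] unfolding m by auto
    moreover have "((\<lambda>x. s * rdl x) has_real_derivative s * rdl' x) (at x)" "((\<lambda>x. s * agl x) has_real_derivative s * agl' x) (at x)"
      by (intro DERIV_cmult rad_has_deriv ang_has_deriv)+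
    ultimately have "- rdl' (- x) = s * rdl' x" "- agl' (- x) = s * agl' x" using DERIV_unique by blast+
    then show "rdl' (- x) = - (s * rdl' x)" "agl' (- x) = - (s * agl' x)" by auto
  qed
  show "rdl (- x) * agl (- y) = rdl x * agl y" "rdl' (- x) * agl (- y) = - (rdl' x * agl y)" "rdl (- x) * agl' (- y) = - (rdl x * agl' y)"
    unfolding m m' using s by auto
  show "agl (y + 2 * pi) = agl y" "agl' (y + 2 * pi) = agl' y" using ang_periodic[of "fst i" "snd i" "mq lam" y] i by auto
qed

lemma continuous_lift:
  "continuous_on UNIV (\<lambda>(x, y). lift1 lam i x y)" "continuous_on UNIV (\<lambda>(x, y). lift2 lam i x y)"
  using is_lift[OF lam i] unfolding is_lift_def by blast+

text \<open>The formulas for \<open>ew\<close> times the components have these symmetries, and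
  \<open>ew\<close> has them too; cancel off the axis and extend by continuity. They express that
  the lift is well defined on the elliptical domain, across the segment between the foci.\<close>

lemma lift_symmetries:
  "lift1 lam i (- x) (- y) = lift1 lam i x y" "lift2 lam i (- x) (- y) = lift2 lam i x y"
  "lift1 lam i x (y + 2 * pi) = lift1 lam i x y" "lift2 lam i x (y + 2 * pi) = lift2 lam i x y"
proof -
  have AB: "eA (- x) (- y) = - eA x y" "eB (- x) (- y) = - eB x y" "ew (- x) (- y) = ew x y"
    "eA x (y + 2 * pi) = eA x y" "eB x (y + 2 * pi) = eB x y" "ew x (y + 2 * pi) = ew x y" for x y
    by (auto simp: eA_def eB_def ew_eq(1))
  have w: "ew x y \<noteq> 0" if "x \<noteq> 0" for x y using that by (simp add: ew_eq_0_iff)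
  have c: "continuous_on UNIV (\<lambda>p. lift1 lam i (f p) (g p))" "continuous_on UNIV (\<lambda>p. lift2 lam i (f p) (g p))"
    if "continuous_on UNIV f" "continuous_on UNIV g" for f g :: "real \<times> real \<Rightarrow> real"
    using continuous_on_compose2[OF continuous_lift(1), of UNIV "\<lambda>p. (f p, g p)"]
      continuous_on_compose2[OF continuous_lift(2), of UNIV "\<lambda>p. (f p, g p)"] that
    by (auto intro!: continuous_intros)
  have "lift1 lam i (- x) (- y) - lift1 lam i x y = 0" "lift2 lam i (- x) (- y) - lift2 lam i x y = 0"
    "lift1 lam i x (y + 2 * pi) - lift1 lam i x y = 0" "lift2 lam i x (y + 2 * pi) - lift2 lam i x y = 0"
    if "x \<noteq> 0" for x y
  proof -
    have "ew x y * lift1 lam i (- x) (- y) = ew x y * lift1 lam i x y" "ew x y * lift2 lam i (- x) (- y) = ew x y * lift2 lam i x y"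
      "ew x y * lift1 lam i x (y + 2 * pi) = ew x y * lift1 lam i x y" "ew x y * lift2 lam i x (y + 2 * pi) = ew x y * lift2 lam i x y"
      using lift_eqs(1)[of "- x" "- y"] lift_eqs(1)[of x y] lift_eqs(2)[of "- x" "- y"] lift_eqs(2)[of x y]
        lift_eqs(1)[of x "y + 2 * pi"] lift_eqs(2)[of x "y + 2 * pi"]
      unfolding AB base_symmetries by simp_all
    then show "lift1 lam i (- x) (- y) - lift1 lam i x y = 0" "lift2 lam i (- x) (- y) - lift2 lam i x y = 0"
    "lift1 lam i x (y + 2 * pi) - lift1 lam i x y = 0" "lift2 lam i x (y + 2 * pi) - lift2 lam i x y = 0"
      using w[OF that, of y] by simp_all
  qed
  note z = this
  have "continuous_on UNIV (\<lambda>p. lift1 lam i (- fst p) (- snd p) - lift1 lam i (fst p) (snd p))"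
    by (intro continuous_on_diff c continuous_intros)
  from continuous_zero_off_axis[OF this, of "(x, y)"] show "lift1 lam i (- x) (- y) = lift1 lam i x y"
    using z(1) by simp
  have "continuous_on UNIV (\<lambda>p. lift2 lam i (- fst p) (- snd p) - lift2 lam i (fst p) (snd p))"
    by (intro continuous_on_diff c continuous_intros)
  from continuous_zero_off_axis[OF this, of "(x, y)"] show "lift2 lam i (- x) (- y) = lift2 lam i x y"
    using z(2) by simp
  have "continuous_on UNIV (\<lambda>p. lift1 lam i (fst p) (snd p + 2 * pi) - lift1 lam i (fst p) (snd p))"
    by (intro continuous_on_diff c continuous_intros)
  from continuous_zero_off_axis[OF this, of "(x, y)"] show "lift1 lam i x (y + 2 * pi) = lift1 lam i x y"
    using z(3) by simp
  have "continuous_on UNIV (\<lambda>p. lift2 lam i (fst p) (snd p + 2 * pi) - lift2 lam i (fst p) (snd p))"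
    by (intro continuous_on_diff c continuous_intros)
  from continuous_zero_off_axis[OF this, of "(x, y)"] show "lift2 lam i x (y + 2 * pi) = lift2 lam i x y"
    using z(4) by simp
qed

lemma mlift_symmetries:
  "mlift lam i (- x, - y) = mlift lam i (x, y)" "mlift lam i (x, y + 2 * pi) = mlift lam i (x, y)"
  unfolding mlift_def by (simp_all add: zfun_def base_symmetries lift_symmetries)

text \<open>The last two conclusions are the scalar and the k component of the first-order equation
  times the weight. The former is the Helmholtz equation for the product, the latter the equality of
  its mixed partial derivatives. Both come from differentiating the gradient relations once more and
  comparing with the derivatives computed from the product directly.\<close>

lemma mlift_derivs:
  obtains Mx My where
    "\<And>x y. ((\<lambda>s. mlift lam i (s, y)) has_vector_derivative Mx (x, y)) (at x)"
    "\<And>x y. ((\<lambda>t. mlift lam i (x, t)) has_vector_derivative My (x, y)) (at y)"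
    "continuous_on UNIV Mx" "continuous_on UNIV My"
    "\<And>x y. snd (Mx (x, y)) $ 3 = 0" "\<And>x y. snd (My (x, y)) $ 3 = 0"
    "\<And>x y. fst (Mx (x, y)) = rdl' x * agl y" "\<And>x y. fst (My (x, y)) = rdl x * agl' y"
    "\<And>x y. - (eA x y * snd (Mx (x, y)) $ 1 + eB x y * snd (Mx (x, y)) $ 2)
        + (eB x y * snd (My (x, y)) $ 1 - eA x y * snd (My (x, y)) $ 2) + lam * ew x y * zfun lam i x y = 0"
    "\<And>x y. eA x y * snd (Mx (x, y)) $ 2 - eB x y * snd (Mx (x, y)) $ 1
        - (eB x y * snd (My (x, y)) $ 2 + eA x y * snd (My (x, y)) $ 1) = 0"
proof -
  define G1 where "G1 = lift1 lam i"
  define G2 where "G2 = lift2 lam i"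
  obtain G1x G1y G2x G2y where "is_lift lam i G1 G2 G1x G1y G2x G2y"
    using is_lift[OF lam i] unfolding G1_def G2_def by blast
  then have d: "\<And>x y. ((\<lambda>x. G1 x y) has_real_derivative G1x x y) (at x)" "\<And>x y. (G1 x has_real_derivative G1y x y) (at y)"
      "\<And>x y. ((\<lambda>x. G2 x y) has_real_derivative G2x x y) (at x)" "\<And>x y. (G2 x has_real_derivative G2y x y) (at y)"
    and e: "\<And>x y. rdl' x * agl y = - lam * (eA x y * G1 x y + eB x y * G2 x y)"
      "\<And>x y. rdl x * agl' y = lam * (eB x y * G1 x y - eA x y * G2 x y)"
    and c: "continuous_on UNIV (\<lambda>(x, y). G1x x y)" "continuous_on UNIV (\<lambda>(x, y). G1y x y)"
      "continuous_on UNIV (\<lambda>(x, y). G2x x y)" "continuous_on UNIV (\<lambda>(x, y). G2y x y)"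
    unfolding is_lift_def by blast+
  have M: "mlift lam i (x, y) = qvec (rdl x * agl y) (G1 x y) (G2 x y)" for x y
    by (simp add: mlift_def zfun_def G1_def G2_def)
  have cR: "continuous_on S (rad s a q)" "continuous_on S (rad' s a q)" for S s a q
    by (rule DERIV_continuous_on[OF rad_has_deriv(1)], rule DERIV_continuous_on[OF rad_has_deriv(2)])
  have cb: "continuous_on UNIV (\<lambda>p :: real \<times> real. rdl (fst p))" "continuous_on UNIV (\<lambda>p :: real \<times> real. rdl' (fst p))"
    "continuous_on UNIV (\<lambda>p :: real \<times> real. agl (snd p))" "continuous_on UNIV (\<lambda>p :: real \<times> real. agl' (snd p))"
    by (auto intro!: continuous_on_compose2[OF cR(1)] continuous_on_compose2[OF cR(2)]
        continuous_on_compose2[OF ang_continuous(1)] continuous_on_compose2[OF ang_continuous(2)] continuous_intros)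
  note dd = eAB_has_deriv d rad_has_deriv ang_has_deriv
  have "((\<lambda>x. rdl' x * agl y) has_real_derivative - lam * (eA' x y * G1 x y + eA x y * G1x x y + eB' x y * G2 x y + eB x y * G2x x y)) (at x)" for x y
    unfolding e by (rule derivative_eq_intros dd refl)+ (simp add: algebra_simps)
  moreover have "((\<lambda>x. rdl' x * agl y) has_real_derivative (snd i - 2 * mq lam * cosh (2 * x)) * rdl x * agl y) (at x)" for x y
    by (rule derivative_eq_intros dd refl)+ simp
  ultimately have xx: "(snd i - 2 * mq lam * cosh (2 * x)) * rdl x * agl y
      = - lam * (eA' x y * G1 x y + eA x y * G1x x y + eB' x y * G2 x y + eB x y * G2x x y)" for x y
    using DERIV_unique by blast
  have "((\<lambda>y. rdl x * agl' y) has_real_derivative lam * (eA' x y * G1 x y + eB x y * G1y x y + eB' x y * G2 x y - eA x y * G2y x y)) (at y)" for x y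
    unfolding e by (rule derivative_eq_intros dd refl)+ (simp add: algebra_simps)
  moreover have "((\<lambda>y. rdl x * agl' y) has_real_derivative rdl x * ((2 * mq lam * cos (2 * y) - snd i) * agl y)) (at y)" for x y
    by (rule derivative_eq_intros dd refl)+ simp
  ultimately have yy: "rdl x * ((2 * mq lam * cos (2 * y) - snd i) * agl y)
      = lam * (eA' x y * G1 x y + eB x y * G1y x y + eB' x y * G2 x y - eA x y * G2y x y)" for x y
    using DERIV_unique by blast
  have "((\<lambda>y. rdl' x * agl y) has_real_derivative - lam * (- eB' x y * G1 x y + eA x y * G1y x y + eA' x y * G2 x y + eB x y * G2y x y)) (at y)" for x y
    unfolding e by (rule derivative_eq_intros dd refl)+ (simp add: algebra_simps)
  moreover have "((\<lambda>y. rdl' x * agl y) has_real_derivative rdl' x * agl' y) (at y)" for x y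
    by (rule derivative_eq_intros dd refl)+ simp
  ultimately have xy: "rdl' x * agl' y = - lam * (- eB' x y * G1 x y + eA x y * G1y x y + eA' x y * G2 x y + eB x y * G2y x y)" for x y
    using DERIV_unique by blast
  have "((\<lambda>x. rdl x * agl' y) has_real_derivative lam * (eB' x y * G1 x y + eB x y * G1x x y - eA' x y * G2 x y - eA x y * G2x x y)) (at x)" for x y
    unfolding e by (rule derivative_eq_intros dd refl)+ (simp add: algebra_simps)
  moreover have "((\<lambda>x. rdl x * agl' y) has_real_derivative rdl' x * agl' y) (at x)" for x y
    by (rule derivative_eq_intros dd refl)+ simp
  ultimately have yx: "rdl' x * agl' y = lam * (eB' x y * G1 x y + eB x y * G1x x y - eA' x y * G2 x y - eA x y * G2x x y)" for x y
    using DERIV_unique by blast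
  show thesis
  proof (rule that[of "\<lambda>(x, y). qvec (rdl' x * agl y) (G1x x y) (G2x x y)" "\<lambda>(x, y). qvec (rdl x * agl' y) (G1y x y) (G2y x y)"])
    fix x y
    show "((\<lambda>s. mlift lam i (s, y)) has_vector_derivative (case (x, y) of (x, y) \<Rightarrow> qvec (rdl' x * agl y) (G1x x y) (G2x x y))) (at x)"
      unfolding M prod.case by (intro qvec_has_vector_derivative d DERIV_cmult_right rad_has_deriv)
    show "((\<lambda>t. mlift lam i (x, t)) has_vector_derivative (case (x, y) of (x, y) \<Rightarrow> qvec (rdl x * agl' y) (G1y x y) (G2y x y))) (at y)"
      unfolding M prod.case by (intro qvec_has_vector_derivative d DERIV_cmult ang_has_deriv)
    have "lam * (- (eA x y * G1x x y + eB x y * G2x x y) + (eB x y * G1y x y - eA x y * G2y x y) + lam * ew x y * zfun lam i x y)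
        = (snd i - 2 * mq lam * cosh (2 * x)) * rdl x * agl y + rdl x * ((2 * mq lam * cos (2 * y) - snd i) * agl y)
          + lam\<^sup>2 * ew x y * (rdl x * agl y)"
      unfolding xx yy zfun_def by (simp add: power2_eq_square algebra_simps)
    also have "\<dots> = 0" by (simp add: ew_def field_simps)
    finally show "- (eA x y * snd (case (x, y) of (x, y) \<Rightarrow> qvec (rdl' x * agl y) (G1x x y) (G2x x y)) $ 1
        + eB x y * snd (case (x, y) of (x, y) \<Rightarrow> qvec (rdl' x * agl y) (G1x x y) (G2x x y)) $ 2)
      + (eB x y * snd (case (x, y) of (x, y) \<Rightarrow> qvec (rdl x * agl' y) (G1y x y) (G2y x y)) $ 1
        - eA x y * snd (case (x, y) of (x, y) \<Rightarrow> qvec (rdl x * agl' y) (G1y x y) (G2y x y)) $ 2) + lam * ew x y * zfun lam i x y = 0"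
      using lam by simp
    have "lam * (eA x y * G2x x y - eB x y * G1x x y - (eB x y * G2y x y + eA x y * G1y x y)) = (- lam * (- eB' x y * G1 x y + eA x y * G1y x y + eA' x y * G2 x y + eB x y * G2y x y))
        - lam * (eB' x y * G1 x y + eB x y * G1x x y - eA' x y * G2 x y - eA x y * G2x x y)"
      by (simp add: algebra_simps)
    also have "\<dots> = 0" unfolding xy[symmetric] yx[symmetric] by simp
    finally show "eA x y * snd (case (x, y) of (x, y) \<Rightarrow> qvec (rdl' x * agl y) (G1x x y) (G2x x y)) $ 2
        - eB x y * snd (case (x, y) of (x, y) \<Rightarrow> qvec (rdl' x * agl y) (G1x x y) (G2x x y)) $ 1
        - (eB x y * snd (case (x, y) of (x, y) \<Rightarrow> qvec (rdl x * agl' y) (G1y x y) (G2y x y)) $ 2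
        + eA x y * snd (case (x, y) of (x, y) \<Rightarrow> qvec (rdl x * agl' y) (G1y x y) (G2y x y)) $ 1) = 0"
      using lam by simp
  qed (use c cb in \<open>auto simp: case_prod_beta' intro!: continuous_intros\<close>)
qed

end

section \<open>Membership of the lifts in the weighted space\<close>

lemma qcnj_mult_self: "qcnj x \<odot> x = ((fst x)\<^sup>2 + snd x \<bullet> snd x) *\<^sub>R (1, 0)"
  by (simp add: qcnj_def qmult_def power2_eq_square cross_refl cross_minus_left)

lemma continuous_mlift:
  assumes "lam \<noteq> 0" "i \<in> eig_index (mq lam)"
  shows "continuous_on UNIV (mlift lam i)"
proof -
  have "continuous_on UNIV (rad (fst i) (snd i) (mq lam))"
    by (rule DERIV_continuous_on[OF rad_has_deriv(1)])
  then have "continuous_on UNIV (\<lambda>p :: real \<times> real. rad (fst i) (snd i) (mq lam) (fst p))"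
    by (rule continuous_on_compose2) (auto intro!: continuous_intros)
  moreover have "continuous_on UNIV (\<lambda>p :: real \<times> real. ang (fst i) (snd i) (mq lam) (snd p))"
    by (rule continuous_on_compose2[OF ang_continuous(1)[of UNIV]]) (auto intro!: continuous_intros)
  ultimately show ?thesis
    using continuous_lift[OF assms] unfolding mlift_def zfun_def case_prod_beta'
    by (intro continuous_intros)
qed

text \<open>Stated for any \<open>f\<close> that agrees with a multiple of a lift on the rectangle,
  since the functions of the system are known only on the half-strip x \<ge> 0, 0 \<le> y \<le> 2
  pi. Square integrability holds because the lift is continuous up to the closed rectangle.\<close>

lemma ell_M2I:
  assumes lam: "lam \<noteq> 0" and i: "i \<in> eig_index (mq lam)" and \<xi>0: "\<xi>0 > 0"
    and f: "\<And>p. p \<in> ell_rect \<xi>0 \<Longrightarrow> f p = c *\<^sub>R mlift lam i p"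
  shows "f \<in> ell_M2 \<xi>0 lam"
proof -
  obtain Mx My where d: "\<And>x y. ((\<lambda>s. mlift lam i (s, y)) has_vector_derivative Mx (x, y)) (at x)"
    "\<And>x y. ((\<lambda>t. mlift lam i (x, t)) has_vector_derivative My (x, y)) (at y)"
    and cM: "continuous_on UNIV Mx" "continuous_on UNIV My"
    and M3: "\<And>x y. snd (Mx (x, y)) $ 3 = 0" "\<And>x y. snd (My (x, y)) $ 3 = 0"
    and M0: "\<And>x y. fst (Mx (x, y)) = rad' (fst i) (snd i) (mq lam) x * ang (fst i) (snd i) (mq lam) y"
      "\<And>x y. fst (My (x, y)) = rad (fst i) (snd i) (mq lam) x * ang' (fst i) (snd i) (mq lam) y"
    and eq1: "\<And>x y. - (eA x y * snd (Mx (x, y)) $ 1 + eB x y * snd (Mx (x, y)) $ 2)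
        + (eB x y * snd (My (x, y)) $ 1 - eA x y * snd (My (x, y)) $ 2) + lam * ew x y * zfun lam i x y = 0"
    and eq2: "\<And>x y. eA x y * snd (Mx (x, y)) $ 2 - eB x y * snd (Mx (x, y)) $ 1
        - (eB x y * snd (My (x, y)) $ 2 + eA x y * snd (My (x, y)) $ 1) = 0"
    by (rule mlift_derivs[OF lam i]) blast
  have C1: "C1_on S (\<lambda>p. c *\<^sub>R mlift lam i p)" for S
  proof (rule C1_on_partials)
    show "((\<lambda>s. c *\<^sub>R mlift lam i (s, y)) has_vector_derivative c *\<^sub>R Mx (x, y)) (at x)"
      "((\<lambda>t. c *\<^sub>R mlift lam i (x, t)) has_vector_derivative c *\<^sub>R My (x, y)) (at y)" for x y
      by (intro bounded_linear.has_vector_derivative[OF bounded_linear_scaleR_right] d)+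
    show "continuous_on UNIV (\<lambda>p. c *\<^sub>R Mx p)" "continuous_on UNIV (\<lambda>p. c *\<^sub>R My p)"
      by (intro continuous_intros cM)+
  qed
  have Cf: "C1_on (ell_rect \<xi>0) f"
  proof -
    obtain D where D: "\<And>p. p \<in> ell_rect \<xi>0 \<Longrightarrow> ((\<lambda>p. c *\<^sub>R mlift lam i p) has_derivative blinfun_apply (D p)) (at p within ell_rect \<xi>0)"
      "continuous_on (ell_rect \<xi>0) D" using C1[of "ell_rect \<xi>0"] by (auto simp: C1_on_def)
    then show ?thesis
      unfolding C1_on_def by (intro exI[of _ D]) (auto intro!: has_derivative_transform[OF _ f])
  qed
  have dx: "((\<lambda>s. f (s, y)) has_vector_derivative c *\<^sub>R Mx (x, y)) (at x within {0..<\<xi>0})"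
    and dy: "((\<lambda>t. f (x, t)) has_vector_derivative c *\<^sub>R My (x, y)) (at y within circ)"
    if "x \<in> {0..<\<xi>0}" "y \<in> circ" for x y
  proof -
    show "((\<lambda>s. f (s, y)) has_vector_derivative c *\<^sub>R Mx (x, y)) (at x within {0..<\<xi>0})"
      by (rule has_vector_derivative_transform[OF that(1), of _ "\<lambda>s. c *\<^sub>R mlift lam i (s, y)"])
         (use that f in \<open>simp_all add: ell_rect_def has_vector_derivative_at_within[OF
            bounded_linear.has_vector_derivative[OF bounded_linear_scaleR_right d(1)]]\<close>)
    show "((\<lambda>t. f (x, t)) has_vector_derivative c *\<^sub>R My (x, y)) (at y within circ)"
      by (rule has_vector_derivative_transform[OF that(2), of _ "\<lambda>t. c *\<^sub>R mlift lam i (x, t)"])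
         (use that f in \<open>simp_all add: ell_rect_def has_vector_derivative_at_within[OF
            bounded_linear.has_vector_derivative[OF bounded_linear_scaleR_right d(2)]]\<close>)
  qed
  note sym = mlift_symmetries[OF lam i]
  have sym0: "mlift lam i (s, 2 * pi - y) = mlift lam i (- s, y)" for s y
    using sym(2)[of s "- y"] sym(1)[of "- s" y] by (simp add: add.commute)
  \<comment> \<open>At x = 0 the reflection in y equals the reflection in x, which reverses the sign
    of the x-derivative.\<close>
  have dodd: "Mx (0, 2 * pi - y) = - Mx (0, y)" for y
  proof -
    have "(uminus has_vector_derivative - 1) (at (0::real))" by (auto intro!: derivative_eq_intros)
    from vector_diff_chain_at[OF this, of "\<lambda>s. mlift lam i (s, y)" "Mx (0, y)"] d(1)[of y 0]
    have "((\<lambda>s. mlift lam i (- s, y)) has_vector_derivative - Mx (0, y)) (at 0)" by (simp add: o_def)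
    then show ?thesis using d(1)[of "2 * pi - y" 0] unfolding sym0 by (metis vector_derivative_unique_at)
  qed
  have "f \<in> ell_S \<xi>0"
    unfolding ell_S_def
  proof (intro CollectI conjI ballI Cf)
    fix x assume x: "x \<in> {0..<\<xi>0}"
    then show "f (x, 0) = f (x, 2 * pi)" using sym(2)[of x 0] by (simp add: f ell_rect_def)
  next
    fix y assume y: "y \<in> circ"
    have m: "0 \<in> {0..<\<xi>0}" "2 * pi - y \<in> circ" using y \<xi>0 by auto
    show "f (0, y) = f (0, 2 * pi - y)" using y m sym0[of 0 y] by (simp add: f ell_rect_def)
    show "d_xi f (0, y) = - d_xi f (0, 2 * pi - y)"
      unfolding d_xi_eq[OF dx[OF m(1) y] m(1)] d_xi_eq[OF dx[OF m] m(1)] dodd by simp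
  qed
  moreover have "f p \<in> reduced_quats" if "p \<in> ell_rect \<xi>0" for p
    using f[OF that] by (cases p) (simp add: reduced_quats_def mlift_def)
  moreover have "ell_D f p + lam *\<^sub>R f p = 0" if p: "p \<in> ell_rect \<xi>0 - foci" for p
  proof -
    obtain x y where xy: "p = (x, y)" by (cases p)
    have x: "x \<in> {0..<\<xi>0}" and y: "y \<in> circ" and w: "ew x y \<noteq> 0"
      using p unfolding xy by (auto simp: ell_rect_def foci_iff)
    have fp: "f p = c *\<^sub>R mlift lam i (x, y)" using f p xy by auto
    note comp = ell_D_components[of f x y, unfolded d_xi_eq[OF dx[OF x y] x] d_eta_eq[OF dy[OF x y] y]]
    note lift = lift_eqs[OF lam i, of x y]
    have "fst (ell_D f p) = (1 / ew x y) * (c * (- (eA x y * snd (Mx (x, y)) $ 1 + eB x y * snd (Mx (x, y)) $ 2)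
        + (eB x y * snd (My (x, y)) $ 1 - eA x y * snd (My (x, y)) $ 2)))"
      unfolding xy comp(1) by (simp add: algebra_simps)
    also have "- (eA x y * snd (Mx (x, y)) $ 1 + eB x y * snd (Mx (x, y)) $ 2)
        + (eB x y * snd (My (x, y)) $ 1 - eA x y * snd (My (x, y)) $ 2) = - (lam * ew x y * zfun lam i x y)"
      using eq1[of x y] by linarith
    finally have "fst (ell_D f p) = (1 / ew x y) * (c * (- (lam * ew x y * zfun lam i x y)))" .
    then have 1: "fst (ell_D f p + lam *\<^sub>R f p) = 0" using w fp by (simp add: mlift_def)
    have "snd (ell_D f p) $ 1 = (1 / ew x y) * (c * (- lam * (ew x y * lift1 lam i x y)))"
      unfolding xy comp(2) lift(1) using lam by (simp add: M0 M3 algebra_simps)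
    then have 2: "snd (ell_D f p + lam *\<^sub>R f p) $ 1 = 0" using w fp by (simp add: mlift_def)
    have "snd (ell_D f p) $ 2 = (1 / ew x y) * (c * (- lam * (ew x y * lift2 lam i x y)))"
      unfolding xy comp(3) lift(2) using lam by (simp add: M0 M3 algebra_simps)
    then have 3: "snd (ell_D f p + lam *\<^sub>R f p) $ 2 = 0" using w fp by (simp add: mlift_def)
    have "snd (ell_D f p) $ 3 = (1 / ew x y) * (c * (eA x y * snd (Mx (x, y)) $ 2 - eB x y * snd (Mx (x, y)) $ 1
        - (eB x y * snd (My (x, y)) $ 2 + eA x y * snd (My (x, y)) $ 1)))"
      unfolding xy comp(4) by (simp add: algebra_simps)
    then have 4: "snd (ell_D f p + lam *\<^sub>R f p) $ 3 = 0" using fp eq2[of x y] by (simp add: mlift_def)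
    show ?thesis using 1 2 3 4 unfolding quat_eq_iff by simp
  qed
  moreover have "set_integrable lborel (ell_rect \<xi>0) (\<lambda>p. ell_weight p *\<^sub>R (qcnj (f p) \<odot> f p))"
  proof -
    define h where "h p = ell_weight p *\<^sub>R (qcnj (c *\<^sub>R mlift lam i p) \<odot> (c *\<^sub>R mlift lam i p))" for p
    have "continuous_on UNIV (mlift lam i)" by (rule continuous_mlift[OF lam i])
    then have m: "continuous_on UNIV (\<lambda>p. c *\<^sub>R mlift lam i p)" by (intro continuous_intros)
    have "h = (\<lambda>p. ell_weight p *\<^sub>R (((fst (c *\<^sub>R mlift lam i p))\<^sup>2
        + snd (c *\<^sub>R mlift lam i p) \<bullet> snd (c *\<^sub>R mlift lam i p)) *\<^sub>R (1, 0)))"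
      unfolding h_def by (rule ext) (simp only: qcnj_mult_self)
    then have "continuous_on UNIV h"
      using m unfolding ell_weight_def case_prod_beta' by (auto intro!: continuous_intros simp del: fst_scaleR snd_scaleR)
    then have "set_integrable lborel ({0..\<xi>0} \<times> circ) h"
      unfolding set_integrable_def
      by (intro borel_integrable_compact compact_Times) (auto intro: continuous_on_subset)
    then have "set_integrable lborel (ell_rect \<xi>0) h"
      by (rule set_integrable_subset) (auto simp: ell_rect_def intro!: borel_Times)
    then show ?thesis
      by (rule set_integrable_cong[THEN iffD1, OF refl refl, rotated]) (simp add: h_def f)
  qed
  ultimately show ?thesis by (simp add: ell_M2_def ell_M_def)
qed

text \<open>Away from the foci this is the solved form of the gradient relations. At a focus the
  left side is a limit of the values around it, and the continuity of the lift identifies that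
  limit.\<close>

lemma D_minus_scaled_zfun:
  assumes lam: "lam \<noteq> 0" and i: "i \<in> eig_index (mq lam)" and x: "x \<ge> 0" and y: "y \<in> circ"
    and u: "\<And>x y. u (x, y) = c * zfun lam i x y"
  shows "D_minus_scaled lam u (x, y) = c *\<^sub>R mlift lam i (x, y)"
proof -
  define F where "F = (\<lambda>p. (- (1 / lam)) *\<^sub>R (ell_D (\<lambda>p. qreal (u p)) p - lam *\<^sub>R qreal (u p)))"
  have off: "F (x, y) = c *\<^sub>R mlift lam i (x, y)" if x: "x \<ge> 0" and y: "y \<in> circ" and w: "ew x y \<noteq> 0" for x y
  proof -
    have Q: "qreal (u (x, y)) = qvec (c * zfun lam i x y) 0 0" for x y
      by (rule qvec_eqI) (auto simp: qreal_def u)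
    have xx: "x \<in> {0..<x + 1}" using x by simp
    have dx: "((\<lambda>s. qreal (u (s, y))) has_vector_derivative
        qvec (c * (rad' (fst i) (snd i) (mq lam) x * ang (fst i) (snd i) (mq lam) y)) 0 0) (at x within {0..<x + 1})"
      unfolding Q zfun_def by (intro qvec_has_vector_derivative DERIV_cmult DERIV_cmult_right rad_has_deriv DERIV_const)
    have dy: "((\<lambda>t. qreal (u (x, t))) has_vector_derivative
        qvec (c * (rad (fst i) (snd i) (mq lam) x * ang' (fst i) (snd i) (mq lam) y)) 0 0) (at y within circ)"
      unfolding Q zfun_def by (intro qvec_has_vector_derivative DERIV_cmult ang_has_deriv DERIV_const)
    note comp = ell_D_components[of "\<lambda>p. qreal (u p)" x y, unfolded d_xi_eq[where f = "\<lambda>p. qreal (u p)", OF dx xx]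
        d_eta_eq[where f = "\<lambda>p. qreal (u p)", OF dy y] qvec_components]
    define R' E R E' where "R' = rad' (fst i) (snd i) (mq lam) x" and "E = ang (fst i) (snd i) (mq lam) y"
      and "R = rad (fst i) (snd i) (mq lam) x" and "E' = ang' (fst i) (snd i) (mq lam) y"
    note defs = R'_def E_def R_def E'_def
    have l: "lift1 lam i x y = - (1 / lam) * (eA x y * (R' * E) - eB x y * (R * E')) / ew x y"
      "lift2 lam i x y = - (1 / lam) * (eB x y * (R' * E) + eA x y * (R * E')) / ew x y"
    proof -
      have "lift1 lam i x y = (ew x y * lift1 lam i x y) / ew x y" "lift2 lam i x y = (ew x y * lift2 lam i x y) / ew x y"
        using w by simp_all
      then show "lift1 lam i x y = - (1 / lam) * (eA x y * (R' * E) - eB x y * (R * E')) / ew x y"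
        "lift2 lam i x y = - (1 / lam) * (eB x y * (R' * E) + eA x y * (R * E')) / ew x y"
        unfolding lift_eqs[OF lam i] defs by simp_all
    qed
    show ?thesis
      unfolding mlift_def prod.case scaleR_qvec
    proof (rule qvec_eqI)
      show "fst (F (x, y)) = c * zfun lam i x y" using lam by (simp add: F_def comp Q)
      show "snd (F (x, y)) $ 1 = c * lift1 lam i x y"
        using lam w unfolding l by (simp add: F_def comp Q defs field_simps)
      show "snd (F (x, y)) $ 2 = c * lift2 lam i x y"
        using lam w unfolding l by (simp add: F_def comp Q defs field_simps)
      show "snd (F (x, y)) $ 3 = 0" by (simp add: F_def comp Q)
    qed
  qed
  show ?thesis
  proof (cases "ew x y = 0")
    case False
    then show ?thesis using off[OF x y] by (simp add: D_minus_scaled_def F_def foci_iff)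
  next
    case True
    then have x0: "x = 0" and sy: "sin y = 0" by (auto simp: ew_eq_0_iff)
    define S where "S = {0::real..} \<times> circ"
    \<comment> \<open>Distinct foci are at least pi apart, so the ball of radius 1 around one
      contains no other.\<close>
    have ev: "\<forall>\<^sub>F p in at (x, y) within S. F p = c *\<^sub>R mlift lam i p"
      unfolding eventually_at
    proof (intro exI[of _ 1] conjI ballI impI)
      fix p assume p: "p \<in> S" "p \<noteq> (x, y) \<and> dist p (x, y) < 1"
      obtain x' y' where p': "p = (x', y')" by (cases p)
      have "ew x' y' \<noteq> 0"
      proof
        assume "ew x' y' = 0"
        then have a: "x' = 0" "sin y' = 0" by (auto simp: ew_eq_0_iff)
        have d1: "\<bar>y' - y\<bar> < 1" using p(2) dist_snd_le[of p "(x, y)"] by (simp add: p' dist_real_def)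
        have "sin (y' - y) = 0" using a sy by (simp add: sin_diff)
        moreover have "- pi < y' - y" "y' - y < pi" using d1 pi_gt3 by linarith+
        ultimately have "y' - y = 0" by (rule sin_eq_0_pi[rotated 2])
        then show False using p(2) a x0 by (simp add: p')
      qed
      then show "F p = c *\<^sub>R mlift lam i p" using off[of x' y'] p(1) by (auto simp: S_def p')
    qed auto
    have cont: "isCont (\<lambda>p. c *\<^sub>R mlift lam i p) (x, y)"
      using continuous_mlift[OF lam i]
      by (auto simp: continuous_on_eq_continuous_at intro!: continuous_intros)
    have "((\<lambda>p. c *\<^sub>R mlift lam i p) \<longlongrightarrow> c *\<^sub>R mlift lam i (x, y)) (at (x, y) within S)"
      using cont by (auto simp: isCont_def intro: tendsto_within_subset[of _ _ _ UNIV])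
    then have lim: "(F \<longlongrightarrow> c *\<^sub>R mlift lam i (x, y)) (at (x, y) within S)"
      using ev by (subst tendsto_cong)
    have "(x, y) islimpt S"
      unfolding islimpt_approachable
    proof (intro allI impI)
      fix e :: real assume e: "e > 0"
      show "\<exists>x'\<in>S. x' \<noteq> (x, y) \<and> dist x' (x, y) < e"
        by (rule bexI[of _ "(e / 2, y)"]) (use e y x0 in \<open>auto simp: S_def dist_prod_def\<close>)
    qed
    then have "at (x, y) within S \<noteq> bot" by (simp add: trivial_limit_within)
    then have "Lim (at (x, y) within S) F = c *\<^sub>R mlift lam i (x, y)" using lim by (rule tendsto_Lim)
    then show ?thesis using True unfolding D_minus_scaled_def F_def[symmetric] S_def by (simp add: foci_iff Let_def)
  qed
qed

text \<open>Rescaling the base solution shows that a normalized eigenfunction exists, so the choice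
  in \<open>mathieu_fun\<close> really yields one. Parity makes it a multiple of the base solution,
  and the factor is real because both are real on the real axis. Either outcome of the sign
  selection preserves the conclusion.\<close>

lemma mathieu_fun_multiple:
  assumes s: "s = 1 \<or> s = -1" and a: "ev q \<in> mathieu_eigenvalues s q" and c: "c > 0"
  shows "\<exists>r::real. r \<noteq> 0 \<and> (\<forall>z. mathieu_fun s c ev t q z = of_real r * mathieu_base s (ev q) q z)"
proof -
  define Y where "Y = mathieu_base s (ev q) q"
  define n where "n = ang_norm q (s, ev q)"
  have i: "(s, ev q) \<in> eig_index q" using s a by auto
  have n: "n > 0" unfolding n_def by (rule ang_norm_pos[OF i])
  have sol: "mathieu_sol (ev q) q Y" using a mathieu_eigenvalues_iff[OF s] by (simp add: Y_def)
  have cm: "cmod (Y (of_real x)) = \<bar>ang s (ev q) q x\<bar>" for x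
    unfolding Y_def of_real_ang[OF s, symmetric] by simp
  have "mathieu_normalized s c (ev q) q (\<lambda>z. of_real (c / n) * Y z)"
    unfolding mathieu_normalized_def
  proof (intro conjI allI)
    have eq: "mathieu_eq (ev q) q (\<lambda>z. of_real (c / n) * Y z)"
    proof (rule mathieu_eqI(1))
      note d = mathieu_eq_deriv[of "ev q" q Y]
      show "((\<lambda>z. of_real (c / n) * Y z) has_field_derivative of_real (c / n) * deriv Y z) (at z)" for z
        by (intro DERIV_cmult d) (simp add: Y_def mathieu_base)
      show "((\<lambda>z. of_real (c / n) * deriv Y z) has_field_derivative
          (2 * of_real q * cos (2 * z) - of_real (ev q)) * (of_real (c / n) * Y z)) (at z)" for z
        using DERIV_cmult[OF d(2), of "of_real (c / n)" z] by (simp add: Y_def mathieu_base mult_ac)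
    qed
    then show "mathieu_sol (ev q) q (\<lambda>z. of_real (c / n) * Y z)"
      using sol c n unfolding mathieu_sol_altdef by auto
    show "of_real (c / n) * Y (- z) = of_real s * (of_real (c / n) * Y z)" for z
      using mathieu_base_minus[OF s] by (simp add: Y_def)
    show "of_real (c / n) * Y (of_real x) \<in> \<real>" for x
      unfolding Y_def of_real_ang[OF s, symmetric] by (simp flip: of_real_mult)
    have "integral circ (\<lambda>x. (cmod (of_real (c / n) * Y (of_real x)))\<^sup>2) = integral circ (\<lambda>x. (c / n)\<^sup>2 * (ang s (ev q) q x * ang s (ev q) q x))"
    proof (intro integral_cong)
      fix x
      have "cmod (of_real (c / n) * Y (of_real x)) = \<bar>c / n\<bar> * \<bar>ang s (ev q) q x\<bar>" unfolding norm_mult cm norm_of_real by (rule refl)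
      then show "(cmod (of_real (c / n) * Y (of_real x)))\<^sup>2 = (c / n)\<^sup>2 * (ang s (ev q) q x * ang s (ev q) q x)"
        by (simp only: power_mult_distrib power2_abs power2_eq_square[of "ang s (ev q) q x"])
    qed
    also have "\<dots> = (c / n)\<^sup>2 * ip (ang s (ev q) q) (ang s (ev q) q)" by (simp add: ip_def)
    also have "ip (ang s (ev q) q) (ang s (ev q) q) = n\<^sup>2"
      unfolding n_def ang_norm_def using ip_nonneg by simp
    finally show "sqrt (integral circ (\<lambda>x. (cmod (of_real (c / n) * Y (of_real x)))\<^sup>2)) = c"
      using n c by (simp add: power_mult_distrib[symmetric])
  qed
  from someI[of "mathieu_normalized s c (ev q) q", OF this]
  have norm: "mathieu_normalized s c (ev q) q (SOME \<psi>. mathieu_normalized s c (ev q) q \<psi>)" .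
  define \<psi> where "\<psi> = (SOME \<psi>. mathieu_normalized s c (ev q) q \<psi>)"
  have \<psi>: "mathieu_eq (ev q) q \<psi>" "\<And>z. \<psi> (- z) = of_real s * \<psi> z" "\<And>x::real. \<psi> (of_real x) \<in> \<real>" "\<exists>z. \<psi> z \<noteq> 0"
    using norm unfolding \<psi>_def mathieu_normalized_def mathieu_sol_altdef by blast+
  define k where "k = (if s = 1 then \<psi> 0 else deriv \<psi> 0)"
  have rep: "\<psi> z = k * Y z" for z unfolding Y_def k_def by (rule mathieu_eq_parity[OF \<psi>(1) s \<psi>(2)])
  have "k \<noteq> 0" using rep \<psi>(4) by auto
  obtain x where x: "ang s (ev q) q x \<noteq> 0"
  proof (rule ccontr)
    assume "\<not> thesis"
    then have "ang s (ev q) q x = 0" for x using that by blast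
    then have "n = 0" by (simp add: n_def ang_norm_def ip_def)
    then show False using n by simp
  qed
  have "k * of_real (ang s (ev q) q x) \<in> \<real>" using \<psi>(3)[of x] unfolding rep Y_def of_real_ang[OF s, symmetric] .
  then have "k * of_real (ang s (ev q) q x) / of_real (ang s (ev q) q x) \<in> \<real>" by (rule Reals_divide) simp
  then have "k \<in> \<real>" using x by simp
  then obtain r where r: "k = of_real r" by (auto elim: Reals_cases)
  have "r \<noteq> 0" using r \<open>k \<noteq> 0\<close> by auto
  show ?thesis
  proof (cases "mathieu_branch s c ev t q \<psi>")
    case True
    then show ?thesis
      using rep r \<open>r \<noteq> 0\<close> by (intro exI[of _ r]) (simp add: mathieu_fun_def \<psi>_def[symmetric] Y_def)
  next
    case False
    then show ?thesis
      using rep r \<open>r \<noteq> 0\<close> by (intro exI[of _ "- r"]) (simp add: mathieu_fun_def \<psi>_def[symmetric] Y_def)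
  qed
qed

lemma rqM_plus_eq:
  assumes lam: "lam \<noteq> 0"
  shows "\<exists>c. c \<noteq> 0 \<and> (\<forall>x\<ge>0. \<forall>y\<in>circ. rqM_plus n lam (x, y) = c *\<^sub>R mlift lam (1, mathieu_a n (mq lam)) (x, y))"
proof -
  have a: "mathieu_a n (mq lam) \<in> mathieu_eigenvalues 1 (mq lam)"
    using bij_betwE[OF mathieu_eigenvalues_bij[of 1 "mq lam"]] by (auto simp: mathieu_a_def)
  then have i: "(1, mathieu_a n (mq lam)) \<in> eig_index (mq lam)" by simp
  have "(if n = 0 then sqrt (2 * pi) else sqrt pi) > 0" by simp
  then obtain r :: real where r: "r \<noteq> 0" "\<And>z. mathieu_ce n z (mq lam) = of_real r * mathieu_base 1 (mathieu_a n (mq lam)) (mq lam) z"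
    using mathieu_fun_multiple[of 1 "mathieu_a n" "mq lam" "if n = 0 then sqrt (2 * pi) else sqrt pi" "\<lambda>x. cos (real n * x)"] a
    unfolding mathieu_ce_def by blast
  have "zeta_plus n (mq lam) (x, y) = r\<^sup>2 * zfun lam (1, mathieu_a n (mq lam)) x y" for x y
    unfolding zeta_plus_def mathieu_Ce_def prod.case r(2) of_real_rad[OF disjI1[OF refl]] of_real_ang[OF disjI1[OF refl], symmetric]
    by (simp add: zfun_def power2_eq_square)
  from D_minus_scaled_zfun[OF lam i _ _ this] r(1) show ?thesis
    unfolding rqM_plus_def by (intro exI[of _ "r\<^sup>2"]) auto
qed

lemma rqM_minus_eq:
  assumes lam: "lam \<noteq> 0" and n: "n \<ge> 1"
  shows "\<exists>c. c \<noteq> 0 \<and> (\<forall>x\<ge>0. \<forall>y\<in>circ. rqM_minus n lam (x, y) = c *\<^sub>R mlift lam (-1, mathieu_b n (mq lam)) (x, y))"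
proof -
  have a: "mathieu_b n (mq lam) \<in> mathieu_eigenvalues (-1) (mq lam)"
    using bij_betwE[OF mathieu_eigenvalues_bij[of "-1" "mq lam"]] by (auto simp: mathieu_b_def)
  then have i: "(-1, mathieu_b n (mq lam)) \<in> eig_index (mq lam)" by simp
  obtain r :: real where r: "r \<noteq> 0" "\<And>z. mathieu_se n z (mq lam) = of_real r * mathieu_base (-1) (mathieu_b n (mq lam)) (mq lam) z"
    using mathieu_fun_multiple[of "-1" "mathieu_b n" "mq lam" "sqrt pi" "\<lambda>x. sin (real n * x)"] a
    unfolding mathieu_se_def by auto
  \<comment> \<open>The -i in the definition of Se cancels the i that an odd solution carries on the
    imaginary axis; the factor enters once through Se and once through se, hence squared and
    nonzero.\<close>
  have "zeta_minus n (mq lam) (x, y) = r\<^sup>2 * zfun lam (-1, mathieu_b n (mq lam)) x y" for x y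
    unfolding zeta_minus_def mathieu_Se_def prod.case r(2) of_real_rad[OF disjI2[OF refl]] of_real_ang[OF disjI2[OF refl], symmetric]
    by (simp add: zfun_def power2_eq_square)
  from D_minus_scaled_zfun[OF lam i _ _ this] r(1) show ?thesis
    unfolding rqM_minus_def by (intro exI[of _ "r\<^sup>2"]) auto
qed

lemma rqM_system_subset:
  assumes lam: "lam \<noteq> 0" and \<xi>0: "\<xi>0 > 0"
  shows "rqM_system lam \<subseteq> ell_M2 \<xi>0 lam"
proof
  fix h assume h: "h \<in> rqM_system lam"
  have a: "(1, mathieu_a n (mq lam)) \<in> eig_index (mq lam)" for n
    using bij_betwE[OF mathieu_eigenvalues_bij[of 1 "mq lam"]] by (auto simp: mathieu_a_def)
  have b: "(-1, mathieu_b n (mq lam)) \<in> eig_index (mq lam)" for n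
    using bij_betwE[OF mathieu_eigenvalues_bij[of "-1" "mq lam"]] by (auto simp: mathieu_b_def)
  obtain i c where "i \<in> eig_index (mq lam)" "\<And>x y. x \<ge> 0 \<Longrightarrow> y \<in> circ \<Longrightarrow> h (x, y) = c *\<^sub>R mlift lam i (x, y)"
  proof (cases "\<exists>n. h = rqM_plus n lam")
    case True
    then show ?thesis using that[OF a] rqM_plus_eq[OF lam] by metis
  next
    case False
    then obtain n where "n \<ge> 1" "h = rqM_minus n lam" using h by (auto simp: rqM_system_def)
    then show ?thesis using that[OF b] rqM_minus_eq[OF lam] by metis
  qed
  then show "h \<in> ell_M2 \<xi>0 lam"
    by (intro ell_M2I[OF lam _ \<xi>0, of i _ c]) (auto simp: ell_rect_def)
qed

lemma rqM_system_index:
  assumes lam: "lam \<noteq> 0"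
  shows "\<exists>h\<in>rqM_system lam. \<exists>c. c \<noteq> 0 \<and> (\<forall>x\<ge>0. \<forall>y\<in>circ. h (x, y) = c *\<^sub>R mlift lam (eig_idx (mq lam) k) (x, y))"
proof (cases "even k")
  case True
  then show ?thesis using rqM_plus_eq[OF lam, of "k div 2"] by (auto simp: eig_idx_def rqM_system_def)
next
  case False
  then show ?thesis
    using rqM_minus_eq[OF lam, of "Suc (k div 2)"] unfolding rqM_system_def eig_idx_def
    by (intro bexI[of _ "rqM_minus (Suc (k div 2)) lam"]) auto
qed

section \<open>Finite real linear combinations of the system\<close>

lemma real_lin_combs_add:
  assumes "g \<in> real_lin_combs B" "h \<in> real_lin_combs B"
  shows "(\<lambda>p. g p + h p) \<in> real_lin_combs B"
proof -
  obtain F c where F: "finite F" "F \<subseteq> B" "g = (\<lambda>p. \<Sum>h\<in>F. c h *\<^sub>R h p)" using assms(1) by (auto simp: real_lin_combs_def)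
  obtain G d where G: "finite G" "G \<subseteq> B" "h = (\<lambda>p. \<Sum>h\<in>G. d h *\<^sub>R h p)" using assms(2) by (auto simp: real_lin_combs_def)
  define e where "e k = (if k \<in> F then c k else 0) + (if k \<in> G then d k else 0)" for k
  have "(\<Sum>k\<in>F \<union> G. e k *\<^sub>R k p) = g p + h p" for p
  proof -
    have "(\<Sum>k\<in>F. c k *\<^sub>R k p) = (\<Sum>k\<in>F \<union> G. (if k \<in> F then c k else 0) *\<^sub>R k p)"
      "(\<Sum>k\<in>G. d k *\<^sub>R k p) = (\<Sum>k\<in>F \<union> G. (if k \<in> G then d k else 0) *\<^sub>R k p)"
      using F G by (auto intro!: sum.mono_neutral_cong_left)
    then show ?thesis by (simp add: F G e_def scaleR_left_distrib sum.distrib)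
  qed
  then show ?thesis
    unfolding real_lin_combs_def using F G by (intro CollectI exI[of _ "F \<union> G"] exI[of _ e]) auto
qed

lemma real_lin_combs_partial_sums:
  assumes lam: "lam \<noteq> 0"
  shows "\<exists>g\<in>real_lin_combs (rqM_system lam). \<forall>x\<ge>0. \<forall>y\<in>circ.
    g (x, y) = (\<Sum>k<N. b k *\<^sub>R mlift lam (eig_idx (mq lam) k) (x, y))"
proof (induction N)
  case 0
  have "(\<lambda>p. 0) \<in> real_lin_combs (rqM_system lam)"
    by (auto simp: real_lin_combs_def intro!: exI[of _ "{}"])
  then show ?case by (intro bexI[of _ "\<lambda>p. 0"]) auto
next
  case (Suc N)
  then obtain g where g: "g \<in> real_lin_combs (rqM_system lam)"
    "\<And>x y. x \<ge> 0 \<Longrightarrow> y \<in> circ \<Longrightarrow> g (x, y) = (\<Sum>k<N. b k *\<^sub>R mlift lam (eig_idx (mq lam) k) (x, y))" by blast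
  obtain h c where h: "h \<in> rqM_system lam" "c \<noteq> 0"
    "\<And>x y. x \<ge> 0 \<Longrightarrow> y \<in> circ \<Longrightarrow> h (x, y) = c *\<^sub>R mlift lam (eig_idx (mq lam) N) (x, y)"
    using rqM_system_index[OF lam, of N] by blast
  have "(\<lambda>p. (b N / c) *\<^sub>R h p) \<in> real_lin_combs (rqM_system lam)"
    unfolding real_lin_combs_def using h(1) by (intro CollectI exI[of _ "{h}"] exI[of _ "\<lambda>_. b N / c"]) auto
  from real_lin_combs_add[OF g(1) this] show ?case
    by (rule bexI[rotated]) (use g(2) h(2,3) in auto)
qed

section \<open>Convergence of the eigenfunction expansion\<close>

lemma nondecreasing_within:
  assumes "a \<le> b" "\<And>t. t \<in> {a..b} \<Longrightarrow> (g has_real_derivative g' t) (at t within {a..b})"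
    "\<And>t. t \<in> {a..b} \<Longrightarrow> g' t \<ge> 0"
  shows "g a \<le> g b"
proof -
  obtain y where "y \<in> {a..b}" "g b - g a = g' y * (b - a)"
    using mvt_very_simple[OF assms(1), of g "\<lambda>t h. g' t * h"] assms(2)
    by (auto simp: has_field_derivative_def)
  then show ?thesis using assms(1,3) by (metis diff_ge_0_iff_ge mult_nonneg_nonneg)
qed

text \<open>Since (c c')' = c'^2 + p c^2 \<ge> 0, the product c c' stays nonnegative, so c^2 and
  c'^2 are nondecreasing, and c c' grows at rate at least M c(x)^2 beyond \<open>x\<close>;
  integrating twice gives the first bound. For the second, the mean value theorem equates c' at some
  later point with a difference quotient of c.\<close>

lemma linear_ode_growth:
  assumes c: "\<And>x. x \<in> {0..T} \<Longrightarrow> (c has_real_derivative c' x) (at x within {0..T})"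
      "\<And>x. x \<in> {0..T} \<Longrightarrow> (c' has_real_derivative p x * c x) (at x within {0..T})"
    and p: "\<And>x. x \<in> {0..T} \<Longrightarrow> M \<le> p x" and M: "M \<ge> 0" and ini: "c 0 * c' 0 \<ge> 0"
    and x: "0 \<le> x" "0 \<le> h" "x + h \<le> T"
  shows "(c x)\<^sup>2 * (1 + M * h\<^sup>2) \<le> (c (x + h))\<^sup>2" "(c' x)\<^sup>2 * h\<^sup>2 \<le> 4 * (c (x + h))\<^sup>2"
proof -
  have sub: "(c has_real_derivative c' t) (at t within {a..b})" "(c' has_real_derivative p t * c t) (at t within {a..b})"
    if "0 \<le> a" "b \<le> T" "t \<in> {a..b}" for a b t
    using DERIV_subset[OF c(1)] DERIV_subset[OF c(2)] that by auto
  have pp: "0 \<le> p t" if "t \<in> {0..T}" for t using p[OF that] M by simp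
  have w: "c a * c' a + M * (c x)\<^sup>2 * (b - a) \<le> c b * c' b"
    if ab: "0 \<le> a" "a \<le> b" "b \<le> T" "\<And>t. t \<in> {a..b} \<Longrightarrow> M * (c x)\<^sup>2 \<le> M * (c t)\<^sup>2" for a b
  proof -
    have "c a * c' a - M * (c x)\<^sup>2 * a \<le> c b * c' b - M * (c x)\<^sup>2 * b"
    proof (rule nondecreasing_within[OF ab(2), where g = "\<lambda>t. c t * c' t - M * (c x)\<^sup>2 * t" and g' = "\<lambda>t. (c' t)\<^sup>2 + p t * (c t)\<^sup>2 - M * (c x)\<^sup>2"])
      fix t assume t: "t \<in> {a..b}"
      show "((\<lambda>t. c t * c' t - M * (c x)\<^sup>2 * t) has_real_derivative (c' t)\<^sup>2 + p t * (c t)\<^sup>2 - M * (c x)\<^sup>2) (at t within {a..b})"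
        by (rule derivative_eq_intros sub[OF ab(1,3) t] refl)+ (simp add: power2_eq_square algebra_simps)
      have "M * (c x)\<^sup>2 \<le> p t * (c t)\<^sup>2"
      proof -
        have "M \<le> p t" using p[of t] t ab by simp
        then have "M * (c t)\<^sup>2 \<le> p t * (c t)\<^sup>2" by (rule mult_right_mono) simp
        then show ?thesis using ab(4)[OF t] by linarith
      qed
      then show "0 \<le> (c' t)\<^sup>2 + p t * (c t)\<^sup>2 - M * (c x)\<^sup>2" by (simp add: add_increasing)
    qed
    then show ?thesis by (simp add: algebra_simps)
  qed
  have w0: "c t * c' t \<ge> 0" if "t \<in> {0..T}" for t
  proof -
    have "c 0 * c' 0 \<le> c t * c' t"
    proof (rule nondecreasing_within[where g = "\<lambda>t. c t * c' t" and g' = "\<lambda>t. (c' t)\<^sup>2 + p t * (c t)\<^sup>2"])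
      fix r assume r: "r \<in> {0..t}"
      show "((\<lambda>t. c t * c' t) has_real_derivative (c' r)\<^sup>2 + p r * (c r)\<^sup>2) (at r within {0..t})"
      proof -
        have "(c has_real_derivative c' r) (at r within {0..t})" "(c' has_real_derivative p r * c r) (at r within {0..t})"
          using sub[of 0 t r] that r by auto
        from DERIV_mult[OF this] show ?thesis by (simp add: power2_eq_square algebra_simps)
      qed
      show "0 \<le> (c' r)\<^sup>2 + p r * (c r)\<^sup>2" using pp[of r] r that by simp
    qed (use that in auto)
    then show ?thesis using ini by simp
  qed
  have csq: "(c a)\<^sup>2 \<le> (c b)\<^sup>2" "(c' a)\<^sup>2 \<le> (c' b)\<^sup>2" if ab: "0 \<le> a" "a \<le> b" "b \<le> T" for a b
  proof -
    show "(c a)\<^sup>2 \<le> (c b)\<^sup>2"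
    proof (rule nondecreasing_within[OF ab(2), where g = "\<lambda>t. (c t)\<^sup>2" and g' = "\<lambda>t. 2 * (c t * c' t)"])
      fix t assume t: "t \<in> {a..b}"
      show "((\<lambda>t. (c t)\<^sup>2) has_real_derivative 2 * (c t * c' t)) (at t within {a..b})"
        by (rule derivative_eq_intros sub[OF ab(1,3) t] refl)+ simp
      show "0 \<le> 2 * (c t * c' t)" using w0[of t] t ab by simp
    qed
    show "(c' a)\<^sup>2 \<le> (c' b)\<^sup>2"
    proof (rule nondecreasing_within[OF ab(2), where g = "\<lambda>t. (c' t)\<^sup>2" and g' = "\<lambda>t. 2 * (p t * (c t * c' t))"])
      fix t assume t: "t \<in> {a..b}"
      show "((\<lambda>t. (c' t)\<^sup>2) has_real_derivative 2 * (p t * (c t * c' t))) (at t within {a..b})"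
        by (rule derivative_eq_intros sub[OF ab(1,3) t] refl)+ simp
      show "0 \<le> 2 * (p t * (c t * c' t))" using w0[of t] pp[of t] t ab by simp
    qed
  qed
  have "(c x)\<^sup>2 - M * (c x)\<^sup>2 * (x - x)\<^sup>2 \<le> (c (x + h))\<^sup>2 - M * (c x)\<^sup>2 * (x + h - x)\<^sup>2"
  proof (rule nondecreasing_within[where g = "\<lambda>t. (c t)\<^sup>2 - M * (c x)\<^sup>2 * (t - x)\<^sup>2"
        and g' = "\<lambda>t. 2 * (c t * c' t - M * (c x)\<^sup>2 * (t - x))"])
    fix t assume t: "t \<in> {x..x + h}"
    show "((\<lambda>t. (c t)\<^sup>2 - M * (c x)\<^sup>2 * (t - x)\<^sup>2) has_real_derivative 2 * (c t * c' t - M * (c x)\<^sup>2 * (t - x)))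
        (at t within {x..x + h})"
      by (rule derivative_eq_intros sub[OF x(1,3) t] refl)+ (simp add: algebra_simps)
    have "c x * c' x + M * (c x)\<^sup>2 * (t - x) \<le> c t * c' t"
      using t x csq(1) M by (intro w mult_left_mono) auto
    moreover have "c x * c' x \<ge> 0" using w0 x by simp
    ultimately show "0 \<le> 2 * (c t * c' t - M * (c x)\<^sup>2 * (t - x))" by simp
  qed (use x in auto)
  then show "(c x)\<^sup>2 * (1 + M * h\<^sup>2) \<le> (c (x + h))\<^sup>2" by (simp add: algebra_simps)
  obtain t where t: "t \<in> {x..x + h}" "c (x + h) - c x = c' t * h"
    using mvt_very_simple[of x "x + h" c "\<lambda>t h. c' t * h"] sub(1)[OF x(1,3)] x
    by (auto simp: has_field_derivative_def)
  have "(c' x)\<^sup>2 * h\<^sup>2 \<le> (c' t)\<^sup>2 * h\<^sup>2" using csq(2)[of x t] t x by (intro mult_right_mono) auto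
  also have "\<dots> = (c (x + h) - c x)\<^sup>2" unfolding t(2) by (simp add: power_mult_distrib)
  also have "\<dots> \<le> 2 * (c (x + h))\<^sup>2 + 2 * (c x)\<^sup>2"
    using zero_le_power2[of "c (x + h) + c x"] by (simp add: power2_eq_square algebra_simps)
  also have "\<dots> \<le> 4 * (c (x + h))\<^sup>2" using csq(1)[of x "x + h"] x by simp
  finally show "(c' x)\<^sup>2 * h\<^sup>2 \<le> 4 * (c (x + h))\<^sup>2" .
qed

text \<open>Steps of fixed length gain a factor M h^2 each, so a fixed distance split into n steps
  gains the n-th power of M. A polynomial gain of arbitrary order suffices in what follows.\<close>

lemma linear_ode_growth_iterate:
  assumes c: "\<And>x. x \<in> {0..T} \<Longrightarrow> (c has_real_derivative c' x) (at x within {0..T})"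
      "\<And>x. x \<in> {0..T} \<Longrightarrow> (c' has_real_derivative p x * c x) (at x within {0..T})"
    and p: "\<And>x. x \<in> {0..T} \<Longrightarrow> M \<le> p x" and M: "M \<ge> 0" and ini: "c 0 * c' 0 \<ge> 0"
    and x: "0 \<le> x" "0 \<le> h" "x + real n * h \<le> T"
  shows "(c x)\<^sup>2 * (M * h\<^sup>2) ^ n \<le> (c (x + real n * h))\<^sup>2"
  using x(3)
proof (induction n)
  case (Suc n)
  have n: "x + real n * h + h \<le> T" using Suc.prems by (simp add: algebra_simps)
  have "(c x)\<^sup>2 * (M * h\<^sup>2) ^ Suc n = (c x)\<^sup>2 * (M * h\<^sup>2) ^ n * (M * h\<^sup>2)" by simp
  also have "\<dots> \<le> (c (x + real n * h))\<^sup>2 * (M * h\<^sup>2)"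
    using Suc.IH n x M by (intro mult_right_mono) auto
  also have "\<dots> \<le> (c (x + real n * h))\<^sup>2 * (1 + M * h\<^sup>2)" by (intro mult_left_mono) auto
  also have "\<dots> \<le> (c (x + real n * h + h))\<^sup>2"
    by (rule linear_ode_growth(1)[OF c p M ini]) (use n x in auto)
  finally show ?case by (simp add: algebra_simps)
qed auto

text \<open>Up to pi / 3 the function 2 sin t - t has derivative 2 cos t - 1 \<ge> 0; beyond, 2 sin
  t is at least 1.7, which exceeds pi / 2.\<close>

lemma abs_le_twice_sin:
  assumes "\<bar>t\<bar> \<le> pi / 2"
  shows "\<bar>t\<bar> \<le> 2 * \<bar>sin t\<bar>"
proof -
  have pos: "t \<le> 2 * sin t" if t: "0 \<le> t" "t \<le> pi / 2" for t :: real
  proof (cases "t \<le> pi / 3")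
    case True
    have "2 * sin 0 - 0 \<le> 2 * sin t - t"
    proof (rule nondecreasing_within[OF t(1), where g = "\<lambda>t. 2 * sin t - t" and g' = "\<lambda>t. 2 * cos t - 1"])
      fix r assume r: "r \<in> {0..t}"
      show "((\<lambda>t. 2 * sin t - t) has_real_derivative 2 * cos r - 1) (at r within {0..t})"
        by (auto intro!: derivative_eq_intros)
      have "cos (pi / 3) \<le> cos r" using r True pi_gt_zero by (intro cos_monotone_0_pi_le) auto
      then show "0 \<le> 2 * cos r - 1" by (simp add: cos_60)
    qed
    then show ?thesis by simp
  next
    case False
    have "sin (pi / 3) \<le> sin t" using False t by (intro sin_monotone_2pi_le) auto
    moreover have "17 / 10 \<le> sqrt 3" by (rule real_le_rsqrt) (simp add: power2_eq_square)
    then have "sin (pi / 3) \<ge> 17 / 20" unfolding sin_60 by linarith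
    moreover have "t < 17 / 10" using t pi_less_4 pi_approx by simp
    ultimately show ?thesis by simp
  qed
  show ?thesis using pos[of "\<bar>t\<bar>"] assms by (cases "t \<ge> 0") auto
qed

lemma near_focus:
  assumes "y \<in> circ"
  shows "\<exists>y0\<in>circ. sin y0 = 0 \<and> \<bar>y - y0\<bar> \<le> 2 * \<bar>sin y\<bar>"
proof -
  have s: "\<bar>sin (y - y0)\<bar> = \<bar>sin y\<bar>" if "sin y0 = 0" for y0
  proof -
    have "\<bar>cos y0\<bar> = 1" using that sin_cos_squared_add[of y0] by (simp add: abs_square_eq_1)
    then show ?thesis using that by (simp add: sin_diff abs_mult)
  qed
  have "\<exists>y0\<in>circ. sin y0 = 0 \<and> \<bar>y - y0\<bar> \<le> pi / 2"
  proof -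
    consider "y \<le> pi / 2" | "pi / 2 \<le> y" "y \<le> 3 * pi / 2" | "3 * pi / 2 \<le> y" by linarith
    then show ?thesis
    proof cases
      case 1 then show ?thesis using assms by (intro bexI[of _ 0]) auto
    next
      case 2
      then have "\<bar>y - pi\<bar> \<le> pi / 2" by linarith
      then show ?thesis by (intro bexI[of _ pi]) auto
    next
      case 3 then show ?thesis using assms by (intro bexI[of _ "2 * pi"]) auto
    qed
  qed
  then show ?thesis using abs_le_twice_sin s by metis
qed

text \<open>If a0 b0 = 0 at the nearest focus, then a b = (a - a0) b + a0 (b - b0), and each
  difference is at most a derivative bound times the coordinate distance to that focus. These
  distances are at most sqrt ew in x, since x \<le> sinh x, and 2 sqrt ew in y; together they give
  the constant 3.\<close>

lemma product_gradient_bound: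
  assumes X: "\<And>x. x \<in> {0..T} \<Longrightarrow> (X has_real_derivative X' x) (at x within {0..T})"
      "\<And>x. x \<in> {0..T} \<Longrightarrow> (X' has_real_derivative X'' x) (at x within {0..T})"
    and XB: "\<And>x. x \<in> {0..T} \<Longrightarrow> \<bar>X x\<bar> \<le> C" "\<And>x. x \<in> {0..T} \<Longrightarrow> \<bar>X' x\<bar> \<le> C" "\<And>x. x \<in> {0..T} \<Longrightarrow> \<bar>X'' x\<bar> \<le> C"
    and E: "\<And>y. y \<in> circ \<Longrightarrow> (E has_real_derivative E' y) (at y within circ)"
      "\<And>y. y \<in> circ \<Longrightarrow> (E' has_real_derivative E'' y) (at y within circ)"
    and EB: "\<And>y. y \<in> circ \<Longrightarrow> \<bar>E y\<bar> \<le> D" "\<And>y. y \<in> circ \<Longrightarrow> \<bar>E' y\<bar> \<le> D" "\<And>y. y \<in> circ \<Longrightarrow> \<bar>E'' y\<bar> \<le> D"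
    and foc: "\<And>y. y \<in> circ \<Longrightarrow> sin y = 0 \<Longrightarrow> X' 0 * E y = 0" "\<And>y. y \<in> circ \<Longrightarrow> sin y = 0 \<Longrightarrow> X 0 * E' y = 0"
    and xy: "x \<in> {0..T}" "y \<in> circ"
  shows "\<bar>X' x * E y\<bar> \<le> 3 * C * D * sqrt (ew x y)" "\<bar>X x * E' y\<bar> \<le> 3 * C * D * sqrt (ew x y)"
proof -
  have x0: "0 \<in> {0..T}" using xy by auto
  have CD: "0 \<le> C" "0 \<le> D" using XB(1)[OF x0] EB(1)[OF xy(2)] by linarith+
  obtain y0 where y0: "y0 \<in> circ" "sin y0 = 0" "\<bar>y - y0\<bar> \<le> 2 * \<bar>sin y\<bar>" using near_focus[OF xy(2)] by blast
  have "x \<le> sinh x"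
  proof -
    have "sinh 0 - 0 \<le> sinh x - x"
    proof (rule nondecreasing_within[where g = "\<lambda>t. sinh t - t" and g' = "\<lambda>t. cosh t - 1"])
      fix r :: real
      show "((\<lambda>t. sinh t - t) has_real_derivative cosh r - 1) (at r within {0..x})" by (auto intro!: derivative_eq_intros)
      show "0 \<le> cosh r - 1" by (simp add: cosh_real_ge_1)
    qed (use xy in auto)
    then show ?thesis by simp
  qed
  also have "\<dots> \<le> sqrt (ew x y)" unfolding ew_eq(1) by (intro real_le_rsqrt) simp
  finally have xs: "x \<le> sqrt (ew x y)" .
  have "\<bar>sin y\<bar> \<le> sqrt (ew x y)" unfolding ew_eq(1) by (intro real_le_rsqrt) simp
  then have ys: "\<bar>y - y0\<bar> \<le> 2 * sqrt (ew x y)" using y0(3) by linarith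
  have bx: "\<bar>Y x - Y 0\<bar> \<le> C * sqrt (ew x y)"
    if "\<And>x. x \<in> {0..T} \<Longrightarrow> (Y has_real_derivative Y' x) (at x within {0..T})" "\<And>x. x \<in> {0..T} \<Longrightarrow> \<bar>Y' x\<bar> \<le> C" for Y Y'
  proof -
    have "norm (Y x - Y 0) \<le> C * norm (x - 0)"
      by (rule field_differentiable_bound[of "{0..T}" Y Y']) (use that xy x0 in auto)
    also have "\<dots> \<le> C * sqrt (ew x y)" using xs CD xy by (intro mult_left_mono) auto
    finally show ?thesis by simp
  qed
  have by': "\<bar>F y - F y0\<bar> \<le> D * (2 * sqrt (ew x y))"
    if "\<And>y. y \<in> circ \<Longrightarrow> (F has_real_derivative F' y) (at y within circ)" "\<And>y. y \<in> circ \<Longrightarrow> \<bar>F' y\<bar> \<le> D" for F F'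
  proof -
    have "norm (F y - F y0) \<le> D * norm (y - y0)"
      by (rule field_differentiable_bound[of circ F F']) (use that xy y0 in auto)
    also have "\<dots> \<le> D * (2 * sqrt (ew x y))" using ys CD by (intro mult_left_mono) auto
    finally show ?thesis by simp
  qed
  have comb: "\<bar>a * b\<bar> \<le> 3 * C * D * sqrt (ew x y)"
    if "\<bar>a - a0\<bar> \<le> C * sqrt (ew x y)" "\<bar>b\<bar> \<le> D" "\<bar>a0\<bar> \<le> C" "\<bar>b - b0\<bar> \<le> D * (2 * sqrt (ew x y))" "a0 * b0 = 0"
    for a b a0 b0
  proof -
    have "a * b = (a - a0) * b + a0 * (b - b0)" using that(5) by (simp add: algebra_simps)
    then have "\<bar>a * b\<bar> \<le> \<bar>a - a0\<bar> * \<bar>b\<bar> + \<bar>a0\<bar> * \<bar>b - b0\<bar>" by (metis abs_mult abs_triangle_ineq)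
    also have "\<dots> \<le> (C * sqrt (ew x y)) * D + C * (D * (2 * sqrt (ew x y)))"
      using that CD by (intro add_mono mult_mono) (auto simp: ew_nonneg)
    finally show ?thesis by (simp add: algebra_simps)
  qed
  show "\<bar>X' x * E y\<bar> \<le> 3 * C * D * sqrt (ew x y)"
    by (rule comb[OF _ EB(1)[OF xy(2)] XB(2)[OF x0] _ foc(1)[OF y0(1,2)]])
       (intro bx[of X' X''] by'[of E E'] X XB E EB; assumption)+
  show "\<bar>X x * E' y\<bar> \<le> 3 * C * D * sqrt (ew x y)"
    by (rule comb[OF _ EB(2)[OF xy(2)] XB(1)[OF x0] _ foc(2)[OF y0(1,2)]])
       (intro bx[of X X'] by'[of E' E''] X XB E EB; assumption)+
qed

lemma norm_qvec_le: "norm (qvec a b c) \<le> \<bar>a\<bar> + \<bar>b\<bar> + \<bar>c\<bar>"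
proof -
  have "norm (qvec a b c) \<le> norm (a *\<^sub>R (1, 0) :: quat) + norm (b *\<^sub>R qi) + norm (c *\<^sub>R qj)"
    unfolding qvec_def by (intro norm_triangle_le add_mono norm_triangle_ineq) auto
  then show ?thesis by (simp add: qi_def qj_def norm_Pair norm_axis_1)
qed

text \<open>The first and second derivatives of a product solution bound its lift: the gradient of the
  scalar part vanishes at the foci, to the same order as the square root of the weight.\<close>

lemma mlift_bound:
  assumes lam: "lam \<noteq> 0" and i: "i \<in> eig_index (mq lam)" and T: "T > 0"
    and X: "\<And>x. x \<in> {0..T} \<Longrightarrow> (X has_real_derivative X' x) (at x within {0..T})"
      "\<And>x. x \<in> {0..T} \<Longrightarrow> (X' has_real_derivative X'' x) (at x within {0..T})"
    and XB: "\<And>x. x \<in> {0..T} \<Longrightarrow> \<bar>X x\<bar> \<le> C" "\<And>x. x \<in> {0..T} \<Longrightarrow> \<bar>X' x\<bar> \<le> C" "\<And>x. x \<in> {0..T} \<Longrightarrow> \<bar>X'' x\<bar> \<le> C"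
    and E: "\<And>y. y \<in> circ \<Longrightarrow> (E has_real_derivative E' y) (at y within circ)"
      "\<And>y. y \<in> circ \<Longrightarrow> (E' has_real_derivative E'' y) (at y within circ)"
    and EB: "\<And>y. y \<in> circ \<Longrightarrow> \<bar>E y\<bar> \<le> D" "\<And>y. y \<in> circ \<Longrightarrow> \<bar>E' y\<bar> \<le> D" "\<And>y. y \<in> circ \<Longrightarrow> \<bar>E'' y\<bar> \<le> D"
    and b: "\<And>x y. x \<in> {0..T} \<Longrightarrow> y \<in> circ \<Longrightarrow> X x * E y = b * (rad (fst i) (snd i) (mq lam) x * ang (fst i) (snd i) (mq lam) y)"
      "\<And>x y. x \<in> {0..T} \<Longrightarrow> y \<in> circ \<Longrightarrow> X' x * E y = b * (rad' (fst i) (snd i) (mq lam) x * ang (fst i) (snd i) (mq lam) y)"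
      "\<And>x y. x \<in> {0..T} \<Longrightarrow> y \<in> circ \<Longrightarrow> X x * E' y = b * (rad (fst i) (snd i) (mq lam) x * ang' (fst i) (snd i) (mq lam) y)"
    and xy: "x \<in> {0..T}" "y \<in> circ"
  shows "norm (b *\<^sub>R mlift lam i (x, y)) \<le> (1 + 12 / \<bar>lam\<bar>) * C * D"
proof -
  obtain G1x G1y G2x G2y where "is_lift lam i (lift1 lam i) (lift2 lam i) G1x G1y G2x G2y"
    using is_lift[OF lam i] by blast
  then have e: "rad' (fst i) (snd i) (mq lam) x * ang (fst i) (snd i) (mq lam) y = - lam * (eA x y * lift1 lam i x y + eB x y * lift2 lam i x y)"
    "rad (fst i) (snd i) (mq lam) x * ang' (fst i) (snd i) (mq lam) y = lam * (eB x y * lift1 lam i x y - eA x y * lift2 lam i x y)" for x y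
    unfolding is_lift_def by blast+
  have foc: "X' 0 * E y = 0" "X 0 * E' y = 0" if "y \<in> circ" "sin y = 0" for y
    using b(2,3)[of 0 y] that T unfolding e by (simp_all add: eA_def eB_def)
  have gb: "\<bar>X' x * E y\<bar> \<le> 3 * C * D * sqrt (ew x y)" "\<bar>X x * E' y\<bar> \<le> 3 * C * D * sqrt (ew x y)"
    if "x \<in> {0..T}" "y \<in> circ" for x y
    using X XB E EB foc that by (intro product_gradient_bound[of T X X' X'' C E E' E'' D x y]; blast)+
  have CD: "0 \<le> C" "0 \<le> D" using XB(1)[of 0] EB(1)[OF xy(2)] T by (force, linarith)
  \<comment> \<open>Each component of the lift times the weight is a sum of two products of a
    coefficient of size at most sqrt ew and a gradient of size at most 3 C D sqrt ew.\<close>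
  define K where "K = 6 * C * D / \<bar>lam\<bar>"
  have off: "\<bar>b * lift1 lam i x y\<bar> \<le> K \<and> \<bar>b * lift2 lam i x y\<bar> \<le> K" if xy: "x \<in> {0<..T}" "y \<in> circ" for x y
  proof -
    have x: "x \<in> {0..T}" using xy by auto
    have w: "ew x y > 0" using xy ew_nonneg[of x y] ew_eq_0_iff[of x y] by auto
    have ab: "\<bar>eA x y\<bar> \<le> sqrt (ew x y)" "\<bar>eB x y\<bar> \<le> sqrt (ew x y)"
      unfolding ew_eq(2) by (auto intro!: real_le_rsqrt)
    have m: "\<bar>r * t\<bar> \<le> 3 * C * D * ew x y" if "\<bar>r\<bar> \<le> sqrt (ew x y)" "\<bar>t\<bar> \<le> 3 * C * D * sqrt (ew x y)" for r t
    proof -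
      have "\<bar>r * t\<bar> \<le> sqrt (ew x y) * (3 * C * D * sqrt (ew x y))"
        unfolding abs_mult using that CD by (intro mult_mono) (auto simp: ew_nonneg)
      also have "\<dots> = 3 * C * D * (sqrt (ew x y) * sqrt (ew x y))" by (simp only: mult_ac)
      also have "sqrt (ew x y) * sqrt (ew x y) = ew x y" by (simp add: ew_nonneg)
      finally show ?thesis .
    qed
    have l: "ew x y * (b * lift1 lam i x y) = - (1 / lam) * (eA x y * (X' x * E y) - eB x y * (X x * E' y))"
      "ew x y * (b * lift2 lam i x y) = - (1 / lam) * (eB x y * (X' x * E y) + eA x y * (X x * E' y))"
      unfolding b(2,3)[OF x xy(2)]
      using arg_cong[OF lift_eqs(1)[OF lam i, of x y], of "\<lambda>t. b * t"] arg_cong[OF lift_eqs(2)[OF lam i, of x y], of "\<lambda>t. b * t"]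
      by (simp_all add: algebra_simps)
    have fin: "\<bar>g\<bar> \<le> K" if "ew x y * g = - (1 / lam) * z" "\<bar>z\<bar> \<le> 6 * C * D * ew x y" for g z
    proof -
      have "ew x y * \<bar>g\<bar> = \<bar>z\<bar> / \<bar>lam\<bar>"
        using arg_cong[OF that(1), of abs] w by (simp add: abs_mult)
      also have "\<dots> \<le> 6 * C * D * ew x y / \<bar>lam\<bar>" using that(2) by (intro divide_right_mono) auto
      also have "\<dots> = ew x y * K" by (simp add: K_def)
      finally show ?thesis using w by simp
    qed
    show ?thesis
    proof (intro conjI fin[OF l(1)] fin[OF l(2)])
      show "\<bar>eA x y * (X' x * E y) - eB x y * (X x * E' y)\<bar> \<le> 6 * C * D * ew x y"
        "\<bar>eB x y * (X' x * E y) + eA x y * (X x * E' y)\<bar> \<le> 6 * C * D * ew x y"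
        using m[OF ab(1) gb(1)[OF x xy(2)]] m[OF ab(2) gb(2)[OF x xy(2)]] m[OF ab(2) gb(1)[OF x xy(2)]] m[OF ab(1) gb(2)[OF x xy(2)]]
        by linarith+
    qed
  qed
  have bound: "\<bar>b * lift1 lam i x y\<bar> \<le> K \<and> \<bar>b * lift2 lam i x y\<bar> \<le> K"
  proof (cases "x = 0")
    case True
    have lim: "\<bar>b * g 0 y\<bar> \<le> K" if g: "continuous_on UNIV (\<lambda>(x, y). g x y)" "\<And>x. x \<in> {0<..T} \<Longrightarrow> \<bar>b * g x y\<bar> \<le> K" for g :: "real \<Rightarrow> real \<Rightarrow> real"
    proof -
      have "continuous_on UNIV (\<lambda>x. g x y)"
      proof -
        have "continuous_on UNIV (\<lambda>x :: real. (x, y))" by (intro continuous_on_Pair continuous_on_id continuous_on_const)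
        from continuous_on_compose2[OF g(1) this] show ?thesis by simp
      qed
      then have "isCont (\<lambda>x. \<bar>b * g x y\<bar>) 0" by (auto simp: continuous_on_eq_continuous_at intro!: continuous_intros)
      then have "((\<lambda>x. \<bar>b * g x y\<bar>) \<longlongrightarrow> \<bar>b * g 0 y\<bar>) (at_right 0)"
        by (simp add: isCont_def filterlim_at_split)
      moreover have "\<forall>\<^sub>F x in at_right 0. \<bar>b * g x y\<bar> \<le> K"
        using g(2) T by (auto simp: eventually_at_right intro!: exI[of _ T])
      ultimately show ?thesis by (intro tendsto_upperbound) auto
    qed
    have "\<bar>b * lift1 lam i 0 y\<bar> \<le> K"
      by (rule lim[OF continuous_lift(1)[OF lam i] conjunct1[OF off[OF _ xy(2)]]])
    moreover have "\<bar>b * lift2 lam i 0 y\<bar> \<le> K"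
      by (rule lim[OF continuous_lift(2)[OF lam i] conjunct2[OF off[OF _ xy(2)]]])
    ultimately show ?thesis unfolding True by blast
  next
    case False
    then have "x \<in> {0<..T}" using xy(1) by simp
    then show ?thesis by (rule off[OF _ xy(2)])
  qed
  have "norm (b *\<^sub>R mlift lam i (x, y)) \<le> \<bar>b * zfun lam i x y\<bar> + \<bar>b * lift1 lam i x y\<bar> + \<bar>b * lift2 lam i x y\<bar>"
    unfolding mlift_def prod.case scaleR_qvec by (rule norm_qvec_le)
  also have "\<bar>b * zfun lam i x y\<bar> \<le> C * D"
    unfolding zfun_def b(1)[OF xy, symmetric] abs_mult using XB(1)[OF xy(1)] EB(1)[OF xy(2)] CD by (intro mult_mono) auto
  also have "C * D + \<bar>b * lift1 lam i x y\<bar> + \<bar>b * lift2 lam i x y\<bar> \<le> C * D + K + K"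
    using bound by simp
  also have "\<dots> = (1 + 12 / \<bar>lam\<bar>) * C * D" by (simp add: K_def algebra_simps)
  finally show ?thesis by simp
qed

text \<open>Quadratic growth in the shifted eigenvalue is crude for the first two functions; the
  third is the second derivative, for which the equation costs one further power. A single exponent
  keeps the later bound uniform.\<close>

lemma eigfun_bounds:
  "\<exists>K>0. \<forall>i\<in>eig_index q. \<forall>y\<in>circ. \<bar>eigfun q i y\<bar> \<le> K * (shift_ev q i)\<^sup>2 \<and> \<bar>eigfun' q i y\<bar> \<le> K * (shift_ev q i)\<^sup>2
     \<and> \<bar>(pot q y - shift_ev q i) * eigfun q i y\<bar> \<le> K * (shift_ev q i)\<^sup>2"
proof -
  define P where "P = 4 * \<bar>q\<bar> + 1"
  define K1 where "K1 = 4 * P\<^sup>2 + 6"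
  define K where "K = 2 * (P + 1) + sqrt K1"
  have K1: "K1 > 0" unfolding K1_def by (simp add: add_nonneg_pos)
  have P: "P \<ge> 1" by (simp add: P_def)
  have K: "K > 0" "2 \<le> K" "sqrt K1 \<le> K" "2 * (P + 1) \<le> K" using K1 P by (auto simp: K_def add_pos_pos)
  show ?thesis
  proof (intro exI[of _ K] conjI ballI K(1))
    fix i y assume i: "i \<in> eig_index q" and y: "y \<in> circ"
    define \<mu> where "\<mu> = shift_ev q i"
    have \<mu>: "\<mu> \<ge> 1" unfolding \<mu>_def by (rule shift_ev_ge_1[OF i])
    have \<mu>2: "\<mu> \<le> \<mu>\<^sup>2" using \<mu> by (simp add: power2_eq_square)
    have "(eigfun q i y)\<^sup>2 \<le> 2 * \<mu>" unfolding \<mu>_def by (rule eigfun_le[OF i y])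
    also have "\<dots> \<le> (2 * \<mu>)\<^sup>2" using \<mu> by (simp add: power2_eq_square)
    finally have e: "\<bar>eigfun q i y\<bar> \<le> 2 * \<mu>" using \<mu> unfolding abs_le_square_iff[symmetric] by simp
    have "2 * \<mu> \<le> K * \<mu>\<^sup>2" using K \<mu>2 \<mu> by (intro mult_mono) auto
    then show "\<bar>eigfun q i y\<bar> \<le> K * (shift_ev q i)\<^sup>2" using e unfolding \<mu>_def by linarith
    have "(eigfun' q i y)\<^sup>2 \<le> K1 * ip (\<lambda>x. \<mu> * eigfun q i x) (\<lambda>x. \<mu> * eigfun q i x)"
      unfolding K1_def P_def \<mu>_def by (rule per_sol_sup(2)[OF per_sol_eigfun[OF i] y])
    also have "\<dots> = (sqrt K1 * \<mu>)\<^sup>2"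
      using K1 by (simp add: ip_cmult eigfun_orthonormal[OF i i] power_mult_distrib power2_eq_square)
    finally have "\<bar>eigfun' q i y\<bar> \<le> sqrt K1 * \<mu>" using \<mu> K1 unfolding abs_le_square_iff[symmetric] by simp
    also have "\<dots> \<le> K * \<mu>\<^sup>2" using K \<mu>2 K1 \<mu> by (intro mult_mono) auto
    finally show "\<bar>eigfun' q i y\<bar> \<le> K * (shift_ev q i)\<^sup>2" unfolding \<mu>_def .
    have "\<bar>pot q y - \<mu>\<bar> \<le> P + \<mu>" using pot_bounds[where q = q and x = y] \<mu> unfolding P_def by linarith
    also have "\<dots> \<le> (P + 1) * \<mu>" using P \<mu> mult_left_mono[of 1 \<mu> P] by (simp add: algebra_simps)
    finally have "\<bar>(pot q y - \<mu>) * eigfun q i y\<bar> \<le> ((P + 1) * \<mu>) * (2 * \<mu>)"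
      unfolding abs_mult using e P \<mu> by (intro mult_mono) auto
    also have "\<dots> = 2 * (P + 1) * \<mu>\<^sup>2" by (simp add: power2_eq_square)
    also have "\<dots> \<le> K * \<mu>\<^sup>2" using K by (intro mult_right_mono) auto
    finally show "\<bar>(pot q y - shift_ev q i) * eigfun q i y\<bar> \<le> K * (shift_ev q i)\<^sup>2" unfolding \<mu>_def .
  qed
qed

lemma eigfun_deriv:
  assumes "i \<in> eig_index q" "y \<in> circ"
  shows "(eigfun q i has_real_derivative eigfun' q i y) (at y within circ)"
    "(eigfun' q i has_real_derivative (pot q y - shift_ev q i) * eigfun q i y) (at y within circ)"
  using per_sol_eigfun[OF assms(1)] assms(2) by (auto simp: per_sol_def algebra_simps)

abbreviation "efun lam k \<equiv> eigfun (mq lam) (eig_idx (mq lam) k)"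
abbreviation "efun' lam k \<equiv> eigfun' (mq lam) (eig_idx (mq lam) k)"
abbreviation "emu lam k \<equiv> shift_ev (mq lam) (eig_idx (mq lam) k)"

lemma continuous_efun: "continuous_on circ (efun lam k)" "continuous_on circ (efun' lam k)"
  using continuous_eigfun[OF eig_idx_in] by auto

lemma ip_efun: "ip (efun lam j) (efun lam k) = (if j = k then 1 else 0)"
proof -
  have "eig_idx (mq lam) j = eig_idx (mq lam) k \<longleftrightarrow> j = k"
    using eig_idx_bij[of "mq lam"] by (auto simp: bij_betw_def inj_def)
  then show ?thesis using eigfun_orthonormal[OF eig_idx_in[of "mq lam" j] eig_idx_in[of "mq lam" k]] by simp
qed

lemma ip_partial_sum_efun:
  "ip (\<lambda>y. \<Sum>k<N. c k * efun lam k y) (efun lam j) = (if j < N then c j else 0)"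
proof -
  have "ip (\<lambda>y. \<Sum>k<N. c k * efun lam k y) (efun lam j) = (\<Sum>k<N. c k * ip (efun lam k) (efun lam j))"
    by (intro ip_sum continuous_efun)
  also have "\<dots> = (\<Sum>k<N. if k = j then c j else 0)" by (intro sum.cong) (auto simp: ip_efun)
  finally show ?thesis by simp
qed

lemma Bessel_efun:
  assumes g: "continuous_on circ g"
  shows "ip (\<lambda>y. g y - (\<Sum>k<N. ip g (efun lam k) * efun lam k y)) (\<lambda>y. g y - (\<Sum>k<N. ip g (efun lam k) * efun lam k y)) \<le> ip g g"
proof -
  define S where "S y = (\<Sum>k<N. ip g (efun lam k) * efun lam k y)" for y
  have cS: "continuous_on circ S" unfolding S_def[abs_def] by (intro continuous_intros continuous_efun)
  have "ip S h = (\<Sum>k<N. ip g (efun lam k) * ip (efun lam k) h)" if "continuous_on circ h" for h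
    unfolding S_def[abs_def] by (intro ip_sum continuous_efun that)
  note Sh = this
  have "ip (efun lam k) S = ip g (efun lam k)" if "k < N" for k
    using ip_partial_sum_efun[of "\<lambda>k. ip g (efun lam k)" lam N k] that ip_commute[of "efun lam k" S]
    unfolding S_def[abs_def, symmetric] by simp
  then have "ip S S = (\<Sum>k<N. ip g (efun lam k) * ip g (efun lam k))" unfolding Sh[OF cS] by simp
  also have "\<dots> = ip S g" unfolding Sh[OF g] by (intro sum.cong refl arg_cong2[of _ _ _ _ "(*)"] ip_commute)
  finally have SS: "ip S S = ip S g" .
  have "ip (\<lambda>y. 1 * g y + - 1 * S y) (\<lambda>y. 1 * g y + - 1 * S y) = ip g g - ip S S"
    using ip_square[OF g cS, of 1 "-1"] SS ip_commute[of g S] by simp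
  then show ?thesis using ip_nonneg[of S] by (simp add: S_def)
qed

section \<open>Decay of the coefficients and uniform convergence of the lifted series\<close>

context ell_solution
begin

text \<open>Lifts are built from the base solution with fixed initial data, Fourier coefficients
  from the normalized one, hence the division by the norm.\<close>

definition "bco k = (let i = eig_idx (mq lam) k in (if fst i = 1 then coef i 0 else coef' i 0) / ang_norm (mq lam) i)"

abbreviation "cf k \<equiv> coef (eig_idx (mq lam) k)"
abbreviation "cf' k \<equiv> coef' (eig_idx (mq lam) k)"

lemma bco_products:
  fixes k
  defines "i \<equiv> eig_idx (mq lam) k"
  assumes x: "x \<in> {0..<\<xi>0}"
  shows "cf k x * efun lam k y = bco k * (rad (fst i) (snd i) (mq lam) x * ang (fst i) (snd i) (mq lam) y)"
    "cf' k x * efun lam k y = bco k * (rad' (fst i) (snd i) (mq lam) x * ang (fst i) (snd i) (mq lam) y)"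
    "cf k x * efun' lam k y = bco k * (rad (fst i) (snd i) (mq lam) x * ang' (fst i) (snd i) (mq lam) y)"
  unfolding coef_eq[OF eig_idx_in x, of k] bco_def Let_def i_def eigfun_def eigfun'_def by simp_all

text \<open>A coefficient is bounded up to \<open>T\<close> > \<open>\<xi>1\<close> by the size of
  u, yet grows from \<open>\<xi>1\<close> to \<open>T\<close> by any power of the eigenvalue; so it
  is small up to \<open>\<xi>1\<close>. For large eigenvalues the coefficient function of the radial
  equation lies between mu / 2 and mu, and the product of coefficient and derivative vanishes at 0,
  as the growth lemma requires.\<close>

lemma coef_decay:
  assumes \<xi>1: "0 < \<xi>1" "\<xi>1 < \<xi>0"
  shows "\<exists>K L. \<forall>k. emu lam k \<ge> L \<longrightarrow> (\<forall>x\<in>{0..\<xi>1}. \<bar>cf k x\<bar> \<le> K / emu lam k ^ 3 \<and> \<bar>cf' k x\<bar> \<le> K / emu lam k ^ 3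
    \<and> \<bar>(snd (eig_idx (mq lam) k) - 2 * mq lam * cosh (2 * x)) * cf k x\<bar> \<le> K / emu lam k ^ 3)"
proof -
  define q where "q = mq lam"
  have q: "q \<ge> 0" by (simp add: q_def)
  define T where "T = (\<xi>1 + \<xi>0) / 2"
  \<comment> \<open>One step passes from the value and derivative at x to the value at x + h; eight
    further steps gain mu^8 in the square, thus mu^4 in modulus. Of this the second derivative
    consumes one power.\<close>
  define h where "h = (T - \<xi>1) / 9"
  have T: "\<xi>1 < T" "T < \<xi>0" "0 < T" using \<xi>1 by (auto simp: T_def)
  have h: "h > 0" using T by (simp add: h_def)
  define P where "P = 2 * q * cosh (2 * T) + (2 * \<bar>q\<bar> + 1)"
  have P0: "P \<ge> 0" using q by (simp add: P_def)
  have "compact ({0..T} \<times> circ)" by (intro compact_Times) auto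
  moreover have "continuous_on ({0..T} \<times> circ) (\<lambda>(x, y). u x y)"
    by (rule continuous_on_subset[OF cont(1)]) (use T in \<open>auto simp: ell_rect_def\<close>)
  ultimately have "bounded ((\<lambda>(x, y). u x y) ` ({0..T} \<times> circ))"
    by (intro compact_imp_bounded compact_continuous_image)
  then obtain B0 where B0: "\<And>x y. x \<in> {0..T} \<Longrightarrow> y \<in> circ \<Longrightarrow> \<bar>u x y\<bar> \<le> B0"
    unfolding bounded_iff by fastforce
  define B where "B = 2 * pi * B0\<^sup>2"
  have B: "(cf k x)\<^sup>2 \<le> B" if x: "x \<in> {0..T}" for k x
  proof -
    have x': "x \<in> {0..<\<xi>0}" using x T by auto
    have "(cf k x)\<^sup>2 \<le> ip (u x) (u x) * ip (efun lam k) (efun lam k)"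
      unfolding coef_def by (rule ip_Cauchy_Schwarz[OF sections(1)[OF x'] continuous_efun(1)])
    also have "\<dots> = ip (u x) (u x)" by (simp add: ip_efun)
    also have "\<dots> \<le> ip (\<lambda>_. B0) (\<lambda>_. B0)"
    proof (rule ip_mono)
      fix y assume "y \<in> circ"
      then have "\<bar>u x y\<bar> * \<bar>u x y\<bar> \<le> B0 * B0" using B0[OF x] by (intro mult_mono) (auto intro: order_trans[OF abs_ge_zero])
      then show "u x y * u x y \<le> B0 * B0" by (simp flip: abs_mult)
    qed (use sections(1)[OF x'] in auto)
    also have "\<dots> = B" by (simp add: ip_def B_def power2_eq_square)
    finally show ?thesis .
  qed
  have B00: "B \<ge> 0" by (simp add: B_def)
  define K1 where "K1 = sqrt (B * (2 / h\<^sup>2) ^ 8)"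
  have K1: "K1 \<ge> 0" "K1\<^sup>2 = B * (2 / h\<^sup>2) ^ 8" using B00 by (auto simp: K1_def)
  define K where "K = K1 * (1 + 2 / h)"
  have KK: "K1 \<le> K" "K1 * (2 / h) \<le> K" using K1 h by (auto simp: K_def algebra_simps)
  show ?thesis
  proof (rule exI[of _ K], rule exI[of _ "max 1 (2 * P)"], intro allI impI ballI conjI)
    fix k x assume \<mu>L: "max 1 (2 * P) \<le> emu lam k" and x: "x \<in> {0..\<xi>1}"
    define i where "i = eig_idx (mq lam) k"
    define \<mu> where "\<mu> = emu lam k"
    have i: "i \<in> eig_index (mq lam)" unfolding i_def by (rule eig_idx_in)
    have \<mu>: "\<mu> \<ge> 1" "\<mu> \<ge> 2 * P" using \<mu>L by (auto simp: \<mu>_def)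
    define p where "p x = snd i - 2 * mq lam * cosh (2 * x)" for x
    have p: "\<mu> / 2 \<le> p t \<and> p t \<le> \<mu>" if t: "t \<in> {0..T}" for t
    proof -
      have "cosh (2 * t) \<le> cosh (2 * T)" using t by (subst cosh_real_nonneg_le_iff) auto
      then have "2 * q * cosh (2 * t) \<le> 2 * q * cosh (2 * T)" using q by (intro mult_left_mono) auto
      moreover have "0 \<le> 2 * q * cosh (2 * t)" using q by simp
      moreover have "p t = \<mu> - (2 * \<bar>q\<bar> + 1) - 2 * q * cosh (2 * t)" by (simp add: p_def \<mu>_def i_def shift_ev_def q_def)
      moreover define Z ZT C where "Z = 2 * q * cosh (2 * t)" and "ZT = 2 * q * cosh (2 * T)" and "C = 2 * \<bar>q\<bar> + 1"
      moreover have "C \<ge> 0" by (simp add: C_def)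
      ultimately have "Z \<le> ZT" "0 \<le> Z" "p t = \<mu> - C - Z" "C \<ge> 0" "2 * (ZT + C) \<le> \<mu>"
        using \<mu>(2) unfolding P_def by blast+
      then show ?thesis by (intro conjI) (simp_all add: field_simps)
    qed
    have d: "(cf k has_real_derivative cf' k t) (at t within {0..T})" "(cf' k has_real_derivative p t * cf k t) (at t within {0..T})"
      if "t \<in> {0..T}" for t
      using coef_derivs[OF i, of t] T that unfolding p_def i_def[symmetric]
      by (auto intro: DERIV_subset[where s = "{0..<\<xi>0}"])
    have ini: "0 \<le> cf k 0 * cf' k 0"
      using coef_at_0[OF i] unfolding i_def by (cases "fst (eig_idx (mq lam) k) = 1") auto
    have x9: "x + h + 8 * h \<le> T" "0 \<le> x + h" "x + h \<le> T" "x \<in> {0..T}"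
    proof -
      have "9 * h = T - \<xi>1" by (simp add: h_def)
      moreover have "0 \<le> x" "x \<le> \<xi>1" using x by auto
      ultimately show "x + h + 8 * h \<le> T" "0 \<le> x + h" "x + h \<le> T" "x \<in> {0..T}"
        using h T unfolding atLeastAtMost_iff by linarith+
    qed
    have "(cf k (x + h))\<^sup>2 * (\<mu> / 2 * h\<^sup>2) ^ 8 \<le> (cf k (x + h + real 8 * h))\<^sup>2"
      by (rule linear_ode_growth_iterate[OF d(1) d(2) _ _ ini]) (use p \<mu> x9 h in auto)
    also have "\<dots> \<le> B" by (rule B) (use x9 h in auto)
    finally have "(cf k (x + h))\<^sup>2 * (\<mu> / 2 * h\<^sup>2) ^ 8 \<le> B" .
    moreover have pos: "(\<mu> / 2 * h\<^sup>2) ^ 8 > 0" using \<mu> h by simp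
    ultimately have "(cf k (x + h))\<^sup>2 \<le> B / (\<mu> / 2 * h\<^sup>2) ^ 8" by (simp add: pos_le_divide_eq)
    also have "\<dots> = (K1 / \<mu> ^ 4)\<^sup>2"
      unfolding power_divide K1(2) using h \<mu> by (simp add: field_simps flip: power_mult)
    finally have a: "\<bar>cf k (x + h)\<bar> \<le> K1 / \<mu> ^ 4"
      using K1(1) \<mu> unfolding abs_le_square_iff[symmetric] by simp
    have "(cf k x)\<^sup>2 * 1 \<le> (cf k x)\<^sup>2 * (1 + \<mu> / 2 * h\<^sup>2)" using \<mu> by (intro mult_left_mono) auto
    also have "\<dots> \<le> (cf k (x + h))\<^sup>2"
      by (rule linear_ode_growth(1)[OF d(1) d(2) _ _ ini]) (use p \<mu> x9 h x in auto)
    finally have "\<bar>cf k x\<bar> \<le> \<bar>cf k (x + h)\<bar>" by (simp add: abs_le_square_iff)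
    then have a0: "\<bar>cf k x\<bar> \<le> K1 / \<mu> ^ 4" using a by linarith
    have "(cf' k x)\<^sup>2 * h\<^sup>2 \<le> 4 * (cf k (x + h))\<^sup>2"
      by (rule linear_ode_growth(2)[OF d(1) d(2) _ _ ini, of "\<mu> / 2"]) (use p \<mu> x9 h x in auto)
    then have "(cf' k x * h)\<^sup>2 \<le> (2 * cf k (x + h))\<^sup>2" by (simp add: power_mult_distrib)
    then have "\<bar>cf' k x\<bar> * h \<le> 2 * \<bar>cf k (x + h)\<bar>" using h unfolding abs_le_square_iff[symmetric] abs_mult by simp
    also have "\<dots> \<le> 2 * (K1 / \<mu> ^ 4)" using a by simp
    finally have "\<bar>cf' k x\<bar> \<le> 2 * (K1 / \<mu> ^ 4) / h" unfolding pos_le_divide_eq[OF h] .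
    also have "\<dots> = (K1 * (2 / h)) / \<mu> ^ 4" by (simp add: mult_ac)
    finally have a1: "\<bar>cf' k x\<bar> \<le> (K1 * (2 / h)) / \<mu> ^ 4" .
    have \<mu>4: "Z / \<mu> ^ 4 \<le> K / \<mu> ^ 3" if "Z \<le> K" for Z
    proof -
      have "0 \<le> K" using KK K1 by linarith
      have "Z / \<mu> ^ 4 \<le> K / \<mu> ^ 4" using that \<mu> by (intro divide_right_mono) auto
      also have "\<dots> \<le> K / \<mu> ^ 3"
        using \<mu> \<open>0 \<le> K\<close> by (intro divide_left_mono power_increasing mult_pos_pos) auto
      finally show ?thesis .
    qed
    show "\<bar>cf k x\<bar> \<le> K / emu lam k ^ 3" using order_trans[OF a0 \<mu>4[OF KK(1)]] unfolding \<mu>_def .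
    show "\<bar>cf' k x\<bar> \<le> K / emu lam k ^ 3" using order_trans[OF a1 \<mu>4[OF KK(2)]] unfolding \<mu>_def .
    have "\<bar>p x * cf k x\<bar> \<le> \<mu> * (K1 / \<mu> ^ 4)"
      unfolding abs_mult using p[OF x9(4)] a0 \<mu> by (intro mult_mono) auto
    also have "\<dots> = K1 / \<mu> ^ 3" using \<mu> by (simp add: field_simps power_numeral_reduce)
    also have "\<dots> \<le> K / \<mu> ^ 3" using KK \<mu> by (intro divide_right_mono) auto
    finally show "\<bar>(snd (eig_idx (mq lam) k) - 2 * mq lam * cosh (2 * x)) * cf k x\<bar> \<le> K / emu lam k ^ 3"
      unfolding p_def i_def \<mu>_def .
  qed
qed

definition "SN N p = (\<Sum>k<N. bco k *\<^sub>R mlift lam (eig_idx (mq lam) k) p)"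

text \<open>Coefficients of size mu^-3 against angular factors of size mu^2 leave a multiple of 1 /
  mu, summable by the trace bound, so the Weierstrass test applies. Only the existence of a limit is
  claimed; it is identified separately.\<close>

lemma SN_converges:
  assumes \<xi>1: "0 < \<xi>1" "\<xi>1 < \<xi>0"
  shows "\<exists>F. uniform_limit ({0..\<xi>1} \<times> circ) SN F sequentially"
proof -
  obtain K L where KL: "\<And>k x. emu lam k \<ge> L \<Longrightarrow> x \<in> {0..\<xi>1} \<Longrightarrow> \<bar>cf k x\<bar> \<le> K / emu lam k ^ 3 \<and> \<bar>cf' k x\<bar> \<le> K / emu lam k ^ 3
    \<and> \<bar>(snd (eig_idx (mq lam) k) - 2 * mq lam * cosh (2 * x)) * cf k x\<bar> \<le> K / emu lam k ^ 3"
    using coef_decay[OF \<xi>1] by blast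
  obtain D where D: "\<And>i y. i \<in> eig_index (mq lam) \<Longrightarrow> y \<in> circ \<Longrightarrow> \<bar>eigfun (mq lam) i y\<bar> \<le> D * (shift_ev (mq lam) i)\<^sup>2
      \<and> \<bar>eigfun' (mq lam) i y\<bar> \<le> D * (shift_ev (mq lam) i)\<^sup>2
      \<and> \<bar>(pot (mq lam) y - shift_ev (mq lam) i) * eigfun (mq lam) i y\<bar> \<le> D * (shift_ev (mq lam) i)\<^sup>2"
    using eigfun_bounds by blast
  define M where "M k = (1 + 12 / \<bar>lam\<bar>) * K * D * (1 / emu lam k)" for k
  have "summable M" unfolding M_def by (intro summable_mult summable_inverse_shift_ev)
  moreover have "\<forall>\<^sub>F k in sequentially. \<forall>p\<in>{0..\<xi>1} \<times> circ. norm (bco k *\<^sub>R mlift lam (eig_idx (mq lam) k) p) \<le> M k"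
  proof -
    have "\<forall>\<^sub>F k in sequentially. emu lam k \<ge> L"
    proof -
      have "(\<lambda>k. 1 / emu lam k) \<longlonglongrightarrow> 0" by (rule summable_LIMSEQ_zero[OF summable_inverse_shift_ev])
      then have "\<forall>\<^sub>F k in sequentially. 1 / emu lam k < 1 / max 1 L" by (rule order_tendstoD) simp
      then show ?thesis
      proof eventually_elim
        case (elim k)
        then have "max 1 L < emu lam k" using shift_ev_ge_1[OF eig_idx_in, of "mq lam" k] by (simp add: field_simps)
        then show ?case by simp
      qed
    qed
    then show ?thesis
    proof eventually_elim
      case (elim k)
      show ?case
      proof
        fix p assume p: "p \<in> {0..\<xi>1} \<times> circ"
        obtain x y where xy: "p = (x, y)" "x \<in> {0..\<xi>1}" "y \<in> circ" using p by auto
        define i where "i = eig_idx (mq lam) k"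
        have i: "i \<in> eig_index (mq lam)" unfolding i_def by (rule eig_idx_in)
        have sub: "t \<in> {0..<\<xi>0}" if "t \<in> {0..\<xi>1}" for t using that \<xi>1 by auto
        have d: "(cf k has_real_derivative cf' k t) (at t within {0..\<xi>1})"
          "(cf' k has_real_derivative (snd i - 2 * mq lam * cosh (2 * t)) * cf k t) (at t within {0..\<xi>1})"
          if "t \<in> {0..\<xi>1}" for t
          using coef_derivs[OF i sub[OF that]] \<xi>1 unfolding i_def by (auto intro: DERIV_subset[where s = "{0..<\<xi>0}"])
        have "norm (bco k *\<^sub>R mlift lam i (x, y)) \<le> (1 + 12 / \<bar>lam\<bar>) * (K / emu lam k ^ 3) * (D * (emu lam k)\<^sup>2)"
        proof (rule mlift_bound[OF lam i \<xi>1(1) d(1) d(2)])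
          fix t assume t: "t \<in> {0..\<xi>1}"
          show "\<bar>cf k t\<bar> \<le> K / emu lam k ^ 3" "\<bar>cf' k t\<bar> \<le> K / emu lam k ^ 3"
            "\<bar>(snd i - 2 * mq lam * cosh (2 * t)) * cf k t\<bar> \<le> K / emu lam k ^ 3" using KL[OF elim t] by (auto simp: i_def)
        next
          fix y assume y: "y \<in> circ"
          show "(efun lam k has_real_derivative efun' lam k y) (at y within circ)"
            "(efun' lam k has_real_derivative (pot (mq lam) y - emu lam k) * efun lam k y) (at y within circ)"
            using eigfun_deriv[OF i y] by (auto simp: i_def)
          show "\<bar>efun lam k y\<bar> \<le> D * (emu lam k)\<^sup>2" "\<bar>efun' lam k y\<bar> \<le> D * (emu lam k)\<^sup>2"
            "\<bar>(pot (mq lam) y - emu lam k) * efun lam k y\<bar> \<le> D * (emu lam k)\<^sup>2" using D[OF i y] by (auto simp: i_def)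
        next
          fix t y assume t: "t \<in> {0..\<xi>1}" and y: "y \<in> circ"
          show "cf k t * efun lam k y = bco k * (rad (fst i) (snd i) (mq lam) t * ang (fst i) (snd i) (mq lam) y)"
            "cf' k t * efun lam k y = bco k * (rad' (fst i) (snd i) (mq lam) t * ang (fst i) (snd i) (mq lam) y)"
            "cf k t * efun' lam k y = bco k * (rad (fst i) (snd i) (mq lam) t * ang' (fst i) (snd i) (mq lam) y)"
            unfolding i_def by (rule bco_products[OF sub[OF t]])+
        qed (use xy in auto)
        also have "\<dots> = M k"
          using shift_ev_ge_1[OF eig_idx_in, of "mq lam" k] by (simp add: M_def field_simps power_numeral_reduce)
        finally show "norm (bco k *\<^sub>R mlift lam (eig_idx (mq lam) k) p) \<le> M k" unfolding xy i_def .
      qed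
    qed
  qed
  ultimately show ?thesis unfolding SN_def[abs_def] by (intro exI) (rule Weierstrass_m_test_ev[rotated])
qed

lemma SN_components:
  assumes "x \<in> {0..<\<xi>0}"
  shows "fst (SN N (x, y)) = (\<Sum>k<N. cf k x * efun lam k y)"
    "- lam * (eA x y * snd (SN N (x, y)) $ 1 + eB x y * snd (SN N (x, y)) $ 2) = (\<Sum>k<N. cf' k x * efun lam k y)"
    "lam * (eB x y * snd (SN N (x, y)) $ 1 - eA x y * snd (SN N (x, y)) $ 2) = (\<Sum>k<N. cf k x * efun' lam k y)"
    "snd (SN N (x, y)) $ 3 = 0"
proof -
  have c: "fst (SN N (x, y)) = (\<Sum>k<N. bco k * zfun lam (eig_idx (mq lam) k) x y)"
    "snd (SN N (x, y)) $ 1 = (\<Sum>k<N. bco k * lift1 lam (eig_idx (mq lam) k) x y)"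
    "snd (SN N (x, y)) $ 2 = (\<Sum>k<N. bco k * lift2 lam (eig_idx (mq lam) k) x y)"
    "snd (SN N (x, y)) $ 3 = 0"
    unfolding SN_def mlift_def by (simp_all add: fst_sum snd_sum sum_component)
  show "snd (SN N (x, y)) $ 3 = 0" by (rule c(4))
  show "fst (SN N (x, y)) = (\<Sum>k<N. cf k x * efun lam k y)"
    unfolding c zfun_def bco_products[OF assms] ..
  have e: "rad' (fst i) (snd i) (mq lam) x * ang (fst i) (snd i) (mq lam) y = - lam * (eA x y * lift1 lam i x y + eB x y * lift2 lam i x y)"
    "rad (fst i) (snd i) (mq lam) x * ang' (fst i) (snd i) (mq lam) y = lam * (eB x y * lift1 lam i x y - eA x y * lift2 lam i x y)"
    if "i \<in> eig_index (mq lam)" for i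
    using is_lift[OF lam that] unfolding is_lift_def by blast+
  show "- lam * (eA x y * snd (SN N (x, y)) $ 1 + eB x y * snd (SN N (x, y)) $ 2) = (\<Sum>k<N. cf' k x * efun lam k y)"
    unfolding c bco_products[OF assms] e(1)[OF eig_idx_in]
    by (simp add: sum_distrib_left sum.distrib[symmetric] sum_negf[symmetric] algebra_simps)
  show "lam * (eB x y * snd (SN N (x, y)) $ 1 - eA x y * snd (SN N (x, y)) $ 2) = (\<Sum>k<N. cf k x * efun' lam k y)"
    unfolding c bco_products[OF assms] e(2)[OF eig_idx_in]
    by (simp add: sum_distrib_left sum_subtractf[symmetric] algebra_simps)
qed

text \<open>As <v, e_k> = mu_k <u, e_k>, the partial sum of \<open>u\<close> is the resolvent image
  of the partial sum of \<open>v\<close>, so the remainder of \<open>u\<close> is the image of the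
  remainder \<open>w\<close> of \<open>v\<close>. The last bound is Bessel's inequality for the
  energy form: the sum of mu_k c_k^2 is what is subtracted from <v, u>.\<close>

lemma remainder:
  assumes x: "x \<in> {0..<\<xi>0}"
  obtains w where
    "per_sol (mq lam) w (\<lambda>y. u x y - (\<Sum>k<N. cf k x * efun lam k y)) (\<lambda>y. uy x y - (\<Sum>k<N. cf k x * efun' lam k y))"
    "\<And>k. k < N \<Longrightarrow> ip w (efun lam k) = 0"
    "ip w w \<le> ip (\<lambda>y. pot (mq lam) y * u x y - uyy x y) (\<lambda>y. pot (mq lam) y * u x y - uyy x y)"
    "ip w (\<lambda>y. u x y - (\<Sum>k<N. cf k x * efun lam k y)) \<le> ip (\<lambda>y. pot (mq lam) y * u x y - uyy x y) (u x)"
proof -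
  define v where "v y = pot (mq lam) y * u x y - uyy x y" for y
  have sol: "per_sol (mq lam) v (u x) (uy x)" unfolding v_def[abs_def] by (rule per_sol_u[OF x])
  have cv: "continuous_on circ v" by (rule per_sol_continuous(1)[OF sol])
  have cu: "continuous_on circ (u x)" by (rule sections(1)[OF x])
  have ve: "ip v (efun lam k) = emu lam k * cf k x" for k
    using per_sol_symmetric[OF sol per_sol_eigfun[OF eig_idx_in]] by (simp add: ip_cmult coef_def)
  define w where "w y = v y - (\<Sum>k<N. ip v (efun lam k) * efun lam k y)" for y
  have "per_sol (mq lam) (\<lambda>y. \<Sum>k<N. cf k x * (emu lam k * efun lam k y)) (\<lambda>y. \<Sum>k<N. cf k x * efun lam k y)
      (\<lambda>y. \<Sum>k<N. cf k x * efun' lam k y)"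
    by (intro per_sol_sum per_sol_eigfun eig_idx_in) auto
  from per_sol_lin[OF sol this, of 1 "-1"]
  have s: "per_sol (mq lam) w (\<lambda>y. u x y - (\<Sum>k<N. cf k x * efun lam k y)) (\<lambda>y. uy x y - (\<Sum>k<N. cf k x * efun' lam k y))"
    by (simp add: w_def[abs_def] ve mult_ac)
  have cw: "continuous_on circ w" by (rule per_sol_continuous(1)[OF s])
  have cS: "continuous_on circ (\<lambda>y. \<Sum>k<N. c k * efun lam k y)" for c by (intro continuous_intros continuous_efun)
  have orth: "ip w (efun lam k) = 0" if "k < N" for k
    using ip_lin[OF cv cS continuous_efun(1), of 1 "-1"] that
    by (simp add: w_def[abs_def] ip_partial_sum_efun)
  have "ip w (\<lambda>y. u x y - (\<Sum>k<N. cf k x * efun lam k y)) = ip w (u x) - (\<Sum>k<N. cf k x * ip w (efun lam k))"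
  proof -
    have "ip (\<lambda>y. 1 * u x y + - 1 * (\<Sum>k<N. cf k x * efun lam k y)) w
        = 1 * ip (u x) w + - 1 * ip (\<lambda>y. \<Sum>k<N. cf k x * efun lam k y) w"
      by (rule ip_lin[OF cu cS cw])
    moreover have "ip (\<lambda>y. \<Sum>k<N. cf k x * efun lam k y) w = (\<Sum>k<N. cf k x * ip (efun lam k) w)"
      by (intro ip_sum continuous_efun cw)
    ultimately show ?thesis by (simp add: ip_commute[of w])
  qed
  also have "\<dots> = ip w (u x)" by (simp add: orth)
  also have "\<dots> = ip v (u x) - (\<Sum>k<N. emu lam k * cf k x * cf k x)"
  proof -
    have "ip w (u x) = 1 * ip v (u x) + - 1 * ip (\<lambda>y. \<Sum>k<N. ip v (efun lam k) * efun lam k y) (u x)"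
      unfolding w_def[abs_def] using ip_lin[OF cv cS cu, of 1 "-1"] by simp
    also have "ip (\<lambda>y. \<Sum>k<N. ip v (efun lam k) * efun lam k y) (u x) = (\<Sum>k<N. ip v (efun lam k) * ip (efun lam k) (u x))"
      by (intro ip_sum continuous_efun cu)
    finally show ?thesis by (simp add: ve coef_def ip_commute[of _ "u x"])
  qed
  also have "\<dots> \<le> ip v (u x)"
  proof -
    have "0 \<le> (\<Sum>k<N. emu lam k * cf k x * cf k x)"
    proof (rule sum_nonneg)
      fix k
      have "0 \<le> emu lam k" using shift_ev_ge_1[OF eig_idx_in, of "mq lam" k] by linarith
      then show "0 \<le> emu lam k * cf k x * cf k x" by (simp add: mult.assoc)
    qed
    then show ?thesis by simp
  qed
  finally have e: "ip w (\<lambda>y. u x y - (\<Sum>k<N. cf k x * efun lam k y)) \<le> ip v (u x)" .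
  have ww: "ip w w \<le> ip v v" unfolding w_def by (rule Bessel_efun[OF cv])
  show thesis by (rule that[OF s orth ww[unfolded v_def] e[unfolded v_def]])
qed

text \<open>Once \<open>N\<close> exceeds all positions with shifted eigenvalue below L, the
  remainder of v is orthogonal to those eigenfunctions, and the resolvent gains a factor 1 / L^2 in
  the squared norm.\<close>

lemma L2_expansion:
  assumes x: "x \<in> {0..<\<xi>0}"
  shows "(\<lambda>N. ip (\<lambda>y. u x y - (\<Sum>k<N. cf k x * efun lam k y)) (\<lambda>y. u x y - (\<Sum>k<N. cf k x * efun lam k y))) \<longlonglongrightarrow> 0"
proof (rule LIMSEQ_I)
  fix r :: real assume r: "r > 0"
  define V where "V = ip (\<lambda>y. pot (mq lam) y * u x y - uyy x y) (\<lambda>y. pot (mq lam) y * u x y - uyy x y)"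
  have V0: "V \<ge> 0" unfolding V_def by (rule ip_nonneg)
  \<comment> \<open>Since L \<ge> 1, bounding the squared norm by V / L is enough, and V < L
    r.\<close>
  define L where "L = 1 + V / r"
  have L: "L \<ge> 1" using r V0 by (simp add: L_def)
  have "finite {k. emu lam k < L}"
  proof -
    have "inj (eig_idx (mq lam))" using eig_idx_bij by (auto simp: bij_betw_def)
    then have "finite (eig_idx (mq lam) -` {i \<in> eig_index (mq lam). shift_ev (mq lam) i \<le> L})"
      by (intro finite_vimageI finite_eig_index)
    then show ?thesis by (rule rev_finite_subset) (use eig_idx_in in auto)
  qed
  then obtain N0 where N0: "\<And>k. emu lam k < L \<Longrightarrow> k < N0" using finite_nat_set_iff_bounded by auto
  have "norm (ip (\<lambda>y. u x y - (\<Sum>k<N. cf k x * efun lam k y)) (\<lambda>y. u x y - (\<Sum>k<N. cf k x * efun lam k y)) - 0) < r"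
    if N: "N \<ge> N0" for N
  proof -
    define g where "g y = u x y - (\<Sum>k<N. cf k x * efun lam k y)" for y
    obtain w where w: "per_sol (mq lam) w g (\<lambda>y. uy x y - (\<Sum>k<N. cf k x * efun' lam k y))"
      "\<And>k. k < N \<Longrightarrow> ip w (efun lam k) = 0" "ip w w \<le> V"
      using remainder[OF x, of N] unfolding g_def[abs_def] V_def by blast
    have "L\<^sup>2 * ip g g \<le> ip w w"
    proof (rule eigfun_complete[where F = "eig_idx (mq lam) ` {..<N}"])
      show "i \<in> eig_idx (mq lam) ` {..<N}" if i: "i \<in> eig_index (mq lam)" "shift_ev (mq lam) i < L" for i
      proof -
        obtain k where k: "i = eig_idx (mq lam) k" using i(1) eig_idx_bij[of "mq lam"] unfolding bij_betw_def by blast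
        then show ?thesis using N0[of k] i(2) N by auto
      qed
      show "eig_idx (mq lam) ` {..<N} \<subseteq> eig_index (mq lam)" by (rule image_subsetI) (rule eig_idx_in)
      show "per_sol (mq lam) w g (\<lambda>y. uy x y - (\<Sum>k<N. cf k x * efun' lam k y))" by (rule w(1))
    qed (use w(2) L in auto)
    then have "L\<^sup>2 * ip g g \<le> V" using w(3) by linarith
    moreover have "L * 1 * ip g g \<le> L\<^sup>2 * ip g g"
      unfolding power2_eq_square using L ip_nonneg[of g] by (intro mult_right_mono mult_left_mono) auto
    ultimately have "L * ip g g \<le> V" by simp
    also have "V < L * r" using r V0 by (simp add: L_def field_simps)
    finally have "ip g g < r" using L by simp
    then show ?thesis using ip_nonneg[of g] unfolding g_def[abs_def] by simp
  qed
  then show "\<exists>no. \<forall>N\<ge>no. norm (ip (\<lambda>y. u x y - (\<Sum>k<N. cf k x * efun lam k y)) (\<lambda>y. u x y - (\<Sum>k<N. cf k x * efun lam k y)) - 0) < r"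
    by blast
qed

end

section \<open>Identification of the uniform limit\<close>

lemma uniform_limit_Lipschitz:
  fixes f :: "nat \<Rightarrow> 'a \<Rightarrow> 'b::real_normed_vector" and g :: "nat \<Rightarrow> 'a \<Rightarrow> 'c::real_normed_vector"
  assumes "uniform_limit X f l sequentially"
    and "\<And>n x. x \<in> X \<Longrightarrow> norm (g n x - h x) \<le> K * norm (f n x - l x)"
  shows "uniform_limit X g h sequentially"
proof (rule uniform_limitI)
  fix e :: real assume e: "e > 0"
  define K' where "K' = max K 1"
  have K': "K' > 0" "K \<le> K'" by (auto simp: K'_def)
  have "\<forall>\<^sub>F n in sequentially. \<forall>x\<in>X. dist (f n x) (l x) < e / K'"
    using e K' by (intro uniform_limitD[OF assms(1)]) simp
  then show "\<forall>\<^sub>F n in sequentially. \<forall>x\<in>X. dist (g n x) (h x) < e"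
  proof eventually_elim
    case (elim n)
    show ?case
    proof
      fix x assume x: "x \<in> X"
      have "norm (g n x - h x) \<le> K' * norm (f n x - l x)"
        using assms(2)[OF x, of n] mult_right_mono[OF K'(2) norm_ge_zero[of "f n x - l x"]] by linarith
      also have "\<dots> < e" using elim x K' by (simp add: dist_norm field_simps)
      finally show "dist (g n x) (h x) < e" by (simp add: dist_norm)
    qed
  qed
qed

lemma eAB_bounds:
  assumes "0 \<le> x" "x \<le> T"
  shows "\<bar>eA x y\<bar> \<le> cosh T" "\<bar>eB x y\<bar> \<le> cosh T" "ew x y \<le> (cosh T)\<^sup>2"
proof -
  have c: "cosh x \<le> cosh T" using assms by (subst cosh_real_nonneg_le_iff) auto
  have s: "\<bar>sinh x\<bar> \<le> cosh x" using assms sinh_less_cosh_real[of x] by (simp add: less_imp_le)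
  have "\<bar>eA x y\<bar> \<le> cosh x * 1" unfolding eA_def abs_mult using s by (intro mult_mono) auto
  then show "\<bar>eA x y\<bar> \<le> cosh T" using c by simp
  have "\<bar>eB x y\<bar> \<le> cosh x * 1" unfolding eB_def abs_mult by (intro mult_mono) auto
  then show "\<bar>eB x y\<bar> \<le> cosh T" using c by simp
  have "(sin y)\<^sup>2 \<le> 1" using abs_sin_le_one[of y] by (simp add: abs_square_le_1)
  then have "ew x y \<le> (cosh x)\<^sup>2" unfolding ew_eq(1) cosh_square_eq by simp
  also have "\<dots> \<le> (cosh T)\<^sup>2" using c by (intro power_mono) auto
  finally show "ew x y \<le> (cosh T)\<^sup>2" .
qed

lemma norm_quat_square: "(norm (z :: quat))\<^sup>2 = (fst z)\<^sup>2 + (snd z $ 1)\<^sup>2 + (snd z $ 2)\<^sup>2 + (snd z $ 3)\<^sup>2"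
proof -
  have "(norm z)\<^sup>2 = (fst z)\<^sup>2 + (norm (snd z))\<^sup>2" by (cases z) (simp add: norm_Pair)
  also have "(norm (snd z))\<^sup>2 = (snd z $ 1)\<^sup>2 + (snd z $ 2)\<^sup>2 + (snd z $ 3)\<^sup>2"
    unfolding power2_norm_eq_inner by (simp add: inner_vec_def sum_3 power2_eq_square)
  finally show ?thesis by simp
qed

context ell_solution
begin

lemma continuous_SN: "continuous_on S (SN N)"
  unfolding SN_def[abs_def]
  by (intro continuous_intros continuous_on_subset[OF continuous_mlift[OF lam eig_idx_in]]) auto

text \<open>The scalar part of the limit is u on each curve, by comparison with the mean square
  limit. The gradient of the partial sums is a Lipschitz function of their vector part and so
  converges uniformly too; termwise differentiation then identifies it with the gradient of u.
  Inverting the gradient relations gives the vector part for x > 0, and continuity gives it at x =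
  0.\<close>

lemma SN_limit:
  assumes \<xi>1: "0 < \<xi>1" "\<xi>1 < \<xi>0"
  shows "uniform_limit ({0..\<xi>1} \<times> circ) SN (\<lambda>(x, y). qvec (u x y) (f1 x y) (f2 x y)) sequentially"
proof -
  define X where "X = {0..\<xi>1} \<times> circ"
  have sub: "x \<in> {0..<\<xi>0}" if "x \<in> {0..\<xi>1}" for x using that \<xi>1 by auto
  obtain F where F: "uniform_limit X SN F sequentially" using SN_converges[OF \<xi>1] unfolding X_def by blast
  have Fx: "uniform_limit circ (\<lambda>N y. SN N (x, y)) (\<lambda>y. F (x, y)) sequentially" if "x \<in> {0..\<xi>1}" for x
  proof (rule uniform_limitI)
    fix e :: real assume "e > 0"
    from uniform_limitD[OF F this] show "\<forall>\<^sub>F N in sequentially. \<forall>y\<in>circ. dist (SN N (x, y)) (F (x, y)) < e"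
      by (rule eventually_mono) (use that in \<open>auto simp: X_def\<close>)
  qed
  have Fy: "uniform_limit {0..\<xi>1} (\<lambda>N x. SN N (x, y)) (\<lambda>x. F (x, y)) sequentially" if "y \<in> circ" for y
  proof (rule uniform_limitI)
    fix e :: real assume "e > 0"
    from uniform_limitD[OF F this] show "\<forall>\<^sub>F N in sequentially. \<forall>x\<in>{0..\<xi>1}. dist (SN N (x, y)) (F (x, y)) < e"
      by (rule eventually_mono) (use that in \<open>auto simp: X_def\<close>)
  qed
  have cF: "continuous_on X F"
    by (rule uniform_limit_theorem[OF _ F]) (auto intro: continuous_SN always_eventually)
  have F0: "fst (F (x, y)) = u x y" if x: "x \<in> {0..\<xi>1}" and y: "y \<in> circ" for x y
  proof -
    define S where "S N y = (\<Sum>k<N. cf k x * efun lam k y)" for N y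
    have ul: "uniform_limit circ S (\<lambda>y. fst (F (x, y))) sequentially"
      using bounded_linear.uniform_limit[OF bounded_linear_fst Fx[OF x]]
      unfolding SN_components[OF sub[OF x]] S_def[abs_def] .
    have cS: "continuous_on circ (S N)" for N unfolding S_def[abs_def] by (intro continuous_intros continuous_efun)
    have cF0: "continuous_on circ (\<lambda>y. fst (F (x, y)))"
      by (rule uniform_limit_theorem[OF _ ul]) (auto intro: cS always_eventually)
    have cu: "continuous_on circ (u x)" by (rule sections(1)[OF sub[OF x]])
    have "(\<lambda>N. 2 * ip (\<lambda>y. u x y - S N y) (\<lambda>y. u x y - S N y)
        + 2 * ip (\<lambda>y. S N y - fst (F (x, y))) (\<lambda>y. S N y - fst (F (x, y)))) \<longlonglongrightarrow> 2 * 0 + 2 * 0"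
      by (intro tendsto_intros L2_expansion[OF sub[OF x], folded S_def] ip_diff_uniform_limit[OF ul cS cF0])
    moreover have "ip (\<lambda>y. u x y - fst (F (x, y))) (\<lambda>y. u x y - fst (F (x, y)))
        \<le> 2 * ip (\<lambda>y. u x y - S N y) (\<lambda>y. u x y - S N y)
        + 2 * ip (\<lambda>y. S N y - fst (F (x, y))) (\<lambda>y. S N y - fst (F (x, y)))" for N
      using ip_add_le[of "\<lambda>y. u x y - S N y" "\<lambda>y. S N y - fst (F (x, y))"] cu cS cF0
      by (simp add: continuous_intros)
    ultimately have "ip (\<lambda>y. u x y - fst (F (x, y))) (\<lambda>y. u x y - fst (F (x, y))) \<le> 2 * 0 + 2 * 0"
      by (intro LIMSEQ_le_const) auto
    then have "ip (\<lambda>y. u x y - fst (F (x, y))) (\<lambda>y. u x y - fst (F (x, y))) = 0"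
      using ip_nonneg[of "\<lambda>y. u x y - fst (F (x, y))"] by simp
    moreover have "continuous_on circ (\<lambda>y. u x y - fst (F (x, y)))" by (rule continuous_on_diff[OF cu cF0])
    ultimately show ?thesis using ip_square_eq_0D[OF _ _ y] by fastforce
  qed
  have lip: "norm ((c * (a * snd p $ 1 + b * snd p $ 2)) - (c * (a * snd p' $ 1 + b * snd p' $ 2))) \<le> (\<bar>c\<bar> * (2 * K)) * norm (p - p')"
    if "\<bar>a\<bar> \<le> K" "\<bar>b\<bar> \<le> K" for a b c K :: real and p p' :: quat
  proof -
    have comp: "\<bar>snd (p - p') $ i\<bar> \<le> norm (p - p')" for i
    proof -
      have "\<bar>snd (p - p') $ i\<bar> \<le> norm (snd (p - p'))" by (rule component_le_norm_cart)
      also have "\<dots> \<le> norm (p - p')" using norm_snd_le[of "snd (p - p')" "fst (p - p')"] by (simp only: prod.collapse)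
      finally show ?thesis .
    qed
    have "(c * (a * snd p $ 1 + b * snd p $ 2)) - (c * (a * snd p' $ 1 + b * snd p' $ 2))
        = c * (a * (snd (p - p') $ 1) + b * (snd (p - p') $ 2))" by (simp add: algebra_simps)
    also have "\<bar>\<dots>\<bar> \<le> \<bar>c\<bar> * (K * norm (p - p') + K * norm (p - p'))"
      unfolding abs_mult
    proof (intro mult_left_mono order_trans[OF abs_triangle_ineq] add_mono)
      show "\<bar>a * (snd (p - p') $ 1)\<bar> \<le> K * norm (p - p')" "\<bar>b * (snd (p - p') $ 2)\<bar> \<le> K * norm (p - p')"
        unfolding abs_mult
        by (rule mult_mono[OF that(1) comp], use that(1) in simp, simp) (rule mult_mono[OF that(2) comp], use that(2) in simp, simp)
    qed auto
    finally show ?thesis by (simp add: algebra_simps)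
  qed
  have conv: "(\<lambda>k. cf k x * efun lam k y) sums u x y" if x: "x \<in> {0..\<xi>1}" and y: "y \<in> circ" for x y
  proof -
    have "(\<lambda>N. SN N (x, y)) \<longlonglongrightarrow> F (x, y)" using tendsto_uniform_limitI[OF F] x y by (simp add: X_def)
    from tendsto_fst[OF this] show ?thesis
      unfolding sums_def SN_components[OF sub[OF x]] F0[OF x y] .
  qed
  have gx: "eA x y * snd (F (x, y)) $ 1 + eB x y * snd (F (x, y)) $ 2 = eA x y * f1 x y + eB x y * f2 x y"
    if x: "x \<in> {0..\<xi>1}" and y: "y \<in> circ" for x y
  proof -
    define H where "H x = - lam * (eA x y * snd (F (x, y)) $ 1 + eB x y * snd (F (x, y)) $ 2)" for x
    have "uniform_limit {0..\<xi>1} (\<lambda>N x. - lam * (eA x y * snd (SN N (x, y)) $ 1 + eB x y * snd (SN N (x, y)) $ 2)) H sequentially"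
      unfolding H_def
      by (rule uniform_limit_Lipschitz[OF Fy[OF y]], rule lip) (use eAB_bounds[of _ \<xi>1 y] in auto)
    then have ul: "uniform_limit {0..\<xi>1} (\<lambda>N x. \<Sum>k<N. cf' k x * efun lam k y) H sequentially"
      by (rule uniform_limit_cong'[THEN iffD1, rotated 2]) (use SN_components(2)[OF sub] in auto)
    have "\<exists>g. \<forall>x\<in>{0..\<xi>1}. (\<lambda>k. cf k x * efun lam k y) sums g x \<and> (g has_real_derivative H x) (at x within {0..\<xi>1})"
    proof (rule has_field_derivative_series[OF _ _ ul])
      show "((\<lambda>x. cf k x * efun lam k y) has_real_derivative cf' k x * efun lam k y) (at x within {0..\<xi>1})"
        if x: "x \<in> {0..\<xi>1}" for k x
        by (rule DERIV_cmult_right, rule DERIV_subset[OF coef_derivs(1)[OF eig_idx_in sub[OF x]]]) (use \<xi>1 in auto)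
      show "summable (\<lambda>k. cf k 0 * efun lam k y)" by (rule sums_summable[OF conv[OF _ y]]) (use \<xi>1 in auto)
    qed (use \<xi>1 in auto)
    then obtain g where g: "\<And>x. x \<in> {0..\<xi>1} \<Longrightarrow> (\<lambda>k. cf k x * efun lam k y) sums g x"
      "\<And>x. x \<in> {0..\<xi>1} \<Longrightarrow> (g has_real_derivative H x) (at x within {0..\<xi>1})" by blast
    have gu: "g x = u x y" if "x \<in> {0..\<xi>1}" for x using sums_unique2[OF g(1)[OF that] conv[OF that y]] .
    have "((\<lambda>s. u s y) has_real_derivative H x) (at x within {0..\<xi>1})"
      unfolding has_field_derivative_def
      by (rule has_derivative_transform[OF x, of _ g]) (use gu g(2)[OF x] in \<open>auto simp: has_field_derivative_def\<close>)
    moreover have "((\<lambda>s. u s y) has_real_derivative ux x y) (at x within {0..\<xi>1})"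
      by (rule DERIV_subset[OF u_derivs(1)[OF sub[OF x] y]]) (use \<xi>1 in auto)
    moreover have "at x within {0..\<xi>1} \<noteq> bot" using x \<xi>1 by (simp add: trivial_limit_within islimpt_Icc)
    ultimately have "H x = ux x y" by (rule has_field_derivative_unique)
    then have "lam * (eA x y * snd (F (x, y)) $ 1 + eB x y * snd (F (x, y)) $ 2) = lam * (eA x y * f1 x y + eB x y * f2 x y)"
      unfolding H_def ux_def by linarith
    then show ?thesis unfolding mult_left_cancel[OF lam] .
  qed
  have gy: "eB x y * snd (F (x, y)) $ 1 - eA x y * snd (F (x, y)) $ 2 = eB x y * f1 x y - eA x y * f2 x y"
    if x: "x \<in> {0..\<xi>1}" and y: "y \<in> circ" for x y
  proof -
    define H where "H y = lam * (eB x y * snd (F (x, y)) $ 1 - eA x y * snd (F (x, y)) $ 2)" for y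
    have "uniform_limit circ (\<lambda>N y. lam * (eB x y * snd (SN N (x, y)) $ 1 + - eA x y * snd (SN N (x, y)) $ 2))
        (\<lambda>y. lam * (eB x y * snd (F (x, y)) $ 1 + - eA x y * snd (F (x, y)) $ 2)) sequentially"
      by (rule uniform_limit_Lipschitz[OF Fx[OF x]], rule lip) (use eAB_bounds[of x \<xi>1] x in auto)
    then have "uniform_limit circ (\<lambda>N y. lam * (eB x y * snd (SN N (x, y)) $ 1 - eA x y * snd (SN N (x, y)) $ 2)) H sequentially"
      unfolding H_def by simp
    then have ul: "uniform_limit circ (\<lambda>N y. \<Sum>k<N. cf k x * efun' lam k y) H sequentially"
      unfolding SN_components(3)[OF sub[OF x]] .
    have "\<exists>g. \<forall>y\<in>circ. (\<lambda>k. cf k x * efun lam k y) sums g y \<and> (g has_real_derivative H y) (at y within circ)"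
    proof (rule has_field_derivative_series[OF _ _ ul])
      show "((\<lambda>y. cf k x * efun lam k y) has_real_derivative cf k x * efun' lam k y) (at y within circ)" if "y \<in> circ" for k y
        by (intro DERIV_cmult eigfun_deriv(1)[OF eig_idx_in that])
      show "summable (\<lambda>k. cf k x * efun lam k 0)" using conv[OF x, of 0] by (auto intro: sums_summable)
    qed auto
    then obtain g where g: "\<And>y. y \<in> circ \<Longrightarrow> (\<lambda>k. cf k x * efun lam k y) sums g y"
      "\<And>y. y \<in> circ \<Longrightarrow> (g has_real_derivative H y) (at y within circ)" by blast
    have gu: "g y = u x y" if "y \<in> circ" for y using sums_unique2[OF g(1)[OF that] conv[OF x that]] .
    have "(u x has_real_derivative H y) (at y within circ)"
      unfolding has_field_derivative_def
      by (rule has_derivative_transform[OF y, of _ g]) (use gu g(2)[OF y] in \<open>auto simp: has_field_derivative_def\<close>)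
    moreover have "at y within circ \<noteq> bot" using y by (simp add: trivial_limit_within islimpt_Icc)
    ultimately have "H y = uy x y" using u_derivs(2)[OF sub[OF x] y] has_field_derivative_unique by blast
    then show ?thesis unfolding H_def uy_def mult_left_cancel[OF lam] .
  qed
  have off: "snd (F (x, y)) $ 1 = f1 x y \<and> snd (F (x, y)) $ 2 = f2 x y" if x: "x \<in> {0<..\<xi>1}" and y: "y \<in> circ" for x y
  proof -
    have x': "x \<in> {0..\<xi>1}" using x by auto
    have w: "ew x y \<noteq> 0" using x by (auto simp: ew_eq_0_iff)
    have e: "ew x y * a = eA x y * (eA x y * a + eB x y * b) + eB x y * (eB x y * a - eA x y * b)"
      "ew x y * b = eB x y * (eA x y * a + eB x y * b) - eA x y * (eB x y * a - eA x y * b)" for a b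
      unfolding ew_eq(2) by (simp_all add: power2_eq_square algebra_simps)
    have "ew x y * snd (F (x, y)) $ 1 = ew x y * f1 x y" "ew x y * snd (F (x, y)) $ 2 = ew x y * f2 x y"
      unfolding e(1)[of "snd (F (x, y)) $ 1" "snd (F (x, y)) $ 2"] e(2)[of "snd (F (x, y)) $ 2" "snd (F (x, y)) $ 1"]
        e(1)[of "f1 x y" "f2 x y"] e(2)[of "f2 x y" "f1 x y"] gx[OF x' y] gy[OF x' y] by (rule refl)+
    then show ?thesis using w by simp
  qed
  have ext: "h 0 = 0" if "continuous_on {0..\<xi>1} h" "\<And>x. x \<in> {0<..\<xi>1} \<Longrightarrow> h x = 0" for h :: "real \<Rightarrow> real"
  proof -
    have "(h \<longlongrightarrow> h 0) (at 0 within {0..\<xi>1})" using that(1) \<xi>1 by (auto simp: continuous_on_def)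
    moreover have "(h \<longlongrightarrow> 0) (at 0 within {0..\<xi>1})"
      by (rule tendsto_eventually) (use that(2) in \<open>auto simp: eventually_at_filter\<close>)
    moreover have "at 0 within {0..\<xi>1} \<noteq> bot" using \<xi>1 by (simp add: trivial_limit_within islimpt_Icc)
    ultimately show ?thesis using tendsto_unique by blast
  qed
  have F12: "snd (F (x, y)) $ 1 = f1 x y \<and> snd (F (x, y)) $ 2 = f2 x y" if x: "x \<in> {0..\<xi>1}" and y: "y \<in> circ" for x y
  proof (cases "x = 0")
    case True
    have pr: "continuous_on {0..\<xi>1} (\<lambda>x. (x, y))" by (intro continuous_on_Pair continuous_on_id continuous_on_const)
    have c: "continuous_on {0..\<xi>1} (\<lambda>x. F (x, y))"
      by (rule continuous_on_compose2[OF cF pr]) (use y in \<open>auto simp: X_def\<close>)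
    have im: "(\<lambda>x. (x, y)) ` {0..\<xi>1} \<subseteq> ell_rect \<xi>0" using y \<xi>1 by (auto simp: ell_rect_def)
    have c12: "continuous_on {0..\<xi>1} (\<lambda>x. f1 x y)" "continuous_on {0..\<xi>1} (\<lambda>x. f2 x y)"
      using continuous_on_compose2[OF cont(2) pr im] continuous_on_compose2[OF cont(3) pr im] by simp_all
    have "snd (F (0, y)) $ 1 - f1 0 y = 0" "snd (F (0, y)) $ 2 - f2 0 y = 0"
      by (rule ext[of "\<lambda>x. snd (F (x, y)) $ 1 - f1 x y"] ext[of "\<lambda>x. snd (F (x, y)) $ 2 - f2 x y"],
          intro continuous_intros c c12, use off y in simp)+
    then show ?thesis using True by simp
  next
    case False
    then show ?thesis using off[OF _ y] x by simp
  qed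
  have "F p = (case p of (x, y) \<Rightarrow> qvec (u x y) (f1 x y) (f2 x y))" if pX: "p \<in> X" for p
  proof -
    obtain x y where p: "p = (x, y)" "x \<in> {0..\<xi>1}" "y \<in> circ" using pX by (auto simp: X_def)
    have "(\<lambda>N. SN N (x, y)) \<longlonglongrightarrow> F (x, y)" using tendsto_uniform_limitI[OF F] p by (simp add: X_def)
    then have "(\<lambda>N. snd (SN N (x, y)) $ 3) \<longlonglongrightarrow> snd (F (x, y)) $ 3" by (intro tendsto_intros)
    then have "snd (F (x, y)) $ 3 = 0" unfolding SN_components(4)[OF sub[OF p(2)]] by (simp add: LIMSEQ_const_iff)
    then show ?thesis unfolding p(1) prod.case using F0[OF p(2,3)] F12[OF p(2,3)] by (intro qvec_eqI) auto
  qed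
  then show ?thesis using F unfolding X_def[symmetric] by (subst uniform_limit_cong'[where g = SN and i = F]) auto
qed

end

section \<open>Convergence in the weighted mean square\<close>

context ell_solution
begin

definition "qf p = (case p of (x, y) \<Rightarrow> qvec (u x y) (f1 x y) (f2 x y))"

lemma continuous_qf: "continuous_on (ell_rect \<xi>0) qf"
  using cont(1-3) unfolding qf_def[abs_def] case_prod_beta' by (intro continuous_intros)

lemma continuous_qf_section:
  assumes x: "x \<in> {0..<\<xi>0}"
  shows "continuous_on circ (\<lambda>y. qf (x, y))"
  unfolding qf_def prod.case using sections(1-3)[OF x] by (intro continuous_intros)

lemma continuous_SN_section: "continuous_on S (\<lambda>y. SN N (x, y))"
  by (rule continuous_on_compose2[OF continuous_SN[of UNIV]]) (auto intro: continuous_on_Pair continuous_on_const continuous_on_id)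

definition "rem_int N x = integral circ (\<lambda>y. ew x y * (norm (qf (x, y) - SN N (x, y)))\<^sup>2)"

definition "dom_int x = ip (u x) (u x) + ip (ux x) (ux x) + ip (uy x) (uy x)"

definition "dom_const = (cosh \<xi>0)\<^sup>2 + (4 * \<bar>mq lam\<bar> + 2) / lam\<^sup>2"

text \<open>The weight is just what makes division unnecessary: \<open>ew\<close> times the squared
  vector part of the error is the squared error of the gradient divided by lam^2. The bound is
  independent of \<open>N\<close> and involves only one curve.\<close>

lemma rem_int_le:
  assumes x: "x \<in> {0..<\<xi>0}"
  shows "rem_int N x \<le> dom_const * dom_int x"
proof -
  define d0 where "d0 y = u x y - (\<Sum>k<N. cf k x * efun lam k y)" for y
  define dx where "dx y = ux x y - (\<Sum>k<N. cf' k x * efun lam k y)" for y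
  define dy where "dy y = uy x y - (\<Sum>k<N. cf k x * efun' lam k y)" for y
  have c: "continuous_on circ d0" "continuous_on circ dx" "continuous_on circ dy"
    unfolding d0_def[abs_def] dx_def[abs_def] dy_def[abs_def]
    using sections[OF x] by (auto intro!: continuous_intros continuous_efun)
  define P where "P = 4 * \<bar>mq lam\<bar> + 1"
  have pw: "ew x y * (norm (qf (x, y) - SN N (x, y)))\<^sup>2 = ew x y * (d0 y)\<^sup>2 + 1 / lam\<^sup>2 * (dx y * dx y) + 1 / lam\<^sup>2 * (dy y * dy y)" for y
  proof -
    define a where "a = f1 x y - snd (SN N (x, y)) $ 1"
    define b where "b = f2 x y - snd (SN N (x, y)) $ 2"
    have n: "(norm (qf (x, y) - SN N (x, y)))\<^sup>2 = (d0 y)\<^sup>2 + a\<^sup>2 + b\<^sup>2"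
      unfolding norm_quat_square qf_def prod.case d0_def a_def b_def by (simp add: SN_components[OF x])
    have d: "dx y = - lam * (eA x y * a + eB x y * b)" "dy y = lam * (eB x y * a - eA x y * b)"
      unfolding dx_def dy_def ux_def uy_def SN_components(2,3)[OF x, symmetric] a_def b_def
      by (simp_all add: algebra_simps)
    have "dx y * dx y + dy y * dy y = lam\<^sup>2 * (ew x y * (a\<^sup>2 + b\<^sup>2))"
      unfolding d ew_eq(2) by (simp add: power2_eq_square algebra_simps)
    then have "1 / lam\<^sup>2 * (dx y * dx y) + 1 / lam\<^sup>2 * (dy y * dy y) = ew x y * (a\<^sup>2 + b\<^sup>2)"
      using lam by (simp add: field_simps)
    then show ?thesis unfolding n by (simp add: algebra_simps)
  qed
  have "rem_int N x \<le> integral circ (\<lambda>y. (cosh \<xi>0)\<^sup>2 * (d0 y * d0 y) + 1 / lam\<^sup>2 * (dx y * dx y) + 1 / lam\<^sup>2 * (dy y * dy y))"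
    unfolding rem_int_def pw
  proof (rule integral_le)
    fix y
    show "ew x y * (d0 y)\<^sup>2 + 1 / lam\<^sup>2 * (dx y * dx y) + 1 / lam\<^sup>2 * (dy y * dy y)
      \<le> (cosh \<xi>0)\<^sup>2 * (d0 y * d0 y) + 1 / lam\<^sup>2 * (dx y * dx y) + 1 / lam\<^sup>2 * (dy y * dy y)"
      using mult_right_mono[OF eAB_bounds(3)[of x \<xi>0 y], of "(d0 y)\<^sup>2"] x by (simp add: power2_eq_square)
  qed (use c lam in \<open>auto intro!: integrable_continuous_real continuous_intros\<close>)
  also have "\<dots> = (cosh \<xi>0)\<^sup>2 * ip d0 d0 + 1 / lam\<^sup>2 * ip dx dx + 1 / lam\<^sup>2 * ip dy dy"
  proof -
    have i: "(\<lambda>y. t * (g y * g y)) integrable_on circ" "integral circ (\<lambda>y. t * (g y * g y)) = t * ip g g"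
      if "continuous_on circ g" for g t
      using that by (auto simp: ip_def intro!: integrable_continuous_real continuous_intros)
    show ?thesis
      by (subst integral_add, intro integrable_add i c, rule i, rule c, subst integral_add) (simp_all only: i c)
  qed
  also have "\<dots> \<le> (cosh \<xi>0)\<^sup>2 * ip (u x) (u x) + 1 / lam\<^sup>2 * ip (ux x) (ux x) + 1 / lam\<^sup>2 * (ip (uy x) (uy x) + P * ip (u x) (u x))"
  proof (intro add_mono mult_left_mono)
    show "ip d0 d0 \<le> ip (u x) (u x)"
      unfolding d0_def[abs_def] coef_def by (rule Bessel_efun[OF sections(1)[OF x]])
    show "ip dx dx \<le> ip (ux x) (ux x)"
      unfolding dx_def[abs_def] coef'_def by (rule Bessel_efun[OF sections(8)[OF x]])
    \<comment> \<open>The derivatives of the eigenfunctions are not orthonormal, so the y-derivative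
      is estimated through the energy identity for the remainder and for u, at the price of the
      bound \<open>P\<close> on the potential.\<close>
    obtain w where w: "per_sol (mq lam) w d0 dy"
      "ip w d0 \<le> ip (\<lambda>y. pot (mq lam) y * u x y - uyy x y) (u x)"
      using remainder[OF x, of N] unfolding d0_def[abs_def] dy_def[abs_def] by blast
    have "ip dy dy \<le> ip w d0"
      using per_sol_energy[OF w(1) w(1)] ip_pot_ge[OF c(1), of "mq lam"] ip_nonneg[of d0] by linarith
    also have "\<dots> \<le> ip (uy x) (uy x) + ip (\<lambda>y. pot (mq lam) y * u x y) (u x)"
      using w(2) per_sol_energy[OF per_sol_u[OF x] per_sol_u[OF x]] by linarith
    also have "ip (\<lambda>y. pot (mq lam) y * u x y) (u x) \<le> ip (\<lambda>y. P * u x y) (u x)"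
    proof (rule ip_mono)
      fix y
      have "pot (mq lam) y * (u x y * u x y) \<le> P * (u x y * u x y)"
        unfolding P_def by (intro mult_right_mono pot_bounds) auto
      then show "pot (mq lam) y * u x y * u x y \<le> P * u x y * u x y" by (simp add: mult.assoc)
    qed (use sections(1)[OF x] in \<open>auto intro!: continuous_intros\<close>)
    finally show "ip dy dy \<le> ip (uy x) (uy x) + P * ip (u x) (u x)" by (simp add: ip_cmult)
  qed auto
  also have "\<dots> \<le> dom_const * dom_int x"
  proof -
    define s where "s = 1 / lam\<^sup>2"
    have s: "s \<ge> 0" by (simp add: s_def)
    have P: "P \<ge> 0" by (simp add: P_def)
    have dc: "dom_const = (cosh \<xi>0)\<^sup>2 + s * (P + 1)" by (simp add: dom_const_def P_def s_def)
    have "0 \<le> (cosh \<xi>0)\<^sup>2 * (ip (ux x) (ux x) + ip (uy x) (uy x)) + s * ip (u x) (u x) + s * P * (ip (ux x) (ux x) + ip (uy x) (uy x))"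
      using s P ip_nonneg by (intro add_nonneg_nonneg mult_nonneg_nonneg) auto
    then show ?thesis unfolding dc dom_int_def s_def[symmetric] by (simp add: algebra_simps)
  qed
  finally show ?thesis .
qed

text \<open>A single curve lies inside a smaller closed ellipse, where the convergence is uniform;
  the rate may deteriorate as \<open>x\<close> approaches \<open>\<xi>0\<close>.\<close>

lemma rem_int_tendsto:
  assumes x: "x \<in> {0..<\<xi>0}"
  shows "(\<lambda>N. rem_int N x) \<longlonglongrightarrow> 0"
proof (rule LIMSEQ_I)
  fix r :: real assume r: "r > 0"
  define \<xi>1 where "\<xi>1 = (x + \<xi>0) / 2"
  have \<xi>1: "0 < \<xi>1" "\<xi>1 < \<xi>0" "x \<in> {0..\<xi>1}" using x by (auto simp: \<xi>1_def)
  define Q where "Q = 2 * pi * (cosh \<xi>0)\<^sup>2"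
  have Q: "Q > 0" by (simp add: Q_def)
  define d where "d = sqrt (r / (2 * Q))"
  have d: "d > 0" "d\<^sup>2 = r / (2 * Q)" using r Q by (auto simp: d_def)
  obtain N0 where N0: "\<And>N p. N \<ge> N0 \<Longrightarrow> p \<in> {0..\<xi>1} \<times> circ \<Longrightarrow> dist (SN N p) (qf p) < d"
    using uniform_limitD[OF SN_limit[OF \<xi>1(1,2)] d(1)] unfolding eventually_sequentially qf_def[symmetric] by blast
  have "norm (rem_int N x - 0) < r" if N: "N \<ge> N0" for N
  proof -
    have c: "(\<lambda>y. ew x y * (norm (qf (x, y) - SN N (x, y)))\<^sup>2) integrable_on circ"
      using continuous_qf_section[OF x] continuous_SN_section
      by (intro integrable_continuous_real continuous_intros) auto
    have "rem_int N x \<le> integral circ (\<lambda>y. (cosh \<xi>0)\<^sup>2 * d\<^sup>2)"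
      unfolding rem_int_def
    proof (rule integral_le[OF c])
      fix y assume y: "y \<in> circ"
      have "norm (qf (x, y) - SN N (x, y)) \<le> d"
        using N0[OF N, of "(x, y)"] \<xi>1(3) y by (simp add: dist_norm norm_minus_commute)
      then show "ew x y * (norm (qf (x, y) - SN N (x, y)))\<^sup>2 \<le> (cosh \<xi>0)\<^sup>2 * d\<^sup>2"
        using eAB_bounds(3)[of x \<xi>0 y] x by (intro mult_mono power_mono) auto
    qed auto
    also have "\<dots> = Q * d\<^sup>2" by (simp add: Q_def)
    also have "\<dots> = r / 2" using Q by (simp add: d(2))
    also have "\<dots> < r" using r by simp
    finally have "rem_int N x < r" .
    moreover have "0 \<le> rem_int N x" unfolding rem_int_def by (rule integral_nonneg[OF c]) (simp add: ew_nonneg)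
    ultimately show ?thesis by simp
  qed
  then show "\<exists>no. \<forall>N\<ge>no. norm (rem_int N x - 0) < r" by blast
qed

section \<open>Integration over the rectangle\<close>

lemma slice_nn_integral:
  assumes g: "continuous_on (ell_rect \<xi>0) g" "\<And>p. 0 \<le> g p"
  shows "(\<integral>\<^sup>+y. ennreal (indicator (ell_rect \<xi>0) (x, y) * g (x, y)) \<partial>lborel)
    = (if x \<in> {0..<\<xi>0} then ennreal (integral circ (\<lambda>y. g (x, y))) else 0)"
proof (cases "x \<in> {0..<\<xi>0}")
  case True
  have "continuous_on circ (\<lambda>y. (x, y))" by (intro continuous_on_Pair continuous_on_id continuous_on_const)
  moreover have "(\<lambda>y. (x, y)) ` circ \<subseteq> ell_rect \<xi>0" using True by (auto simp: ell_rect_def)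
  ultimately have c: "continuous_on circ (\<lambda>y. g (x, y))" by (rule continuous_on_compose2[OF g(1)])
  have ind: "indicator (ell_rect \<xi>0) (x, y) * g (x, y) = indicator circ y *\<^sub>R g (x, y)" for y
    using True by (auto simp: ell_rect_def indicator_def)
  have "integral\<^sup>N lborel (\<lambda>y. indicator circ y *\<^sub>R g (x, y)) = integral circ (\<lambda>y. g (x, y))"
  proof (rule nn_integral_has_integral_lborel)
    show "(\<lambda>y. indicator circ y *\<^sub>R g (x, y)) \<in> borel_measurable borel"
      by (rule borel_measurable_continuous_on_indicator[OF _ c]) simp
    have "((\<lambda>y. g (x, y)) has_integral integral circ (\<lambda>y. g (x, y))) circ"
      by (intro integrable_integral integrable_continuous_real c)
    then have "((\<lambda>y. if y \<in> circ then g (x, y) else 0) has_integral integral circ (\<lambda>y. g (x, y))) UNIV"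
      by (simp only: has_integral_restrict_UNIV)
    moreover have "(\<lambda>y. indicator circ y *\<^sub>R g (x, y)) = (\<lambda>y. if y \<in> circ then g (x, y) else 0)"
      by (auto simp: indicator_def)
    ultimately show "((\<lambda>y. indicator circ y *\<^sub>R g (x, y)) has_integral integral circ (\<lambda>y. g (x, y))) UNIV" by simp
  qed (simp add: g)
  then show ?thesis unfolding ind using True by simp
next
  case False
  then have "indicator (ell_rect \<xi>0) (x, y) = (0 :: real)" for y by (auto simp: ell_rect_def indicator_def)
  then show ?thesis unfolding if_not_P[OF False] by simp
qed

lemma ell_rect_borel: "ell_rect \<xi>0 \<in> sets borel"
  unfolding ell_rect_def by (intro borel_Times) auto

lemma rect_measurable:
  fixes g :: "real \<times> real \<Rightarrow> real"
  assumes "continuous_on (ell_rect \<xi>0) g"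
  shows "(\<lambda>p. indicator (ell_rect \<xi>0) p * g p) \<in> borel_measurable borel"
  using borel_measurable_continuous_on_indicator[OF ell_rect_borel assms] by simp

definition "rem_fun N p = ew (fst p) (snd p) * (norm (qf p - SN N p))\<^sup>2"
definition "dom_fun p = (u (fst p) (snd p))\<^sup>2 + (ux (fst p) (snd p))\<^sup>2 + (uy (fst p) (snd p))\<^sup>2"

lemma continuous_rem_dom:
  "continuous_on (ell_rect \<xi>0) (rem_fun N)" "continuous_on (ell_rect \<xi>0) dom_fun"
proof -
  show "continuous_on (ell_rect \<xi>0) (rem_fun N)"
    unfolding rem_fun_def[abs_def] by (intro continuous_intros continuous_qf continuous_SN)
  show "continuous_on (ell_rect \<xi>0) dom_fun"
    using cont(1) continuous_derivs(1,2) unfolding dom_fun_def[abs_def] case_prod_beta' by (intro continuous_intros)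
qed

text \<open>The squared gradient of u is lam^2 \<open>ew\<close> times the squared vector part,
  hence integrable by hypothesis. The square of u itself enters without the weight: for x > T the
  weight is at least sinh^2 T, and for x \<le> T, where it may vanish, u is bounded by compactness.
  The choice \<open>T\<close> = \<open>\<xi>0\<close> / 2 stays clear of both the foci and the outer
  boundary.\<close>

lemma dom_fun_finite:
  assumes int: "integrable lborel (\<lambda>p. indicator (ell_rect \<xi>0) p * (ew (fst p) (snd p) * (norm (qf p))\<^sup>2))"
  shows "(\<integral>\<^sup>+p. ennreal (indicator (ell_rect \<xi>0) p * (dom_const * dom_fun p)) \<partial>lborel) < \<infinity>"
proof -
  define T where "T = \<xi>0 / 2"
  have T: "0 < T" "T < \<xi>0" using \<xi>0 by (auto simp: T_def)
  have dc: "dom_const \<ge> 0" by (simp add: dom_const_def)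
  have "compact ({0..T} \<times> circ)" by (intro compact_Times) auto
  moreover have "continuous_on ({0..T} \<times> circ) (\<lambda>(x, y). u x y)"
    by (rule continuous_on_subset[OF cont(1)]) (use T in \<open>auto simp: ell_rect_def\<close>)
  ultimately have "bounded ((\<lambda>(x, y). u x y) ` ({0..T} \<times> circ))"
    by (intro compact_imp_bounded compact_continuous_image)
  then obtain B where B: "\<And>x y. x \<in> {0..T} \<Longrightarrow> y \<in> circ \<Longrightarrow> \<bar>u x y\<bar> \<le> B"
    unfolding bounded_iff by fastforce
  define \<sigma> where "\<sigma> = (sinh T)\<^sup>2"
  have \<sigma>: "\<sigma> > 0" using T by (simp add: \<sigma>_def)
  define r0 where "r0 p = ew (fst p) (snd p) * (norm (qf p))\<^sup>2" for p
  define h where "h p = dom_const * ((lam\<^sup>2 + 1 / \<sigma>) * (indicator (ell_rect \<xi>0) p * r0 p) + B\<^sup>2 * indicator ({0..\<xi>0} \<times> circ) p)" for p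
  have "bounded ({0..\<xi>0} \<times> circ)" by (intro bounded_Times) auto
  then have "emeasure lborel ({0..\<xi>0} \<times> circ) < \<infinity>" by (rule emeasure_bounded_finite)
  moreover have "{0..\<xi>0} \<times> circ \<in> sets lborel" unfolding sets_lborel by (intro borel_Times) auto
  ultimately have "integrable lborel (\<lambda>p. indicator ({0..\<xi>0} \<times> circ) p :: real)" by (intro integrable_real_indicator)
  then have "integrable lborel h"
    unfolding h_def using int unfolding r0_def[symmetric] by (intro integrable_mult_right integrable_add) auto
  then have fin: "(\<integral>\<^sup>+p. ennreal (norm (h p)) \<partial>lborel) < \<infinity>" by (simp add: integrable_iff_bounded)
  have le: "indicator (ell_rect \<xi>0) p * (dom_const * dom_fun p) \<le> norm (h p)" for p
  proof (cases "p \<in> ell_rect \<xi>0")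
    case True
    obtain x y where p: "p = (x, y)" by (cases p)
    have xy: "x \<in> {0..<\<xi>0}" "y \<in> circ" using True p by (auto simp: ell_rect_def)
    have r0: "r0 p = ew x y * ((u x y)\<^sup>2 + (f1 x y)\<^sup>2 + (f2 x y)\<^sup>2)"
      unfolding r0_def p qf_def norm_quat_square by simp
    have "(ux x y)\<^sup>2 + (uy x y)\<^sup>2 = lam\<^sup>2 * (ew x y * ((f1 x y)\<^sup>2 + (f2 x y)\<^sup>2))"
      unfolding ux_def uy_def ew_eq(2) by (simp add: power2_eq_square algebra_simps)
    also have "\<dots> \<le> lam\<^sup>2 * r0 p"
      unfolding r0 by (intro mult_left_mono) (auto simp: ew_nonneg)
    finally have 1: "(ux x y)\<^sup>2 + (uy x y)\<^sup>2 \<le> lam\<^sup>2 * r0 p" .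
    have r00: "0 \<le> r0 p" unfolding r0 by (intro mult_nonneg_nonneg) (auto simp: ew_nonneg)
    have 2: "(u x y)\<^sup>2 \<le> 1 / \<sigma> * r0 p + B\<^sup>2"
    proof (cases "x \<le> T")
      case True
      then have "\<bar>u x y\<bar> \<le> B" using B xy by auto
      then have "(u x y)\<^sup>2 \<le> B\<^sup>2" by (metis abs_ge_zero power2_abs power_mono)
      moreover have "0 \<le> 1 / \<sigma> * r0 p" using \<sigma> r00 by simp
      ultimately show ?thesis by linarith
    next
      case False
      then have "sinh T \<le> sinh x" by simp
      then have "\<sigma> \<le> (sinh x)\<^sup>2" unfolding \<sigma>_def using T by (intro power_mono) auto
      also have "\<dots> \<le> ew x y" unfolding ew_eq(1) by simp
      finally have "\<sigma> * (u x y)\<^sup>2 \<le> ew x y * (u x y)\<^sup>2" by (rule mult_right_mono) simp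
      also have "\<dots> \<le> r0 p" unfolding r0 by (intro mult_left_mono) (auto simp: ew_nonneg)
      finally have "(u x y)\<^sup>2 \<le> 1 / \<sigma> * r0 p" using \<sigma> by (simp add: field_simps)
      then show ?thesis by (simp add: add_increasing2)
    qed
    have "dom_fun p \<le> (lam\<^sup>2 + 1 / \<sigma>) * r0 p + B\<^sup>2"
      using 1 2 unfolding dom_fun_def p by (simp add: algebra_simps)
    then have "dom_const * dom_fun p \<le> dom_const * ((lam\<^sup>2 + 1 / \<sigma>) * r0 p + B\<^sup>2)" using dc by (rule mult_left_mono)
    also have "\<dots> = h p" using xy True by (simp add: h_def p)
    finally show ?thesis using True by simp
  qed simp
  have "(\<integral>\<^sup>+p. ennreal (indicator (ell_rect \<xi>0) p * (dom_const * dom_fun p)) \<partial>lborel) \<le> (\<integral>\<^sup>+p. ennreal (norm (h p)) \<partial>lborel)"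
    by (intro nn_integral_mono ennreal_leI le)
  then show ?thesis using fin by (rule le_less_trans)
qed

text \<open>The error is dominated after integration over each curve and not shown to be dominated
  pointwise. So the double integral is sliced by Tonelli's theorem, and dominated convergence is
  applied in \<open>x\<close> alone.\<close>

lemma remainder_nn_integral_tendsto:
  assumes int: "integrable lborel (\<lambda>p. indicator (ell_rect \<xi>0) p * (ew (fst p) (snd p) * (norm (qf p))\<^sup>2))"
  shows "(\<lambda>N. \<integral>\<^sup>+p. ennreal (indicator (ell_rect \<xi>0) p * rem_fun N p) \<partial>lborel) \<longlonglongrightarrow> 0"
proof -
  have dc: "dom_const \<ge> 0" by (simp add: dom_const_def)
  have mr: "(\<lambda>p. ennreal (indicator (ell_rect \<xi>0) p * rem_fun N p)) \<in> borel_measurable (lborel \<Otimes>\<^sub>M lborel)" for N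
    unfolding lborel_prod using rect_measurable[OF continuous_rem_dom(1)] by simp
  have cd: "continuous_on (ell_rect \<xi>0) (\<lambda>p. dom_const * dom_fun p)" by (intro continuous_intros continuous_rem_dom)
  have md: "(\<lambda>p. ennreal (indicator (ell_rect \<xi>0) p * (dom_const * dom_fun p))) \<in> borel_measurable (lborel \<Otimes>\<^sub>M lborel)"
    unfolding lborel_prod using rect_measurable[OF cd] by simp
  have fub: "(\<integral>\<^sup>+p. ennreal (indicator (ell_rect \<xi>0) p * rem_fun N p) \<partial>lborel)
      = (\<integral>\<^sup>+x. \<integral>\<^sup>+y. ennreal (indicator (ell_rect \<xi>0) (x, y) * rem_fun N (x, y)) \<partial>lborel \<partial>lborel)" for N
    using lborel.nn_integral_fst[OF mr] unfolding lborel_prod by simp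
  have fubd: "(\<integral>\<^sup>+p. ennreal (indicator (ell_rect \<xi>0) p * (dom_const * dom_fun p)) \<partial>lborel)
      = (\<integral>\<^sup>+x. \<integral>\<^sup>+y. ennreal (indicator (ell_rect \<xi>0) (x, y) * (dom_const * dom_fun (x, y))) \<partial>lborel \<partial>lborel)"
    using lborel.nn_integral_fst[OF md] unfolding lborel_prod by simp
  have sr: "(\<integral>\<^sup>+y. ennreal (indicator (ell_rect \<xi>0) (x, y) * rem_fun N (x, y)) \<partial>lborel)
      = (if x \<in> {0..<\<xi>0} then ennreal (rem_int N x) else 0)" for N x
    by (subst slice_nn_integral[OF continuous_rem_dom(1)]) (auto simp: rem_fun_def ew_nonneg rem_int_def)
  have sd: "(\<integral>\<^sup>+y. ennreal (indicator (ell_rect \<xi>0) (x, y) * (dom_const * dom_fun (x, y))) \<partial>lborel)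
      = (if x \<in> {0..<\<xi>0} then ennreal (dom_const * dom_int x) else 0)" for x
  proof -
    have "integral circ (\<lambda>y. dom_const * dom_fun (x, y)) = dom_const * dom_int x" if x: "x \<in> {0..<\<xi>0}"
    proof -
      have i: "(\<lambda>y. u x y * u x y) integrable_on circ" "(\<lambda>y. ux x y * ux x y) integrable_on circ"
        "(\<lambda>y. uy x y * uy x y) integrable_on circ"
        by (intro ip_integrable sections(1,8,9)[OF x])+
      have "integral circ (\<lambda>y. u x y * u x y + ux x y * ux x y + uy x y * uy x y) = dom_int x"
        unfolding dom_int_def ip_def integral_add[OF integrable_add[OF i(1,2)] i(3)] integral_add[OF i(1,2)] by (rule refl)
      then show ?thesis by (simp add: dom_fun_def power2_eq_square)
    qed
    then show ?thesis
      by (subst slice_nn_integral[OF cd]) (auto simp: dc dom_fun_def)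
  qed
  have "(\<lambda>N. \<integral>\<^sup>+x. \<integral>\<^sup>+y. ennreal (indicator (ell_rect \<xi>0) (x, y) * rem_fun N (x, y)) \<partial>lborel \<partial>lborel) \<longlonglongrightarrow> (\<integral>\<^sup>+x. 0 \<partial>(lborel :: real measure))"
  proof (rule nn_integral_dominated_convergence)
    show "(\<lambda>x. \<integral>\<^sup>+y. ennreal (indicator (ell_rect \<xi>0) (x, y) * rem_fun N (x, y)) \<partial>lborel) \<in> borel_measurable lborel" for N
      by (rule lborel.borel_measurable_nn_integral_fst[OF mr])
    show "(\<lambda>x. \<integral>\<^sup>+y. ennreal (indicator (ell_rect \<xi>0) (x, y) * (dom_const * dom_fun (x, y))) \<partial>lborel) \<in> borel_measurable lborel"
      by (rule lborel.borel_measurable_nn_integral_fst[OF md])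
    show "AE x in lborel. (\<integral>\<^sup>+y. ennreal (indicator (ell_rect \<xi>0) (x, y) * rem_fun N (x, y)) \<partial>lborel)
        \<le> (\<integral>\<^sup>+y. ennreal (indicator (ell_rect \<xi>0) (x, y) * (dom_const * dom_fun (x, y))) \<partial>lborel)" for N
      unfolding sr sd using rem_int_le by (auto intro!: ennreal_leI)
    show "AE x in lborel. (\<lambda>N. \<integral>\<^sup>+y. ennreal (indicator (ell_rect \<xi>0) (x, y) * rem_fun N (x, y)) \<partial>lborel) \<longlonglongrightarrow> 0"
      unfolding sr
    proof (rule AE_I2)
      show "(\<lambda>N. if x \<in> {0..<\<xi>0} then ennreal (rem_int N x) else 0) \<longlonglongrightarrow> 0" for x
      proof (cases "x \<in> {0..<\<xi>0}")
        case True
        then show ?thesis using tendsto_ennrealI[OF rem_int_tendsto[OF True]] by simp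
      next
        case False
        show ?thesis unfolding if_not_P[OF False] by simp
      qed
    qed
    show "(\<integral>\<^sup>+x. \<integral>\<^sup>+y. ennreal (indicator (ell_rect \<xi>0) (x, y) * (dom_const * dom_fun (x, y))) \<partial>lborel \<partial>lborel) < \<infinity>"
      using dom_fun_finite[OF int] unfolding fubd .
  qed auto
  then show ?thesis unfolding fub by simp
qed

end

section \<open>The weighted norm and completeness in both senses\<close>

lemma ell_weight_eq: "ell_weight p = ew (fst p) (snd p)"
  by (cases p) (simp add: ell_weight_def ew_def)

lemma ell_norm_less:
  assumes m: "(\<lambda>p. indicator (ell_rect \<xi>0) p * (ew (fst p) (snd p) * (norm (h p))\<^sup>2)) \<in> borel_measurable borel"
    and lt: "(\<integral>\<^sup>+p. ennreal (indicator (ell_rect \<xi>0) p * (ew (fst p) (snd p) * (norm (h p))\<^sup>2)) \<partial>lborel) < ennreal (\<epsilon>\<^sup>2)"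
    and \<epsilon>: "\<epsilon> > 0"
  shows "ell_norm \<xi>0 h < \<epsilon>"
proof -
  define r where "r p = indicator (ell_rect \<xi>0) p * (ew (fst p) (snd p) * (norm (h p))\<^sup>2)" for p
  have r0: "0 \<le> r p" for p by (simp add: r_def ew_nonneg)
  have q: "qcnj (h p) \<odot> h p = (norm (h p))\<^sup>2 *\<^sub>R (1, 0)" for p
    unfolding qcnj_mult_self norm_quat_square by (simp add: inner_vec_def sum_3 power2_eq_square)
  have int: "integrable lborel r"
    using m lt r0 unfolding integrable_iff_bounded r_def[symmetric] by (auto intro: less_trans)
  have "ell_inner \<xi>0 h h = fst (\<integral>p. r p *\<^sub>R (1, 0 :: real ^ 3) \<partial>lborel)"
    unfolding ell_inner_def Sc_def set_lebesgue_integral_def q ell_weight_eq r_def by (simp add: mult.assoc)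
  also have "\<dots> = (\<integral>p. r p \<partial>lborel)" by (subst integral_scaleR_left) (use int in simp_all)
  finally have e: "ell_inner \<xi>0 h h = (\<integral>p. r p \<partial>lborel)" .
  have "ennreal (\<integral>p. r p \<partial>lborel) = (\<integral>\<^sup>+p. ennreal (r p) \<partial>lborel)"
    by (rule nn_integral_eq_integral[OF int, symmetric]) (simp add: r0)
  also have "\<dots> < ennreal (\<epsilon>\<^sup>2)" using lt unfolding r_def .
  finally have "(\<integral>p. r p \<partial>lborel) < \<epsilon>\<^sup>2" using \<epsilon> by (simp add: ennreal_less_iff r0)
  then have "sqrt (\<integral>p. r p \<partial>lborel) < sqrt (\<epsilon>\<^sup>2)" by (rule real_sqrt_less_mono)
  then show ?thesis unfolding ell_norm_def e using \<epsilon> by simp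
qed

theorem theorem3p5:
  fixes lam \<xi>0 :: real
  assumes "lam \<noteq> 0" and "\<xi>0 > 0"
  shows "(\<forall>f\<in>ell_M \<xi>0 lam. \<exists>g :: nat \<Rightarrow> real \<times> real \<Rightarrow> quat.
            (\<forall>k. g k \<in> real_lin_combs (rqM_system lam)) \<and>
            (\<forall>K. compact K \<and> K \<subseteq> ell_rect \<xi>0 \<longrightarrow> uniform_limit K g f sequentially))
       \<and> rqM_system lam \<subseteq> ell_M2 \<xi>0 lam
       \<and> (\<forall>f\<in>ell_M2 \<xi>0 lam. \<forall>\<epsilon>>0. \<exists>g\<in>real_lin_combs (rqM_system lam).
            ell_norm \<xi>0 (\<lambda>p. f p - g p) < \<epsilon>)"
proof (intro conjI ballI allI impI)
  show "rqM_system lam \<subseteq> ell_M2 \<xi>0 lam" by (rule rqM_system_subset[OF assms])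
next
  fix f assume f: "f \<in> ell_M \<xi>0 lam"
  obtain f1x f1y f2x f2y where sol: "ell_solution \<xi>0 lam (\<lambda>x y. fst (f (x, y))) (\<lambda>x y. snd (f (x, y)) $ 1)
    (\<lambda>x y. snd (f (x, y)) $ 2) f1x f1y f2x f2y" using ell_M_components[OF f assms] by blast
  interpret S: ell_solution \<xi>0 lam "\<lambda>x y. fst (f (x, y))" "\<lambda>x y. snd (f (x, y)) $ 1" "\<lambda>x y. snd (f (x, y)) $ 2"
    f1x f1y f2x f2y by (rule sol)
  have fq: "f p = S.qf p" if "p \<in> ell_rect \<xi>0" for p
    using f that by (cases p) (auto simp: ell_M_def reduced_quats_def S.qf_def intro!: qvec_eqI)
  have "\<exists>g\<in>real_lin_combs (rqM_system lam). \<forall>x\<ge>0. \<forall>y\<in>circ. g (x, y) = S.SN N (x, y)" for N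
    unfolding S.SN_def by (rule real_lin_combs_partial_sums[OF assms(1)])
  then obtain g where g: "\<And>N. g N \<in> real_lin_combs (rqM_system lam)"
    "\<And>N x y. x \<ge> 0 \<Longrightarrow> y \<in> circ \<Longrightarrow> g N (x, y) = S.SN N (x, y)" by metis
  have "uniform_limit K g f sequentially" if K: "compact K" "K \<subseteq> ell_rect \<xi>0" for K
  proof (cases "K = {}")
    case False
    obtain p0 where p0: "p0 \<in> K" "\<And>p. p \<in> K \<Longrightarrow> fst p \<le> fst p0"
      using continuous_attains_sup[OF K(1) False continuous_on_fst[OF continuous_on_id]] by auto
    \<comment> \<open>The largest \<xi>-coordinate on the compact set is attained and less than
      \<xi>0; the midpoint is also positive when it equals 0.\<close>
    define \<xi>1 where "\<xi>1 = (fst p0 + \<xi>0) / 2"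
    have "0 \<le> fst p0" "fst p0 < \<xi>0" using p0(1) K(2) by (auto simp: ell_rect_def)
    then have \<xi>1: "0 < \<xi>1" "\<xi>1 < \<xi>0" "fst p0 \<le> \<xi>1" using assms by (auto simp: \<xi>1_def)
    have sub: "K \<subseteq> {0..\<xi>1} \<times> circ"
    proof
      fix p assume p: "p \<in> K"
      then show "p \<in> {0..\<xi>1} \<times> circ" using p0(2)[OF p] K(2) \<xi>1(3) by (cases p) (auto simp: ell_rect_def)
    qed
    have "uniform_limit K S.SN S.qf sequentially"
      using uniform_limit_on_subset[OF S.SN_limit[OF \<xi>1(1,2)] sub] by (simp add: S.qf_def[abs_def] case_prod_beta')
    then show ?thesis
      by (rule uniform_limit_cong'[THEN iffD1, rotated 2]) (use g(2) fq K(2) sub in \<open>auto simp: subset_iff\<close>)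
  qed (simp add: uniform_limit_iff)
  then show "\<exists>g :: nat \<Rightarrow> real \<times> real \<Rightarrow> quat. (\<forall>k. g k \<in> real_lin_combs (rqM_system lam)) \<and>
      (\<forall>K. compact K \<and> K \<subseteq> ell_rect \<xi>0 \<longrightarrow> uniform_limit K g f sequentially)" using g(1) by blast
next
  fix f and \<epsilon> :: real assume f2: "f \<in> ell_M2 \<xi>0 lam" and \<epsilon>: "\<epsilon> > 0"
  then have f: "f \<in> ell_M \<xi>0 lam" by (simp add: ell_M2_def)
  obtain f1x f1y f2x f2y where sol: "ell_solution \<xi>0 lam (\<lambda>x y. fst (f (x, y))) (\<lambda>x y. snd (f (x, y)) $ 1)
    (\<lambda>x y. snd (f (x, y)) $ 2) f1x f1y f2x f2y" using ell_M_components[OF f assms] by blast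
  interpret S: ell_solution \<xi>0 lam "\<lambda>x y. fst (f (x, y))" "\<lambda>x y. snd (f (x, y)) $ 1" "\<lambda>x y. snd (f (x, y)) $ 2"
    f1x f1y f2x f2y by (rule sol)
  have fq: "f p = S.qf p" if "p \<in> ell_rect \<xi>0" for p
    using f that by (cases p) (auto simp: ell_M_def reduced_quats_def S.qf_def intro!: qvec_eqI)
  have q: "qcnj z \<odot> z = (norm z)\<^sup>2 *\<^sub>R (1, 0)" for z :: quat
    unfolding qcnj_mult_self norm_quat_square by (simp add: inner_vec_def sum_3 power2_eq_square)
  \<comment> \<open>Integrability is given for a quaternion-valued function; conj (f) f is a real
    scalar, so its first component carries everything.\<close>
  have "integrable lborel (\<lambda>p. fst (indicator (ell_rect \<xi>0) p *\<^sub>R (ell_weight p *\<^sub>R (qcnj (f p) \<odot> f p))))"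
    using f2 unfolding ell_M2_def set_integrable_def by (intro integrable_fst) auto
  moreover have "(\<lambda>p. fst (indicator (ell_rect \<xi>0) p *\<^sub>R (ell_weight p *\<^sub>R (qcnj (f p) \<odot> f p))))
      = (\<lambda>p. indicator (ell_rect \<xi>0) p * (ew (fst p) (snd p) * (norm (S.qf p))\<^sup>2))"
  proof
    fix p
    show "fst (indicator (ell_rect \<xi>0) p *\<^sub>R (ell_weight p *\<^sub>R (qcnj (f p) \<odot> f p)))
      = indicator (ell_rect \<xi>0) p * (ew (fst p) (snd p) * (norm (S.qf p))\<^sup>2)"
      unfolding q ell_weight_eq by (cases "p \<in> ell_rect \<xi>0") (simp_all add: fq)
  qed
  ultimately have "integrable lborel (\<lambda>p. indicator (ell_rect \<xi>0) p * (ew (fst p) (snd p) * (norm (S.qf p))\<^sup>2))" by simp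
  from order_tendstoD(2)[OF S.remainder_nn_integral_tendsto[OF this], of "ennreal (\<epsilon>\<^sup>2)"]
  obtain N where N: "(\<integral>\<^sup>+p. ennreal (indicator (ell_rect \<xi>0) p * S.rem_fun N p) \<partial>lborel) < ennreal (\<epsilon>\<^sup>2)"
    using \<epsilon> by (auto simp: eventually_sequentially)
  obtain g where g: "g \<in> real_lin_combs (rqM_system lam)" "\<And>x y. x \<ge> 0 \<Longrightarrow> y \<in> circ \<Longrightarrow> g (x, y) = S.SN N (x, y)"
    using real_lin_combs_partial_sums[OF assms(1), where N = N and b = S.bco] unfolding S.SN_def by blast
  have gq: "indicator (ell_rect \<xi>0) p * (ew (fst p) (snd p) * (norm (f p - g p))\<^sup>2) = indicator (ell_rect \<xi>0) p * S.rem_fun N p" for p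
  proof (cases "p \<in> ell_rect \<xi>0")
    case True
    then have "g p = S.SN N p" using g(2) by (cases p) (auto simp: ell_rect_def)
    then show ?thesis using fq[OF True] by (simp add: S.rem_fun_def)
  qed simp
  have "ell_norm \<xi>0 (\<lambda>p. f p - g p) < \<epsilon>"
    by (rule ell_norm_less) (use N \<epsilon> S.rect_measurable[OF S.continuous_rem_dom(1)] in \<open>simp_all only: gq\<close>)
  then show "\<exists>g\<in>real_lin_combs (rqM_system lam). ell_norm \<xi>0 (\<lambda>p. f p - g p) < \<epsilon>" using g(1) by blast
qed

end
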